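(* Consider two independent samples of size $n$ from the linear models $y_A=x_A^\top\beta_A+u_A$ and $y_B=x_B^\top\beta_B+u_B$ with $\beta_A,\beta_B\in\mathbb{R}^p$ (no sparsity of $\beta_A,\beta_B$ is assumed), where $u_A,u_B$ are independent of the designs and no other restriction is imposed on the distributions of $u_A,u_B$. Suppose: (i) $x_A\sim\mathcal{N}(0,\Sigma_A)$ and $x_B\sim\mathcal{N}(0,\Sigma_B)$; (ii) there exist constants $\kappa_1,\kappa_2\in(0,\infty)$ such that all eigenvalues of $\Sigma_A$ and $\Sigma_B$ lie in $(\kappa_1,\kappa_2)$; (iii) $s_\Pi:=\max_{1\le j\le p}\|\Pi_{*,j}\|_0$ satisfies $s_\Pi=o\big(\sqrt{n/\log^3 p}\big)$. Let $T_n$ and $\hat Q$ be the TIERS test statistic and covariance estimate computed with tuning parameter $\eta\asymp\sqrt{n^{-1}\log p}$, and let $\Gamma^{-1}(\cdot,\hat Q)$ be as in the context. If $\beta_A=\beta_B$, then, as $n\to\infty$ and $p\to\infty$ with $\log p=o(\sqrt n)$, $$\mathbb{P}\big(T_n>\Gamma^{-1}(1-\alpha,\hat Q)\big)\to\alpha\qquad\text{for every }\alpha\in(0,1).$$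
   Context: Asymptotic framework: $n\to\infty$, $p=p_n$ and all model quantities may depend on $n$; "constants" do not. $a_n\asymp b_n$ means that each is bounded by a constant multiple of the other. For a vector $v$, $\|v\|_0=\#\{i:v_i\ne0\}$, $\|v\|_q$ is the usual $\ell_q$ norm. Data and notation: for $k\in\{A,B\}$, $(x_{k,i},y_{k,i})_{i=1}^n$ are i.i.d. copies of $(x_k,y_k)$, and the two samples are independent. $X_k\in\mathbb{R}^{n\times p}$ has rows $x_{k,i}^\top$ and $Y_k=(y_{k,1},\dots,y_{k,n})^\top$. Put $W=X_A+X_B$, $Z=X_A-X_B$, $Y=Y_A+Y_B$; $Z_j$ is the $j$-th column of $Z$. With $w=x_A+x_B$ and $z=x_A-x_B$, let $\Pi_{*,j}=(\mathbb{E}[ww^\top])^{-1}\mathbb{E}[wz_j]\in\mathbb{R}^p$, so that $\Pi_*=(\Pi_{*,1},\dots,\Pi_{*,p})=(\Sigma_A+\Sigma_B)^{-1}(\Sigma_A-\Sigma_B)$. ADDS estimators: with tuning parameter $\eta$, for $\sigma\ge0$ let $\hat\theta(\sigma)$ be a minimizer of $\|\theta\|_1$ over $\theta\in\mathbb{R}^p$ subject to $\|n^{-1}W^\top(Y-W\theta)\|_\infty\le\eta\sigma$; let $\tilde\sigma_u$ be the largest $\sigma\ge0$ with $\|Y-W\hat\theta(\sigma)\|_2^2\ge n\sigma^2/2$; put $\widetilde\theta=\hat\theta(\tilde\sigma_u)$. For each $j$, let $\hat\Pi_j(\sigma)$ be a minimizer of $\|\pi\|_1$ subject to $\|n^{-1}W^\top(Z_j-W\pi)\|_\infty\le\eta\sigma$,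 let $\tilde\sigma_j$ be the largest $\sigma\ge0$ with $\|Z_j-W\hat\Pi_j(\sigma)\|_2^2\ge n\sigma^2/2$, put $\widetilde\Pi_j=\hat\Pi_j(\tilde\sigma_j)$ and $\widetilde\Pi=(\widetilde\Pi_1,\dots,\widetilde\Pi_p)$. TIERS test: $\hat\sigma_u=n^{-1/2}\|Y-W\widetilde\theta\|_2$; $T_n=n^{-1/2}\hat\sigma_u^{-1}\|(Z-W\widetilde\Pi)^\top(Y-W\widetilde\theta)\|_\infty$; $\hat Q=n^{-1}\sum_{i=1}^n\hat v_i\hat v_i^\top$, where $\hat v_i^\top$ is the $i$-th row of $Z-W\widetilde\Pi$. For a covariance matrix $A$, $\Gamma(x,A)=\mathbb{P}(\|\xi\|_\infty\le x)$ with $\xi\sim\mathcal{N}(0,A)$, and $\Gamma^{-1}(\cdot,A)$ is the inverse of $\Gamma(\cdot,A)$. The test rejects $\beta_A=\beta_B$ iff $T_n>\Gamma^{-1}(1-\alpha,\hat Q)$.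
   Formalization: The formal theorem also requires η ≥ c0·sqrt(log p/n) eventually, for some c0 depending only on κ1, κ2 (the claim fails for small constants), and P(σ̂_u = 0) → 0, so that T_n is defined; minimizers are chosen by a fixed measurable rule. *)

theory Defs
  imports
    "HOL-Probability.Probability"
    "HOL-Library.Landau_Symbols"
    "Jordan_Normal_Form.Char_Poly"
    "Jordan_Normal_Form.Gauss_Jordan_Elimination"
begin

(* Vectors and matrices are those of Jordan_Normal_Form, since both dimensions vary with n. *)
hide_type (open) Finite_Cartesian_Product.vec
hide_const (open) Finite_Cartesian_Product.vec Finite_Cartesian_Product.mat
  Finite_Cartesian_Product.row Finite_Cartesian_Product.transpose
unbundle no vec_syntax and no inner_syntax

definition l0_norm :: "real vec \<Rightarrow> nat" where
  "l0_norm v = card {i. i < dim_vec v \<and> v $ i \<noteq> 0}"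

definition l1_norm :: "real vec \<Rightarrow> real" where
  "l1_norm v = (\<Sum>i<dim_vec v. \<bar>v $ i\<bar>)"

definition l2_norm :: "real vec \<Rightarrow> real" where
  "l2_norm v = sqrt (\<Sum>i<dim_vec v. (v $ i)\<^sup>2)"

(* The inserted 0 only matters for the vector of dimension 0. *)
definition linf_norm :: "real vec \<Rightarrow> real" where
  "linf_norm v = Max (insert 0 ((\<lambda>i. \<bar>v $ i\<bar>) ` {..<dim_vec v}))"

(* Borel sigma-algebras of R^p and R^(n x p): generated by the coordinates. *)
definition borel_vec :: "nat \<Rightarrow> real vec measure" where
  "borel_vec p = vimage_algebra (carrier_vec p) (\<lambda>v. \<lambda>i\<in>{..<p}. v $ i)
     (\<Pi>\<^sub>M i\<in>{..<p}. borel)"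

definition borel_mat :: "nat \<Rightarrow> nat \<Rightarrow> real mat measure" where
  "borel_mat n p = vimage_algebra (carrier_mat n p) (\<lambda>A. \<lambda>ij\<in>{..<n} \<times> {..<p}. A $$ ij)
     (\<Pi>\<^sub>M ij\<in>{..<n} \<times> {..<p}. borel)"

(* The centred normal law N(0,A), for A symmetric positive semidefinite and possibly singular:
   the law of L g, where A = L L^T and g has independent standard normal coordinates.
   It does not depend on the choice of L. *)
definition gaussian :: "real mat \<Rightarrow> real vec measure" where
  "gaussian A = (let p = dim_row A;
       L = (SOME L. L \<in> carrier_mat p p \<and> L * transpose_mat L = A)
     in distr (\<Pi>\<^sub>M i\<in>{..<p}. density lborel (\<lambda>t. ennreal (std_normal_density t)))
          (borel_vec p) (\<lambda>g. L *\<^sub>v vec p g))"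

definition Gam :: "real \<Rightarrow> real mat \<Rightarrow> real" where
  "Gam t A = measure (gaussian A) {\<xi> \<in> space (gaussian A). linf_norm \<xi> \<le> t}"

(* For a nonzero covariance matrix A, Gam _ A is a continuous bijection from {0..} to {0..<1},
   and this quantile is its inverse. For A = 0, where no inverse exists, it is 0. *)
definition Gam_inv :: "real \<Rightarrow> real mat \<Rightarrow> real" where
  "Gam_inv q A = Inf {t. q \<le> Gam t A}"

datatype sample = SA | SB

(* D k is the law of (x_k, y_k), of which the (x k i, y k i), i < n, are independent copies.
   The last assumption is independence of x k i and u k i, written out because indep_var needs
   both variables to have the same type. *)
locale two_sample_linear_model = prob_space M for M :: "'a measure" +
  fixes n p :: nat
    and \<beta> :: "sample \<Rightarrow> real vec"
    and D :: "sample \<Rightarrow> (real vec \<times> real) measure"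
    and x :: "sample \<Rightarrow> nat \<Rightarrow> 'a \<Rightarrow> real vec"
    and y u :: "sample \<Rightarrow> nat \<Rightarrow> 'a \<Rightarrow> real"
  assumes coeff_dim: "\<beta> k \<in> carrier_vec p"
    and law: "prob_space (D k)" "sets (D k) = sets (borel_vec p \<Otimes>\<^sub>M borel)"
    and indep: "indep_vars (\<lambda>_. borel_vec p \<Otimes>\<^sub>M borel)
      (\<lambda>(k, i) \<omega>. (x k i \<omega>, y k i \<omega>)) (UNIV \<times> {..<n})"
    and copies: "i < n \<Longrightarrow>
      distr M (borel_vec p \<Otimes>\<^sub>M borel) (\<lambda>\<omega>. (x k i \<omega>, y k i \<omega>)) = D k"
    and linear: "i < n \<Longrightarrow> \<omega> \<in> space M \<Longrightarrow> y k i \<omega> = x k i \<omega> \<bullet> \<beta> k + u k i \<omega>"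
    and error_rv: "i < n \<Longrightarrow> u k i \<in> borel_measurable M"
    and error_indep: "i < n \<Longrightarrow>
      indep_set {x k i -` S \<inter> space M | S. S \<in> sets (borel_vec p)}
        {u k i -` S \<inter> space M | S. S \<in> sets borel}"

(* (E[w w^T])^-1 E[w z^T] for independent (x_A, y_A) from D SA and (x_B, y_B) from D SB,
   with w = x_A + x_B and z = x_A - x_B. *)
definition Pi_star :: "nat \<Rightarrow> (sample \<Rightarrow> (real vec \<times> real) measure) \<Rightarrow> real mat" where
  "Pi_star p D = (let P = D SA \<Otimes>\<^sub>M D SB;
       w = (\<lambda>(a, b). fst a + fst b);
       z = (\<lambda>(a, b). fst a - fst b)
     in the (mat_inverse (mat p p (\<lambda>(i, j). \<integral>c. w c $ i * w c $ j \<partial>P)))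
        * mat p p (\<lambda>(i, j). \<integral>c. w c $ i * z c $ j \<partial>P))"

definition s_Pi :: "nat \<Rightarrow> (sample \<Rightarrow> (real vec \<times> real) measure) \<Rightarrow> nat" where
  "s_Pi p D = Max ((\<lambda>j. l0_norm (col (Pi_star p D) j)) ` {..<p})"

definition design :: "nat \<Rightarrow> nat \<Rightarrow> (nat \<Rightarrow> 'a \<Rightarrow> real vec) \<Rightarrow> 'a \<Rightarrow> real mat" where
  "design n p x \<omega> = mat_of_rows p (map (\<lambda>i. x i \<omega>) [0..<n])"

definition W_mat :: "nat \<Rightarrow> nat \<Rightarrow> (sample \<Rightarrow> nat \<Rightarrow> 'a \<Rightarrow> real vec) \<Rightarrow> 'a \<Rightarrow> real mat" where
  "W_mat n p x \<omega> = design n p (x SA) \<omega> + design n p (x SB) \<omega>"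

definition Z_mat :: "nat \<Rightarrow> nat \<Rightarrow> (sample \<Rightarrow> nat \<Rightarrow> 'a \<Rightarrow> real vec) \<Rightarrow> 'a \<Rightarrow> real mat" where
  "Z_mat n p x \<omega> = design n p (x SA) \<omega> - design n p (x SB) \<omega>"

definition Y_vec :: "nat \<Rightarrow> (sample \<Rightarrow> nat \<Rightarrow> 'a \<Rightarrow> real) \<Rightarrow> 'a \<Rightarrow> real vec" where
  "Y_vec n y \<omega> = vec n (\<lambda>i. y SA i \<omega> + y SB i \<omega>)"

definition is_dantzig_solution ::
    "real \<Rightarrow> real mat \<Rightarrow> real vec \<Rightarrow> real \<Rightarrow> real vec \<Rightarrow> bool" where
  "is_dantzig_solution \<eta> W v \<sigma> \<theta> \<longleftrightarrow>
     is_arg_min l1_norm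
       (\<lambda>\<theta>. \<theta> \<in> carrier_vec (dim_col W) \<and>
          linf_norm ((1 / real (dim_row W)) \<cdot>\<^sub>v (transpose_mat W *\<^sub>v (v - W *\<^sub>v \<theta>))) \<le> \<eta> * \<sigma>) \<theta>"

definition scale_admissible :: "real mat \<Rightarrow> real vec \<Rightarrow> (real \<Rightarrow> real vec) \<Rightarrow> real \<Rightarrow> bool" where
  "scale_admissible W v \<theta> \<sigma> \<longleftrightarrow>
     0 \<le> \<sigma> \<and> (l2_norm (v - W *\<^sub>v \<theta> \<sigma>))\<^sup>2 \<ge> real (dim_row W) * \<sigma>\<^sup>2 / 2"

(* The first-stage solutions need not be unique. A path rule \<theta> W v \<sigma> fixes, for each data set
   (W, v), a solution for every \<sigma>; adds then selects the largest admissible \<sigma>. *)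
definition adds :: "(real mat \<Rightarrow> real vec \<Rightarrow> real \<Rightarrow> real vec) \<Rightarrow> real mat \<Rightarrow> real vec \<Rightarrow> real vec" where
  "adds \<theta> W v = \<theta> W v (GREATEST \<sigma>. scale_admissible W v (\<theta> W v) \<sigma>)"

(* The second clause says that the largest admissible \<sigma> exists, so that adds is well defined.
   For \<eta> > 0 and n > 0 every data set admits such a path: among the solutions at each \<sigma>, take
   one with the largest residual norm. *)
definition adds_rule ::
    "real \<Rightarrow> nat \<Rightarrow> nat \<Rightarrow> (real mat \<Rightarrow> real vec \<Rightarrow> real \<Rightarrow> real vec) \<Rightarrow> bool" where
  "adds_rule \<eta> n p \<theta> \<longleftrightarrow>
     (\<forall>W \<in> carrier_mat n p. \<forall>v \<in> carrier_vec n.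
        (\<forall>\<sigma>\<ge>0. is_dantzig_solution \<eta> W v \<sigma> (\<theta> W v \<sigma>)) \<and>
        (\<exists>\<sigma>. scale_admissible W v (\<theta> W v) \<sigma> \<and>
             (\<forall>\<tau>. scale_admissible W v (\<theta> W v) \<tau> \<longrightarrow> \<tau> \<le> \<sigma>))) \<and>
     (\<lambda>(W, v). adds \<theta> W v) \<in> measurable (borel_mat n p \<Otimes>\<^sub>M borel_vec n) (borel_vec p)"

(* The rules for different columns of Z may break ties differently. *)
definition Pi_tilde ::
    "(nat \<Rightarrow> real mat \<Rightarrow> real vec \<Rightarrow> real \<Rightarrow> real vec) \<Rightarrow> real mat \<Rightarrow> real mat \<Rightarrow> real mat" where
  "Pi_tilde \<pi> W Z = mat_of_cols (dim_col W) (map (\<lambda>j. adds (\<pi> j) W (col Z j)) [0..<dim_col Z])"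

definition sigma_hat ::
    "(real mat \<Rightarrow> real vec \<Rightarrow> real \<Rightarrow> real vec) \<Rightarrow> real mat \<Rightarrow> real vec \<Rightarrow> real" where
  "sigma_hat \<theta> W Y = l2_norm (Y - W *\<^sub>v adds \<theta> W Y) / sqrt (real (dim_row W))"

definition T_stat ::
    "(real mat \<Rightarrow> real vec \<Rightarrow> real \<Rightarrow> real vec) \<Rightarrow> (nat \<Rightarrow> real mat \<Rightarrow> real vec \<Rightarrow> real \<Rightarrow> real vec) \<Rightarrow>
      real mat \<Rightarrow> real mat \<Rightarrow> real vec \<Rightarrow> real" where
  "T_stat \<theta> \<pi> W Z Y =
     linf_norm (transpose_mat (Z - W * Pi_tilde \<pi> W Z) *\<^sub>v (Y - W *\<^sub>v adds \<theta> W Y))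
       / (sqrt (real (dim_row W)) * sigma_hat \<theta> W Y)"

definition Q_hat ::
    "(nat \<Rightarrow> real mat \<Rightarrow> real vec \<Rightarrow> real \<Rightarrow> real vec) \<Rightarrow> real mat \<Rightarrow> real mat \<Rightarrow> real mat" where
  "Q_hat \<pi> W Z = (let V = Z - W * Pi_tilde \<pi> W Z in
     mat (dim_col V) (dim_col V)
       (\<lambda>(j, k). (\<Sum>i<dim_row V. V $$ (i, j) * V $$ (i, k)) / real (dim_row V)))"

end

theory Submission
  imports Defs
begin

text \<open>Put \<open>V = Z - W \<Pi>\<^sub>*\<close>. Under the null hypothesis \<open>Y = W \<beta> + u\<close>, and \<open>V\<close> is independent of \<open>(W, u)\<close> with
  independent \<open>N(0, \<Sigma>\<^sub>V)\<close> rows. The residual \<open>e\<close> of the regression of \<open>Y\<close> on \<open>W\<close> is a function of \<open>(W, u)\<close>, so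
  \<open>V\<^sup>T e / \<parallel>e\<parallel>\<close> has exactly the law \<open>N(0, \<Sigma>\<^sub>V)\<close>, whatever the sparsity of \<open>\<beta>\<close> and the law of the errors. The statistic
  differs from its maximum norm by at most the \<open>\<ell>\<^sub>1\<close> error of the estimated \<open>\<Pi>\<close>, which is controlled by the
  Dantzig selector bound, times the bound on \<open>W\<^sup>T e\<close> that the constraint gives; Nazarov's anticoncentration inequality
  absorbs the difference.

  For the critical value, let \<open>F\<close> be the distribution function of the maximum norm of \<open>N(0, \<Sigma>\<^sub>V)\<close>. Given the data,
  \<open>Gam t Q\<close> is the probability that \<open>(Z - W \<Pi>)\<^sup>T g\<close>, with the estimated \<open>\<Pi>\<close> and a standard normal \<open>g\<close>, has maximum norm at most \<open>t \<surd>n\<close>.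
  Two independent such \<open>g\<close> are nearly orthogonal and of norm nearly \<open>\<surd>n\<close>, so the first two moments of \<open>Gam t Q\<close> are close
  to \<open>F t\<close> and \<open>(F t)\<^sup>2\<close>, and Chebyshev's inequality gives \<open>Gam t Q \<rightarrow> F t\<close> in probability. This needs only
  \<open>log p = o(\<surd>n)\<close>.\<close>

section \<open>Uniqueness of joint characteristic functions\<close>

text \<open>Equality in law and independence rest on characteristic functions alone:
  \<open>gauss\<close> fixes the joint characteristic function of a family, so linear images and
  independence become identities between quadratic forms, singular covariances included. The
  arbitrary error law is a factor that is never evaluated. The obstacle is that the estimated \<Pi>
  depends on \<open>V\<close>. Hence the order of integration in the critical value is reversed: the
  multipliers \<open>g\<close> are held fixed while the data vary, and \<open>V\<close> keeps its
  exact law. With L = ln p, two rates carry the limit. The l1 error, of order s * sqrt (L / n),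
  times sqrt L from a Gaussian maximum and sqrt L from anticoncentration, is of order s * sqrt (L^3
  / n). The relative accuracy \<delta> of the multiplier norms costs \<delta> * L, while n *
  \<delta>^2 must diverge; \<delta> = sqrt (L / sqrt n) / L achieves both when L = o(sqrt n). The
  lower bound on \<eta> makes the true \<Pi> feasible at the noise scale. The statistic divides by
  \<open>sigma_hat\<close>, so a vanishing residual must be asymptotically negligible.\<close>

lemma weighted_law_eq_if_char_eq:
  fixes M :: "'a measure" and N :: "'b measure" and X w :: "'a \<Rightarrow> real" and Y v :: "'b \<Rightarrow> real"
  assumes "prob_space M" "prob_space N"
    and [measurable]: "X \<in> borel_measurable M" "Y \<in> borel_measurable N"
      "w \<in> borel_measurable M" "v \<in> borel_measurable N"
    and w: "\<And>x. 0 \<le> w x" "\<And>x. w x \<le> c" and v: "\<And>y. 0 \<le> v y" "\<And>y. v y \<le> c"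
    and eq: "\<And>s. (CLINT x|M. w x * iexp (s * X x)) = (CLINT y|N. v y * iexp (s * Y y))"
    and B: "B \<in> sets borel"
  shows "(\<integral>x. w x * indicator B (X x) \<partial>M) = (\<integral>y. v y * indicator B (Y y) \<partial>N)"
proof -
  interpret M: prob_space M by fact
  interpret N: prob_space N by fact
  have iw: "integrable M w" by (rule M.integrable_const_bound[of _ c]) (use w in auto)
  have iv: "integrable N v" by (rule N.integrable_const_bound[of _ c]) (use v in auto)
  have "complex_of_real (\<integral>x. w x \<partial>M) = complex_of_real (\<integral>y. v y \<partial>N)"
    using eq[of 0] by simp
  then have m: "(\<integral>x. w x \<partial>M) = (\<integral>y. v y \<partial>N)" by simp
  define m where "m = (\<integral>x. w x \<partial>M)"
  have m0: "0 \<le> m" unfolding m_def using w by (intro integral_nonneg_AE) auto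
  have iwB: "integrable M (\<lambda>x. w x * indicator B (X x))"
    by (rule M.integrable_const_bound[of _ c]) (use w B in \<open>auto simp: indicator_def intro: order_trans\<close>)
  have ivB: "integrable N (\<lambda>x. v x * indicator B (Y x))"
    by (rule N.integrable_const_bound[of _ c]) (use v B in \<open>auto simp: indicator_def intro: order_trans\<close>)
  show ?thesis
  proof (cases "m = 0")
    case True
    have "(\<integral>x. w x * indicator B (X x) \<partial>M) \<le> m"
      unfolding m_def using iw iwB w by (intro integral_mono) (auto simp: indicator_def)
    moreover have "(\<integral>x. v x * indicator B (Y x) \<partial>N) \<le> m"
      unfolding m_def m using iv ivB v by (intro integral_mono) (auto simp: indicator_def)
    moreover have "0 \<le> (\<integral>x. w x * indicator B (X x) \<partial>M)"
      using w by (intro integral_nonneg_AE) (auto simp: indicator_def)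
    moreover have "0 \<le> (\<integral>x. v x * indicator B (Y x) \<partial>N)"
      using v by (intro integral_nonneg_AE) (auto simp: indicator_def)
    ultimately show ?thesis using True by linarith
  next
    case False
    then have mp: "m > 0" using m0 by simp
    \<comment> \<open>The total masses agree by the hypothesis at \<open>s = 0\<close>. Dividing by
      this common mass \<open>m\<close> turns the weighted laws into probability measures with equal
      characteristic functions.\<close>
    define M' where "M' = distr (density M (\<lambda>x. ennreal (w x / m))) borel X"
    define N' where "N' = distr (density N (\<lambda>x. ennreal (v x / m))) borel Y"
    have [measurable]: "X \<in> borel_measurable (density M (\<lambda>x. ennreal (w x / m)))" by simp
    have [measurable]: "Y \<in> borel_measurable (density N (\<lambda>x. ennreal (v x / m)))" by simp
    have pM: "prob_space (density M (\<lambda>x. ennreal (w x / m)))"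
    proof (rule prob_spaceI)
      have "(\<integral>\<^sup>+x. ennreal (w x / m) \<partial>M) = ennreal (\<integral>x. w x / m \<partial>M)"
        by (rule nn_integral_eq_integral) (use iw w mp in auto)
      also have "(\<integral>x. w x / m \<partial>M) = 1" using mp by (simp add: m_def[symmetric])
      finally show "emeasure (density M (\<lambda>x. ennreal (w x / m))) (space (density M (\<lambda>x. ennreal (w x / m)))) = 1"
        by (simp add: emeasure_density cong: nn_integral_cong)
    qed
    have pN: "prob_space (density N (\<lambda>x. ennreal (v x / m)))"
    proof (rule prob_spaceI)
      have "(\<integral>\<^sup>+x. ennreal (v x / m) \<partial>N) = ennreal (\<integral>x. v x / m \<partial>N)"
        by (rule nn_integral_eq_integral) (use iv v mp in auto)
      also have "(\<integral>x. v x / m \<partial>N) = 1" using mp m by (simp add: m_def[symmetric])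
      finally show "emeasure (density N (\<lambda>x. ennreal (v x / m))) (space (density N (\<lambda>x. ennreal (v x / m)))) = 1"
        by (simp add: emeasure_density cong: nn_integral_cong)
    qed
    interpret M': real_distribution M'
      unfolding M'_def real_distribution_def real_distribution_axioms_def
      by (auto intro!: prob_space.prob_space_distr[OF pM])
    interpret N': real_distribution N'
      unfolding N'_def real_distribution_def real_distribution_axioms_def
      by (auto intro!: prob_space.prob_space_distr[OF pN])
    have cM: "char M' s = (CLINT x|M. w x * iexp (s * X x)) / m" for s
      unfolding char_def M'_def using mp w
      by (subst integral_distr, simp, simp, subst integral_density)
        (auto simp: scaleR_conv_of_real simp flip: integral_divide_zero intro!: Bochner_Integration.integral_cong)
    have cN: "char N' s = (CLINT x|N. v x * iexp (s * Y x)) / m" for s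
      unfolding char_def N'_def using mp v
      by (subst integral_distr, simp, simp, subst integral_density)
        (auto simp: scaleR_conv_of_real simp flip: integral_divide_zero intro!: Bochner_Integration.integral_cong)
    have "M' = N'"
      by (rule Levy_uniqueness[OF M'.real_distribution_axioms N'.real_distribution_axioms], rule ext) (simp only: cM cN eq)
    moreover have "(\<integral>z. indicator B z \<partial>M') = (\<integral>x. w x * indicator B (X x) \<partial>M) / m"
      unfolding M'_def using mp w B
      by (subst integral_distr, simp, simp, subst integral_density)
        (auto simp flip: integral_divide_zero intro!: Bochner_Integration.integral_cong)
    moreover have "(\<integral>z. indicator B z \<partial>N') = (\<integral>x. v x * indicator B (Y x) \<partial>N) / m"
      unfolding N'_def using mp v B
      by (subst integral_distr, simp, simp, subst integral_density)
        (auto simp flip: integral_divide_zero intro!: Bochner_Integration.integral_cong)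
    ultimately show ?thesis using mp by simp
  qed
qed

text \<open>Inverts one coordinate at a time, so that the one-dimensional uniqueness theorem
  suffices: \<open>I\<close> is the set of coordinates whose exponential has already been exchanged
  for the indicator of a Borel set. The exponential of the other coordinates acts as a weight. As it
  is complex while \<open>weighted_law_eq_if_char_eq\<close> needs nonnegative weights, it is
  assembled from the weights 1, 1 + cos and 1 + sin.\<close>

lemma mixed_char_eq:
  fixes M :: "'a measure" and N :: "'b measure" and X :: "'i \<Rightarrow> 'a \<Rightarrow> real" and Y :: "'i \<Rightarrow> 'b \<Rightarrow> real"
  assumes pM: "prob_space M" and pN: "prob_space N" and K: "finite K"
    and X[measurable]: "\<And>i. i \<in> K \<Longrightarrow> X i \<in> borel_measurable M"
    and Y[measurable]: "\<And>i. i \<in> K \<Longrightarrow> Y i \<in> borel_measurable N"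
    and eq: "\<And>t. (CLINT x|M. iexp (\<Sum>i\<in>K. t i * X i x)) = (CLINT y|N. iexp (\<Sum>i\<in>K. t i * Y i y))"
    and B: "\<And>i. i \<in> K \<Longrightarrow> B i \<in> sets borel"
    and I: "finite I" "I \<subseteq> K"
  shows "(CLINT x|M. (\<Prod>i\<in>I. indicator (B i) (X i x)) * iexp (\<Sum>i\<in>K-I. t i * X i x))
       = (CLINT y|N. (\<Prod>i\<in>I. indicator (B i) (Y i y)) * iexp (\<Sum>i\<in>K-I. t i * Y i y))"
  using I
proof (induction I arbitrary: t)
  case empty
  then show ?case using eq[of t] by simp
next
  case (insert k I)
  interpret M: prob_space M by fact
  interpret N: prob_space N by fact
  have kK: "k \<in> K" and IK: "I \<subseteq> K" and kI: "k \<notin> I" and fI: "finite I" using insert by auto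
  define R where "R = K - insert k I"
  have R: "K - I = insert k R" "k \<notin> R" "finite R" "R \<subseteq> K" using kK kI K unfolding R_def by auto
  define fX where "fX = (\<lambda>x. \<Prod>i\<in>I. indicator (B i) (X i x) :: real)"
  define fY where "fY = (\<lambda>x. \<Prod>i\<in>I. indicator (B i) (Y i x) :: real)"
  have [measurable]: "Measurable.pred M (\<lambda>x. X i x \<in> B i)" "Measurable.pred N (\<lambda>x. Y i x \<in> B i)" if "i \<in> K" for i
    using B[OF that] X[OF that] Y[OF that] by measurable
  have mf[measurable]: "fX \<in> borel_measurable M" "fY \<in> borel_measurable N"
    unfolding fX_def fY_def using IK by (auto intro!: borel_measurable_prod borel_measurable_indicator' simp: subset_eq)
  have f01: "0 \<le> fX x" "fX x \<le> 1" "0 \<le> fY y" "fY y \<le> 1" for x y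
    unfolding fX_def fY_def by (auto intro!: prod_nonneg prod_le_1)
  have fc: "(\<Prod>i\<in>I. indicator (B i) (X i x)) = complex_of_real (fX x)"
     "(\<Prod>i\<in>I. indicator (B i) (Y i y)) = complex_of_real (fY y)" for x y
    unfolding fX_def fY_def by (auto simp: indicator_def of_bool_def intro!: prod.cong)
  define oX where "oX = (\<lambda>x. \<Sum>i\<in>R. t i * X i x)"
  define oY where "oY = (\<lambda>x. \<Sum>i\<in>R. t i * Y i x)"
  have [measurable]: "X i \<in> borel_measurable M" "Y i \<in> borel_measurable N" if "i \<in> R" for i
    using that R by auto
  have mo[measurable]: "oX \<in> borel_measurable M" "oY \<in> borel_measurable N"
    unfolding oX_def oY_def by (auto intro!: borel_measurable_sum borel_measurable_times simp: R(4)[THEN subsetD])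
  note [measurable] = X[OF kK] Y[OF kK] B[OF kK]
  \<comment> \<open>The frequencies are free, so the remaining exponent may be scaled by
    \<open>a\<close>; the values 0, 1 and -1 give the transforms of all three weights.\<close>
  have IH: "(CLINT x|M. fX x * iexp (a * oX x + s * X k x)) = (CLINT y|N. fY y * iexp (a * oY y + s * Y k y))" for a s
  proof -
    define t' where "t' = (\<lambda>i. if i = k then s else a * t i)"
    have "(\<Sum>i\<in>K-I. t' i * Z i) = a * (\<Sum>i\<in>R. t i * Z i) + s * Z k" for Z
    proof -
      have "(\<Sum>i\<in>R. t' i * Z i) = (\<Sum>i\<in>R. a * (t i * Z i))"
        using R(2) by (intro sum.cong) (auto simp: t'_def)
      then show ?thesis unfolding R(1) using R(2,3) by (simp add: t'_def sum_distrib_left)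
    qed
    then show ?thesis using insert.IH[OF IK, of t'] by (simp add: fc oX_def oY_def)
  qed
  have bnd: "integrable M (\<lambda>x. complex_of_real (fX x) * g x)" if "g \<in> borel_measurable M" "\<And>x. norm (g x) \<le> 1" for g
    by (rule M.integrable_const_bound[of _ 1]) (use that f01 in \<open>auto simp: norm_mult intro!: mult_le_one\<close>)
  have bndN: "integrable N (\<lambda>x. complex_of_real (fY x) * g x)" if "g \<in> borel_measurable N" "\<And>x. norm (g x) \<le> 1" for g
    by (rule N.integrable_const_bound[of _ 1]) (use that f01 in \<open>auto simp: norm_mult intro!: mult_le_one\<close>)
  have nI: "norm (iexp r) \<le> 1" for r by simp
  have iE: "integrable M (\<lambda>x. complex_of_real (fX x) * iexp (a * oX x + s * X k x))"
    "integrable N (\<lambda>x. complex_of_real (fY x) * iexp (a * oY x + s * Y k x))" for a s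
    by (rule bnd bndN; (rule nI)?; measurable)+
  have e1: "iexp (a * o' + s * x) = iexp (a * o') * iexp (s * x)" for a o' s x :: real
    by (simp add: exp_add[symmetric] algebra_simps)
  have w1: "(\<integral>x. fX x * indicator (B k) (X k x) \<partial>M) = (\<integral>y. fY y * indicator (B k) (Y k y) \<partial>N)"
    by (rule weighted_law_eq_if_char_eq[of M N _ _ _ _ 1]) (use IH[of 0] f01 in \<open>auto simp: pM pN\<close>)
  have wc: "(\<integral>x. (fX x * (1 + cos (oX x))) * indicator (B k) (X k x) \<partial>M)
     = (\<integral>y. (fY y * (1 + cos (oY y))) * indicator (B k) (Y k y) \<partial>N)"
  proof (rule weighted_law_eq_if_char_eq[of M N _ _ _ _ 2])
    fix s
    have d: "complex_of_real (f * (1 + cos o')) * iexp (s * x)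
       = f * iexp (0 * o' + s * x) + (f * iexp (1 * o' + s * x) + f * iexp ((-1) * o' + s * x)) / 2" for f o' x :: real
      unfolding e1 by (simp add: cos_of_real[symmetric] cos_exp_eq algebra_simps add_divide_distrib)
    show "(CLINT x|M. complex_of_real (fX x * (1 + cos (oX x))) * iexp (s * X k x)) = (CLINT x|N. complex_of_real (fY x * (1 + cos (oY x))) * iexp (s * Y k x))"
      unfolding d by (subst Bochner_Integration.integral_add, (intro iE Bochner_Integration.integrable_add integrable_divide_zero)+,
        subst Bochner_Integration.integral_add, (intro iE Bochner_Integration.integrable_add integrable_divide_zero)+,
        simp only: integral_divide_zero,
        subst Bochner_Integration.integral_add, (intro iE Bochner_Integration.integrable_add integrable_divide_zero)+,
        subst Bochner_Integration.integral_add, (intro iE Bochner_Integration.integrable_add integrable_divide_zero)+,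
        simp only: IH)
  next
    have "0 \<le> f * (1 + cos o')" "f * (1 + cos o') \<le> 2" if "0 \<le> f" "f \<le> 1" for f o' :: real
      using that mult_mono[of f 1 "1 + cos o'" 2] cos_ge_minus_one[of o'] cos_le_one[of o'] by (auto intro!: mult_nonneg_nonneg; linarith)+
    then show "0 \<le> fX x * (1 + cos (oX x))" "fX x * (1 + cos (oX x)) \<le> 2" "0 \<le> fY y * (1 + cos (oY y))" "fY y * (1 + cos (oY y)) \<le> 2" for x y
      using f01 by blast+
  qed (auto simp: pM pN)
  have ws: "(\<integral>x. (fX x * (1 + sin (oX x))) * indicator (B k) (X k x) \<partial>M)
     = (\<integral>y. (fY y * (1 + sin (oY y))) * indicator (B k) (Y k y) \<partial>N)"
  proof (rule weighted_law_eq_if_char_eq[of M N _ _ _ _ 2])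
    fix s
    have d: "complex_of_real (f * (1 + sin o')) * iexp (s * x)
       = f * iexp (0 * o' + s * x) + (f * iexp (1 * o' + s * x) - f * iexp ((-1) * o' + s * x)) / (2 * \<i>)" for f o' x :: real
      unfolding e1 by (simp add: sin_of_real[symmetric] sin_exp_eq algebra_simps diff_divide_distrib)
    show "(CLINT x|M. complex_of_real (fX x * (1 + sin (oX x))) * iexp (s * X k x)) = (CLINT x|N. complex_of_real (fY x * (1 + sin (oY x))) * iexp (s * Y k x))"
      unfolding d by (subst Bochner_Integration.integral_add, (intro iE Bochner_Integration.integrable_diff integrable_divide_zero)+,
        subst Bochner_Integration.integral_add, (intro iE Bochner_Integration.integrable_diff integrable_divide_zero)+,
        simp only: integral_divide_zero,
        subst Bochner_Integration.integral_diff, (intro iE)+,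
        subst Bochner_Integration.integral_diff, (intro iE)+,
        simp only: IH)
  next
    have "0 \<le> f * (1 + sin o')" "f * (1 + sin o') \<le> 2" if "0 \<le> f" "f \<le> 1" for f o' :: real
      using that mult_mono[of f 1 "1 + sin o'" 2] sin_ge_minus_one[of o'] sin_le_one[of o'] by (auto intro!: mult_nonneg_nonneg; linarith)+
    then show "0 \<le> fX x * (1 + sin (oX x))" "fX x * (1 + sin (oX x)) \<le> 2" "0 \<le> fY y * (1 + sin (oY y))" "fY y * (1 + sin (oY y)) \<le> 2" for x y
      using f01 by blast+
  qed (auto simp: pM pN)
  \<comment> \<open>Rests on exp (i o) = (1 + cos o) + i (1 + sin o) - (1 + i).\<close>
  have dec: "complex_of_real f * iexp o' * complex_of_real b = complex_of_real (f * ((1 + cos o') * b)) + \<i> * complex_of_real (f * ((1 + sin o') * b))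
      - (1 + \<i>) * complex_of_real (f * b)" for f o' b :: real
    by (simp add: exp_Euler[of "complex_of_real o'"] cos_of_real sin_of_real algebra_simps)
  have iM: "integrable M (\<lambda>x. complex_of_real (fX x * g x))" if [measurable]: "g \<in> borel_measurable M" and "\<And>x. \<bar>g x\<bar> \<le> 2" for g
    by (rule M.integrable_const_bound[of _ 2]) (use that(2) f01 mult_mono[of "\<bar>fX _\<bar>" 1 "\<bar>g _\<bar>" 2] in \<open>auto simp: norm_mult abs_mult\<close>)
  have iN: "integrable N (\<lambda>x. complex_of_real (fY x * g x))" if [measurable]: "g \<in> borel_measurable N" and "\<And>x. \<bar>g x\<bar> \<le> 2" for g
    by (rule N.integrable_const_bound[of _ 2]) (use that(2) f01 mult_mono[of "\<bar>fY _\<bar>" 1 "\<bar>g _\<bar>" 2] in \<open>auto simp: norm_mult abs_mult\<close>)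
  have b2: "\<bar>(1 + cos o') * indicator S z\<bar> \<le> 2" "\<bar>(1 + sin o') * indicator S z\<bar> \<le> 2" "\<bar>indicator S z :: real\<bar> \<le> 2" for o' :: real and S and z :: real
  proof -
    have "\<bar>1 + cos o'\<bar> \<le> 2" using cos_ge_minus_one[of o'] cos_le_one[of o'] by linarith
    moreover have "\<bar>1 + sin o'\<bar> \<le> 2" using sin_ge_minus_one[of o'] sin_le_one[of o'] by linarith
    ultimately show "\<bar>(1 + cos o') * indicator S z\<bar> \<le> 2" "\<bar>(1 + sin o') * indicator S z\<bar> \<le> 2" "\<bar>indicator S z :: real\<bar> \<le> 2"
      by (auto simp: indicator_def)
  qed
  have iM3: "integrable M (\<lambda>x. complex_of_real (fX x * ((1 + cos (oX x)) * indicator (B k) (X k x))))"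
    "integrable M (\<lambda>x. complex_of_real (fX x * ((1 + sin (oX x)) * indicator (B k) (X k x))))"
    "integrable M (\<lambda>x. complex_of_real (fX x * indicator (B k) (X k x)))"
    by (rule iM; (rule b2)?; measurable)+
  have iN3: "integrable N (\<lambda>x. complex_of_real (fY x * ((1 + cos (oY x)) * indicator (B k) (Y k x))))"
    "integrable N (\<lambda>x. complex_of_real (fY x * ((1 + sin (oY x)) * indicator (B k) (Y k x))))"
    "integrable N (\<lambda>x. complex_of_real (fY x * indicator (B k) (Y k x)))"
    by (rule iN; (rule b2)?; measurable)+
  have "(CLINT x|M. fX x * iexp (oX x) * complex_of_real (indicator (B k) (X k x)))
      = (\<integral>x. fX x * ((1 + cos (oX x)) * indicator (B k) (X k x)) \<partial>M)
       + \<i> * (\<integral>x. fX x * ((1 + sin (oX x)) * indicator (B k) (X k x)) \<partial>M)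
       - (1 + \<i>) * (\<integral>x. fX x * indicator (B k) (X k x) \<partial>M)"
    unfolding dec
    by (simp add: iM3 del: of_real_mult)
  moreover have "(CLINT x|N. fY x * iexp (oY x) * complex_of_real (indicator (B k) (Y k x)))
      = (\<integral>x. fY x * ((1 + cos (oY x)) * indicator (B k) (Y k x)) \<partial>N)
       + \<i> * (\<integral>x. fY x * ((1 + sin (oY x)) * indicator (B k) (Y k x)) \<partial>N)
       - (1 + \<i>) * (\<integral>x. fY x * indicator (B k) (Y k x) \<partial>N)"
    unfolding dec
    by (simp add: iN3 del: of_real_mult)
  ultimately have "(CLINT x|M. fX x * iexp (oX x) * complex_of_real (indicator (B k) (X k x)))
      = (CLINT x|N. fY x * iexp (oY x) * complex_of_real (indicator (B k) (Y k x)))"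
    unfolding w1 wc[unfolded mult.assoc] ws[unfolded mult.assoc] by simp
  moreover have "complex_of_real (indicator S z) = indicator S z" for S and z :: real by (simp add: indicator_def)
  ultimately show ?case
    using kI fI by (simp add: fc oX_def oY_def R_def[symmetric] mult_ac)
qed

text \<open>For \<open>I = K\<close> in \<open>mixed_char_eq\<close> no exponential is left, so both
  laws agree on rectangles, which generate the product sigma-algebra.\<close>

lemma law_eq_if_char_eq:
  fixes M :: "'a measure" and N :: "'b measure" and X :: "'i \<Rightarrow> 'a \<Rightarrow> real" and Y :: "'i \<Rightarrow> 'b \<Rightarrow> real"
  assumes pM: "prob_space M" and pN: "prob_space N" and K: "finite K"
    and X[measurable]: "\<And>i. i \<in> K \<Longrightarrow> X i \<in> borel_measurable M"
    and Y[measurable]: "\<And>i. i \<in> K \<Longrightarrow> Y i \<in> borel_measurable N"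
    and eq: "\<And>t. (CLINT x|M. iexp (\<Sum>i\<in>K. t i * X i x)) = (CLINT y|N. iexp (\<Sum>i\<in>K. t i * Y i y))"
  shows "distr M (\<Pi>\<^sub>M i\<in>K. borel) (\<lambda>\<omega>. \<lambda>i\<in>K. X i \<omega>) = distr N (\<Pi>\<^sub>M i\<in>K. borel) (\<lambda>\<omega>. \<lambda>i\<in>K. Y i \<omega>)"
proof (rule measure_eqI_PiM_infinite)
  interpret M: prob_space M by fact
  interpret N: prob_space N by fact
  have mX[measurable]: "(\<lambda>\<omega>. \<lambda>i\<in>K. X i \<omega>) \<in> measurable M (\<Pi>\<^sub>M i\<in>K. borel)"
    by (intro measurable_restrict X)
  have mY[measurable]: "(\<lambda>\<omega>. \<lambda>i\<in>K. Y i \<omega>) \<in> measurable N (\<Pi>\<^sub>M i\<in>K. borel)"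
    by (intro measurable_restrict Y)
  show "finite_measure (distr M (\<Pi>\<^sub>M i\<in>K. borel) (\<lambda>\<omega>. \<lambda>i\<in>K. X i \<omega>))"
    by (intro M.finite_measure_distr mX)
  fix A J assume J: "finite J" "J \<subseteq> K" and A: "\<And>i. i \<in> J \<Longrightarrow> A i \<in> sets (borel :: real measure)"
  \<comment> \<open>Leaving the coordinates outside \<open>J\<close> unconstrained makes the
    cylinder over \<open>J\<close> a rectangle over all of \<open>K\<close>.\<close>
  define B where "B = (\<lambda>i. if i \<in> J then A i else UNIV)"
  have B: "B i \<in> sets borel" for i using A by (auto simp: B_def)
  have e: "prod_emb K (\<lambda>i. borel) J (Pi\<^sub>E J A) = Pi\<^sub>E K B"
    using J by (auto simp: prod_emb_def B_def PiE_def Pi_def extensional_def split: if_splits)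
  have s: "Pi\<^sub>E K B \<in> sets (\<Pi>\<^sub>M i\<in>K. borel)" using B K by (intro sets_PiM_I_finite) auto
  have "complex_of_real (measure M {\<omega>\<in>space M. \<forall>i\<in>K. X i \<omega> \<in> B i}) = (CLINT x|M. (\<Prod>i\<in>K. indicator (B i) (X i x)))"
  proof -
    have "(\<Prod>i\<in>K. indicator (B i) (X i x)) = complex_of_real (indicator {\<omega>\<in>space M. \<forall>i\<in>K. X i \<omega> \<in> B i} x)" if "x \<in> space M" for x
      using that K by (cases "\<forall>i\<in>K. X i x \<in> B i") (auto simp: indicator_def prod_zero_iff)
    then have "(CLINT x|M. (\<Prod>i\<in>K. indicator (B i) (X i x))) = (CLINT x|M. complex_of_real (indicator {\<omega>\<in>space M. \<forall>i\<in>K. X i \<omega> \<in> B i} x))"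
      by (intro Bochner_Integration.integral_cong) auto
    then show ?thesis by (simp add: Int_absorb2 subset_eq)
  qed
  moreover have "complex_of_real (measure N {\<omega>\<in>space N. \<forall>i\<in>K. Y i \<omega> \<in> B i}) = (CLINT x|N. (\<Prod>i\<in>K. indicator (B i) (Y i x)))"
  proof -
    have "(\<Prod>i\<in>K. indicator (B i) (Y i x)) = complex_of_real (indicator {\<omega>\<in>space N. \<forall>i\<in>K. Y i \<omega> \<in> B i} x)" if "x \<in> space N" for x
      using that K by (cases "\<forall>i\<in>K. Y i x \<in> B i") (auto simp: indicator_def prod_zero_iff)
    then have "(CLINT x|N. (\<Prod>i\<in>K. indicator (B i) (Y i x))) = (CLINT x|N. complex_of_real (indicator {\<omega>\<in>space N. \<forall>i\<in>K. Y i \<omega> \<in> B i} x))"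
      by (intro Bochner_Integration.integral_cong) auto
    then show ?thesis by (simp add: Int_absorb2 subset_eq)
  qed
  moreover have "(CLINT x|M. (\<Prod>i\<in>K. indicator (B i) (X i x))) = (CLINT x|N. (\<Prod>i\<in>K. indicator (B i) (Y i x)))"
    using mixed_char_eq[OF pM pN K X Y eq B K order_refl, where t = "\<lambda>_. 0"] by simp
  ultimately have "complex_of_real (measure M {\<omega>\<in>space M. \<forall>i\<in>K. X i \<omega> \<in> B i}) = complex_of_real (measure N {\<omega>\<in>space N. \<forall>i\<in>K. Y i \<omega> \<in> B i})"
    by (simp only:)
  then have "measure M {\<omega>\<in>space M. \<forall>i\<in>K. X i \<omega> \<in> B i} = measure N {\<omega>\<in>space N. \<forall>i\<in>K. Y i \<omega> \<in> B i}"
    by (simp only: of_real_eq_iff)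
  moreover have "(\<lambda>\<omega>. \<lambda>i\<in>K. X i \<omega>) -` Pi\<^sub>E K B \<inter> space M = {\<omega>\<in>space M. \<forall>i\<in>K. X i \<omega> \<in> B i}" by auto
  moreover have "(\<lambda>\<omega>. \<lambda>i\<in>K. Y i \<omega>) -` Pi\<^sub>E K B \<inter> space N = {\<omega>\<in>space N. \<forall>i\<in>K. Y i \<omega> \<in> B i}" by auto
  ultimately show "emeasure (distr M (\<Pi>\<^sub>M i\<in>K. borel) (\<lambda>\<omega>. \<lambda>i\<in>K. X i \<omega>)) (prod_emb K (\<lambda>i. borel) J (Pi\<^sub>E J A))
    = emeasure (distr N (\<Pi>\<^sub>M i\<in>K. borel) (\<lambda>\<omega>. \<lambda>i\<in>K. Y i \<omega>)) (prod_emb K (\<lambda>i. borel) J (Pi\<^sub>E J A))"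
    unfolding e by (simp add: emeasure_distr s M.emeasure_eq_measure N.emeasure_eq_measure)
qed simp_all

text \<open>With a product measure as \<open>N\<close> this is a criterion for independence of two
  families, and it needs no conditional distributions. The two families are joined into one that is
  indexed by the disjoint sum.\<close>

lemma pair_law_eq_if_char_eq:
  fixes M :: "'a measure" and N :: "'b measure" and X :: "'i \<Rightarrow> 'a \<Rightarrow> real" and Y :: "'j \<Rightarrow> 'a \<Rightarrow> real"
    and X' :: "'i \<Rightarrow> 'b \<Rightarrow> real" and Y' :: "'j \<Rightarrow> 'b \<Rightarrow> real"
  assumes pM: "prob_space M" and pN: "prob_space N" and I: "finite I" "finite J"
    and X: "\<And>i. i \<in> I \<Longrightarrow> X i \<in> borel_measurable M" "\<And>j. j \<in> J \<Longrightarrow> Y j \<in> borel_measurable M"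
    and Y: "\<And>i. i \<in> I \<Longrightarrow> X' i \<in> borel_measurable N" "\<And>j. j \<in> J \<Longrightarrow> Y' j \<in> borel_measurable N"
    and eq: "\<And>s t. (CLINT x|M. iexp ((\<Sum>i\<in>I. s i * X i x) + (\<Sum>j\<in>J. t j * Y j x)))
       = (CLINT y|N. iexp ((\<Sum>i\<in>I. s i * X' i y) + (\<Sum>j\<in>J. t j * Y' j y)))"
  shows "distr M ((\<Pi>\<^sub>M i\<in>I. borel) \<Otimes>\<^sub>M (\<Pi>\<^sub>M j\<in>J. borel)) (\<lambda>\<omega>. (\<lambda>i\<in>I. X i \<omega>, \<lambda>j\<in>J. Y j \<omega>))
    = distr N ((\<Pi>\<^sub>M i\<in>I. borel) \<Otimes>\<^sub>M (\<Pi>\<^sub>M j\<in>J. borel)) (\<lambda>\<omega>. (\<lambda>i\<in>I. X' i \<omega>, \<lambda>j\<in>J. Y' j \<omega>))"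
proof -
  let ?K = "I <+> J" and ?P = "(\<Pi>\<^sub>M i\<in>I. borel) \<Otimes>\<^sub>M (\<Pi>\<^sub>M j\<in>J. borel) :: (('i \<Rightarrow> real) \<times> ('j \<Rightarrow> real)) measure"
  let ?f = "\<lambda>g :: 'i + 'j \<Rightarrow> real. (\<lambda>i\<in>I. g (Inl i), \<lambda>j\<in>J. g (Inr j))"
  have m: "case_sum X Y i \<in> borel_measurable M" "case_sum X' Y' i \<in> borel_measurable N" if "i \<in> ?K" for i
    using that X Y by auto
  have su: "(\<Sum>i\<in>?K. t i * case_sum A B i x) = (\<Sum>i\<in>I. t (Inl i) * A i x) + (\<Sum>j\<in>J. t (Inr j) * B j x)"
    for t :: "'i + 'j \<Rightarrow> real" and A :: "'i \<Rightarrow> 'c \<Rightarrow> real" and B x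
    using I by (simp add: sum.Plus)
  have 1: "distr M (\<Pi>\<^sub>M i\<in>?K. borel) (\<lambda>\<omega>. \<lambda>i\<in>?K. case_sum X Y i \<omega>) = distr N (\<Pi>\<^sub>M i\<in>?K. borel) (\<lambda>\<omega>. \<lambda>i\<in>?K. case_sum X' Y' i \<omega>)"
    using eq by (intro law_eq_if_char_eq pM pN m) (auto simp: I su)
  have mf: "?f \<in> measurable (\<Pi>\<^sub>M i\<in>?K. borel) ?P"
    by (intro measurable_Pair measurable_restrict measurable_component_singleton) auto
  have "distr M ?P (\<lambda>\<omega>. (\<lambda>i\<in>I. X i \<omega>, \<lambda>j\<in>J. Y j \<omega>)) = distr (distr M (\<Pi>\<^sub>M i\<in>?K. borel) (\<lambda>\<omega>. \<lambda>i\<in>?K. case_sum X Y i \<omega>)) ?P ?f"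
    by (subst distr_distr[OF mf measurable_restrict[OF m(1)]]) (auto intro!: distr_cong simp: o_def restrict_def fun_eq_iff)
  also have "\<dots> = distr (distr N (\<Pi>\<^sub>M i\<in>?K. borel) (\<lambda>\<omega>. \<lambda>i\<in>?K. case_sum X' Y' i \<omega>)) ?P ?f" by (simp only: 1)
  also have "\<dots> = distr N ?P (\<lambda>\<omega>. (\<lambda>i\<in>I. X' i \<omega>, \<lambda>j\<in>J. Y' j \<omega>))"
    by (subst distr_distr[OF mf measurable_restrict[OF m(2)]]) (auto intro!: distr_cong simp: o_def restrict_def fun_eq_iff)
  finally show ?thesis .
qed

section \<open>Gaussian families\<close>

definition std_gauss :: "'i set \<Rightarrow> ('i \<Rightarrow> real) measure" where
  "std_gauss I = (\<Pi>\<^sub>M i\<in>I. std_normal_distribution)"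

text \<open>A characteristic function rather than a density, because \<open>Q_hat\<close> is the
  Gram matrix of \<open>n\<close> rows and is singular for p > n. The index type is arbitrary, so
  that matrices of normal entries and disjoint unions of blocks are families as well.\<close>

definition gauss :: "'a measure \<Rightarrow> 'i set \<Rightarrow> ('i \<Rightarrow> 'a \<Rightarrow> real) \<Rightarrow> ('i \<Rightarrow> 'i \<Rightarrow> real) \<Rightarrow> bool" where
  "gauss M I X C \<longleftrightarrow> prob_space M \<and> finite I \<and> (\<forall>i\<in>I. X i \<in> borel_measurable M) \<and>
     (\<forall>t. (CLINT \<omega>|M. iexp (\<Sum>i\<in>I. t i * X i \<omega>)) = exp (- (\<Sum>i\<in>I. \<Sum>j\<in>I. t i * t j * C i j) / 2))"

lemma gaussD:
  assumes "gauss M I X C"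
  shows "prob_space M" "finite I" "\<And>i. i \<in> I \<Longrightarrow> X i \<in> borel_measurable M"
    "\<And>t. (CLINT \<omega>|M. iexp (\<Sum>i\<in>I. t i * X i \<omega>)) = exp (- (\<Sum>i\<in>I. \<Sum>j\<in>I. t i * t j * C i j) / 2)"
  using assms unfolding gauss_def by auto

lemma prob_space_std_normal: "prob_space std_normal_distribution"
  by (rule prob_space_normal_density) simp

interpretation std_normal: prob_space std_normal_distribution
  by (rule prob_space_std_normal)

interpretation std_normals: product_sigma_finite "\<lambda>_ :: 'i. std_normal_distribution"
  by standard

lemma prob_space_std_gauss: "prob_space (std_gauss I)"
  unfolding std_gauss_def by (intro prob_space_PiM prob_space_std_normal)

lemma sets_std_gauss[measurable_cong]: "sets (std_gauss I) = sets (\<Pi>\<^sub>M i\<in>I. borel)"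
  unfolding std_gauss_def by (intro sets_PiM_cong) auto

lemma space_std_gauss: "space (std_gauss I) = extensional I"
  unfolding std_gauss_def by (auto simp: space_PiM PiE_def)

lemma gauss_std:
  assumes I: "finite I"
  shows "gauss (std_gauss I) I (\<lambda>i \<omega>. \<omega> i) (\<lambda>i j. of_bool (i = j))"
  unfolding gauss_def
proof (intro conjI allI ballI)
  fix t :: "'a \<Rightarrow> real"
  have "(CLINT \<omega>|std_gauss I. iexp (\<Sum>i\<in>I. t i * \<omega> i)) = (CLINT \<omega>|std_gauss I. (\<Prod>i\<in>I. iexp (t i * \<omega> i)))"
    using I by (intro Bochner_Integration.integral_cong) (auto simp: exp_sum sum_distrib_left)
  also have "\<dots> = (\<Prod>i\<in>I. CLINT x|std_normal_distribution. iexp (t i * x))"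
    unfolding std_gauss_def
    by (rule std_normals.product_integral_prod[OF I]) (rule std_normal.integrable_iexp, auto)
  also have "\<dots> = (\<Prod>i\<in>I. complex_of_real (exp (- (t i)\<^sup>2 / 2)))"
    using char_std_normal_distribution by (intro prod.cong refl) (simp add: char_def fun_eq_iff)
  also have "\<dots> = exp (- (\<Sum>i\<in>I. (t i)\<^sup>2) / 2)"
    using I by (simp add: exp_sum[symmetric] sum_negf sum_divide_distrib flip: of_real_prod)
  also have "(\<Sum>i\<in>I. (t i)\<^sup>2) = (\<Sum>i\<in>I. \<Sum>j\<in>I. t i * t j * of_bool (i = j))"
  proof (intro sum.cong refl)
    fix i assume "i \<in> I"
    then have "(\<Sum>j\<in>I. t i * t j * of_bool (i = j)) = (\<Sum>j\<in>I. if i = j then t i * t j else 0)"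
      by (intro sum.cong) auto
    then show "(t i)\<^sup>2 = (\<Sum>j\<in>I. t i * t j * of_bool (i = j))" using I \<open>i \<in> I\<close> by (simp add: power2_eq_square)
  qed
  finally show "(CLINT \<omega>|std_gauss I. iexp (\<Sum>i\<in>I. t i * \<omega> i)) = exp (- (\<Sum>i\<in>I. \<Sum>j\<in>I. t i * t j * of_bool (i = j)) / 2)" by simp
qed (auto simp: I prob_space_std_gauss)

lemma gauss_cong:
  assumes "gauss M I X C" and "\<And>i \<omega>. i \<in> I \<Longrightarrow> \<omega> \<in> space M \<Longrightarrow> Y i \<omega> = X i \<omega>"
    and "\<And>i j. i \<in> I \<Longrightarrow> j \<in> I \<Longrightarrow> D i j = C i j"
  shows "gauss M I Y D"
proof -
  note g = gaussD[OF assms(1)]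
  have "Y i \<in> borel_measurable M" if "i \<in> I" for i
    using g(3)[OF that] assms(2)[OF that] by (simp cong: measurable_cong)
  moreover have "(CLINT \<omega>|M. iexp (\<Sum>i\<in>I. t i * Y i \<omega>)) = (CLINT \<omega>|M. iexp (\<Sum>i\<in>I. t i * X i \<omega>))" for t
    by (intro Bochner_Integration.integral_cong) (auto simp: assms(2))
  moreover have "(\<Sum>i\<in>I. \<Sum>j\<in>I. t i * t j * D i j) = (\<Sum>i\<in>I. \<Sum>j\<in>I. t i * t j * C i j)" for t
    by (intro sum.cong) (auto simp: assms(3))
  ultimately show ?thesis using g unfolding gauss_def by simp
qed

lemma gauss_linear:
  assumes g: "gauss M I X C" and J: "finite J"
  shows "gauss M J (\<lambda>j \<omega>. \<Sum>i\<in>I. A j i * X i \<omega>) (\<lambda>j k. \<Sum>i\<in>I. \<Sum>l\<in>I. A j i * A k l * C i l)"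
  unfolding gauss_def
proof (intro conjI allI ballI)
  note G = gaussD[OF g]
  fix t :: "'c \<Rightarrow> real"
  define s where "s i = (\<Sum>j\<in>J. t j * A j i)" for i
  have "(\<Sum>j\<in>J. t j * (\<Sum>i\<in>I. A j i * X i \<omega>)) = (\<Sum>i\<in>I. s i * X i \<omega>)" for \<omega>
    unfolding s_def sum_distrib_left sum_distrib_right by (subst sum.swap) (simp add: mult_ac)
  moreover have "(\<Sum>i\<in>I. \<Sum>l\<in>I. s i * s l * C i l) = (\<Sum>j\<in>J. \<Sum>k\<in>J. t j * t k * (\<Sum>i\<in>I. \<Sum>l\<in>I. A j i * A k l * C i l))"
  proof -
    have "(\<Sum>i\<in>I. \<Sum>l\<in>I. s i * s l * C i l) = (\<Sum>i\<in>I. \<Sum>l\<in>I. \<Sum>j\<in>J. \<Sum>k\<in>J. t j * A j i * (t k * A k l) * C i l)"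
      unfolding s_def unfolding sum_product unfolding sum_distrib_right by simp
    also have "\<dots> = (\<Sum>i\<in>I. \<Sum>j\<in>J. \<Sum>l\<in>I. \<Sum>k\<in>J. t j * A j i * (t k * A k l) * C i l)"
      by (intro sum.cong refl sum.swap)
    also have "\<dots> = (\<Sum>j\<in>J. \<Sum>i\<in>I. \<Sum>l\<in>I. \<Sum>k\<in>J. t j * A j i * (t k * A k l) * C i l)"
      by (rule sum.swap)
    also have "\<dots> = (\<Sum>j\<in>J. \<Sum>i\<in>I. \<Sum>k\<in>J. \<Sum>l\<in>I. t j * A j i * (t k * A k l) * C i l)"
      by (intro sum.cong refl sum.swap)
    also have "\<dots> = (\<Sum>j\<in>J. \<Sum>k\<in>J. \<Sum>i\<in>I. \<Sum>l\<in>I. t j * A j i * (t k * A k l) * C i l)"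
      by (intro sum.cong refl sum.swap)
    finally show ?thesis by (simp add: sum_distrib_left mult_ac)
  qed
  ultimately show "(CLINT \<omega>|M. iexp (\<Sum>j\<in>J. t j * (\<Sum>i\<in>I. A j i * X i \<omega>)))
    = exp (- (\<Sum>j\<in>J. \<Sum>k\<in>J. t j * t k * (\<Sum>i\<in>I. \<Sum>l\<in>I. A j i * A k l * C i l)) / 2)"
    using G(4)[of s] by simp
qed (use gaussD[OF g] J in auto)

lemma gauss_linear_std:
  assumes I: "finite I" and J: "finite J"
  shows "gauss (std_gauss I) J (\<lambda>j \<omega>. \<Sum>i\<in>I. A j i * \<omega> i) (\<lambda>j k. \<Sum>i\<in>I. A j i * A k i)"
proof (rule gauss_cong[OF gauss_linear[OF gauss_std[OF I] J, of A]])
  fix j k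
  have "(\<Sum>l\<in>I. A j i * A k l * of_bool (i = l)) = A j i * A k i" if "i \<in> I" for i
  proof -
    have "(\<Sum>l\<in>I. A j i * A k l * of_bool (i = l)) = (\<Sum>l\<in>I. if i = l then A j i * A k l else 0)"
      by (intro sum.cong) auto
    then show ?thesis using I that by simp
  qed
  then show "(\<Sum>i\<in>I. A j i * A k i) = (\<Sum>i\<in>I. \<Sum>l\<in>I. A j i * A k l * of_bool (i = l))" by simp
qed simp

lemma gauss_law_eq:
  assumes "gauss M I X C" "gauss N I Y C"
  shows "distr M (\<Pi>\<^sub>M i\<in>I. borel) (\<lambda>\<omega>. \<lambda>i\<in>I. X i \<omega>) = distr N (\<Pi>\<^sub>M i\<in>I. borel) (\<lambda>\<omega>. \<lambda>i\<in>I. Y i \<omega>)"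
  using gaussD[OF assms(1)] gaussD[OF assms(2)] by (intro law_eq_if_char_eq) auto

lemma gauss_prob_eq:
  assumes g: "gauss M I X C" "gauss N I Y C" and P: "Measurable.pred (\<Pi>\<^sub>M i\<in>I. borel) P"
  shows "measure M {\<omega>\<in>space M. P (\<lambda>i\<in>I. X i \<omega>)} = measure N {\<omega>\<in>space N. P (\<lambda>i\<in>I. Y i \<omega>)}"
proof -
  let ?A = "{f \<in> space (\<Pi>\<^sub>M i\<in>I. borel). P f}"
  have A: "?A \<in> sets (\<Pi>\<^sub>M i\<in>I. borel)" using P by measurable
  have m: "(\<lambda>\<omega>. \<lambda>i\<in>I. X i \<omega>) \<in> measurable M (\<Pi>\<^sub>M i\<in>I. borel)" "(\<lambda>\<omega>. \<lambda>i\<in>I. Y i \<omega>) \<in> measurable N (\<Pi>\<^sub>M i\<in>I. borel)"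
    using gaussD[OF g(1)] gaussD[OF g(2)] by (auto intro!: measurable_restrict)
  have "(\<lambda>\<omega>. \<lambda>i\<in>I. X i \<omega>) -` ?A \<inter> space M = {\<omega>\<in>space M. P (\<lambda>i\<in>I. X i \<omega>)}"
    "(\<lambda>\<omega>. \<lambda>i\<in>I. Y i \<omega>) -` ?A \<inter> space N = {\<omega>\<in>space N. P (\<lambda>i\<in>I. Y i \<omega>)}"
    by (auto simp: space_PiM)
  then show ?thesis
    using measure_distr[OF m(1) A] measure_distr[OF m(2) A] gauss_law_eq[OF g] by simp
qed

lemma gauss_prob_all_le_eq:
  assumes g: "gauss M I X C" "gauss N I Y C"
  shows "measure M {\<omega>\<in>space M. \<forall>i\<in>I. \<bar>X i \<omega>\<bar> \<le> t i} = measure N {\<omega>\<in>space N. \<forall>i\<in>I. \<bar>Y i \<omega>\<bar> \<le> t i}"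
proof -
  have I: "finite I" using gaussD[OF g(1)] by simp
  then have "Measurable.pred (\<Pi>\<^sub>M i\<in>I. borel) (\<lambda>f :: 'b \<Rightarrow> real. \<forall>i\<in>I. \<bar>f i\<bar> \<le> t i)"
    by measurable
  from gauss_prob_eq[OF g this] show ?thesis by (simp cong: conj_cong ball_cong)
qed

section \<open>Product spaces and independent Gaussian blocks\<close>

lemma integral_pair_mult:
  fixes f :: "'a \<Rightarrow> complex" and g :: "'b \<Rightarrow> complex"
  assumes "prob_space M" "prob_space N" "integrable M f" "integrable N g"
  shows "(\<integral>z. f (fst z) * g (snd z) \<partial>(M \<Otimes>\<^sub>M N)) = (\<integral>x. f x \<partial>M) * (\<integral>y. g y \<partial>N)"
proof -
  interpret M: prob_space M by fact
  interpret N: prob_space N by fact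
  interpret P: pair_prob_space M N by standard
  have "(\<integral>z. f (fst z) * g (snd z) \<partial>(M \<Otimes>\<^sub>M N)) = (\<integral>x. \<integral>y. f x * g y \<partial>N \<partial>M)"
  proof (subst P.integral_fst'[symmetric])
    have [measurable]: "f \<in> borel_measurable M" "g \<in> borel_measurable N" using assms by auto
    show "integrable (M \<Otimes>\<^sub>M N) (\<lambda>z. f (fst z) * g (snd z))"
    proof (rule P.Fubini_integrable)
      have "(\<lambda>x. \<integral>y. norm (f (fst (x, y)) * g (snd (x, y))) \<partial>N) = (\<lambda>x. norm (f x) * (\<integral>y. norm (g y) \<partial>N))"
        by (simp add: norm_mult)
      then show "integrable M (\<lambda>x. \<integral>y. norm (f (fst (x, y)) * g (snd (x, y))) \<partial>N)"
        using assms by simp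
      show "AE x in M. integrable N (\<lambda>y. f (fst (x, y)) * g (snd (x, y)))"
        using assms by auto
    qed simp
  qed simp
  also have "\<dots> = (\<integral>x. f x \<partial>M) * (\<integral>y. g y \<partial>N)" using assms by simp
  finally show ?thesis .
qed

lemma integrable_iexp_real:
  assumes "prob_space M" "f \<in> borel_measurable M"
  shows "integrable M (\<lambda>x. iexp (f x))"
  using assms by (intro prob_space.integrable_iexp) auto

lemma gauss_pair:
  assumes X: "gauss M I X C" and Y: "gauss N J Y D"
  shows "gauss (M \<Otimes>\<^sub>M N) (I <+> J) (\<lambda>k z. case_sum (\<lambda>i. X i (fst z)) (\<lambda>j. Y j (snd z)) k)
    (\<lambda>k l. case k of Inl i \<Rightarrow> (case l of Inl i' \<Rightarrow> C i i' | Inr _ \<Rightarrow> 0)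
       | Inr j \<Rightarrow> (case l of Inl _ \<Rightarrow> 0 | Inr j' \<Rightarrow> D j j'))" (is "gauss _ _ ?Z ?E")
  unfolding gauss_def
proof (intro conjI allI ballI)
  note gX = gaussD[OF X] and gY = gaussD[OF Y]
  interpret M: prob_space M by fact
  interpret N: prob_space N by fact
  interpret P: pair_prob_space M N by standard
  show "prob_space (M \<Otimes>\<^sub>M N)" by (rule P.prob_space_axioms)
  show "finite (I <+> J)" using gX gY by auto
  have [measurable]: "X i \<in> borel_measurable M" if "i \<in> I" for i using gX that by auto
  have [measurable]: "Y i \<in> borel_measurable N" if "i \<in> J" for i using gY that by auto
  show "?Z k \<in> borel_measurable (M \<Otimes>\<^sub>M N)" if "k \<in> I <+> J" for k
    using that by auto
  fix t
  have *: "(\<Sum>k\<in>I <+> J. t k * ?Z k z) = (\<Sum>i\<in>I. t (Inl i) * X i (fst z)) + (\<Sum>j\<in>J. t (Inr j) * Y j (snd z))" for z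
    using gX gY by (simp add: sum.Plus)
  have q: "(\<Sum>k\<in>I <+> J. \<Sum>l\<in>I <+> J. t k * t l * ?E k l) = (\<Sum>i\<in>I. \<Sum>i'\<in>I. t (Inl i) * t (Inl i') * C i i') + (\<Sum>j\<in>J. \<Sum>j'\<in>J. t (Inr j) * t (Inr j') * D j j')"
    using gX gY by (simp add: sum.Plus)
  have "(CLINT z|M \<Otimes>\<^sub>M N. iexp (\<Sum>k\<in>I <+> J. t k * ?Z k z))
     = (CLINT z|M \<Otimes>\<^sub>M N. iexp (\<Sum>i\<in>I. t (Inl i) * X i (fst z)) * iexp (\<Sum>j\<in>J. t (Inr j) * Y j (snd z)))"
    unfolding * by (simp add: exp_add[symmetric] algebra_simps)
  also have "\<dots> = (CLINT x|M. iexp (\<Sum>i\<in>I. t (Inl i) * X i x)) * (CLINT y|N. iexp (\<Sum>j\<in>J. t (Inr j) * Y j y))"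
    by (rule integral_pair_mult) (intro integrable_iexp_real borel_measurable_sum borel_measurable_times gX gY; simp)+
  also have "\<dots> = exp (- (\<Sum>k\<in>I <+> J. \<Sum>l\<in>I <+> J. t k * t l * ?E k l) / 2)"
    unfolding gX gY q by (simp flip: exp_add of_real_mult add: field_simps)
  finally show "(CLINT z|M \<Otimes>\<^sub>M N. iexp (\<Sum>k\<in>I <+> J. t k * ?Z k z)) = \<dots>" .
qed

lemma prob_pair_times:
  assumes "prob_space M" "prob_space N" "A \<in> sets M" "B \<in> sets N"
  shows "measure (M \<Otimes>\<^sub>M N) (A \<times> B) = measure M A * measure N B"
proof -
  interpret N: prob_space N by fact
  interpret M: prob_space M by fact
  show ?thesis using N.emeasure_pair_measure_Times[OF assms(3,4)]
    by (simp add: measure_def enn2real_mult)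
qed

lemma
  assumes "prob_space M" "prob_space N" and A: "A \<in> sets (M \<Otimes>\<^sub>M N)"
  shows measurable_prob_section: "(\<lambda>x. measure N (Pair x -` A)) \<in> borel_measurable M"
    and prob_pair_integral: "measure (M \<Otimes>\<^sub>M N) A = (\<integral>x. measure N (Pair x -` A) \<partial>M)"
proof -
  interpret M: prob_space M by fact
  interpret N: prob_space N by fact
  interpret P: pair_prob_space M N by standard
  show m: "(\<lambda>x. measure N (Pair x -` A)) \<in> borel_measurable M"
    using N.measurable_emeasure_Pair[OF A] by (simp add: measure_def)
  have "ennreal (measure (M \<Otimes>\<^sub>M N) A) = (\<integral>\<^sup>+x. ennreal (measure N (Pair x -` A)) \<partial>M)"
    using N.emeasure_pair_measure_alt[OF A] by (simp add: P.emeasure_eq_measure N.emeasure_eq_measure)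
  also have "\<dots> = ennreal (\<integral>x. measure N (Pair x -` A) \<partial>M)"
    by (rule nn_integral_eq_integral) (auto intro!: M.integrable_const_bound[of _ 1] m)
  finally show "measure (M \<Otimes>\<^sub>M N) A = (\<integral>x. measure N (Pair x -` A) \<partial>M)"
    by (subst (asm) ennreal_inj) (auto intro!: integral_nonneg_AE)
qed

lemma prob_pair_le:
  assumes "prob_space M" "prob_space N" and A: "A \<in> sets (M \<Otimes>\<^sub>M N)"
    and le: "\<And>x. x \<in> space M \<Longrightarrow> measure N (Pair x -` A) \<le> c"
  shows "measure (M \<Otimes>\<^sub>M N) A \<le> c"
proof -
  interpret M: prob_space M by fact
  interpret N: prob_space N by fact
  have "(\<integral>x. measure N (Pair x -` A) \<partial>M) \<le> (\<integral>x. c \<partial>M)"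
  proof (rule integral_mono)
    show "integrable M (\<lambda>x. measure N (Pair x -` A))"
      by (rule M.integrable_const_bound[of _ 1]) (auto intro!: measurable_prob_section assms)
  qed (use le in auto)
  then show ?thesis by (simp add: prob_pair_integral assms M.prob_space)
qed

text \<open>A block diagonal covariance means independent blocks: the family has the law of two
  families on a product space, where the event is a rectangle.\<close>

lemma gauss_prob_two_blocks:
  assumes g: "gauss M (I <+> J) Z (\<lambda>k l. case k of Inl i \<Rightarrow> (case l of Inl i' \<Rightarrow> C i i' | Inr _ \<Rightarrow> 0)
       | Inr j \<Rightarrow> (case l of Inl _ \<Rightarrow> 0 | Inr j' \<Rightarrow> D j j'))"
    and X: "gauss N I X C" and Y: "gauss N' J Y D"
  shows "measure M {\<omega>\<in>space M. (\<forall>i\<in>I. \<bar>Z (Inl i) \<omega>\<bar> \<le> t) \<and> (\<forall>j\<in>J. \<bar>Z (Inr j) \<omega>\<bar> \<le> s)}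
    = measure N {\<omega>\<in>space N. \<forall>i\<in>I. \<bar>X i \<omega>\<bar> \<le> t} * measure N' {\<omega>\<in>space N'. \<forall>j\<in>J. \<bar>Y j \<omega>\<bar> \<le> s}"
proof -
  let ?t = "case_sum (\<lambda>_. t) (\<lambda>_. s)"
  have [measurable]: "X i \<in> borel_measurable N" if "i \<in> I" for i using gaussD[OF X] that by auto
  have [measurable]: "Y i \<in> borel_measurable N'" if "i \<in> J" for i using gaussD[OF Y] that by auto
  have fin: "finite I" "finite J" using gaussD[OF X] gaussD[OF Y] by auto
  have "{\<omega>\<in>space M. (\<forall>i\<in>I. \<bar>Z (Inl i) \<omega>\<bar> \<le> t) \<and> (\<forall>j\<in>J. \<bar>Z (Inr j) \<omega>\<bar> \<le> s)}
     = {\<omega>\<in>space M. \<forall>k\<in>I<+>J. \<bar>Z k \<omega>\<bar> \<le> ?t k}" by (auto simp: Plus_def ball_Un)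
  moreover have "{z\<in>space (N \<Otimes>\<^sub>M N'). \<forall>k\<in>I<+>J. \<bar>case_sum (\<lambda>i. X i (fst z)) (\<lambda>j. Y j (snd z)) k\<bar> \<le> ?t k}
     = {\<omega>\<in>space N. \<forall>i\<in>I. \<bar>X i \<omega>\<bar> \<le> t} \<times> {\<omega>\<in>space N'. \<forall>j\<in>J. \<bar>Y j \<omega>\<bar> \<le> s}"
    by (auto simp: space_pair_measure Plus_def ball_Un)
  moreover have "{\<omega>\<in>space N. \<forall>i\<in>I. \<bar>X i \<omega>\<bar> \<le> t} \<in> sets N" using fin by measurable
  moreover have "{\<omega>\<in>space N'. \<forall>i\<in>J. \<bar>Y i \<omega>\<bar> \<le> s} \<in> sets N'" using fin by measurable
  ultimately show ?thesis
    using gauss_prob_all_le_eq[OF g gauss_pair[OF X Y], of ?t] prob_pair_times[of N N'] gaussD[OF X] gaussD[OF Y] by simp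
qed

section \<open>Tail bounds\<close>

text \<open>The integrand times the standard density is \<open>1 / sqrt (1 - 2 * a)\<close> times
  the normal density of variance \<open>1 / (1 - 2 * a)\<close>.\<close>

lemma std_normal_exp_square:
  assumes "a < 1/2"
  shows "integrable std_normal_distribution (\<lambda>x. exp (a * x\<^sup>2))"
    "(\<integral>x. exp (a * x\<^sup>2) \<partial>std_normal_distribution) = 1 / sqrt (1 - 2 * a)"
proof -
  define s where "s = 1 / sqrt (1 - 2 * a)"
  have p: "1 - 2 * a > 0" and s: "s > 0" and s2: "s\<^sup>2 = 1 / (1 - 2 * a)"
    using assms by (auto simp: s_def power_divide)
  have e: "std_normal_density x *\<^sub>R exp (a * x\<^sup>2) = s * normal_density 0 s x" for x
  proof -
    have "s * normal_density 0 s x = s * (1 / sqrt (2 * pi) / s * exp (- x\<^sup>2 / (2 * s\<^sup>2)))"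
      using s by (simp add: normal_density_def real_sqrt_mult)
    also have "\<dots> = 1 / sqrt (2 * pi) * exp (- x\<^sup>2 / 2 + a * x\<^sup>2)"
      using s p by (simp add: s2 field_simps)
    finally show ?thesis by (simp add: normal_density_def[of 0 1] mult_exp_exp)
  qed
  show "integrable std_normal_distribution (\<lambda>x. exp (a * x\<^sup>2))"
    by (subst integrable_density) (use s in \<open>auto simp: e[unfolded real_scaleR_def] normal_density_nonneg\<close>)
  show "(\<integral>x. exp (a * x\<^sup>2) \<partial>std_normal_distribution) = 1 / sqrt (1 - 2 * a)"
    by (subst integral_density) (use s in \<open>auto simp: e[unfolded real_scaleR_def] normal_density_nonneg s_def[symmetric]\<close>)
qed

lemma std_gauss_exp_square:
  assumes "a < 1/2" and I: "finite I"
  shows "integrable (std_gauss I) (\<lambda>\<omega>. exp (a * (\<Sum>i\<in>I. (\<omega> i)\<^sup>2)))"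
    "(\<integral>\<omega>. exp (a * (\<Sum>i\<in>I. (\<omega> i)\<^sup>2)) \<partial>std_gauss I) = (1 / sqrt (1 - 2 * a)) ^ card I"
  using std_normals.product_integrable_prod[OF I, of "\<lambda>_ x. exp (a * x\<^sup>2)"]
    std_normals.product_integral_prod[OF I, of "\<lambda>_ x. exp (a * x\<^sup>2)"] std_normal_exp_square[OF assms(1)] I
  by (auto simp: std_gauss_def exp_sum sum_distrib_left)

text \<open>Chernoff's bound with exponent e / 8. The sign of \<open>e\<close> selects the tail,
  which is why the inequality in the event is multiplied by \<open>e\<close>.\<close>

lemma std_gauss_sum_squares_one_sided:
  fixes e :: real
  assumes I: "finite I" and e: "\<bar>e\<bar> \<le> 1"
  shows "measure (std_gauss I) {\<omega>\<in>space (std_gauss I). card I * e\<^sup>2 \<le> e * ((\<Sum>i\<in>I. (\<omega> i)\<^sup>2) - real (card I))}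
    \<le> exp (- (card I * e\<^sup>2) / 16)"
proof -
  interpret prob_space "std_gauss I" by (rule prob_space_std_gauss)
  let ?n = "real (card I)"
  define S :: "('a \<Rightarrow> real) \<Rightarrow> real" where "S = (\<lambda>\<omega>. \<Sum>i\<in>I. (\<omega> i)\<^sup>2)"
  let ?a = "e / 8"
  have a: "?a < 1/2" using e by linarith
  define b where "b = ?n * e * (1 + e) / 8"
  have "{\<omega>\<in>space (std_gauss I). ?n * e\<^sup>2 \<le> e * (S \<omega> - ?n)} = {\<omega>\<in>space (std_gauss I). exp b \<le> exp (?a * S \<omega>)}"
    unfolding b_def exp_le_cancel_iff by (intro Collect_cong conj_cong refl) (auto simp: power2_eq_square field_simps)
  moreover have "measure (std_gauss I) {\<omega>\<in>space (std_gauss I). exp b \<le> exp (?a * S \<omega>)} \<le> (\<integral>\<omega>. exp (?a * S \<omega>) \<partial>std_gauss I) / exp b"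
    using std_gauss_exp_square(1)[OF a I] by (intro integral_Markov_inequality_measure[where A = "{}"]) (auto simp: S_def)
  moreover have "(\<integral>\<omega>. exp (?a * S \<omega>) \<partial>std_gauss I) = (1 / sqrt (1 - e / 4)) ^ card I"
    using std_gauss_exp_square(2)[OF a I] by (simp add: S_def)
  moreover have "(1 / sqrt (1 - e / 4)) ^ card I = exp (- ?n / 2 * ln (1 - e / 4))"
  proof -
    have p: "1 - e / 4 > 0" using e by linarith
    then have "1 / sqrt (1 - e / 4) = exp (- (ln (1 - e / 4) / 2))"
      by (simp add: exp_minus inverse_eq_divide ln_sqrt[symmetric])
    then show ?thesis by (simp add: exp_of_nat_mult[symmetric] field_simps)
  qed
  moreover have "exp (- ?n / 2 * ln (1 - e / 4)) / exp b \<le> exp (- (?n * e\<^sup>2) / 16)"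
  proof -
    \<comment> \<open>With -ln (1 - e/4) \<le> e/4 + e^2/8 the linear terms cancel: n/2 * (e/4 +
      e^2/8) - n * e * (1 + e)/8 = - n * e^2/16.\<close>
    have "\<bar>ln (1 + (- e / 4)) - (- e / 4)\<bar> \<le> 2 * (- e / 4)\<^sup>2"
      by (rule abs_ln_one_plus_x_minus_x_bound) (use e in auto)
    have l: "- ln (1 - e / 4) \<le> e / 4 + e\<^sup>2 / 8" using abs_le_D2[OF \<open>\<bar>ln (1 + (- e / 4)) - (- e / 4)\<bar> \<le> 2 * (- e / 4)\<^sup>2\<close>] by (simp add: power_divide)
    have "- ?n / 2 * ln (1 - e / 4) = ?n / 2 * (- ln (1 - e / 4))" by simp
    also have "\<dots> \<le> ?n / 2 * (e / 4 + e\<^sup>2 / 8)" by (intro mult_left_mono l) auto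
    finally have "- ?n / 2 * ln (1 - e / 4) - b \<le> - (?n * e\<^sup>2) / 16"
      unfolding b_def by (simp add: power2_eq_square algebra_simps)
    then show ?thesis by (simp flip: exp_diff)
  qed
  ultimately show ?thesis by (simp add: S_def)
qed

lemma std_gauss_sum_squares:
  fixes e :: real
  assumes I: "finite I" and e: "0 \<le> e" "e \<le> 1"
  shows "measure (std_gauss I) {\<omega>\<in>space (std_gauss I). card I * e < \<bar>(\<Sum>i\<in>I. (\<omega> i)\<^sup>2) - real (card I)\<bar>}
    \<le> 2 * exp (- (card I * e\<^sup>2) / 16)"
proof -
  interpret prob_space "std_gauss I" by (rule prob_space_std_gauss)
  let ?A = "\<lambda>e::real. {\<omega>\<in>space (std_gauss I). card I * e\<^sup>2 \<le> e * ((\<Sum>i\<in>I. (\<omega> i)\<^sup>2) - real (card I))}"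
  have m: "?A e \<in> sets (std_gauss I)" for e using I by measurable
  have "{\<omega>\<in>space (std_gauss I). card I * e < \<bar>(\<Sum>i\<in>I. (\<omega> i)\<^sup>2) - real (card I)\<bar>} \<subseteq> ?A e \<union> ?A (- e)"
  proof (safe, goal_cases)
    case (1 \<omega>)
    let ?d = "(\<Sum>i\<in>I. (\<omega> i)\<^sup>2) - real (card I)"
    have "e * (card I * e) \<le> e * \<bar>?d\<bar>" using 1 e by (intro mult_left_mono) auto
    then show ?case using 1 by (cases "?d \<ge> 0") (auto simp: power2_eq_square algebra_simps)
  qed
  then have "prob {\<omega>\<in>space (std_gauss I). card I * e < \<bar>(\<Sum>i\<in>I. (\<omega> i)\<^sup>2) - real (card I)\<bar>} \<le> prob (?A e \<union> ?A (- e))"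
    using m by (intro finite_measure_mono) auto
  also have "\<dots> \<le> prob (?A e) + prob (?A (- e))" using m by (intro measure_Un_le) auto
  also have "\<dots> \<le> exp (- (card I * e\<^sup>2) / 16) + exp (- (card I * (- e)\<^sup>2) / 16)"
    using e by (intro add_mono std_gauss_sum_squares_one_sided I) auto
  finally show ?thesis by simp
qed

lemma gauss_reindex:
  assumes g: "gauss M I X C" and J: "finite J" and f: "\<And>j. j \<in> J \<Longrightarrow> f j \<in> I"
  shows "gauss M J (\<lambda>j. X (f j)) (\<lambda>j k. C (f j) (f k))"
proof (rule gauss_cong[OF gauss_linear[OF g J, of "\<lambda>j i. of_bool (i = f j)"]])
  have fin: "finite I" using gaussD[OF g] by simp
  have s: "(\<Sum>i\<in>I. of_bool (i = a) * h i) = h a" if "a \<in> I" for a and h :: "'b \<Rightarrow> real"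
  proof -
    have "(\<Sum>i\<in>I. of_bool (i = a) * h i) = (\<Sum>i\<in>I. if a = i then h i else 0)" by (intro sum.cong) auto
    then show ?thesis using fin that by simp
  qed
  show "X (f j) \<omega> = (\<Sum>i\<in>I. of_bool (i = f j) * X i \<omega>)" if "j \<in> J" for j \<omega>
    using s[OF f[OF that]] by simp
  show "C (f j) (f k) = (\<Sum>i\<in>I. \<Sum>l\<in>I. of_bool (i = f j) * of_bool (l = f k) * C i l)" if "j \<in> J" "k \<in> J" for j k
  proof -
    have "(\<Sum>i\<in>I. \<Sum>l\<in>I. of_bool (i = f j) * of_bool (l = f k) * C i l) = (\<Sum>i\<in>I. of_bool (i = f j) * (\<Sum>l\<in>I. of_bool (l = f k) * C i l))"
      by (simp only: sum_distrib_left mult.assoc)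
    then show ?thesis by (simp only: s[OF f[OF that(1)]] s[OF f[OF that(2)]])
  qed
qed

text \<open>A characteristic function has modulus at most 1, so
  \<open>exp (- C i i / 2) \<le> 1\<close>.\<close>

lemma gauss_var_nonneg:
  assumes g: "gauss M I X C" and i: "i \<in> I"
  shows "0 \<le> C i i"
proof -
  have "gauss M {i} X C" using gauss_reindex[OF g, of "{i}" "\<lambda>i. i"] i by simp
  from gaussD(4)[OF this, of "\<lambda>_. 1"] have e: "(CLINT \<omega>|M. iexp (X i \<omega>)) = exp (- C i i / 2)" by simp
  interpret prob_space M using gaussD[OF g] by simp
  have "norm (CLINT \<omega>|M. iexp (X i \<omega>)) \<le> (\<integral>\<omega>. norm (iexp (X i \<omega>)) \<partial>M)" by (rule integral_norm_bound)
  then have "norm (complex_of_real (exp (- C i i / 2))) \<le> 1" unfolding e by (simp add: prob_space)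
  then show ?thesis by (simp del: of_real_exp add: norm_of_real)
qed

text \<open>Markov's inequality for exp (g^2 / 4), whose mean is sqrt 2 for a standard normal g. The
  bound is in terms of an upper bound \<open>v\<close> of the variance, so that a degenerate
  variable causes no division by zero.\<close>

lemma gauss_tail:
  assumes g: "gauss M I X C" and i: "i \<in> I" and v: "C i i \<le> v" "0 < v" and t: "0 \<le> t"
  shows "measure M {\<omega>\<in>space M. t < \<bar>X i \<omega>\<bar>} \<le> sqrt 2 * exp (- t\<^sup>2 / (4 * v))"
proof -
  let ?G = "std_gauss {()}"
  interpret M: prob_space M using gaussD[OF g] by simp
  interpret G: prob_space ?G by (rule prob_space_std_gauss)
  have c: "0 \<le> C i i" by (rule gauss_var_nonneg[OF g i])
  have [measurable]: "X i \<in> borel_measurable M" using gaussD[OF g] i by simp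
  have 1: "gauss M {()} (\<lambda>_. X i) (\<lambda>_ _. C i i)" using gauss_reindex[OF g, of "{()}" "\<lambda>_. i"] i by simp
  have 2: "gauss ?G {()} (\<lambda>_ \<omega>. sqrt (C i i) * \<omega> ()) (\<lambda>_ _. C i i)"
    using gauss_linear_std[of "{()}" "{()}" "\<lambda>_ _. sqrt (C i i)"] c by simp
  have eq: "measure M {\<omega>\<in>space M. \<forall>j\<in>{()}. \<bar>X i \<omega>\<bar> \<le> t} = measure ?G {\<omega>\<in>space ?G. \<forall>j\<in>{()}. \<bar>sqrt (C i i) * \<omega> ()\<bar> \<le> t}"
    by (rule gauss_prob_all_le_eq[OF 1 2])
  have "measure M {\<omega>\<in>space M. t < \<bar>X i \<omega>\<bar>} = 1 - measure M {\<omega>\<in>space M. \<not> (t < \<bar>X i \<omega>\<bar>)}"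
    by (subst M.prob_neg) auto
  also have "\<dots> = 1 - measure ?G {\<omega>\<in>space ?G. \<not> t < \<bar>sqrt (C i i) * \<omega> ()\<bar>}" using eq by (simp add: not_less)
  also have "\<dots> = measure ?G {\<omega>\<in>space ?G. t < \<bar>sqrt (C i i) * \<omega> ()\<bar>}"
  proof -
    have "{\<omega>\<in>space ?G. t < \<bar>sqrt (C i i) * \<omega> ()\<bar>} \<in> sets ?G" by measurable
    from G.prob_neg[OF this] show ?thesis by simp
  qed
  also have "\<dots> \<le> measure ?G {\<omega>\<in>space ?G. exp (t\<^sup>2 / (4 * v)) \<le> exp (1/4 * (\<Sum>i\<in>{()}. (\<omega> i)\<^sup>2))}"
  proof (intro G.finite_measure_mono subsetI CollectI conjI)
    fix \<omega> assume "\<omega> \<in> {\<omega>\<in>space ?G. t < \<bar>sqrt (C i i) * \<omega> ()\<bar>}"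
    then have "t < \<bar>sqrt (C i i) * \<omega> ()\<bar>" by simp
    then have "t\<^sup>2 \<le> (sqrt (C i i) * \<omega> ())\<^sup>2" using t power_mono[of t "\<bar>sqrt (C i i) * \<omega> ()\<bar>" 2] by simp
    also have "\<dots> = C i i * (\<omega> ())\<^sup>2" using c by (simp add: power_mult_distrib)
    also have "\<dots> \<le> v * (\<omega> ())\<^sup>2" using v by (intro mult_right_mono) auto
    finally show "exp (t\<^sup>2 / (4 * v)) \<le> exp (1/4 * (\<Sum>i\<in>{()}. (\<omega> i)\<^sup>2))" using v by (simp add: field_simps)
  qed auto
  also have "\<dots> \<le> (\<integral>\<omega>. exp (1/4 * (\<Sum>i\<in>{()}. (\<omega> i)\<^sup>2)) \<partial>?G) / exp (t\<^sup>2 / (4 * v))"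
    using std_gauss_exp_square(1)[of "1/4" "{()}"] by (intro integral_Markov_inequality_measure[where A = "{}"]) auto
  also have "\<dots> = sqrt 2 * exp (- t\<^sup>2 / (4 * v))"
    using std_gauss_exp_square(2)[of "1/4" "{()}"] by (simp add: exp_minus field_simps real_sqrt_divide)
  finally show ?thesis .
qed

lemma gauss_max_tail:
  assumes g: "gauss M I X C" and v: "\<And>i. i \<in> I \<Longrightarrow> C i i \<le> v" "0 < v" and t: "0 \<le> t"
  shows "measure M {\<omega>\<in>space M. \<exists>i\<in>I. t < \<bar>X i \<omega>\<bar>} \<le> 2 * real (card I) * exp (- t\<^sup>2 / (4 * v))"
proof -
  interpret M: prob_space M using gaussD[OF g] by simp
  have I: "finite I" using gaussD[OF g] by simp
  have [measurable]: "X i \<in> borel_measurable M" if "i \<in> I" for i using gaussD[OF g] that by simp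
  have "{\<omega>\<in>space M. \<exists>i\<in>I. t < \<bar>X i \<omega>\<bar>} = (\<Union>i\<in>I. {\<omega>\<in>space M. t < \<bar>X i \<omega>\<bar>})" by auto
  also have "measure M \<dots> \<le> (\<Sum>i\<in>I. measure M {\<omega>\<in>space M. t < \<bar>X i \<omega>\<bar>})"
    by (rule measure_UNION_le) (use I in auto)
  also have "\<dots> \<le> (\<Sum>i\<in>I. 2 * exp (- t\<^sup>2 / (4 * v)))"
  proof (intro sum_mono)
    fix i assume "i \<in> I"
    then have "measure M {\<omega>\<in>space M. t < \<bar>X i \<omega>\<bar>} \<le> sqrt 2 * exp (- t\<^sup>2 / (4 * v))" by (intro gauss_tail[OF g]) (use v t in auto)
    also have "\<dots> \<le> 2 * exp (- t\<^sup>2 / (4 * v))" by (intro mult_right_mono real_le_lsqrt) auto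
    finally show "measure M {\<omega>\<in>space M. t < \<bar>X i \<omega>\<bar>} \<le> 2 * exp (- t\<^sup>2 / (4 * v))" .
  qed
  finally show ?thesis by simp
qed

lemma gauss_iid_sum_squares:
  fixes c e :: real
  assumes g: "gauss M I X (\<lambda>i j. c * of_bool (i = j))" and c: "0 \<le> c" and e: "0 \<le> e" "e \<le> 1"
  shows "measure M {\<omega>\<in>space M. c * card I * e < \<bar>(\<Sum>i\<in>I. (X i \<omega>)\<^sup>2) - c * card I\<bar>} \<le> 2 * exp (- (card I * e\<^sup>2) / 16)"
proof -
  have I: "finite I" using gaussD[OF g] by simp
  let ?G = "std_gauss I"
  interpret G: prob_space ?G by (rule prob_space_std_gauss)
  have 2: "gauss ?G I (\<lambda>j \<omega>. sqrt c * \<omega> j) (\<lambda>i j. c * of_bool (i = j))"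
  proof (rule gauss_cong[OF gauss_linear_std[OF I I, of "\<lambda>i j. sqrt c * of_bool (i = j)"]])
    show "sqrt c * \<omega> i = (\<Sum>ia\<in>I. sqrt c * of_bool (i = ia) * \<omega> ia)" if "i \<in> I" for i \<omega>
    proof -
      have "(\<Sum>ia\<in>I. sqrt c * of_bool (i = ia) * \<omega> ia) = (\<Sum>ia\<in>I. if i = ia then sqrt c * \<omega> ia else 0)" by (intro sum.cong) auto
      then show ?thesis using I that by simp
    qed
    show "c * of_bool (i = j) = (\<Sum>ia\<in>I. sqrt c * of_bool (i = ia) * (sqrt c * of_bool (j = ia)))" if "i \<in> I" for i j
    proof -
      have "(\<Sum>ia\<in>I. sqrt c * of_bool (i = ia) * (sqrt c * of_bool (j = ia))) = (\<Sum>ia\<in>I. if i = ia then c * of_bool (j = ia) else 0)"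
        using c by (intro sum.cong) (auto simp: real_sqrt_mult_self)
      then show ?thesis using I that by auto
    qed
  qed
  have "measure M {\<omega>\<in>space M. c * card I * e < \<bar>(\<Sum>i\<in>I. ((\<lambda>i\<in>I. X i \<omega>) i)\<^sup>2) - c * card I\<bar>}
     = measure ?G {\<omega>\<in>space ?G. c * card I * e < \<bar>(\<Sum>i\<in>I. ((\<lambda>j\<in>I. sqrt c * \<omega> j) i)\<^sup>2) - c * card I\<bar>}"
    by (rule gauss_prob_eq[OF g 2]) measurable
  also have "{\<omega>\<in>space ?G. c * card I * e < \<bar>(\<Sum>i\<in>I. ((\<lambda>j\<in>I. sqrt c * \<omega> j) i)\<^sup>2) - c * card I\<bar>}
     \<subseteq> {\<omega>\<in>space ?G. card I * e < \<bar>(\<Sum>i\<in>I. (\<omega> i)\<^sup>2) - real (card I)\<bar>}"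
  proof (safe, goal_cases)
    case (1 \<omega>)
    have "(\<Sum>i\<in>I. ((\<lambda>j\<in>I. sqrt c * \<omega> j) i)\<^sup>2) - c * card I = c * ((\<Sum>i\<in>I. (\<omega> i)\<^sup>2) - real (card I))"
      using c by (simp add: power_mult_distrib sum_distrib_left right_diff_distrib)
    \<comment> \<open>The strict inequality forces c > 0, so that \<open>c\<close> can be
      cancelled.\<close>
    with 1 have "c * (card I * e) < c * \<bar>(\<Sum>i\<in>I. (\<omega> i)\<^sup>2) - real (card I)\<bar>" using c by (simp add: abs_mult mult.assoc)
    then show ?case using c by (simp add: mult_less_cancel_left)
  qed
  then have "measure ?G {\<omega>\<in>space ?G. c * card I * e < \<bar>(\<Sum>i\<in>I. ((\<lambda>j\<in>I. sqrt c * \<omega> j) i)\<^sup>2) - c * card I\<bar>}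
     \<le> measure ?G {\<omega>\<in>space ?G. card I * e < \<bar>(\<Sum>i\<in>I. (\<omega> i)\<^sup>2) - real (card I)\<bar>}"
    using I by (intro G.finite_measure_mono) auto
  also have "\<dots> \<le> 2 * exp (- (card I * e\<^sup>2) / 16)" by (rule std_gauss_sum_squares[OF I e])
  finally show ?thesis by (simp cong: conj_cong)
qed

section \<open>Anticoncentration\<close>

lemma std_normal_measure_interval_le:
  assumes "a \<le> b" and "\<And>x. a \<le> x \<Longrightarrow> x \<le> b \<Longrightarrow> std_normal_density x \<le> s" and "0 \<le> s"
  shows "measure std_normal_distribution {a..b} \<le> (b - a) * s"
proof -
  have "emeasure std_normal_distribution {a..b} = (\<integral>\<^sup>+x. ennreal (std_normal_density x) * indicator {a..b} x \<partial>lborel)"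
    by (simp add: emeasure_density)
  also have "\<dots> \<le> (\<integral>\<^sup>+x. ennreal s * indicator {a..b} x \<partial>lborel)"
    using assms by (intro nn_integral_mono) (auto simp: indicator_def ennreal_leI)
  also have "\<dots> = ennreal ((b - a) * s)"
    using assms by (subst nn_integral_cmult_indicator) (auto simp: ennreal_mult' mult.commute)
  finally show ?thesis using assms by (simp add: std_normal.emeasure_eq_measure)
qed

lemma std_normal_measure_interval_ge:
  assumes "a \<le> b" and "\<And>x. a < x \<Longrightarrow> x \<le> b \<Longrightarrow> s \<le> std_normal_density x" and "0 \<le> s"
  shows "(b - a) * s \<le> measure std_normal_distribution {a<..b}"
proof -
  have "ennreal ((b - a) * s) = (\<integral>\<^sup>+x. ennreal s * indicator {a<..b} x \<partial>lborel)"
    using assms by (subst nn_integral_cmult_indicator) (auto simp: ennreal_mult' mult.commute)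
  also have "\<dots> \<le> (\<integral>\<^sup>+x. ennreal (std_normal_density x) * indicator {a<..b} x \<partial>lborel)"
    using assms by (intro nn_integral_mono) (auto simp: indicator_def ennreal_leI)
  also have "\<dots> = emeasure std_normal_distribution {a<..b}"
    by (simp add: emeasure_density)
  finally show ?thesis using assms by (simp add: std_normal.emeasure_eq_measure)
qed

lemma std_normal_measure_uminus:
  assumes A: "A \<in> sets borel"
  shows "measure std_normal_distribution (uminus -` A) = measure std_normal_distribution A"
proof -
  have [measurable]: "uminus -` A \<in> sets borel" using measurable_sets_borel[OF _ A, of uminus] by simp
  have "emeasure std_normal_distribution A = (\<integral>\<^sup>+x. ennreal (std_normal_density x) * indicator A x \<partial>distr lborel borel uminus)"
    using A by (simp add: emeasure_density lborel_distr_uminus)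
  also have "\<dots> = (\<integral>\<^sup>+x. ennreal (std_normal_density x) * indicator (uminus -` A) x \<partial>lborel)"
    using A by (subst nn_integral_distr) (auto simp: normal_density_def indicator_def intro!: nn_integral_cong)
  also have "\<dots> = emeasure std_normal_distribution (uminus -` A)"
    by (simp add: emeasure_density)
  finally show ?thesis by (simp add: measure_def)
qed

text \<open>Up to the level L the hazard rate of the normal law is of order at most L, so a layer of
  width e to the left of \<open>a\<close> weighs at most a multiple of e * L of the tail beyond
  \<open>a\<close>. Past L the density itself is at most 2 * exp (- L^2 / 2).\<close>

lemma std_normal_near_boundary:
  assumes L: "1 \<le> L" and e: "0 < e" "e * L \<le> 1"
  shows "measure std_normal_distribution {a - e..a} \<le> 27 * (e * L) * measure std_normal_distribution {a<..} + 2 * e * exp (- L\<^sup>2 / 2)"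
proof (cases "a \<le> L")
  case True
  let ?N = std_normal_distribution
  define m where "m = measure ?N {a - e..a}"
  define s where "s = m / (27 * e)"
  have iL: "1 / L \<le> 1" "0 < 1 / L" "e \<le> 1 / L" "1 \<le> L\<^sup>2" using L e by (auto simp: field_simps)
  have e1: "exp (3::real) \<le> 27"
    using power_mono[OF exp_le, of 3] exp_of_nat_mult[of 3 "1::real"] by simp
  \<comment> \<open>Between a - e and a + 1 / L the exponent changes by at most 3, because v - u
    \<le> 2 / L and v + u \<le> 3 * L; 27 bounds exp 3. The window of length 1 / L to the right of
    \<open>a\<close> thus has mass at least s / L.\<close>
  have r: "std_normal_density u \<le> 27 * std_normal_density v" if "a - e \<le> u" "u \<le> a" "a < v" "v \<le> a + 1 / L" for u v
  proof -
    have "(v - u) * (v + u) \<le> 6"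
    proof (cases "v + u \<ge> 0")
      case True
      have "v - u \<le> 2 / L" using that iL by linarith
      moreover have "v + u \<le> 3 * L" using that iL \<open>a \<le> L\<close> L by linarith
      ultimately have "(v - u) * (v + u) \<le> (2 / L) * (3 * L)" using True that L by (intro mult_mono) auto
      then show ?thesis using L by simp
    next
      case False
      then have "(v - u) * (v + u) \<le> 0" using that by (intro mult_nonneg_nonpos) auto
      then show ?thesis by simp
    qed
    then have "- u\<^sup>2 / 2 \<le> 3 + (- v\<^sup>2 / 2)" by (simp add: power2_eq_square algebra_simps)
    then have "exp (- u\<^sup>2 / 2) \<le> exp 3 * exp (- v\<^sup>2 / 2)" by (simp flip: exp_add)
    also have "\<dots> \<le> 27 * exp (- v\<^sup>2 / 2)" using e1 by (intro mult_right_mono) auto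
    finally show ?thesis by (simp add: normal_density_def divide_simps)
  qed
  have "s \<le> std_normal_density v" if v: "a < v" "v \<le> a + 1 / L" for v
  proof -
    have "m \<le> (a - (a - e)) * (27 * std_normal_density v)"
      unfolding m_def using e r[OF _ _ v] by (intro std_normal_measure_interval_le) (auto simp: normal_density_nonneg)
    then show ?thesis using e by (simp add: s_def field_simps)
  qed
  moreover have s0: "0 \<le> s" using e by (simp add: s_def m_def)
  ultimately have "(a + 1 / L - a) * s \<le> measure ?N {a<..a + 1 / L}"
    using iL by (intro std_normal_measure_interval_ge) auto
  also have "\<dots> \<le> measure ?N {a<..}" by (intro std_normal.finite_measure_mono) auto
  finally have "s / L \<le> measure ?N {a<..}" by simp
  then have "m \<le> 27 * (e * L) * measure ?N {a<..}" using e L by (simp add: s_def field_simps)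
  moreover have "0 \<le> 2 * e * exp (- L\<^sup>2 / 2)" using e by simp
  ultimately show ?thesis unfolding m_def by linarith
next
  case False
  let ?N = std_normal_distribution
  have iL: "1 / L \<le> 1" "0 < 1 / L" "e \<le> 1 / L" using L e by (auto simp: field_simps)
  have "std_normal_density x \<le> 2 * exp (- L\<^sup>2 / 2)" if "a - e \<le> x" for x
  proof -
    \<comment> \<open>Here x \<ge> a - e \<ge> L - 1 / L, and replacing L by L - 1 / L costs only a
      factor exp 1.\<close>
    have "0 \<le> L - 1 / L" "L - 1 / L \<le> x" using that False iL L by linarith+
    then have "(L - 1 / L)\<^sup>2 \<le> x\<^sup>2" by (intro power_mono) auto
    moreover have "(L - 1 / L)\<^sup>2 \<ge> L\<^sup>2 - 2" using L by (simp add: power2_diff)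
    ultimately have "exp (- x\<^sup>2 / 2) \<le> exp 1 * exp (- L\<^sup>2 / 2)" by (simp flip: exp_add)
    also have "\<dots> \<le> 3 * exp (- L\<^sup>2 / 2)" using exp_le by (intro mult_right_mono) auto
    finally have "exp (- x\<^sup>2 / 2) \<le> 3 * exp (- L\<^sup>2 / 2)" .
    moreover have "2 \<le> sqrt (2 * pi)" using pi_gt3 by (intro real_le_rsqrt) auto
    ultimately have "exp (- x\<^sup>2 / 2) / sqrt (2 * pi) \<le> 3 * exp (- L\<^sup>2 / 2) / 2" by (intro frac_le) auto
    also have "\<dots> \<le> 2 * exp (- L\<^sup>2 / 2)" by simp
    finally show ?thesis by (simp add: normal_density_def)
  qed
  then have "measure ?N {a - e..a} \<le> (a - (a - e)) * (2 * exp (- L\<^sup>2 / 2))"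
    using e by (intro std_normal_measure_interval_le) auto
  moreover have "0 \<le> 27 * (e * L) * measure ?N {a<..}" using e L by simp
  ultimately show ?thesis by (simp add: mult_ac)
qed

text \<open>The layer has two faces. The negative one is reflected onto the positive axis, which
  turns the shift \<open>h\<close> into \<open>- h\<close>; the two contributions double the
  constants.\<close>

lemma std_normal_abs_near_boundary:
  assumes L: "1 \<le> L" and e: "0 < e" "e * L \<le> 1"
  shows "measure std_normal_distribution {x. t < \<bar>x + h\<bar> \<and> \<bar>x + h\<bar> \<le> t + e}
    \<le> 54 * (e * L) * measure std_normal_distribution {x. t + e < \<bar>x + h\<bar>} + 4 * e * exp (- L\<^sup>2 / 2)"
proof -
  let ?N = std_normal_distribution
  define a where "a = t + e - h"
  define b where "b = t + e + h"
  have "{x. t < \<bar>x + h\<bar> \<and> \<bar>x + h\<bar> \<le> t + e} \<subseteq> {a - e..a} \<union> uminus -` {b - e..b}"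
    by (auto simp: a_def b_def)
  then have "measure ?N {x. t < \<bar>x + h\<bar> \<and> \<bar>x + h\<bar> \<le> t + e} \<le> measure ?N ({a - e..a} \<union> uminus -` {b - e..b})"
    using measurable_sets_borel[of uminus borel "{b - e..b}"]
    by (intro std_normal.finite_measure_mono) auto
  also have "\<dots> \<le> measure ?N {a - e..a} + measure ?N (uminus -` {b - e..b})"
    using measurable_sets_borel[of uminus borel "{b - e..b}"]
    by (intro measure_Un_le) auto
  also have "\<dots> = measure ?N {a - e..a} + measure ?N {b - e..b}" by (subst std_normal_measure_uminus) auto
  also have "\<dots> \<le> (27 * (e * L) * measure ?N {a<..} + 2 * e * exp (- L\<^sup>2 / 2)) + (27 * (e * L) * measure ?N {b<..} + 2 * e * exp (- L\<^sup>2 / 2))"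
    by (intro add_mono std_normal_near_boundary assms)
  also have "measure ?N {b<..} = measure ?N (uminus -` {b<..})" by (subst std_normal_measure_uminus) auto
  also have "(27 * (e * L) * measure ?N {a<..} + 2 * e * exp (- L\<^sup>2 / 2)) + (27 * (e * L) * measure ?N (uminus -` {b<..}) + 2 * e * exp (- L\<^sup>2 / 2))
    \<le> (27 * (e * L) * measure ?N {x. t + e < \<bar>x + h\<bar>} + 2 * e * exp (- L\<^sup>2 / 2)) + (27 * (e * L) * measure ?N {x. t + e < \<bar>x + h\<bar>} + 2 * e * exp (- L\<^sup>2 / 2))"
    using e L by (intro add_mono mult_left_mono std_normal.finite_measure_mono order_refl) (auto simp: a_def b_def)
  finally show ?thesis by (simp add: mult_ac)
qed

lemma std_gauss_prob_PiE:
  assumes "finite I" "\<And>i. i \<in> I \<Longrightarrow> A i \<in> sets borel"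
  shows "measure (std_gauss I) (Pi\<^sub>E I A) = (\<Prod>i\<in>I. measure std_normal_distribution (A i))"
proof -
  interpret finite_product_prob_space "\<lambda>_. std_normal_distribution" I by standard (rule assms)
  show ?thesis unfolding std_gauss_def by (rule prob_times) (use assms in auto)
qed

(* Nazarov's bound for a product measure. The density estimate charges the mass of a thin layer at the j-th face
   to the event that only the j-th coordinate exceeds t + e, and those events are disjoint. *)
lemma std_gauss_anticoncentration:
  fixes h :: "'i \<Rightarrow> real"
  assumes J: "finite J" and L: "1 \<le> L" "card J * exp (- L\<^sup>2 / 2) \<le> 1" and e: "0 < e" "e * L \<le> 1"
  shows "measure (std_gauss J) {g\<in>space (std_gauss J). \<forall>j\<in>J. \<bar>g j + h j\<bar> \<le> t + e}
    \<le> measure (std_gauss J) {g\<in>space (std_gauss J). \<forall>j\<in>J. \<bar>g j + h j\<bar> \<le> t} + 58 * (e * L)"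
proof -
  let ?G = "std_gauss J" and ?N = std_normal_distribution
  interpret G: prob_space ?G by (rule prob_space_std_gauss)
  define R where "R j = {x. \<bar>x + h j\<bar> \<le> t + e}" for j
  define Q where "Q j = {x. t < \<bar>x + h j\<bar> \<and> \<bar>x + h j\<bar> \<le> t + e}" for j
  define Oc where "Oc j = {x. t + e < \<bar>x + h j\<bar>}" for j
  have ms: "R j \<in> sets borel" "Q j \<in> sets borel" "Oc j \<in> sets borel" for j
    unfolding R_def Q_def Oc_def by measurable
  define E where "E j = Pi\<^sub>E J (R(j := Q j))" for j
  define F where "F j = Pi\<^sub>E J (R(j := Oc j))" for j
  \<comment> \<open>The probability that all other coordinates stay inside, a common factor of
    \<open>E j\<close> and \<open>F j\<close>.\<close>
  define c where "c j = (\<Prod>k\<in>J-{j}. measure ?N (R k))" for j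
  have c: "0 \<le> c j" "c j \<le> 1" for j unfolding c_def by (auto intro!: prod_nonneg prod_le_1)
  have pr: "measure ?G (Pi\<^sub>E J (R(j := S))) = measure ?N S * c j" if "j \<in> J" "S \<in> sets borel" for j S
  proof -
    have "measure ?G (Pi\<^sub>E J (R(j := S))) = (\<Prod>k\<in>J. measure ?N ((R(j := S)) k))"
      by (rule std_gauss_prob_PiE) (use J ms that in auto)
    also have "\<dots> = measure ?N S * c j" unfolding c_def
      using J that by (subst prod.remove[of _ j]) (auto intro!: prod.cong)
    finally show ?thesis .
  qed
  have sE: "E j \<in> sets ?G" "F j \<in> sets ?G" for j
    unfolding E_def F_def using J ms by (auto intro!: sets_PiM_I_finite simp: sets_std_gauss)
  have m: "{g\<in>space ?G. \<forall>j\<in>J. \<bar>g j + h j\<bar> \<le> t} \<in> sets ?G" using J by measurable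
  have "{g\<in>space ?G. \<forall>j\<in>J. \<bar>g j + h j\<bar> \<le> t + e} \<subseteq> {g\<in>space ?G. \<forall>j\<in>J. \<bar>g j + h j\<bar> \<le> t} \<union> (\<Union>j\<in>J. E j)"
    by (auto simp: E_def R_def Q_def space_std_gauss PiE_def Pi_def not_le)
  then have "measure ?G {g\<in>space ?G. \<forall>j\<in>J. \<bar>g j + h j\<bar> \<le> t + e} \<le> measure ?G ({g\<in>space ?G. \<forall>j\<in>J. \<bar>g j + h j\<bar> \<le> t} \<union> (\<Union>j\<in>J. E j))"
    using J by (intro G.finite_measure_mono sets.Un sets.finite_UN m sE) auto
  also have "\<dots> \<le> measure ?G {g\<in>space ?G. \<forall>j\<in>J. \<bar>g j + h j\<bar> \<le> t} + measure ?G (\<Union>j\<in>J. E j)"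
    using J by (intro measure_Un_le sets.finite_UN m sE) auto
  also have "measure ?G (\<Union>j\<in>J. E j) \<le> (\<Sum>j\<in>J. measure ?G (E j))"
    using J sE by (intro measure_UNION_le) auto
  also have "\<dots> \<le> (\<Sum>j\<in>J. 54 * (e * L) * measure ?G (F j) + 4 * e * exp (- L\<^sup>2 / 2))"
  proof (intro sum_mono)
    fix j assume j: "j \<in> J"
    have "measure ?G (E j) = measure ?N (Q j) * c j" unfolding E_def using j ms by (intro pr) auto
    also have "\<dots> \<le> (54 * (e * L) * measure ?N (Oc j) + 4 * e * exp (- L\<^sup>2 / 2)) * c j"
      unfolding Q_def Oc_def by (intro mult_right_mono std_normal_abs_near_boundary L e c)
    also have "\<dots> = 54 * (e * L) * measure ?G (F j) + 4 * e * exp (- L\<^sup>2 / 2) * c j"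
      unfolding F_def using j ms by (subst pr) (auto simp: algebra_simps)
    also have "\<dots> \<le> 54 * (e * L) * measure ?G (F j) + 4 * e * exp (- L\<^sup>2 / 2)"
      using c[of j] e by (intro add_left_mono mult_left_le) auto
    finally show "measure ?G (E j) \<le> 54 * (e * L) * measure ?G (F j) + 4 * e * exp (- L\<^sup>2 / 2)" .
  qed
  also have "\<dots> = 54 * (e * L) * (\<Sum>j\<in>J. measure ?G (F j)) + 4 * e * (card J * exp (- L\<^sup>2 / 2))"
    by (simp add: sum.distrib sum_distrib_left)
  also have "(\<Sum>j\<in>J. measure ?G (F j)) = measure ?G (\<Union>j\<in>J. F j)"
  proof (rule G.finite_measure_finite_Union[symmetric])
    have "x = y" if "x \<in> J" "y \<in> J" "g \<in> F x" "g \<in> F y" for x y g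
    proof (rule ccontr)
      assume "x \<noteq> y"
      have "g x \<in> Oc x" using that by (auto simp: F_def PiE_def Pi_def split: if_splits)
      moreover have "g x \<in> R x" using that \<open>x \<noteq> y\<close> by (auto simp: F_def PiE_def Pi_def split: if_splits)
      ultimately show False by (auto simp: Oc_def R_def)
    qed
    then show "disjoint_family_on F J" unfolding disjoint_family_on_def by blast
  qed (use J sE in auto)
  \<comment> \<open>The disjoint events \<open>F j\<close> have total probability at most 1, and the
    choice of L keeps the \<open>card J\<close> remainders below 1 in total. The constant 58 is 54 +
    4.\<close>
  also have "54 * (e * L) * measure ?G (\<Union>j\<in>J. F j) + 4 * e * (card J * exp (- L\<^sup>2 / 2)) \<le> 54 * (e * L) * 1 + 4 * e * 1"
    using e L by (intro add_mono mult_left_mono) auto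
  also have "\<dots> \<le> 54 * (e * L) * 1 + 4 * (e * L)" using e L by simp
  finally show ?thesis by (simp add: mult_ac)
qed

text \<open>Since the covariance exceeds \<kappa>^2 times the identity by a Gram matrix, the family
  is \<kappa> times white noise plus an independent Gaussian vector. Once that vector is fixed, it
  only shifts the centre, so the product measure bound with arbitrary shift \<open>h\<close> applies
  to every section.\<close>

lemma gauss_anticoncentration:
  assumes g: "gauss M J X C" and La: "finite \<Lambda>" and \<kappa>: "0 < \<kappa>"
    and C: "\<And>i j. i \<in> J \<Longrightarrow> j \<in> J \<Longrightarrow> C i j = \<kappa>\<^sup>2 * of_bool (i = j) + (\<Sum>l\<in>\<Lambda>. K i l * K j l)"
    and L: "1 \<le> L" "card J * exp (- L\<^sup>2 / 2) \<le> 1" and e: "0 \<le> e"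
  shows "measure M {\<omega>\<in>space M. \<forall>j\<in>J. \<bar>X j \<omega>\<bar> \<le> t + e} \<le> measure M {\<omega>\<in>space M. \<forall>j\<in>J. \<bar>X j \<omega>\<bar> \<le> t} + 58 * e * L / \<kappa>"
proof -
  have J: "finite J" using gaussD[OF g] by simp
  interpret M: prob_space M using gaussD[OF g] by simp
  \<comment> \<open>In the middle case the claimed error term exceeds 1 and the bound is
    trivial.\<close>
  consider "e = 0" | "0 < e" "1 < e / \<kappa> * L" | "0 < e" "e / \<kappa> * L \<le> 1" using e by linarith
  then show ?thesis
  proof cases
    case 1 then show ?thesis by simp
  next
    case 2
    then have "1 \<le> 58 * e * L / \<kappa>" by simp
    then show ?thesis using M.prob_le_1[of "{\<omega>\<in>space M. \<forall>j\<in>J. \<bar>X j \<omega>\<bar> \<le> t + e}"] measure_nonneg[of M "{\<omega>\<in>space M. \<forall>j\<in>J. \<bar>X j \<omega>\<bar> \<le> t}"] by linarith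
  next
    case 3
    let ?H = "std_gauss \<Lambda>" and ?G = "std_gauss J"
    interpret H: prob_space ?H by (rule prob_space_std_gauss)
    interpret G: prob_space ?G by (rule prob_space_std_gauss)
    let ?A = "\<lambda>j. case_sum (\<lambda>l. K j l) (\<lambda>i. \<kappa> * of_bool (i = j))"
    let ?Y = "\<lambda>j z. (\<Sum>l\<in>\<Lambda>. K j l * fst z l) + \<kappa> * snd z j"
    have delta: "(\<Sum>i\<in>J. \<kappa> * of_bool (i = j) * f i) = \<kappa> * f j" if "j \<in> J" for j and f :: "_ \<Rightarrow> real"
    proof -
      have "(\<Sum>i\<in>J. \<kappa> * of_bool (i = j) * f i) = (\<Sum>i\<in>J. if j = i then \<kappa> * f i else 0)" by (intro sum.cong) auto
      then show ?thesis using J that by simp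
    qed
    have ob: "(\<Sum>l\<in>\<Lambda>. f l * of_bool (i = l)) = (if i \<in> \<Lambda> then f i else 0)" for f :: "_ \<Rightarrow> real" and i
    proof -
      have "(\<Sum>l\<in>\<Lambda>. f l * of_bool (i = l)) = (\<Sum>l\<in>\<Lambda>. if i = l then f l else 0)" by (intro sum.cong) auto
      then show ?thesis using La by simp
    qed
    have ob': "(\<Sum>l\<in>J. f l * of_bool (i = l)) = (if i \<in> J then f i else 0)" for f :: "_ \<Rightarrow> real" and i
    proof -
      have "(\<Sum>l\<in>J. f l * of_bool (i = l)) = (\<Sum>l\<in>J. if i = l then f l else 0)" by (intro sum.cong) auto
      then show ?thesis using J by simp
    qed
    have gY: "gauss (?H \<Otimes>\<^sub>M ?G) J ?Y C"
    proof (rule gauss_cong[OF gauss_linear[OF gauss_pair[OF gauss_std[OF La] gauss_std[OF J]] J, of ?A]])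
      show "?Y j z = (\<Sum>i\<in>\<Lambda> <+> J. ?A j i * (case i of Inl i \<Rightarrow> fst z i | Inr j \<Rightarrow> snd z j))" if "j \<in> J" for j z
        using La J delta[OF that, of "snd z"] by (simp add: sum.Plus)
      show "C i j = (\<Sum>k\<in>\<Lambda> <+> J. \<Sum>l\<in>\<Lambda> <+> J. ?A i k * ?A j l * (case k of Inl i \<Rightarrow> (case l of Inl i' \<Rightarrow> of_bool (i = i') | Inr _ \<Rightarrow> 0)
       | Inr j \<Rightarrow> (case l of Inl _ \<Rightarrow> 0 | Inr j' \<Rightarrow> of_bool (j = j'))))" if "i \<in> J" "j \<in> J" for i j
      proof -
        have "(\<Sum>k\<in>J. \<kappa> * of_bool (k = i) * (\<kappa> * of_bool (k = j))) = \<kappa>\<^sup>2 * of_bool (i = j)"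
          using delta[OF that(1), of "\<lambda>k. \<kappa> * of_bool (k = j)"] by (simp add: power2_eq_square)
        then show ?thesis using La J C[OF that] by (simp add: sum.Plus ob ob' del: sum_mult_of_bool_eq sum_of_bool_mult_eq)
      qed
    qed
    let ?S = "\<lambda>t. {z\<in>space (?H \<Otimes>\<^sub>M ?G). \<forall>j\<in>J. \<bar>?Y j z\<bar> \<le> t}"
    have mS: "?S t \<in> sets (?H \<Otimes>\<^sub>M ?G)" for t using J La by measurable
    have sec: "measure ?G (Pair x -` ?S (t + e)) \<le> measure ?G (Pair x -` ?S t) + 58 * (e / \<kappa> * L)" if "x \<in> space ?H" for x
    proof -
      define h where "h j = (\<Sum>l\<in>\<Lambda>. K j l * x l) / \<kappa>" for j
      have "\<bar>(\<Sum>l\<in>\<Lambda>. K j l * x l) + \<kappa> * y\<bar> = \<kappa> * \<bar>y + h j\<bar>" for j y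
      proof -
        have "(\<Sum>l\<in>\<Lambda>. K j l * x l) + \<kappa> * y = \<kappa> * (y + h j)" using \<kappa> by (simp add: h_def field_simps)
        then show ?thesis using \<kappa> by (simp add: abs_mult)
      qed
      then have ab: "\<bar>(\<Sum>l\<in>\<Lambda>. K j l * x l) + \<kappa> * y\<bar> \<le> u \<longleftrightarrow> \<bar>y + h j\<bar> \<le> u / \<kappa>" for j y u
        using \<kappa> by (simp only: le_divide_eq mult.commute[of _ \<kappa>] if_True)
      have "Pair x -` ?S u = {g\<in>space ?G. \<forall>j\<in>J. \<bar>g j + h j\<bar> \<le> u / \<kappa>}" for u
        using that by (auto simp: space_pair_measure ab)
      then show ?thesis using std_gauss_anticoncentration[OF J L, of "e / \<kappa>" h "t / \<kappa>"] 3 \<kappa> by (simp add: add_divide_distrib)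
    qed
    have int: "integrable ?H (\<lambda>x. measure ?G (Pair x -` ?S t))" for t
      by (rule H.integrable_const_bound[of _ 1], simp, rule measurable_prob_section[OF H.prob_space_axioms G.prob_space_axioms mS])
    have "measure (?H \<Otimes>\<^sub>M ?G) (?S (t + e)) = (\<integral>x. measure ?G (Pair x -` ?S (t + e)) \<partial>?H)"
      by (rule prob_pair_integral) (auto intro!: mS H.prob_space_axioms G.prob_space_axioms)
    also have "\<dots> \<le> (\<integral>x. measure ?G (Pair x -` ?S t) + 58 * (e / \<kappa> * L) \<partial>?H)"
      by (intro integral_mono Bochner_Integration.integrable_add int sec) auto
    also have "\<dots> = (\<integral>x. measure ?G (Pair x -` ?S t) \<partial>?H) + 58 * (e / \<kappa> * L)"
      using int by (simp add: H.prob_space)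
    also have "(\<integral>x. measure ?G (Pair x -` ?S t) \<partial>?H) = measure (?H \<Otimes>\<^sub>M ?G) (?S t)"
      by (rule prob_pair_integral[symmetric]) (auto intro!: mS H.prob_space_axioms G.prob_space_axioms)
    finally show ?thesis
      using gauss_prob_all_le_eq[OF g gY, of "\<lambda>_. t + e"] gauss_prob_all_le_eq[OF g gY, of "\<lambda>_. t"] by simp
  qed
qed

section \<open>Quadratic forms and the Dantzig selector\<close>

text \<open>Cholesky factorisation, by elimination of the last index. A zero pivot forces the last
  column to vanish; otherwise the Schur complement is again positive semidefinite.\<close>

lemma psd_factor:
  fixes a :: "nat \<Rightarrow> nat \<Rightarrow> real"
  assumes "\<And>i j. i < p \<Longrightarrow> j < p \<Longrightarrow> a i j = a j i"
    and "\<And>v. 0 \<le> (\<Sum>i<p. \<Sum>j<p. v i * v j * a i j)"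
  shows "\<exists>L. \<forall>i<p. \<forall>j<p. a i j = (\<Sum>l<p. L i l * L j l)"
  using assms
proof (induction p arbitrary: a)
  case 0
  then show ?case by simp
next
  case (Suc p)
  note sym = Suc.prems(1) and psd = Suc.prems(2)
  have Q: "(\<Sum>i<Suc p. \<Sum>j<Suc p. v i * v j * a i j)
    = (\<Sum>i<p. \<Sum>j<p. v i * v j * a i j) + 2 * v p * (\<Sum>i<p. v i * a i p) + (v p)\<^sup>2 * a p p" for v
  proof -
    have "(\<Sum>j<p. v p * v j * a p j) = v p * (\<Sum>i<p. v i * a i p)"
      unfolding sum_distrib_left by (intro sum.cong) (auto simp: sym[of p])
    moreover have "(\<Sum>i<p. v i * v p * a i p) = v p * (\<Sum>i<p. v i * a i p)"
      unfolding sum_distrib_left by (intro sum.cong) auto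
    ultimately show ?thesis by (simp add: sum.distrib power2_eq_square)
  qed
  define d where "d = a p p"
  have d: "0 \<le> d" using psd[of "\<lambda>i. of_bool (i = p)"] unfolding Q d_def by simp
  show ?case
  proof (cases "d = 0")
    case True
    have z: "a k p = 0" if k: "k < p" for k
    proof (rule ccontr)
      assume nz: "a k p \<noteq> 0"
      \<comment> \<open>With this value the form at e_k + s * e_p would be a k k + 2 * s * a k p =
        -1.\<close>
      define s where "s = - (a k k + 1) / (2 * a k p)"
      define v where "v i = (if i = k then 1 else if i = p then s else 0)" for i
      have "(\<Sum>i<p. v i * a i p) = (\<Sum>i<p. if k = i then a i p else 0)"
        by (intro sum.cong) (auto simp: v_def)
      also have "\<dots> = a k p" using k by simp
      finally have 1: "(\<Sum>i<p. v i * a i p) = a k p" .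
      have "(\<Sum>j<p. v i * v j * a i j) = v i * a i k" for i
      proof -
        have "(\<Sum>j<p. v i * v j * a i j) = (\<Sum>j<p. if k = j then v i * a i j else 0)"
          by (intro sum.cong) (auto simp: v_def)
        then show ?thesis using k by simp
      qed
      then have "(\<Sum>i<p. \<Sum>j<p. v i * v j * a i j) = (\<Sum>i<p. v i * a i k)" by simp
      also have "\<dots> = (\<Sum>i<p. if k = i then a i k else 0)"
        by (intro sum.cong) (auto simp: v_def)
      finally have 2: "(\<Sum>i<p. \<Sum>j<p. v i * v j * a i j) = a k k" using k by simp
      have "v p = s" using k by (simp add: v_def)
      then have "0 \<le> a k k + 2 * s * a k p"
        using psd[of v] True unfolding Q 1 2 by (simp add: d_def)
      moreover have "2 * s * a k p = - (a k k + 1)" using nz by (simp add: s_def)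
      ultimately show False by linarith
    qed
    have "\<exists>L. \<forall>i<p. \<forall>j<p. a i j = (\<Sum>l<p. L i l * L j l)"
    proof (rule Suc.IH)
      fix v
      show "0 \<le> (\<Sum>i<p. \<Sum>j<p. v i * v j * a i j)"
        using psd[of "v(p := 0)"] unfolding Q by simp
    qed (use sym in auto)
    then obtain L where L: "\<forall>i<p. \<forall>j<p. a i j = (\<Sum>l<p. L i l * L j l)" by blast
    have "a i j = (\<Sum>l<Suc p. (if i < p \<and> l < p then L i l else 0) * (if j < p \<and> l < p then L j l else 0))"
      if "i < Suc p" "j < Suc p" for i j
    proof -
      have "a p k = 0" if "k < p" for k using sym[of p k] z[OF that] that by simp
      then show ?thesis using that L z True unfolding d_def by (cases "i = p"; cases "j = p") (auto simp: less_Suc_eq)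
    qed
    then show ?thesis by (intro exI[of _ "\<lambda>i l. if i < p \<and> l < p then L i l else 0"] allI impI)
  next
    case False
    then have dp: "d > 0" using d by simp
    have "\<exists>L. \<forall>i<p. \<forall>j<p. a i j - a i p * a j p / d = (\<Sum>l<p. L i l * L j l)"
    proof (rule Suc.IH)
      fix v
      \<comment> \<open>The last coordinate - t / d minimises the form, and the minimum is the form
        of the Schur complement.\<close>
      define t where "t = (\<Sum>i<p. v i * a i p)"
      have "0 \<le> (\<Sum>i<p. \<Sum>j<p. v i * v j * a i j) + 2 * (- t / d) * t + (- t / d)\<^sup>2 * d"
        using psd[of "v(p := - t / d)"] unfolding Q t_def[symmetric] by (simp add: d_def t_def)
      also have "\<dots> = (\<Sum>i<p. \<Sum>j<p. v i * v j * a i j) - t * t / d"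
        using dp by (simp add: power2_eq_square field_simps)
      also have "t * t / d = (\<Sum>i<p. \<Sum>j<p. v i * v j * (a i p * a j p / d))"
        unfolding t_def sum_product sum_divide_distrib by (intro sum.cong) auto
      finally show "0 \<le> (\<Sum>i<p. \<Sum>j<p. v i * v j * (a i j - a i p * a j p / d))"
        by (simp add: right_diff_distrib sum_subtractf)
    qed (use sym in auto)
    then obtain L where L: "\<forall>i<p. \<forall>j<p. a i j - a i p * a j p / d = (\<Sum>l<p. L i l * L j l)" by blast
    define L' where "L' i l = (if l < p then (if i < p then L i l else 0) else a i p / sqrt d)" for i l
    have "a i j = (\<Sum>l<Suc p. L' i l * L' j l)" if "i < Suc p" "j < Suc p" for i j
    proof -
      have "(\<Sum>l<Suc p. L' i l * L' j l) = (\<Sum>l<p. L' i l * L' j l) + a i p * a j p / d"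
        using dp by (simp add: L'_def)
      also have "(\<Sum>l<p. L' i l * L' j l) = a i j - a i p * a j p / d"
      proof -
        consider "i < p" "j < p" | "i = p" "j < p" | "i < p" "j = p" | "i = p" "j = p" using \<open>i < Suc p\<close> \<open>j < Suc p\<close> by linarith
        then show ?thesis
        proof cases
          case 1
          then show ?thesis using L by (simp add: L'_def)
        next
          case 2
          then show ?thesis using dp sym[of p j] by (simp add: L'_def d_def)
        next
          case 3
          then show ?thesis using dp by (simp add: L'_def d_def)
        next
          case 4
          then show ?thesis using dp by (simp add: L'_def d_def)
        qed
      qed
      finally show ?thesis by simp
    qed
    then show ?thesis by (intro exI[of _ L'] allI impI)
  qed
qed

text \<open>The dimension \<open>p\<close> is not a type, so vectors are functions that vanish from
  \<open>p\<close> on. Compactness is inherited from the cube with sides [-1, 1], which is compact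
  by Tychonoff's theorem.\<close>

lemma compact_unit_sphere_fun:
  "compact {v :: nat \<Rightarrow> real. (\<forall>i\<ge>p. v i = 0) \<and> (\<Sum>i<p. (v i)\<^sup>2) = 1}"
proof -
  have c: "compactin (product_topology (\<lambda>i::nat. euclideanreal) UNIV) (Pi\<^sub>E UNIV (\<lambda>i. {-1..1}))"
    by (simp add: compactin_PiE)
  then have "compact (Pi\<^sub>E UNIV (\<lambda>i. {-1..1}) :: (nat \<Rightarrow> real) set)"
    by (simp add: euclidean_product_topology)
  moreover have "closed {v :: nat \<Rightarrow> real. (\<forall>i\<ge>p. v i = 0) \<and> (\<Sum>i<p. (v i)\<^sup>2) = 1}"
  proof -
    have co: "continuous_on UNIV (\<lambda>v :: nat \<Rightarrow> real. v i)" for i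
      by (rule continuous_on_product_coordinates)
    have "closed {v :: nat \<Rightarrow> real. v i = 0}" for i
      by (rule closed_Collect_eq) (auto intro!: co)
    moreover have "closed {v :: nat \<Rightarrow> real. (\<Sum>i<p. (v i)\<^sup>2) = 1}"
      by (rule closed_Collect_eq) (auto intro!: continuous_intros co)
    ultimately have "closed ((\<Inter>i\<in>{p..}. {v :: nat \<Rightarrow> real. v i = 0}) \<inter> {v. (\<Sum>i<p. (v i)\<^sup>2) = 1})"
      by (intro closed_Int closed_INT) auto
    also have "(\<Inter>i\<in>{p..}. {v :: nat \<Rightarrow> real. v i = 0}) \<inter> {v. (\<Sum>i<p. (v i)\<^sup>2) = 1} = {v. (\<forall>i\<ge>p. v i = 0) \<and> (\<Sum>i<p. (v i)\<^sup>2) = 1}" by auto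
    finally show ?thesis .
  qed
  ultimately have "compact (Pi\<^sub>E UNIV (\<lambda>i. {-1..1}) \<inter> {v :: nat \<Rightarrow> real. (\<forall>i\<ge>p. v i = 0) \<and> (\<Sum>i<p. (v i)\<^sup>2) = 1})"
    by (rule compact_Int_closed)
  moreover have "v i \<in> {-1..1}" if "(\<forall>i\<ge>p. v i = 0) \<and> (\<Sum>i<p. (v i)\<^sup>2) = 1" for v :: "nat \<Rightarrow> real" and i
  proof (cases "i < p")
    case True
    then have "(v i)\<^sup>2 \<le> (\<Sum>i<p. (v i)\<^sup>2)" by (intro member_le_sum) auto
    then have "\<bar>v i\<bar> \<le> 1" using that by (simp add: abs_square_le_1)
    then show ?thesis by (auto simp: abs_le_iff)
  qed (use that in auto)
  then have "Pi\<^sub>E UNIV (\<lambda>i. {-1..1}) \<inter> {v :: nat \<Rightarrow> real. (\<forall>i\<ge>p. v i = 0) \<and> (\<Sum>i<p. (v i)\<^sup>2) = 1} = {v :: nat \<Rightarrow> real. (\<forall>i\<ge>p. v i = 0) \<and> (\<Sum>i<p. (v i)\<^sup>2) = 1}"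
    by (auto simp: PiE_def Pi_def)
  ultimately show ?thesis by simp
qed

text \<open>The form attains its minimum over the unit sphere. Homogeneity makes the minimum a lower
  bound for all vectors, and variation of the minimiser in each coordinate direction shows that it
  is an eigenvector.\<close>

lemma rayleigh_minimum:
  fixes a :: "nat \<Rightarrow> nat \<Rightarrow> real"
  assumes sym: "\<And>i j. i < p \<Longrightarrow> j < p \<Longrightarrow> a i j = a j i" and p: "0 < p"
  shows "\<exists>e v. (\<exists>i<p. v i \<noteq> 0) \<and> (\<forall>i<p. (\<Sum>j<p. a i j * v j) = e * v i) \<and>
    (\<forall>w. e * (\<Sum>i<p. (w i)\<^sup>2) \<le> (\<Sum>i<p. \<Sum>j<p. w i * w j * a i j))"
proof -
  define K where "K = {v :: nat \<Rightarrow> real. (\<forall>i\<ge>p. v i = 0) \<and> (\<Sum>i<p. (v i)\<^sup>2) = 1}"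
  define Q where "Q v = (\<Sum>i<p. \<Sum>j<p. v i * v j * a i j)" for v
  have co: "continuous_on S (\<lambda>v :: nat \<Rightarrow> real. v i)" for i S
    by (rule continuous_on_subset[OF continuous_on_product_coordinates]) simp
  have "(\<lambda>i. of_bool (i = 0)) \<in> K"
  proof -
    have "(\<Sum>i<p. (of_bool (i = 0))\<^sup>2) = (\<Sum>i<p. if 0 = i then 1 else (0::real))" by (intro sum.cong) auto
    then show ?thesis using p by (auto simp: K_def)
  qed
  then have "K \<noteq> {}" by blast
  moreover have "compact K" unfolding K_def by (rule compact_unit_sphere_fun)
  moreover have "continuous_on K Q" unfolding Q_def by (intro continuous_intros co)
  ultimately obtain v where v: "v \<in> K" "\<And>w. w \<in> K \<Longrightarrow> Q v \<le> Q w"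
    using continuous_attains_inf[of K Q] by blast
  define e where "e = Q v"
  have Qc: "Q w = Q w'" if "\<And>i. i < p \<Longrightarrow> w i = w' i" for w w'
    unfolding Q_def using that by (intro sum.cong) auto
  have Qs: "Q (\<lambda>i. c * w i) = c\<^sup>2 * Q w" for c w
    unfolding Q_def sum_distrib_left by (intro sum.cong) (auto simp: power2_eq_square)
  have min: "e * (\<Sum>i<p. (w i)\<^sup>2) \<le> Q w" for w
  proof (cases "(\<Sum>i<p. (w i)\<^sup>2) = 0")
    case True
    then have "w i = 0" if "i < p" for i using that by (auto simp: sum_nonneg_eq_0_iff)
    then show ?thesis using True by (simp add: Q_def)
  next
    case False
    define r where "r = (\<Sum>i<p. (w i)\<^sup>2)"
    have r: "r > 0" using False unfolding r_def by (simp add: sum_nonneg less_le)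
    define w' where "w' i = (if i < p then 1 / sqrt r * w i else 0)" for i
    have "(\<Sum>i<p. (w' i)\<^sup>2) = (\<Sum>i<p. (w i)\<^sup>2 / r)"
      using r by (intro sum.cong) (auto simp: w'_def power_divide)
    then have "w' \<in> K" using r by (simp add: K_def w'_def sum_divide_distrib[symmetric] r_def[symmetric])
    then have "e \<le> Q w'" unfolding e_def by (rule v)
    also have "Q w' = Q (\<lambda>i. 1 / sqrt r * w i)" by (rule Qc) (simp add: w'_def)
    also have "\<dots> = Q w / r" using r by (simp only: Qs) (simp add: power_divide)
    finally show ?thesis using r by (simp add: r_def[symmetric] field_simps)
  qed
  have nz: "\<exists>i<p. v i \<noteq> 0"
  proof (rule ccontr)
    assume "\<not> ?thesis"
    then have "(\<Sum>i<p. (v i)\<^sup>2) = 0" by simp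
    then show False using v(1) by (simp add: K_def)
  qed
  have eig: "(\<Sum>j<p. a k j * v j) = e * v k" if k: "k < p" for k
  proof -
    \<comment> \<open>\<open>A\<close> and \<open>B\<close> are the coefficients of s and s^2 when
      the minimiser is moved by s in direction k. Nonnegativity for all s forces the linear
      coefficient to vanish.\<close>
    define A where "A = 2 * ((\<Sum>j<p. a k j * v j) - e * v k)"
    define B where "B = a k k - e"
    have pos: "0 \<le> s * A + s\<^sup>2 * B" for s
    proof -
      define w where "w i = v i + s * of_bool (i = k)" for i
      have d: "(\<Sum>i<p. of_bool (i = k) * f i) = f k" for f :: "nat \<Rightarrow> real"
      proof -
        have "(\<Sum>i<p. of_bool (i = k) * f i) = (\<Sum>i<p. if k = i then f i else 0)" by (intro sum.cong) auto
        then show ?thesis using k by simp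
      qed
      have "(\<Sum>i<p. (w i)\<^sup>2) = (\<Sum>i<p. (v i)\<^sup>2 + of_bool (i = k) * (2 * s * v i + s\<^sup>2))"
        by (intro sum.cong) (auto simp: w_def power2_eq_square algebra_simps)
      also have "\<dots> = 1 + 2 * s * v k + s\<^sup>2"
        using v(1) d[of "\<lambda>i. 2 * s * v i + s\<^sup>2"] by (simp add: sum.distrib K_def)
      finally have 1: "(\<Sum>i<p. (w i)\<^sup>2) = 1 + 2 * s * v k + s\<^sup>2" .
      have "Q w = (\<Sum>i<p. \<Sum>j<p. v i * v j * a i j + of_bool (j = k) * (s * v i * a i j) + of_bool (i = k) * (s * v j * a i j + of_bool (j = k) * (s\<^sup>2 * a i j)))"
        unfolding Q_def by (intro sum.cong) (auto simp: w_def power2_eq_square algebra_simps)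
      also have "\<dots> = e + (\<Sum>i<p. s * v i * a i k) + (\<Sum>j<p. s * v j * a k j) + s\<^sup>2 * a k k"
        by (simp add: sum.distrib d e_def Q_def sum_distrib_left[symmetric])
      also have "(\<Sum>i<p. s * v i * a i k) = (\<Sum>j<p. s * v j * a k j)"
        using sym k by (intro sum.cong) auto
      also have "(\<Sum>j<p. s * v j * a k j) = s * (\<Sum>j<p. a k j * v j)"
        unfolding sum_distrib_left by (intro sum.cong) auto
      finally have "Q w = e + 2 * s * (\<Sum>j<p. a k j * v j) + s\<^sup>2 * a k k" by simp
      with min[of w] show ?thesis unfolding 1 A_def B_def by (simp add: algebra_simps)
    qed
    have "A = 0"
    proof (rule ccontr)
      assume A: "A \<noteq> 0"
      define \<beta> where "\<beta> = \<bar>B\<bar> + 1"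
      \<comment> \<open>At this point the polynomial s * A + s^2 * B is at most - A^2 /
        \<beta>^2.\<close>
      define s where "s = - A / \<beta>"
      have b: "\<beta> > 0" "\<bar>B\<bar> = \<beta> - 1" by (auto simp: \<beta>_def)
      have "s * A + s\<^sup>2 * B \<le> s * A + s\<^sup>2 * \<bar>B\<bar>" by (intro add_left_mono mult_left_mono) auto
      also have "\<dots> = - A\<^sup>2 / \<beta>\<^sup>2"
        unfolding b(2) using b(1) by (simp add: s_def power2_eq_square field_simps)
      also have "\<dots> < 0" using A b by (simp add: divide_neg_pos)
      finally show False using pos[of s] by simp
    qed
    then show ?thesis by (simp add: A_def)
  qed
  show ?thesis using nz eig min unfolding Q_def by (intro exI[of _ e] exI[of _ v] conjI allI impI) auto
qed

text \<open>Converts the assumption on eigenvalues into the form in which it is used, two-sided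
  bounds on the quadratic form. The upper bound is \<open>rayleigh_minimum\<close> for
  \<open>- S\<close>.\<close>

lemma eigenvalue_quadratic_form_bounds:
  fixes S :: "real mat"
  assumes S: "S \<in> carrier_mat p p" "transpose_mat S = S"
    and ev: "\<And>e. eigenvalue S e \<Longrightarrow> \<kappa>1 < e \<and> e < \<kappa>2"
  shows "\<kappa>1 * (\<Sum>i<p. (w i)\<^sup>2) \<le> (\<Sum>i<p. \<Sum>j<p. w i * w j * S $$ (i, j))"
    "(\<Sum>i<p. \<Sum>j<p. w i * w j * S $$ (i, j)) \<le> \<kappa>2 * (\<Sum>i<p. (w i)\<^sup>2)"
proof -
  have sym: "S $$ (i, j) = S $$ (j, i)" if "i < p" "j < p" for i j
    using S that by (metis carrier_matD index_transpose_mat(1))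
  have evI: "eigenvalue S e" if "\<exists>i<p. v i \<noteq> 0" "\<And>i. i < p \<Longrightarrow> (\<Sum>j<p. S $$ (i, j) * v j) = e * v i" for e v
  proof -
    have "vec p v \<noteq> 0\<^sub>v p" using that(1) by (auto simp: vec_eq_iff)
    moreover have "S *\<^sub>v vec p v = e \<cdot>\<^sub>v vec p v"
      using S that(2) by (intro eq_vecI) (auto simp: scalar_prod_def lessThan_atLeast0)
    ultimately show ?thesis using S unfolding eigenvalue_def eigenvector_def by (intro exI[of _ "vec p v"]) auto
  qed
  have "\<kappa>1 * (\<Sum>i<p. (w i)\<^sup>2) \<le> (\<Sum>i<p. \<Sum>j<p. w i * w j * S $$ (i, j)) \<and> (\<Sum>i<p. \<Sum>j<p. w i * w j * S $$ (i, j)) \<le> \<kappa>2 * (\<Sum>i<p. (w i)\<^sup>2)"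
  proof (cases "p = 0")
    case False
    have "\<exists>e v. (\<exists>i<p. v i \<noteq> 0) \<and> (\<forall>i<p. (\<Sum>j<p. S $$ (i, j) * v j) = e * v i) \<and>
        (\<forall>w. e * (\<Sum>i<p. (w i)\<^sup>2) \<le> (\<Sum>i<p. \<Sum>j<p. w i * w j * S $$ (i, j)))"
      by (rule rayleigh_minimum) (use sym False in simp_all)
    then obtain e v where H1: "(\<exists>i<p. v i \<noteq> 0) \<and> (\<forall>i<p. (\<Sum>j<p. S $$ (i, j) * v j) = e * v i) \<and>
        (\<forall>w. e * (\<Sum>i<p. (w i)\<^sup>2) \<le> (\<Sum>i<p. \<Sum>j<p. w i * w j * S $$ (i, j)))"
      by (elim exE) (rule that)
    note 1 = conjunct1[OF H1] conjunct1[OF conjunct2[OF H1], rule_format] conjunct2[OF conjunct2[OF H1], rule_format]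
    have "\<exists>e' v'. (\<exists>i<p. v' i \<noteq> 0) \<and> (\<forall>i<p. (\<Sum>j<p. - S $$ (i, j) * v' j) = e' * v' i) \<and>
        (\<forall>w. e' * (\<Sum>i<p. (w i)\<^sup>2) \<le> (\<Sum>i<p. \<Sum>j<p. w i * w j * (- S $$ (i, j))))"
      by (rule rayleigh_minimum) (use sym False in simp_all)
    then obtain e' v' where H2: "(\<exists>i<p. v' i \<noteq> 0) \<and> (\<forall>i<p. (\<Sum>j<p. - S $$ (i, j) * v' j) = e' * v' i) \<and>
        (\<forall>w. e' * (\<Sum>i<p. (w i)\<^sup>2) \<le> (\<Sum>i<p. \<Sum>j<p. w i * w j * (- S $$ (i, j))))"
      by (elim exE) (rule that)
    note 2 = conjunct1[OF H2] conjunct1[OF conjunct2[OF H2], rule_format] conjunct2[OF conjunct2[OF H2], rule_format]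
    have "\<kappa>1 < e" using ev[OF evI[OF 1(1,2)]] by simp
    moreover have "eigenvalue S (- e')"
    proof (rule evI[OF 2(1)])
      show "(\<Sum>j<p. S $$ (i, j) * v' j) = - e' * v' i" if "i < p" for i using 2(2)[OF that] by (simp add: sum_negf)
    qed
    then have "- e' < \<kappa>2" using ev by blast
    moreover have "0 \<le> (\<Sum>i<p. (w i)\<^sup>2)" by (simp add: sum_nonneg)
    ultimately have "\<kappa>1 * (\<Sum>i<p. (w i)\<^sup>2) \<le> e * (\<Sum>i<p. (w i)\<^sup>2)" "- e' * (\<Sum>i<p. (w i)\<^sup>2) \<le> \<kappa>2 * (\<Sum>i<p. (w i)\<^sup>2)"
      by (intro mult_right_mono; simp)+
    then show ?thesis using 1(3)[of w] 2(3)[of w] by (simp add: sum_negf)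
  qed simp
  then show "\<kappa>1 * (\<Sum>i<p. (w i)\<^sup>2) \<le> (\<Sum>i<p. \<Sum>j<p. w i * w j * S $$ (i, j))"
    "(\<Sum>i<p. \<Sum>j<p. w i * w j * S $$ (i, j)) \<le> \<kappa>2 * (\<Sum>i<p. (w i)\<^sup>2)" by auto
qed

text \<open>Minimality of the l1 norm puts the error d into a cone, where l^2 \<le> 4 * s * |d|^2
  for its l1 norm l. Feasibility of both vectors gives D \<le> 2 * lam * l for the prediction error
  D, and the Gram matrix gives D \<ge> c/2 * |d|^2. Chaining the three bounds l by 16 * s * lam /
  c.\<close>

lemma dantzig_l1_error:
  fixes W :: "nat \<Rightarrow> nat \<Rightarrow> real" and z b b' :: "nat \<Rightarrow> real" and \<sigma> :: "nat \<Rightarrow> nat \<Rightarrow> real"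
  assumes n: "0 < n" and c: "0 < c" and lam: "0 \<le> lam"
    and gram: "\<And>j k. j < p \<Longrightarrow> k < p \<Longrightarrow> \<bar>(\<Sum>i<n. W i j * W i k) / n - \<sigma> j k\<bar> \<le> \<epsilon>"
    and quad: "\<And>w. c * (\<Sum>j<p. (w j)\<^sup>2) \<le> (\<Sum>j<p. \<Sum>k<p. w j * w k * \<sigma> j k)"
    and supp: "card {j. j < p \<and> b j \<noteq> 0} \<le> s" and small: "8 * real s * \<epsilon> \<le> c"
    and l1: "(\<Sum>j<p. \<bar>b' j\<bar>) \<le> (\<Sum>j<p. \<bar>b j\<bar>)"
    and feas: "\<And>j. j < p \<Longrightarrow> \<bar>\<Sum>i<n. W i j * (z i - (\<Sum>k<p. W i k * b k))\<bar> \<le> n * lam"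
      "\<And>j. j < p \<Longrightarrow> \<bar>\<Sum>i<n. W i j * (z i - (\<Sum>k<p. W i k * b' k))\<bar> \<le> n * lam"
  shows "(\<Sum>j<p. \<bar>b' j - b j\<bar>) \<le> 16 * real s * lam / c"
    "(\<Sum>i<n. (\<Sum>k<p. W i k * (b' k - b k))\<^sup>2) \<le> n * (32 * real s * lam\<^sup>2 / c)"
proof -
  define S where "S = {j. j < p \<and> b j \<noteq> 0}"
  define d where "d j = b' j - b j" for j
  define D where "D = (\<Sum>i<n. (\<Sum>k<p. W i k * d k)\<^sup>2) / n"
  define l where "l = (\<Sum>j<p. \<bar>d j\<bar>)"
  have S: "finite S" "S \<subseteq> {..<p}" by (auto simp: S_def)
  have l0: "0 \<le> l" unfolding l_def by (simp add: sum_nonneg)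
  \<comment> \<open>Mass of the error outside the support of \<open>b\<close> must be paid for by a
    decrease on the support, so at least half of the l1 norm sits on the support.\<close>
  have cone: "l \<le> 2 * (\<Sum>j\<in>S. \<bar>d j\<bar>)"
  proof -
    have "(\<Sum>j<p. \<bar>b j\<bar>) = (\<Sum>j\<in>S. \<bar>b j\<bar>)"
      using S by (intro sum.mono_neutral_right) (auto simp: S_def)
    moreover have "(\<Sum>j<p. \<bar>b' j\<bar>) = (\<Sum>j\<in>S. \<bar>b' j\<bar>) + (\<Sum>j\<in>{..<p}-S. \<bar>b' j\<bar>)"
      using S by (subst sum.subset_diff[of S]) auto
    moreover have "(\<Sum>j\<in>{..<p}-S. \<bar>b' j\<bar>) = (\<Sum>j\<in>{..<p}-S. \<bar>d j\<bar>)"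
      by (intro sum.cong) (auto simp: S_def d_def)
    moreover have "(\<Sum>j\<in>S. \<bar>b j\<bar>) \<le> (\<Sum>j\<in>S. \<bar>b' j\<bar>) + (\<Sum>j\<in>S. \<bar>d j\<bar>)"
      unfolding sum.distrib[symmetric] by (intro sum_mono) (auto simp: d_def)
    moreover have "l = (\<Sum>j\<in>S. \<bar>d j\<bar>) + (\<Sum>j\<in>{..<p}-S. \<bar>d j\<bar>)"
      unfolding l_def using S by (subst sum.subset_diff[of S]) auto
    ultimately show ?thesis using l1 by linarith
  qed
  have l2: "l\<^sup>2 \<le> 4 * real s * (\<Sum>j<p. (d j)\<^sup>2)"
  proof -
    have "(\<Sum>j\<in>S. \<bar>d j\<bar>)\<^sup>2 \<le> (\<Sum>j\<in>S. (1::real)\<^sup>2) * (\<Sum>j\<in>S. \<bar>d j\<bar>\<^sup>2)"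
      using Cauchy_Schwarz_ineq_sum[of "\<lambda>_. 1" "\<lambda>j. \<bar>d j\<bar>" S] by simp
    also have "\<dots> \<le> real s * (\<Sum>j<p. (d j)\<^sup>2)"
      using supp S by (intro mult_mono) (auto simp: S_def[symmetric] intro!: sum_mono2 sum_nonneg)
    finally have "(\<Sum>j\<in>S. \<bar>d j\<bar>)\<^sup>2 \<le> real s * (\<Sum>j<p. (d j)\<^sup>2)" .
    moreover have "l\<^sup>2 \<le> (2 * (\<Sum>j\<in>S. \<bar>d j\<bar>))\<^sup>2" using cone l0 by (intro power_mono) auto
    ultimately show ?thesis by (simp add: power_mult_distrib)
  qed
  have gr: "(\<Sum>i<n. (\<Sum>k<p. W i k * d k)\<^sup>2) = (\<Sum>j<p. d j * (\<Sum>i<n. W i j * (\<Sum>k<p. W i k * d k)))"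
  proof -
    have "(\<Sum>j<p. d j * (\<Sum>i<n. W i j * (\<Sum>k<p. W i k * d k))) = (\<Sum>j<p. \<Sum>i<n. (W i j * d j) * (\<Sum>k<p. W i k * d k))"
      unfolding sum_distrib_left[of "d _"] by (intro sum.cong) auto
    also have "\<dots> = (\<Sum>i<n. (\<Sum>j<p. W i j * d j) * (\<Sum>k<p. W i k * d k))"
      by (subst sum.swap) (simp add: sum_distrib_right)
    finally show ?thesis by (simp add: power2_eq_square)
  qed
  have up: "D \<le> 2 * lam * l"
  proof -
    have *: "\<bar>\<Sum>i<n. W i j * (\<Sum>k<p. W i k * d k)\<bar> \<le> n * (2 * lam)" if "j < p" for j
    proof -
      have "(\<Sum>i<n. W i j * (\<Sum>k<p. W i k * d k)) = (\<Sum>i<n. W i j * (z i - (\<Sum>k<p. W i k * b k))) - (\<Sum>i<n. W i j * (z i - (\<Sum>k<p. W i k * b' k)))"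
        by (simp add: d_def right_diff_distrib sum_subtractf)
      then show ?thesis using feas[OF that] by linarith
    qed
    then have "(\<Sum>i<n. (\<Sum>k<p. W i k * d k)\<^sup>2) \<le> (\<Sum>j<p. \<bar>d j\<bar> * (n * (2 * lam)))"
      unfolding gr
    proof (intro sum_mono)
      fix j assume "j \<in> {..<p}"
      then have b: "\<bar>\<Sum>i<n. W i j * (\<Sum>k<p. W i k * d k)\<bar> \<le> n * (2 * lam)" by (intro *) simp
      have "d j * (\<Sum>i<n. W i j * (\<Sum>k<p. W i k * d k)) \<le> \<bar>d j\<bar> * \<bar>\<Sum>i<n. W i j * (\<Sum>k<p. W i k * d k)\<bar>"
        unfolding abs_mult[symmetric] by (rule abs_ge_self)
      also have "\<dots> \<le> \<bar>d j\<bar> * (n * (2 * lam))" by (rule mult_left_mono[OF b]) simp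
      finally show "d j * (\<Sum>i<n. W i j * (\<Sum>k<p. W i k * d k)) \<le> \<bar>d j\<bar> * (n * (2 * lam))" .
    qed
    also have "\<dots> = n * (2 * lam * l)" by (simp add: l_def sum_distrib_left sum_distrib_right mult_ac)
    finally show ?thesis using n by (simp add: D_def field_simps)
  qed
  \<comment> \<open>A restricted eigenvalue bound from entrywise closeness: replacing the Gram
    matrix by \<sigma> costs at most l^2 * \<epsilon>, and by the cone bound and
    \<open>small\<close> this is at most half of c * |d|^2.\<close>
  have lo: "c / 2 * (\<Sum>j<p. (d j)\<^sup>2) \<le> D"
  proof -
    define q where "q = (\<Sum>j<p. (d j)\<^sup>2)"
    have q0: "0 \<le> q" by (simp add: q_def sum_nonneg)
    have "D = (\<Sum>j<p. \<Sum>k<p. d j * d k * ((\<Sum>i<n. W i j * W i k) / n))"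
    proof -
      have "(\<Sum>i<n. W i j * (\<Sum>k<p. W i k * d k)) = (\<Sum>k<p. d k * (\<Sum>i<n. W i j * W i k))" for j
        unfolding sum_distrib_left by (subst sum.swap) (auto intro!: sum.cong)
      then show ?thesis unfolding D_def gr by (simp add: sum_divide_distrib sum_distrib_left mult.assoc)
    qed
    then have "(\<Sum>j<p. \<Sum>k<p. d j * d k * \<sigma> j k) - D = (\<Sum>j<p. \<Sum>k<p. d j * d k * (\<sigma> j k - (\<Sum>i<n. W i j * W i k) / n))"
      by (simp add: right_diff_distrib sum_subtractf)
    also have "\<dots> \<le> (\<Sum>j<p. \<Sum>k<p. \<bar>d j\<bar> * \<bar>d k\<bar> * \<epsilon>)"
    proof (intro sum_mono)
      fix j k assume "j \<in> {..<p}" "k \<in> {..<p}"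
      then have "\<bar>\<sigma> j k - (\<Sum>i<n. W i j * W i k) / n\<bar> \<le> \<epsilon>" using gram[of j k] by (simp add: abs_minus_commute)
      then have "\<bar>d j * d k * (\<sigma> j k - (\<Sum>i<n. W i j * W i k) / n)\<bar> \<le> \<bar>d j\<bar> * \<bar>d k\<bar> * \<epsilon>"
        unfolding abs_mult by (intro mult_left_mono) auto
      then show "d j * d k * (\<sigma> j k - (\<Sum>i<n. W i j * W i k) / n) \<le> \<bar>d j\<bar> * \<bar>d k\<bar> * \<epsilon>" by linarith
    qed
    also have "\<dots> = l\<^sup>2 * \<epsilon>" unfolding l_def power2_eq_square unfolding sum_product unfolding sum_distrib_right ..
    finally have 1: "c * q - l\<^sup>2 * \<epsilon> \<le> D" using quad[of d] unfolding q_def by linarith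
    show ?thesis
    proof (cases "p = 0")
      case True
      then show ?thesis by (simp add: D_def)
    next
      case False
      \<comment> \<open>Nonnegativity of \<epsilon> is read off an entry of the Gram matrix, which
        exists only for p > 0.\<close>
      then have "0 \<le> \<epsilon>" using gram[of 0 0] by (meson abs_ge_zero not_gr_zero order_trans)
      then have "l\<^sup>2 * \<epsilon> \<le> (4 * real s * q) * \<epsilon>" using l2 unfolding q_def by (intro mult_right_mono)
      also have "\<dots> = (8 * real s * \<epsilon>) * q / 2" by simp
      also have "\<dots> \<le> c * q / 2" using small q0 by (intro divide_right_mono mult_right_mono) auto
      finally show ?thesis using 1 unfolding q_def by simp
    qed
  qed
  have ll: "l * l \<le> 16 * real s * lam / c * l"
  proof -
    have "l * l * c \<le> 4 * real s * (\<Sum>j<p. (d j)\<^sup>2) * c" using l2 c by (simp add: power2_eq_square)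
    also have "\<dots> = 8 * real s * (c / 2 * (\<Sum>j<p. (d j)\<^sup>2))" by simp
    also have "\<dots> \<le> 8 * real s * (2 * lam * l)" using lo up by (intro mult_left_mono) auto
    finally show ?thesis using c by (simp add: field_simps)
  qed
  have L: "l \<le> 16 * real s * lam / c"
  proof (cases "l = 0")
    case True
    then show ?thesis using c lam by simp
  next
    case False
    then have "0 < l" using l0 by simp
    then show ?thesis using mult_right_le_imp_le[OF ll] by simp
  qed
  then show "(\<Sum>j<p. \<bar>b' j - b j\<bar>) \<le> 16 * real s * lam / c" by (simp add: l_def d_def)
  have "D \<le> 2 * lam * (16 * real s * lam / c)" using up mult_left_mono[OF L, of "2 * lam"] lam by linarith
  also have "2 * lam * (16 * real s * lam / c) = 32 * real s * lam\<^sup>2 / c" by (simp add: power2_eq_square)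
  finally have "n * D \<le> n * (32 * real s * lam\<^sup>2 / c)" by (intro mult_left_mono) auto
  then show "(\<Sum>i<n. (\<Sum>k<p. W i k * (b' k - b k))\<^sup>2) \<le> n * (32 * real s * lam\<^sup>2 / c)"
    using n by (simp add: D_def d_def)
qed

section \<open>The normal law and the ADDS estimator\<close>

lemma space_borel_vec: "space (borel_vec p) = carrier_vec p"
  by (simp add: borel_vec_def)

lemma measurable_borel_vecI:
  assumes "\<And>\<omega>. \<omega> \<in> space M \<Longrightarrow> f \<omega> \<in> carrier_vec p" "\<And>i. i < p \<Longrightarrow> (\<lambda>\<omega>. f \<omega> $ i) \<in> borel_measurable M"
  shows "f \<in> measurable M (borel_vec p)"
  unfolding borel_vec_def
  by (rule measurable_vimage_algebra2) (use assms in \<open>auto intro!: measurable_restrict\<close>)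

lemma measurable_borel_matI:
  assumes "\<And>\<omega>. \<omega> \<in> space M \<Longrightarrow> f \<omega> \<in> carrier_mat n p"
    and "\<And>i j. i < n \<Longrightarrow> j < p \<Longrightarrow> (\<lambda>\<omega>. f \<omega> $$ (i, j)) \<in> borel_measurable M"
  shows "f \<in> measurable M (borel_mat n p)"
  unfolding borel_mat_def
  by (rule measurable_vimage_algebra2) (use assms in \<open>auto intro!: measurable_restrict\<close>)

lemma measurable_vec_index:
  assumes "i < p"
  shows "(\<lambda>v. v $ i) \<in> borel_measurable (borel_vec p)"
proof -
  have "(\<lambda>v. \<lambda>i\<in>{..<p}. v $ i) \<in> measurable (borel_vec p) (\<Pi>\<^sub>M i\<in>{..<p}. borel :: real measure)"
    unfolding borel_vec_def by (rule measurable_vimage_algebra1) (auto simp: space_PiM)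
  from measurable_compose[OF this measurable_component_singleton[of i]] assms show ?thesis by simp
qed

lemma linf_norm_le_iff: "linf_norm v \<le> t \<longleftrightarrow> 0 \<le> t \<and> (\<forall>i<dim_vec v. \<bar>v $ i\<bar> \<le> t)"
  unfolding linf_norm_def by (subst Max_le_iff) auto

text \<open>The factor inside \<open>gaussian\<close> is chosen by \<open>SOME\<close>, so one must
  exist, which is \<open>psd_factor\<close>. The characteristic function then depends on the factor
  only through \<open>L * transpose_mat L\<close>.\<close>

lemma gauss_gaussian:
  fixes a :: "nat \<Rightarrow> nat \<Rightarrow> real"
  assumes A: "A \<in> carrier_mat p p"
    and sym: "\<And>i j. i < p \<Longrightarrow> j < p \<Longrightarrow> A $$ (i, j) = A $$ (j, i)"
    and psd: "\<And>v. 0 \<le> (\<Sum>i<p. \<Sum>j<p. v i * v j * A $$ (i, j))"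
  shows "gauss (gaussian A) {..<p} (\<lambda>i v. v $ i) (\<lambda>i j. A $$ (i, j))"
    and "sets (gaussian A) = sets (borel_vec p)"
proof -
  define L where "L = (SOME L. L \<in> carrier_mat p p \<and> L * transpose_mat L = A)"
  obtain l where l: "\<forall>i<p. \<forall>j<p. A $$ (i, j) = (\<Sum>k<p. l i k * l j k)"
    using psd_factor[of p "\<lambda>i j. A $$ (i, j)"] sym psd by auto
  have "mat p p (\<lambda>(i, k). l i k) \<in> carrier_mat p p \<and> mat p p (\<lambda>(i, k). l i k) * transpose_mat (mat p p (\<lambda>(i, k). l i k)) = A"
    using A l by (auto intro!: eq_matI simp: scalar_prod_def lessThan_atLeast0)
  then have "L \<in> carrier_mat p p \<and> L * transpose_mat L = A" unfolding L_def by (rule someI)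
  then have L: "L \<in> carrier_mat p p" "L * transpose_mat L = A" by auto
  have LA: "(\<Sum>k<p. L $$ (i, k) * L $$ (j, k)) = A $$ (i, j)" if "i < p" "j < p" for i j
  proof -
    have "(L * transpose_mat L) $$ (i, j) = (\<Sum>k<p. L $$ (i, k) * L $$ (j, k))"
      using L(1) that by (simp add: scalar_prod_def lessThan_atLeast0)
    then show ?thesis using L(2) by simp
  qed
  have g: "gaussian A = distr (std_gauss {..<p}) (borel_vec p) (\<lambda>g. L *\<^sub>v vec p g)"
    using A unfolding gaussian_def L_def std_gauss_def Let_def by simp
  have ix: "(L *\<^sub>v vec p g) $ i = (\<Sum>k<p. L $$ (i, k) * g k)" if "i < p" for g i
    using L(1) that by (simp add: scalar_prod_def lessThan_atLeast0)
  have m: "(\<lambda>g. L *\<^sub>v vec p g) \<in> measurable (std_gauss {..<p}) (borel_vec p)"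
  proof (rule measurable_borel_vecI)
    show "(\<lambda>g. (L *\<^sub>v vec p g) $ i) \<in> borel_measurable (std_gauss {..<p})" if "i < p" for i
      using that by (simp add: ix)
  qed (use L in auto)
  interpret G: prob_space "std_gauss {..<p}" by (rule prob_space_std_gauss)
  show "sets (gaussian A) = sets (borel_vec p)" by (simp add: g)
  show "gauss (gaussian A) {..<p} (\<lambda>i v. v $ i) (\<lambda>i j. A $$ (i, j))"
    unfolding gauss_def
  proof (intro conjI allI ballI)
    show "prob_space (gaussian A)" unfolding g by (rule G.prob_space_distr[OF m])
    show "(\<lambda>v. v $ i) \<in> borel_measurable (gaussian A)" if "i \<in> {..<p}" for i
      using measurable_vec_index[of i p] that by (simp add: g)
    fix t :: "nat \<Rightarrow> real"
    have "(CLINT v|gaussian A. iexp (\<Sum>i<p. t i * v $ i)) = (CLINT x|std_gauss {..<p}. iexp (\<Sum>i<p. t i * (L *\<^sub>v vec p x) $ i))"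
      unfolding g
    proof (rule integral_distr[OF m])
      have "(\<lambda>v. (\<Sum>i<p. t i * v $ i)) \<in> borel_measurable (borel_vec p)"
        by (intro borel_measurable_sum borel_measurable_times measurable_vec_index) auto
      then show "(\<lambda>v. iexp (\<Sum>i<p. t i * v $ i)) \<in> borel_measurable (borel_vec p)" by measurable
    qed
    also have "\<dots> = (CLINT x|std_gauss {..<p}. iexp (\<Sum>i<p. t i * (\<Sum>k<p. L $$ (i, k) * x k)))"
      by (simp add: ix)
    also have "\<dots> = exp (- (\<Sum>i<p. \<Sum>j<p. t i * t j * (\<Sum>k<p. L $$ (i, k) * L $$ (j, k))) / 2)"
      using gaussD(4)[OF gauss_linear_std[of "{..<p}" "{..<p}" "\<lambda>i k. L $$ (i, k)"]] by simp
    also have "(\<Sum>i<p. \<Sum>j<p. t i * t j * (\<Sum>k<p. L $$ (i, k) * L $$ (j, k))) = (\<Sum>i<p. \<Sum>j<p. t i * t j * A $$ (i, j))"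
      by (intro sum.cong) (auto simp: LA)
    finally show "(CLINT v|gaussian A. iexp (\<Sum>i<p. t i * v $ i)) = exp (- (\<Sum>i<p. \<Sum>j<p. t i * t j * A $$ (i, j)) / 2)" .
  qed simp
qed

lemma gauss_cov_nonneg:
  assumes g: "gauss M I X C"
  shows "0 \<le> (\<Sum>i\<in>I. \<Sum>j\<in>I. v i * v j * C i j)"
  using gauss_var_nonneg[OF gauss_linear[OF g, of "{()}" "\<lambda>_. v"], of "()"] by simp

text \<open>Allows \<open>Gam\<close> to be evaluated on any space that carries a family with this
  covariance. Negative arguments are separate because \<open>linf_norm\<close> is nonnegative,
  whereas the condition on the coordinates is vacuous for p = 0.\<close>

lemma Gam_eq:
  assumes A: "A \<in> carrier_mat p p"
    and sym: "\<And>i j. i < p \<Longrightarrow> j < p \<Longrightarrow> A $$ (i, j) = A $$ (j, i)"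
    and g: "gauss N {..<p} X (\<lambda>i j. A $$ (i, j))"
  shows "Gam t A = (if 0 \<le> t then measure N {\<omega>\<in>space N. \<forall>j\<in>{..<p}. \<bar>X j \<omega>\<bar> \<le> t} else 0)"
proof -
  note G = gauss_gaussian[OF A sym gauss_cov_nonneg[OF g]]
  have sp: "space (gaussian A) = carrier_vec p"
    using sets_eq_imp_space_eq[OF G(2)] by (simp add: space_borel_vec)
  have "{\<xi> \<in> space (gaussian A). linf_norm \<xi> \<le> t} = (if 0 \<le> t then {\<xi> \<in> space (gaussian A). \<forall>j\<in>{..<p}. \<bar>\<xi> $ j\<bar> \<le> t} else {})"
    unfolding sp by (auto simp: linf_norm_le_iff)
  then show ?thesis using gauss_prob_all_le_eq[OF G(1) g, of "\<lambda>_. t"] by (simp add: Gam_def)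
qed

lemma Gam_mono:
  assumes A: "A \<in> carrier_mat p p"
    and sym: "\<And>i j. i < p \<Longrightarrow> j < p \<Longrightarrow> A $$ (i, j) = A $$ (j, i)"
    and g: "gauss N {..<p} X (\<lambda>i j. A $$ (i, j))" and st: "s \<le> t"
  shows "Gam s A \<le> Gam t A"
proof -
  interpret N: prob_space N using gaussD[OF g] by simp
  have "{\<omega>\<in>space N. \<forall>j\<in>{..<p}. \<bar>X j \<omega>\<bar> \<le> t} \<in> sets N" for t
  proof -
    have [measurable]: "X i \<in> borel_measurable N" if "i \<in> {..<p}" for i using gaussD[OF g] that by simp
    show ?thesis by measurable
  qed
  then have "measure N {\<omega>\<in>space N. \<forall>j\<in>{..<p}. \<bar>X j \<omega>\<bar> \<le> s} \<le> measure N {\<omega>\<in>space N. \<forall>j\<in>{..<p}. \<bar>X j \<omega>\<bar> \<le> t}"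
    by (intro N.finite_measure_mono) (auto intro: order_trans[OF _ st])
  then show ?thesis using st by (simp add: Gam_eq[OF A sym g])
qed

text \<open>Turns rejection into a countable union of conditions on \<open>Gam\<close> at fixed
  arguments. This yields measurability of the rejection event, and it holds without continuity of
  \<open>Gam _ A\<close>, which fails for A = 0.\<close>

lemma less_Gam_inv_iff:
  assumes A: "A \<in> carrier_mat p p"
    and sym: "\<And>i j. i < p \<Longrightarrow> j < p \<Longrightarrow> A $$ (i, j) = A $$ (j, i)"
    and g: "gauss N {..<p} X (\<lambda>i j. A $$ (i, j))" and q: "0 < q" "q < 1"
  shows "Gam_inv q A < T \<longleftrightarrow> (\<exists>r\<in>\<rat>. r < T \<and> q \<le> Gam r A)"
proof -
  interpret N: prob_space N using gaussD[OF g] by simp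
  have mx: "X i \<in> borel_measurable N" if "i \<in> {..<p}" for i using gaussD[OF g] that by simp
  let ?S = "{t. q \<le> Gam t A}"
  have bdd: "bdd_below ?S"
  proof (rule bdd_belowI[of _ 0])
    fix t assume "t \<in> ?S"
    then show "0 \<le> t" using q by (cases "0 \<le> t") (auto simp: Gam_eq[OF A sym g])
  qed
  have ne: "?S \<noteq> {}"
  proof -
    let ?E = "\<lambda>k::nat. {\<omega>\<in>space N. \<forall>j\<in>{..<p}. \<bar>X j \<omega>\<bar> \<le> real k}"
    have "(\<Union>k. ?E k) = space N"
    proof safe
      fix \<omega> assume "\<omega> \<in> space N"
      obtain k :: nat where k: "(\<Sum>j<p. \<bar>X j \<omega>\<bar>) \<le> real k" using real_arch_simple by blast
      have "\<bar>X j \<omega>\<bar> \<le> real k" if "j < p" for j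
      proof -
        have "\<bar>X j \<omega>\<bar> \<le> (\<Sum>j<p. \<bar>X j \<omega>\<bar>)" using that by (intro member_le_sum) auto
        then show ?thesis using k by linarith
      qed
      then show "\<omega> \<in> (\<Union>k. ?E k)" using \<open>\<omega> \<in> space N\<close> by auto
    qed
    moreover have "(\<lambda>k. measure N (?E k)) \<longlonglongrightarrow> measure N (\<Union>k. ?E k)"
    proof (rule N.finite_Lim_measure_incseq)
      show "range ?E \<subseteq> sets N" using mx by (auto intro!: sets.sets_Collect_finite_All' simp: image_subset_iff)
      show "incseq ?E" by (auto simp: incseq_def intro: order_trans)
    qed
    ultimately have "(\<lambda>k. measure N (?E k)) \<longlonglongrightarrow> 1" by (simp add: N.prob_space)
    then have "eventually (\<lambda>k. q < measure N (?E k)) sequentially" by (rule order_tendstoD(1)) (use q in simp)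
    then obtain k where "q < measure N (?E k)" by (auto simp: eventually_sequentially)
    then have "real k \<in> ?S" by (simp add: Gam_eq[OF A sym g])
    then show ?thesis by blast
  qed
  show ?thesis
  proof
    assume "Gam_inv q A < T"
    then obtain t where t: "q \<le> Gam t A" "t < T"
      using cInf_lessD[OF ne] unfolding Gam_inv_def by blast
    obtain r where r: "r \<in> \<rat>" "t < r" "r < T" using Rats_dense_in_real[OF t(2)] by blast
    then show "\<exists>r\<in>\<rat>. r < T \<and> q \<le> Gam r A"
      using Gam_mono[OF A sym g, of t r] t by (intro bexI[of _ r]) auto
  next
    assume "\<exists>r\<in>\<rat>. r < T \<and> q \<le> Gam r A"
    then obtain r where "r < T" "r \<in> ?S" by auto
    then show "Gam_inv q A < T" unfolding Gam_inv_def using cInf_lower[OF _ bdd] by (meson le_less_trans)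
  qed
qed

section \<open>The ADDS estimator at its selected scale\<close>

lemma adds_props:
  assumes rule: "adds_rule \<eta> n p \<theta>" and W: "W \<in> carrier_mat n p" and v: "v \<in> carrier_vec n"
  obtains \<sigma> where "0 \<le> \<sigma>" "adds \<theta> W v = \<theta> W v \<sigma>" "scale_admissible W v (\<theta> W v) \<sigma>"
    "\<And>\<tau>. scale_admissible W v (\<theta> W v) \<tau> \<Longrightarrow> \<tau> \<le> \<sigma>"
    "\<And>\<tau>. 0 \<le> \<tau> \<Longrightarrow> is_dantzig_solution \<eta> W v \<tau> (\<theta> W v \<tau>)"
proof -
  let ?P = "scale_admissible W v (\<theta> W v)"
  have d: "\<And>\<tau>. 0 \<le> \<tau> \<Longrightarrow> is_dantzig_solution \<eta> W v \<tau> (\<theta> W v \<tau>)" and "\<exists>\<sigma>. ?P \<sigma> \<and> (\<forall>\<tau>. ?P \<tau> \<longrightarrow> \<tau> \<le> \<sigma>)"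
    using rule W v unfolding adds_rule_def by auto
  then obtain \<sigma> where s: "?P \<sigma>" "\<forall>\<tau>. ?P \<tau> \<longrightarrow> \<tau> \<le> \<sigma>" by blast
  have "(GREATEST \<sigma>. ?P \<sigma>) = \<sigma>" by (rule Greatest_equality) (use s in auto)
  then have "adds \<theta> W v = \<theta> W v \<sigma>" by (simp add: adds_def)
  moreover have "0 \<le> \<sigma>" using s by (simp add: scale_admissible_def)
  ultimately show ?thesis using that s d by blast
qed

lemma l2_norm_sq: "(l2_norm v)\<^sup>2 = (\<Sum>i<dim_vec v. (v $ i)\<^sup>2)"
  unfolding l2_norm_def by (simp add: sum_nonneg)

lemma mult_mat_vec_index_sum: "W \<in> carrier_mat n p \<Longrightarrow> b \<in> carrier_vec p \<Longrightarrow> i < n \<Longrightarrow> (W *\<^sub>v b) $ i = (\<Sum>k<p. W $$ (i, k) * b $ k)"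
  by (auto simp: scalar_prod_def lessThan_atLeast0)

lemma dantzig_feasible_iff:
  assumes W: "W \<in> carrier_mat n p" and v: "v \<in> carrier_vec n" and b: "b \<in> carrier_vec p" and n: "0 < n" and c: "0 \<le> c"
  shows "linf_norm ((1 / real (dim_row W)) \<cdot>\<^sub>v (transpose_mat W *\<^sub>v (v - W *\<^sub>v b))) \<le> c
    \<longleftrightarrow> (\<forall>j<p. \<bar>\<Sum>i<n. W $$ (i, j) * (v $ i - (\<Sum>k<p. W $$ (i, k) * b $ k))\<bar> \<le> n * c)"
proof -
  have "((1 / real (dim_row W)) \<cdot>\<^sub>v (transpose_mat W *\<^sub>v (v - W *\<^sub>v b))) $ j
    = (\<Sum>i<n. W $$ (i, j) * (v $ i - (\<Sum>k<p. W $$ (i, k) * b $ k))) / n" if "j < p" for j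
    using W v b that by (simp add: scalar_prod_def lessThan_atLeast0)
  then show ?thesis using W n c by (simp add: linf_norm_le_iff field_simps)
qed

lemma is_dantzig_solutionD:
  assumes d: "is_dantzig_solution \<eta> W v \<tau> b" and W: "W \<in> carrier_mat n p" and v: "v \<in> carrier_vec n" and n: "0 < n" and c: "0 \<le> \<eta> * \<tau>"
  shows "b \<in> carrier_vec p"
    "\<And>j. j < p \<Longrightarrow> \<bar>\<Sum>i<n. W $$ (i, j) * (v $ i - (\<Sum>k<p. W $$ (i, k) * b $ k))\<bar> \<le> n * (\<eta> * \<tau>)"
    "\<And>b'. b' \<in> carrier_vec p \<Longrightarrow> (\<And>j. j < p \<Longrightarrow> \<bar>\<Sum>i<n. W $$ (i, j) * (v $ i - (\<Sum>k<p. W $$ (i, k) * b' $ k))\<bar> \<le> n * (\<eta> * \<tau>))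
       \<Longrightarrow> (\<Sum>j<p. \<bar>b $ j\<bar>) \<le> (\<Sum>j<p. \<bar>b' $ j\<bar>)"
proof -
  have f: "b \<in> carrier_vec p" "linf_norm ((1 / real (dim_row W)) \<cdot>\<^sub>v (transpose_mat W *\<^sub>v (v - W *\<^sub>v b))) \<le> \<eta> * \<tau>"
    and m: "\<And>b'. b' \<in> carrier_vec p \<Longrightarrow> linf_norm ((1 / real (dim_row W)) \<cdot>\<^sub>v (transpose_mat W *\<^sub>v (v - W *\<^sub>v b'))) \<le> \<eta> * \<tau> \<Longrightarrow> \<not> l1_norm b' < l1_norm b"
    using d W unfolding is_dantzig_solution_def is_arg_min_def by auto
  show "b \<in> carrier_vec p" by (rule f)
  show "\<bar>\<Sum>i<n. W $$ (i, j) * (v $ i - (\<Sum>k<p. W $$ (i, k) * b $ k))\<bar> \<le> n * (\<eta> * \<tau>)" if "j < p" for j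
    using f(2) that unfolding dantzig_feasible_iff[OF W v f(1) n c] by blast
  fix b' assume b': "b' \<in> carrier_vec p" and "\<And>j. j < p \<Longrightarrow> \<bar>\<Sum>i<n. W $$ (i, j) * (v $ i - (\<Sum>k<p. W $$ (i, k) * b' $ k))\<bar> \<le> n * (\<eta> * \<tau>)"
  then have "\<not> l1_norm b' < l1_norm b" using m[OF b'] unfolding dantzig_feasible_iff[OF W v b' n c] by blast
  then show "(\<Sum>j<p. \<bar>b $ j\<bar>) \<le> (\<Sum>j<p. \<bar>b' $ j\<bar>)" using b' f(1) by (simp add: l1_norm_def)
qed

lemma l2_residual_sq:
  assumes W: "W \<in> carrier_mat n p" and v: "v \<in> carrier_vec n" and b: "b \<in> carrier_vec p"
  shows "(l2_norm (v - W *\<^sub>v b))\<^sup>2 = (\<Sum>i<n. (v $ i - (\<Sum>k<p. W $$ (i, k) * b $ k))\<^sup>2)"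
  unfolding l2_norm_sq using assms by (auto simp: scalar_prod_def lessThan_atLeast0 intro!: sum.cong)

text \<open>The constraint bounds the correlations by n * \<eta> * \<sigma>, and admissibility of
  the selected \<sigma> bounds n * \<sigma> by sqrt (2 * n) times the residual norm. No coefficient
  vector enters, so this covers the regression of Y, whose coefficients may be dense.\<close>

lemma adds_feasible:
  assumes rule: "adds_rule \<eta> n p \<theta>" and W: "W \<in> carrier_mat n p" and v: "v \<in> carrier_vec n" and n: "0 < n" and \<eta>: "0 \<le> \<eta>"
  shows "adds \<theta> W v \<in> carrier_vec p"
    "j < p \<Longrightarrow> \<bar>\<Sum>i<n. W $$ (i, j) * (v $ i - (\<Sum>k<p. W $$ (i, k) * adds \<theta> W v $ k))\<bar>
      \<le> \<eta> * sqrt (2 * n) * sqrt (\<Sum>i<n. (v $ i - (\<Sum>k<p. W $$ (i, k) * adds \<theta> W v $ k))\<^sup>2)"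
proof -
  obtain \<sigma> where s: "0 \<le> \<sigma>" "adds \<theta> W v = \<theta> W v \<sigma>" "scale_admissible W v (\<theta> W v) \<sigma>"
    "is_dantzig_solution \<eta> W v \<sigma> (\<theta> W v \<sigma>)"
    using adds_props[OF rule W v] by metis
  note d = is_dantzig_solutionD[OF s(4) W v n]
  have e: "0 \<le> \<eta> * \<sigma>" using \<eta> s by simp
  show b: "adds \<theta> W v \<in> carrier_vec p" unfolding s(2) by (rule d(1)[OF e])
  define R where "R = (\<Sum>i<n. (v $ i - (\<Sum>k<p. W $$ (i, k) * adds \<theta> W v $ k))\<^sup>2)"
  have R0: "0 \<le> R" by (simp add: R_def sum_nonneg)
  have "n * \<sigma>\<^sup>2 / 2 \<le> R" using s(3) W l2_residual_sq[OF W v b] by (simp add: scale_admissible_def R_def s(2))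
  then have "(n * \<sigma>)\<^sup>2 \<le> 2 * n * R" using n by (simp add: power2_eq_square field_simps)
  then have "n * \<sigma> \<le> sqrt (2 * n * R)" by (rule real_le_rsqrt)
  then have "\<eta> * (n * \<sigma>) \<le> \<eta> * (sqrt (2 * n) * sqrt R)" using \<eta> by (intro mult_left_mono) (auto simp: real_sqrt_mult)
  then show "\<bar>\<Sum>i<n. W $$ (i, j) * (v $ i - (\<Sum>k<p. W $$ (i, k) * adds \<theta> W v $ k))\<bar>
      \<le> \<eta> * sqrt (2 * n) * sqrt (\<Sum>i<n. (v $ i - (\<Sum>k<p. W $$ (i, k) * adds \<theta> W v $ k))\<^sup>2)" if "j < p"
    using d(2)[OF e that] unfolding s(2)[symmetric] R_def[symmetric] by (simp add: mult_ac)
qed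

text \<open>The selected scale is comparable with the noise level \<open>s0\<close>. For every
  \<tau> \<ge> s0 the true vector \<open>b\<close> is feasible, so \<open>dantzig_l1_error\<close>
  applies and the residual norm is within sqrt n * \<tau> / 4 of the noise norm. This makes
  \<open>s0\<close> admissible and every admissible scale at most 3 * s0; the constant 48 is 16 *
  3.\<close>

lemma adds_l1_error:
  fixes b :: "nat \<Rightarrow> real"
  assumes rule: "adds_rule \<eta> n p \<theta>" and W: "W \<in> carrier_mat n p" and v: "v \<in> carrier_vec n" and n: "0 < n" and \<eta>: "0 < \<eta>" and c: "0 < c"
    and gram: "\<And>j k. j < p \<Longrightarrow> k < p \<Longrightarrow> \<bar>(\<Sum>i<n. W $$ (i, j) * W $$ (i, k)) / n - \<sigma> j k\<bar> \<le> \<epsilon>"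
    and quad: "\<And>w. c * (\<Sum>j<p. (w j)\<^sup>2) \<le> (\<Sum>j<p. \<Sum>k<p. w j * w k * \<sigma> j k)"
    and supp: "card {j. j < p \<and> b j \<noteq> 0} \<le> s" and small: "8 * real s * \<epsilon> \<le> c" "512 * real s * \<eta>\<^sup>2 \<le> c"
    and r: "\<And>i. i < n \<Longrightarrow> r i = v $ i - (\<Sum>k<p. W $$ (i, k) * b k)"
    and noise: "\<And>j. j < p \<Longrightarrow> \<bar>\<Sum>i<n. W $$ (i, j) * r i\<bar> \<le> \<eta> * sqrt n * sqrt (\<Sum>i<n. (r i)\<^sup>2)"
  shows "(\<Sum>j<p. \<bar>adds \<theta> W v $ j - b j\<bar>) \<le> 48 * real s * \<eta> / c * (sqrt (\<Sum>i<n. (r i)\<^sup>2) / sqrt n)"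
proof -
  obtain \<sigma>' where s: "0 \<le> \<sigma>'" "adds \<theta> W v = \<theta> W v \<sigma>'" "scale_admissible W v (\<theta> W v) \<sigma>'"
    "\<And>\<tau>. scale_admissible W v (\<theta> W v) \<tau> \<Longrightarrow> \<tau> \<le> \<sigma>'"
    "\<And>\<tau>. 0 \<le> \<tau> \<Longrightarrow> is_dantzig_solution \<eta> W v \<tau> (\<theta> W v \<tau>)"
    using adds_props[OF rule W v] by metis
  define R where "R = sqrt (\<Sum>i<n. (r i)\<^sup>2)"
  have R0: "0 \<le> R" by (simp add: R_def sum_nonneg)
  define s0 where "s0 = R / sqrt n"
  have s0: "0 \<le> s0" "R = sqrt n * s0" using R0 n by (auto simp: s0_def)
  have feas: "\<bar>\<Sum>i<n. W $$ (i, j) * (v $ i - (\<Sum>k<p. W $$ (i, k) * b k))\<bar> \<le> n * (\<eta> * \<tau>)" if "s0 \<le> \<tau>" "j < p" for \<tau> j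
  proof -
    have "\<bar>\<Sum>i<n. W $$ (i, j) * (v $ i - (\<Sum>k<p. W $$ (i, k) * b k))\<bar> = \<bar>\<Sum>i<n. W $$ (i, j) * r i\<bar>"
      by (simp add: r)
    also have "\<dots> \<le> \<eta> * sqrt n * (sqrt n * s0)" using noise[OF that(2)] s0 by (simp add: R_def[symmetric])
    also have "\<dots> = n * (\<eta> * s0)" by (simp add: algebra_simps flip: real_sqrt_mult_self[of "real n"])
    also have "\<dots> \<le> n * (\<eta> * \<tau>)" using that \<eta> by (intro mult_left_mono) auto
    finally show ?thesis .
  qed
  have key: "(\<Sum>j<p. \<bar>\<theta> W v \<tau> $ j - b j\<bar>) \<le> 16 * real s * (\<eta> * \<tau>) / c"
    "\<bar>l2_norm (v - W *\<^sub>v \<theta> W v \<tau>) - R\<bar> \<le> sqrt n * \<tau> / 4" if t: "s0 \<le> \<tau>" for \<tau>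
  proof -
    let ?b = "\<theta> W v \<tau>"
    have t0: "0 \<le> \<tau>" "0 \<le> \<eta> * \<tau>" using t s0 \<eta> by auto
    note d = is_dantzig_solutionD[OF s(5)[OF t0(1)] W v n t0(2)]
    have bv: "vec p b \<in> carrier_vec p" by simp
    have l1: "(\<Sum>j<p. \<bar>?b $ j\<bar>) \<le> (\<Sum>j<p. \<bar>b j\<bar>)"
      using d(3)[OF bv] feas[OF t] by simp
    note D = dantzig_l1_error[of n c "\<eta> * \<tau>" p "\<lambda>i j. W $$ (i, j)" \<sigma> \<epsilon> b s "\<lambda>j. ?b $ j" "\<lambda>i. v $ i", OF n c t0(2) gram quad supp small(1) l1 feas[OF t] d(2)]
    show "(\<Sum>j<p. \<bar>?b $ j - b j\<bar>) \<le> 16 * real s * (\<eta> * \<tau>) / c" using D(1) by simp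
    define q where "q i = (\<Sum>k<p. W $$ (i, k) * (?b $ k - b k))" for i
    have "(\<Sum>i<n. (q i)\<^sup>2) \<le> n * (32 * real s * (\<eta> * \<tau>)\<^sup>2 / c)" using D(2) by (simp add: q_def)
    \<comment> \<open>The constant 512 = 32 * 16 is what turns the prediction error into (sqrt n *
      \<tau> / 4)^2.\<close>
    also have "\<dots> = n * (512 * real s * \<eta>\<^sup>2) * \<tau>\<^sup>2 / (16 * c)" by (simp add: power_mult_distrib)
    also have "\<dots> \<le> n * c * \<tau>\<^sup>2 / (16 * c)" using small(2) c by (intro divide_right_mono mult_right_mono mult_left_mono) auto
    also have "\<dots> = (sqrt n * \<tau> / 4)\<^sup>2" using c by (simp add: power_mult_distrib power_divide)
    finally have q1: "sqrt (\<Sum>i<n. (q i)\<^sup>2) \<le> sqrt n * \<tau> / 4" using t0 by (intro real_le_lsqrt) auto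
    have "l2_norm (v - W *\<^sub>v ?b) = sqrt (\<Sum>i<n. (r i - q i)\<^sup>2)"
    proof -
      have "(l2_norm (v - W *\<^sub>v ?b))\<^sup>2 = (\<Sum>i<n. (r i - q i)\<^sup>2)"
        unfolding l2_residual_sq[OF W v d(1)] by (intro sum.cong) (auto simp: r q_def right_diff_distrib sum_subtractf)
      moreover have "0 \<le> l2_norm (v - W *\<^sub>v ?b)" by (simp add: l2_norm_def sum_nonneg)
      ultimately show ?thesis by (metis abs_of_nonneg real_sqrt_abs)
    qed
    then have "l2_norm (v - W *\<^sub>v ?b) = L2_set (\<lambda>i. r i - q i) {..<n}" "R = L2_set r {..<n}" "sqrt (\<Sum>i<n. (q i)\<^sup>2) = L2_set q {..<n}"
      by (auto simp: L2_set_def R_def)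
    moreover have "L2_set (\<lambda>i. r i - q i) {..<n} \<le> L2_set r {..<n} + L2_set q {..<n}"
      using L2_set_triangle_ineq[of r "\<lambda>i. - q i" "{..<n}"] by (simp add: L2_set_def)
    moreover have "L2_set r {..<n} \<le> L2_set (\<lambda>i. r i - q i) {..<n} + L2_set q {..<n}"
      using L2_set_triangle_ineq[of "\<lambda>i. r i - q i" q "{..<n}"] by simp
    ultimately show "\<bar>l2_norm (v - W *\<^sub>v ?b) - R\<bar> \<le> sqrt n * \<tau> / 4" using q1 by linarith
  qed
  have adm: "scale_admissible W v (\<theta> W v) \<tau> \<longleftrightarrow> sqrt n * \<tau> \<le> sqrt 2 * l2_norm (v - W *\<^sub>v \<theta> W v \<tau>)" if "0 \<le> \<tau>" for \<tau>
  proof -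
    have "sqrt n * \<tau> \<le> sqrt 2 * l2_norm (v - W *\<^sub>v \<theta> W v \<tau>) \<longleftrightarrow> (sqrt n * \<tau>)\<^sup>2 \<le> (sqrt 2 * l2_norm (v - W *\<^sub>v \<theta> W v \<tau>))\<^sup>2"
      using that by (intro power_mono_iff[symmetric]) (auto simp: l2_norm_def sum_nonneg)
    moreover have "scale_admissible W v (\<theta> W v) \<tau> \<longleftrightarrow> n * \<tau>\<^sup>2 \<le> 2 * (l2_norm (v - W *\<^sub>v \<theta> W v \<tau>))\<^sup>2"
      using that W by (auto simp: scale_admissible_def)
    moreover have "(sqrt n * \<tau>)\<^sup>2 = n * \<tau>\<^sup>2" "(sqrt 2 * l2_norm (v - W *\<^sub>v \<theta> W v \<tau>))\<^sup>2 = 2 * (l2_norm (v - W *\<^sub>v \<theta> W v \<tau>))\<^sup>2"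
      by (simp_all add: power_mult_distrib)
    ultimately show ?thesis by (simp only:)
  qed
  \<comment> \<open>The lower bound gives 4/3 * 3/4 = 1, hence admissibility of \<open>s0\<close>.
    The upper bound gives \<sigma>' \<le> 12/5 * s0.\<close>
  have sq2: "4/3 \<le> sqrt (2::real)" "sqrt (2::real) \<le> 3/2"
    by (rule real_le_rsqrt, simp add: power2_eq_square) (rule real_le_lsqrt; simp add: power2_eq_square)
  have le: "s0 \<le> \<sigma>'"
  proof (rule s(4))
    have "3/4 * R \<le> l2_norm (v - W *\<^sub>v \<theta> W v s0)" using key(2)[OF order_refl] unfolding s0(2) by linarith
    then have "4/3 * (3/4 * R) \<le> sqrt 2 * l2_norm (v - W *\<^sub>v \<theta> W v s0)" using sq2 R0 by (intro mult_mono) auto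
    then show "scale_admissible W v (\<theta> W v) s0" unfolding adm[OF s0(1)] using s0(2) by linarith
  qed
  have up: "\<sigma>' \<le> 3 * s0"
  proof -
    have "l2_norm (v - W *\<^sub>v \<theta> W v \<sigma>') \<le> R + sqrt n * \<sigma>' / 4" using key(2)[OF le] by linarith
    then have "sqrt 2 * l2_norm (v - W *\<^sub>v \<theta> W v \<sigma>') \<le> 3/2 * (R + sqrt n * \<sigma>' / 4)"
      using sq2 by (intro mult_mono) (auto simp: l2_norm_def sum_nonneg)
    then have "sqrt n * \<sigma>' \<le> 3/2 * (sqrt n * s0 + sqrt n * \<sigma>' / 4)" using s(3) unfolding adm[OF s(1)] s0(2) by linarith
    then have "sqrt n * (5 * \<sigma>') \<le> sqrt n * (12 * s0)" by (simp add: algebra_simps)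
    then have "5 * \<sigma>' \<le> 12 * s0" using n by (simp only: mult_le_cancel_left) simp
    then show ?thesis using s0 by simp
  qed
  have "(\<Sum>j<p. \<bar>adds \<theta> W v $ j - b j\<bar>) \<le> 16 * real s * (\<eta> * \<sigma>') / c" using key(1)[OF le] s(2) by simp
  also have "\<dots> \<le> 16 * real s * (\<eta> * (3 * s0)) / c" using up \<eta> c by (intro divide_right_mono mult_left_mono) auto
  also have "\<dots> = 48 * real s * \<eta> / c * s0" by simp
  finally show ?thesis by (simp only: s0_def R_def)
qed

section \<open>Population moments\<close>

text \<open>\<open>gauss\<close> provides only a characteristic function. By uniqueness the law is
  that of sqrt c times a standard normal variable, also for c = 0, and the moments are read off
  there.\<close>

lemma gauss_single_moments:
  assumes g: "gauss M {()} (\<lambda>_. Y) (\<lambda>_ _. c)"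
  shows "integrable M Y" "(\<integral>\<omega>. Y \<omega> \<partial>M) = 0" "integrable M (\<lambda>\<omega>. (Y \<omega>)\<^sup>2)" "(\<integral>\<omega>. (Y \<omega>)\<^sup>2 \<partial>M) = c"
proof -
  interpret M: prob_space M using gaussD[OF g] by simp
  have Y[measurable]: "Y \<in> borel_measurable M" using gaussD[OF g] by simp
  have c: "0 \<le> c" using gauss_var_nonneg[OF g, of "()"] by simp
  let ?N = std_normal_distribution
  have "distr M borel Y = distr ?N borel (\<lambda>x. sqrt c * x)"
  proof (rule Levy_uniqueness)
    show "real_distribution (distr M borel Y)"
      unfolding real_distribution_def real_distribution_axioms_def by (auto intro!: M.prob_space_distr)
    show "real_distribution (distr ?N borel (\<lambda>x. sqrt c * x))"
      unfolding real_distribution_def real_distribution_axioms_def by (auto intro!: std_normal.prob_space_distr)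
    show "char (distr M borel Y) = char (distr ?N borel (\<lambda>x. sqrt c * x))"
    proof
      fix t
      have "char (distr M borel Y) t = (CLINT \<omega>|M. iexp (t * Y \<omega>))"
        unfolding char_def by (rule integral_distr) auto
      also have "\<dots> = complex_of_real (exp (- (t * t * c) / 2))"
        using gaussD(4)[OF g, of "\<lambda>_. t"] by simp
      also have "\<dots> = (CLINT x|?N. iexp ((t * sqrt c) * x))"
        using fun_cong[OF char_std_normal_distribution, of "t * sqrt c"] c
        unfolding char_def by (simp add: power_mult_distrib power2_eq_square[of t])
      also have "\<dots> = char (distr ?N borel (\<lambda>x. sqrt c * x)) t"
        unfolding char_def by (subst integral_distr) (auto simp: mult.assoc)
      finally show "char (distr M borel Y) t = char (distr ?N borel (\<lambda>x. sqrt c * x)) t" .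
    qed
  qed
  note d = this
  have m1: "integrable ?N (\<lambda>x. x)" "(\<integral>x. x \<partial>?N) = 0"
    using integrable_std_normal_distribution_moment[of 1] integral_std_normal_distribution_moment_odd[of 1] by auto
  have m2: "integrable ?N (\<lambda>x. x\<^sup>2)" "(\<integral>x. x\<^sup>2 \<partial>?N) = 1"
    using std_normal_distribution_even_moments[of 1] by (auto simp: fact_2)
  have i: "integrable M (\<lambda>\<omega>. f (Y \<omega>)) \<longleftrightarrow> integrable ?N (\<lambda>x. f (sqrt c * x))" if "f \<in> borel_measurable borel" for f :: "real \<Rightarrow> real"
    using integrable_distr_eq[OF Y that] integrable_distr_eq[of "\<lambda>x. sqrt c * x" ?N borel f] that d by simp
  have e: "(\<integral>\<omega>. f (Y \<omega>) \<partial>M) = (\<integral>x. f (sqrt c * x) \<partial>?N)" if "f \<in> borel_measurable borel" for f :: "real \<Rightarrow> real"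
    using integral_distr[OF Y that] integral_distr[of "\<lambda>x. sqrt c * x" ?N borel f] that d by simp
  show "integrable M Y" by (rule iffD2[OF i[of "\<lambda>x. x"]], measurable, rule integrable_mult_right, rule m1(1))
  have "(\<integral>\<omega>. Y \<omega> \<partial>M) = (\<integral>x. sqrt c * x \<partial>?N)" by (rule e[of "\<lambda>x. x"]) measurable
  also have "\<dots> = sqrt c * (\<integral>x. x \<partial>?N)" by (rule integral_mult_right_zero)
  finally show "(\<integral>\<omega>. Y \<omega> \<partial>M) = 0" by (simp only: m1(2) mult_zero_right)
  show "integrable M (\<lambda>\<omega>. (Y \<omega>)\<^sup>2)"
    by (rule iffD2[OF i[of "\<lambda>x. x\<^sup>2"]], measurable, unfold power_mult_distrib, rule integrable_mult_right, rule m2(1))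
  have "(\<integral>\<omega>. (Y \<omega>)\<^sup>2 \<partial>M) = (\<integral>x. (sqrt c * x)\<^sup>2 \<partial>?N)" by (rule e[of "\<lambda>x. x\<^sup>2"]) measurable
  also have "\<dots> = (sqrt c)\<^sup>2 * (\<integral>x. x\<^sup>2 \<partial>?N)" unfolding power_mult_distrib by (rule integral_mult_right_zero)
  finally show "(\<integral>\<omega>. (Y \<omega>)\<^sup>2 \<partial>M) = c" using c by (simp only: m2(2) mult_1_right real_sqrt_pow2)
qed

text \<open>Polarisation reduces the product to two squares of normal variables. Symmetry is assumed
  because the characteristic function sees only the symmetric part of \<open>C\<close>.\<close>

lemma gauss_product_moment:
  assumes g: "gauss M I X C" and i: "i \<in> I" and j: "j \<in> I" and sym: "C i j = C j i"
  shows "integrable M (\<lambda>\<omega>. X i \<omega> * X j \<omega>)" "(\<integral>\<omega>. X i \<omega> * X j \<omega> \<partial>M) = C i j"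
proof -
  have fin: "finite I" using gaussD[OF g] by simp
  have "gauss M {()} (\<lambda>_ \<omega>. X i \<omega> + s * X j \<omega>) (\<lambda>_ _. C i i + 2 * s * C i j + s\<^sup>2 * C j j)" for s
  proof -
    have "gauss M UNIV (\<lambda>b. X (if b then i else j)) (\<lambda>b b'. C (if b then i else j) (if b' then i else j))"
      using i j by (intro gauss_reindex[OF g]) auto
    from gauss_linear[OF this, of "{()}" "\<lambda>_ b. if b then 1 else s"]
    show ?thesis by (rule gauss_cong) (auto simp: UNIV_bool sym power2_eq_square algebra_simps)
  qed
  note m = gauss_single_moments[OF this]
  have eq: "X i \<omega> * X j \<omega> = ((X i \<omega> + 1 * X j \<omega>)\<^sup>2 - (X i \<omega> + (-1) * X j \<omega>)\<^sup>2) / 4" for \<omega>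
    by (simp add: power2_eq_square algebra_simps)
  show "integrable M (\<lambda>\<omega>. X i \<omega> * X j \<omega>)"
    unfolding eq by (intro integrable_divide_zero Bochner_Integration.integrable_diff m)
  show "(\<integral>\<omega>. X i \<omega> * X j \<omega> \<partial>M) = C i j"
    unfolding eq integral_divide_zero
    by (subst Bochner_Integration.integral_diff[OF m(3) m(3)]) (simp only: m(4), simp)
qed

lemma gauss_distrD:
  assumes g: "gauss (distr M N f) I X C" and M: "prob_space M" and f: "f \<in> measurable M N"
  shows "gauss M I (\<lambda>i \<omega>. X i (f \<omega>)) C"
  unfolding gauss_def
proof (intro conjI allI ballI)
  have X: "X i \<in> borel_measurable N" if "i \<in> I" for i using gaussD(3)[OF g that] by simp
  show "(\<lambda>\<omega>. X i (f \<omega>)) \<in> borel_measurable M" if "i \<in> I" for i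
    by (rule measurable_compose[OF f X[OF that]])
  fix t
  have "(\<lambda>y. (\<Sum>i\<in>I. t i * X i y)) \<in> borel_measurable N" using X by auto
  then have "(CLINT \<omega>|distr M N f. iexp (\<Sum>i\<in>I. t i * X i \<omega>)) = (CLINT \<omega>|M. iexp (\<Sum>i\<in>I. t i * X i (f \<omega>)))"
    by (intro integral_distr f) (rule measurable_compose[of _ N borel iexp], assumption, measurable)
  then show "(CLINT \<omega>|M. iexp (\<Sum>i\<in>I. t i * X i (f \<omega>))) = exp (- (\<Sum>i\<in>I. \<Sum>j\<in>I. t i * t j * C i j) / 2)"
    using gaussD(4)[OF g] by simp
qed (use M gaussD[OF g] in auto)

text \<open>One sample size is fixed here. All bounds before the final theorem are non-asymptotic,
  with explicit constants.\<close>

locale gaussian_two_sample = two_sample_linear_model M n p \<beta> D x y u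
  for M :: "'a measure" and n p :: nat and \<beta> :: "sample \<Rightarrow> real vec"
    and D :: "sample \<Rightarrow> (real vec \<times> real) measure"
    and x :: "sample \<Rightarrow> nat \<Rightarrow> 'a \<Rightarrow> real vec" and y u :: "sample \<Rightarrow> nat \<Rightarrow> 'a \<Rightarrow> real" +
  fixes \<Sigma> :: "sample \<Rightarrow> real mat" and \<kappa>1 \<kappa>2 :: real
  assumes Sigma_carrier: "\<Sigma> k \<in> carrier_mat p p" and Sigma_sym: "transpose_mat (\<Sigma> k) = \<Sigma> k"
    and design_law: "distr (D k) (borel_vec p) fst = gaussian (\<Sigma> k)"
    and eigen: "eigenvalue (\<Sigma> k) e \<Longrightarrow> \<kappa>1 < e \<and> e < \<kappa>2"
    and kappa: "0 < \<kappa>1" "0 < \<kappa>2"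
    and null: "\<beta> SA = \<beta> SB"
begin

definition S :: "sample \<Rightarrow> nat \<Rightarrow> nat \<Rightarrow> real" where "S k i j = \<Sigma> k $$ (i, j)"

lemma S_sym: "i < p \<Longrightarrow> j < p \<Longrightarrow> S k i j = S k j i"
  using Sigma_carrier[of k] Sigma_sym[of k] unfolding S_def by (metis carrier_matD index_transpose_mat(1))

lemma S_lower: "\<kappa>1 * (\<Sum>i<p. (w i)\<^sup>2) \<le> (\<Sum>i<p. \<Sum>j<p. w i * w j * S k i j)"
  unfolding S_def by (rule eigenvalue_quadratic_form_bounds(1)[OF Sigma_carrier Sigma_sym eigen])

lemma S_upper: "(\<Sum>i<p. \<Sum>j<p. w i * w j * S k i j) \<le> \<kappa>2 * (\<Sum>i<p. (w i)\<^sup>2)"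
  unfolding S_def by (rule eigenvalue_quadratic_form_bounds(2)[OF Sigma_carrier Sigma_sym eigen])

lemma S_psd: "0 \<le> (\<Sum>i<p. \<Sum>j<p. w i * w j * S k i j)"
  using S_lower[of w k] kappa by (meson mult_nonneg_nonneg less_imp_le order_trans sum_nonneg zero_le_power2)

lemma gauss_law: "gauss (D k) {..<p} (\<lambda>i c. fst c $ i) (S k)"
proof -
  have "gauss (gaussian (\<Sigma> k)) {..<p} (\<lambda>i v. v $ i) (\<lambda>i j. \<Sigma> k $$ (i, j))"
    using S_psd[of _ k] S_sym[of _ _ k] unfolding S_def by (intro gauss_gaussian[OF Sigma_carrier]) auto
  then have g: "gauss (distr (D k) (borel_vec p) fst) {..<p} (\<lambda>i v. v $ i) (S k)"
    by (simp add: design_law S_def[abs_def])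
  show ?thesis
  proof (rule gauss_distrD[OF g law(1)])
    have "fst \<in> measurable (borel_vec p \<Otimes>\<^sub>M borel) (borel_vec p)" by simp
    then show "fst \<in> measurable (D k) (borel_vec p)" by (simp add: measurable_cong_sets[OF law(2) refl])
  qed
qed

lemma pair_rv: "i < n \<Longrightarrow> (\<lambda>\<omega>. (x k i \<omega>, y k i \<omega>)) \<in> measurable M (borel_vec p \<Otimes>\<^sub>M borel)"
  using indep unfolding indep_vars_def by force

lemma x_rv: "i < n \<Longrightarrow> x k i \<in> measurable M (borel_vec p)"
  using measurable_compose[OF pair_rv measurable_fst] by simp

lemma x_index_rv: "i < n \<Longrightarrow> j < p \<Longrightarrow> (\<lambda>\<omega>. x k i \<omega> $ j) \<in> borel_measurable M"
  by (rule measurable_compose[OF x_rv measurable_vec_index])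

lemma x_carrier: "i < n \<Longrightarrow> \<omega> \<in> space M \<Longrightarrow> x k i \<omega> \<in> carrier_vec p"
  using measurable_space[OF x_rv] by (simp add: space_borel_vec)

lemma gauss_x: "i < n \<Longrightarrow> gauss M {..<p} (\<lambda>j \<omega>. x k i \<omega> $ j) (S k)"
proof -
  assume i: "i < n"
  have "gauss (distr M (borel_vec p \<Otimes>\<^sub>M borel) (\<lambda>\<omega>. (x k i \<omega>, y k i \<omega>))) {..<p} (\<lambda>i c. fst c $ i) (S k)"
    using gauss_law copies[OF i] by simp
  from gauss_distrD[OF this prob_space_axioms pair_rv[OF i]] show ?thesis by simp
qed

section \<open>Population moments of w and z and the normal equations\<close>

definition SW :: "nat \<Rightarrow> nat \<Rightarrow> real" where "SW i j = S SA i j + S SB i j"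

definition Pst :: "nat \<Rightarrow> nat \<Rightarrow> real" where "Pst i j = Pi_star p D $$ (i, j)"

lemma SW_sym: "i < p \<Longrightarrow> j < p \<Longrightarrow> SW i j = SW j i"
  unfolding SW_def by (metis S_sym)

lemma SW_lower: "2 * \<kappa>1 * (\<Sum>i<p. (w i)\<^sup>2) \<le> (\<Sum>i<p. \<Sum>j<p. w i * w j * SW i j)"
  using S_lower[of w SA] S_lower[of w SB] by (simp add: SW_def distrib_left sum.distrib)

text \<open>Both w and z are linear images of an independent pair of normal vectors, so the
  integrals in \<open>Pi_star\<close> are entries of the joint covariance \<open>C\<close> of (w,
  z).\<close>

lemma sample_moments:
  assumes "i < p" "j < p"
  defines "P \<equiv> D SA \<Otimes>\<^sub>M D SB" and "w \<equiv> (\<lambda>(a, b). fst a + fst b) :: (real vec \<times> real) \<times> (real vec \<times> real) \<Rightarrow> real vec"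
    and "z \<equiv> (\<lambda>(a, b). fst a - fst b) :: (real vec \<times> real) \<times> (real vec \<times> real) \<Rightarrow> real vec"
  shows "(\<integral>c. w c $ i * w c $ j \<partial>P) = SW i j" "(\<integral>c. w c $ i * z c $ j \<partial>P) = S SA i j - S SB i j"
proof -
  let ?I = "{..<p} <+> {..<p}"
  have g: "gauss P ?I (\<lambda>k z. case_sum (\<lambda>i. fst (fst z) $ i) (\<lambda>j. fst (snd z) $ j) k)
    (\<lambda>k l. case k of Inl i \<Rightarrow> (case l of Inl i' \<Rightarrow> S SA i i' | Inr _ \<Rightarrow> 0)
       | Inr j \<Rightarrow> (case l of Inl _ \<Rightarrow> 0 | Inr j' \<Rightarrow> S SB j j'))"
    unfolding P_def by (rule gauss_pair[OF gauss_law gauss_law])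
  define A :: "nat + nat \<Rightarrow> nat + nat \<Rightarrow> real" where "A l m = (case l of Inl i \<Rightarrow> (case m of Inl a \<Rightarrow> of_bool (a = i) | Inr a \<Rightarrow> of_bool (a = i))
    | Inr i \<Rightarrow> (case m of Inl a \<Rightarrow> of_bool (a = i) | Inr a \<Rightarrow> - of_bool (a = i)))" for l m
  define C where "C l m = (case l of Inl i \<Rightarrow> (case m of Inl j \<Rightarrow> SW i j | Inr j \<Rightarrow> S SA i j - S SB i j)
    | Inr i \<Rightarrow> (case m of Inl j \<Rightarrow> S SA i j - S SB i j | Inr j \<Rightarrow> SW i j))" for l m :: "nat + nat"
  have d: "(\<Sum>a<p. of_bool (a = i) * f a) = f i" if "i < p" for i and f :: "nat \<Rightarrow> real"
  proof -
    have "(\<Sum>a<p. of_bool (a = i) * f a) = (\<Sum>a<p. if i = a then f a else 0)" by (intro sum.cong) auto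
    then show ?thesis using that by simp
  qed
  have d2: "(\<Sum>a<p. \<Sum>b<p. of_bool (a = i) * of_bool (b = j) * f a b) = f i j" if "i < p" "j < p" for i j and f :: "nat \<Rightarrow> nat \<Rightarrow> real"
    by (simp only: mult.assoc sum_distrib_left[symmetric] d[OF that(1)] d[OF that(2)])
  have sp: "fst (fst c) \<in> carrier_vec p \<and> fst (snd c) \<in> carrier_vec p" if "c \<in> space P" for c
  proof -
    have "space (D k) = carrier_vec p \<times> UNIV" for k
      using sets_eq_imp_space_eq[OF law(2)[of k]] by (simp add: space_pair_measure space_borel_vec)
    then show ?thesis using that by (auto simp: P_def space_pair_measure)
  qed
  have G: "gauss P ?I (\<lambda>l c. case l of Inl i \<Rightarrow> w c $ i | Inr i \<Rightarrow> z c $ i) C"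
  proof (rule gauss_cong[OF gauss_linear[OF g, of ?I A]])
    show "(case l of Inl i \<Rightarrow> w c $ i | Inr i \<Rightarrow> z c $ i) = (\<Sum>k\<in>?I. A l k * case_sum (\<lambda>i. fst (fst c) $ i) (\<lambda>j. fst (snd c) $ j) k)"
      if "l \<in> ?I" "c \<in> space P" for l c
      using that sp[OF that(2)] by (auto simp: sum.Plus A_def d sum_negf w_def z_def split: prod.splits)
    show "C l m = (\<Sum>k\<in>?I. \<Sum>k'\<in>?I. A l k * A m k' * (case k of Inl i \<Rightarrow> (case k' of Inl i' \<Rightarrow> S SA i i' | Inr _ \<Rightarrow> 0)
       | Inr j \<Rightarrow> (case k' of Inl _ \<Rightarrow> 0 | Inr j' \<Rightarrow> S SB j j')))" if "l \<in> ?I" "m \<in> ?I" for l m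
      using that by (auto simp: sum.Plus A_def C_def d2 sum_negf SW_def)
  qed simp
  have sy: "C l m = C m l" if "l \<in> ?I" "m \<in> ?I" for l m
    using that unfolding C_def by (auto simp: SW_sym S_sym)
  show "(\<integral>c. w c $ i * w c $ j \<partial>P) = SW i j"
    using gauss_product_moment(2)[OF G, of "Inl i" "Inl j"] sy[of "Inl i" "Inl j"] assms(1,2) by (simp add: C_def InlI)
  show "(\<integral>c. w c $ i * z c $ j \<partial>P) = S SA i j - S SB i j"
    using gauss_product_moment(2)[OF G, of "Inl i" "Inr j"] sy[of "Inl i" "Inr j"] assms(1,2) by (simp add: C_def InlI InrI)
qed

text \<open>Apart from its sparsity, this linear system is what later arguments use of
  \<open>Pi_star\<close>. Positive definiteness of the summed covariances makes the determinant
  nonzero, so \<open>mat_inverse\<close> returns an inverse.\<close>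

lemma normal_equations:
  shows "Pi_star p D \<in> carrier_mat p p"
    and "i < p \<Longrightarrow> j < p \<Longrightarrow> (\<Sum>l<p. SW i l * Pst l j) = S SA i j - S SB i j"
proof -
  define A where "A = mat p p (\<lambda>(i, j). SW i j)"
  define B where "B = mat p p (\<lambda>(i, j). S SA i j - S SB i j)"
  have A: "A \<in> carrier_mat p p" and B: "B \<in> carrier_mat p p" by (auto simp: A_def B_def)
  have PA: "Pi_star p D = the (mat_inverse A) * B"
  proof -
    have "mat p p (\<lambda>(i, j). \<integral>c. (\<lambda>(a, b). fst a + fst b) c $ i * (\<lambda>(a, b). fst a + fst b) c $ j \<partial>(D SA \<Otimes>\<^sub>M D SB)) = A"
      unfolding A_def by (rule cong_mat) (auto simp: sample_moments)
    moreover have "mat p p (\<lambda>(i, j). \<integral>c. (\<lambda>(a, b). fst a + fst b) c $ i * (\<lambda>(a, b). fst a - fst b) c $ j \<partial>(D SA \<Otimes>\<^sub>M D SB)) = B"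
      unfolding B_def by (rule cong_mat) (auto simp: sample_moments)
    ultimately show ?thesis unfolding Pi_star_def Let_def by simp
  qed
  have "det A \<noteq> 0"
  proof
    assume "det A = 0"
    then obtain v where v: "v \<in> carrier_vec p" "v \<noteq> 0\<^sub>v p" "A *\<^sub>v v = 0\<^sub>v p"
      using det_0_iff_vec_prod_zero[OF A] by blast
    have "(\<Sum>j<p. SW i j * v $ j) = 0" if "i < p" for i
    proof -
      have "(A *\<^sub>v v) $ i = (\<Sum>j<p. SW i j * v $ j)"
        using that v(1) by (subst mult_mat_vec_index_sum[OF A v(1) that]) (simp add: A_def)
      then show ?thesis using v(3) that by simp
    qed
    then have "(\<Sum>i<p. \<Sum>j<p. v $ i * v $ j * SW i j) = 0"
      by (simp add: sum_distrib_left[symmetric] mult.assoc mult.commute[of "v $ _" "SW _ _"])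
    then have "2 * \<kappa>1 * (\<Sum>i<p. (v $ i)\<^sup>2) \<le> 0" using SW_lower[of "\<lambda>i. v $ i"] by simp
    then have "(\<Sum>i<p. (v $ i)\<^sup>2) \<le> 0" using kappa by (simp add: mult_le_0_iff)
    then have "(\<Sum>i<p. (v $ i)\<^sup>2) = 0" by (simp add: antisym sum_nonneg)
    then have "v $ i = 0" if "i < p" for i using that by (auto simp: sum_nonneg_eq_0_iff)
    then show False using v(1,2) by (auto simp: vec_eq_iff)
  qed
  then obtain A' where A': "mat_inverse A = Some A'"
    using mat_inverse(1)[OF A, of "()"] det_non_zero_imp_unit[OF A, of "()"] by (cases "mat_inverse A") auto
  have inv: "A * A' = 1\<^sub>m p" "A' \<in> carrier_mat p p" using mat_inverse(2)[OF A A'] by auto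
  have Pi: "Pi_star p D = A' * B" using PA A' by simp
  show c: "Pi_star p D \<in> carrier_mat p p" using inv B unfolding Pi by simp
  have "A * Pi_star p D = B"
  proof -
    have "A * (A' * B) = (A * A') * B" by (rule assoc_mult_mat[symmetric]) (use A inv B in auto)
    then show ?thesis using inv B unfolding Pi by simp
  qed
  then show "(\<Sum>l<p. SW i l * Pst l j) = S SA i j - S SB i j" if "i < p" "j < p"
  proof -
    have "(A * Pi_star p D) $$ (i, j) = (\<Sum>l<p. SW i l * Pst l j)"
      using that A c by (simp add: scalar_prod_def lessThan_atLeast0 A_def Pst_def)
    then show ?thesis using \<open>A * Pi_star p D = B\<close> that by (simp add: B_def)
  qed
qed

end

section \<open>Joint law of the projection residual, the design and the noise\<close>

lemma UNIV_sample: "(UNIV :: sample set) = {SA, SB}"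
  using sample.exhaust by blast

lemma finite_sample[simp]: "finite (A :: sample set)"
proof (rule finite_subset)
  show "A \<subseteq> UNIV" by simp
  show "finite (UNIV :: sample set)" unfolding UNIV_sample by simp
qed

lemma gauss_distrI:
  assumes g: "gauss M I (\<lambda>i \<omega>. X i (f \<omega>)) C" and f: "f \<in> measurable M N" and X: "\<And>i. i \<in> I \<Longrightarrow> X i \<in> borel_measurable N"
  shows "gauss (distr M N f) I X C"
  unfolding gauss_def
proof (intro conjI allI ballI)
  interpret prob_space M using gaussD[OF g] by simp
  show "prob_space (distr M N f)" by (rule prob_space_distr[OF f])
  fix t
  have "(\<lambda>y. (\<Sum>i\<in>I. t i * X i y)) \<in> borel_measurable N" using X by auto
  then have "(CLINT \<omega>|distr M N f. iexp (\<Sum>i\<in>I. t i * X i \<omega>)) = (CLINT \<omega>|M. iexp (\<Sum>i\<in>I. t i * X i (f \<omega>)))"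
    by (intro integral_distr f) (rule measurable_compose[of _ N borel iexp], assumption, measurable)
  then show "(CLINT \<omega>|distr M N f. iexp (\<Sum>i\<in>I. t i * X i \<omega>)) = exp (- (\<Sum>i\<in>I. \<Sum>j\<in>I. t i * t j * C i j) / 2)"
    using gaussD(4)[OF g] by simp
qed (use X gaussD[OF g] in auto)

text \<open>The covariance of the entries of a random matrix whose rows are independent with
  covariance \<open>C\<close>. An index is a pair of row and column.\<close>

definition row_cov :: "(nat \<Rightarrow> nat \<Rightarrow> real) \<Rightarrow> nat \<times> nat \<Rightarrow> nat \<times> nat \<Rightarrow> real" where
  "row_cov C a b = of_bool (fst a = fst b) * C (snd a) (snd b)"

lemma row_cov_sum:
  "(\<Sum>a\<in>{..<n} \<times> {..<p}. \<Sum>b\<in>{..<n} \<times> {..<p}. t a * t b * row_cov C a b)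
   = (\<Sum>i<n. \<Sum>j<p. \<Sum>k<p. t (i, j) * t (i, k) * C j k)"
proof -
  have "(\<Sum>b\<in>{..<n} \<times> {..<p}. t (i, j) * t b * row_cov C (i, j) b) = (\<Sum>k<p. t (i, j) * t (i, k) * C j k)" if "i < n" for i j
  proof -
    have "(\<Sum>b\<in>{..<n} \<times> {..<p}. t (i, j) * t b * row_cov C (i, j) b) = (\<Sum>i'<n. \<Sum>k<p. t (i, j) * t (i', k) * row_cov C (i, j) (i', k))"
      by (simp add: sum.cartesian_product)
    also have "\<dots> = (\<Sum>i'<n. if i = i' then (\<Sum>k<p. t (i, j) * t (i', k) * C j k) else 0)"
      by (intro sum.cong) (auto simp: row_cov_def)
    finally show ?thesis using that by simp
  qed
  then show ?thesis by (subst sum.cartesian_product') (intro sum.cong refl; simp)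
qed

context gaussian_two_sample
begin

text \<open>The design and the error have different types, so their independence is given through
  sigma-algebras. Their exponentials are both complex, and \<open>indep_var\<close> applies to
  them.\<close>

lemma x_u_char:
  assumes i: "i < n"
  shows "(CLINT \<omega>|M. iexp ((\<Sum>j<p. a j * x k i \<omega> $ j) + r * u k i \<omega>))
    = exp (- (\<Sum>j<p. \<Sum>l<p. a j * a l * S k j l) / 2) * (CLINT \<omega>|M. iexp (r * u k i \<omega>))"
proof -
  let ?F = "\<lambda>\<omega>. iexp (\<Sum>j<p. a j * x k i \<omega> $ j)" and ?G = "\<lambda>\<omega>. iexp (r * u k i \<omega>)"
  have [measurable]: "(\<lambda>v. \<Sum>j<p. a j * v $ j) \<in> borel_measurable (borel_vec p)"
    by (intro borel_measurable_sum borel_measurable_times measurable_vec_index) auto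
  have f: "(\<lambda>v. iexp (\<Sum>j<p. a j * v $ j)) \<in> borel_measurable (borel_vec p)"
    by (rule measurable_compose[of "\<lambda>v. \<Sum>j<p. a j * v $ j" _ borel iexp]) (fact, measurable)
  have [measurable]: "u k i \<in> borel_measurable M" by (rule error_rv[OF i])
  have F: "?F \<in> borel_measurable M" by (rule measurable_compose[OF x_rv[OF i] f])
  have G: "?G \<in> borel_measurable M" by measurable
  have sF: "sigma_sets (space M) {?F -` A \<inter> space M | A. A \<in> sets borel} \<subseteq> {x k i -` B \<inter> space M | B. B \<in> sets (borel_vec p)}"
  proof -
    have e: "{x k i -` B \<inter> space M | B. B \<in> sets (borel_vec p)} = sets (vimage_algebra (space M) (x k i) (borel_vec p))"
      by (rule sets_vimage_algebra2[symmetric]) (use measurable_space[OF x_rv[OF i]] in auto)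
    have "{?F -` A \<inter> space M | A. A \<in> sets borel} \<subseteq> {x k i -` B \<inter> space M | B. B \<in> sets (borel_vec p)}"
    proof safe
      fix A :: "complex set" assume A: "A \<in> sets borel"
      let ?B = "(\<lambda>v. iexp (\<Sum>j<p. a j * v $ j)) -` A \<inter> space (borel_vec p)"
      have "?F -` A \<inter> space M = x k i -` ?B \<inter> space M" using measurable_space[OF x_rv[OF i]] by auto
      moreover have "?B \<in> sets (borel_vec p)" by (rule measurable_sets[OF f A])
      ultimately show "\<exists>B. ?F -` A \<inter> space M = x k i -` B \<inter> space M \<and> B \<in> sets (borel_vec p)" by blast
    qed
    then show ?thesis unfolding e
      using sets.sigma_sets_subset[of _ "vimage_algebra (space M) (x k i) (borel_vec p)"] by simp
  qed
  have sG: "sigma_sets (space M) {?G -` A \<inter> space M | A. A \<in> sets borel} \<subseteq> {u k i -` B \<inter> space M | B. B \<in> sets borel}"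
  proof -
    have e: "{u k i -` B \<inter> space M | B. B \<in> sets borel} = sets (vimage_algebra (space M) (u k i) borel)"
      by (rule sets_vimage_algebra2[symmetric]) auto
    have g: "(\<lambda>v. iexp (r * v)) \<in> borel_measurable borel" by measurable
    have "{?G -` A \<inter> space M | A. A \<in> sets borel} \<subseteq> {u k i -` B \<inter> space M | B. B \<in> sets borel}"
    proof safe
      fix A :: "complex set" assume A: "A \<in> sets borel"
      let ?B = "(\<lambda>v. iexp (r * v)) -` A \<inter> space borel"
      have "?G -` A \<inter> space M = u k i -` ?B \<inter> space M" by auto
      moreover have "?B \<in> sets borel" by (rule measurable_sets[OF g A])
      ultimately show "\<exists>B. ?G -` A \<inter> space M = u k i -` B \<inter> space M \<and> B \<in> sets borel" by blast
    qed
    then show ?thesis unfolding e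
      using sets.sigma_sets_subset[of _ "vimage_algebra (space M) (u k i) borel"] by simp
  qed
  have "indep_var borel ?F borel ?G"
    unfolding indep_var_eq
  proof (intro conjI F G)
    show "indep_set (sigma_sets (space M) {?F -` A \<inter> space M | A. A \<in> sets borel}) (sigma_sets (space M) {?G -` A \<inter> space M | A. A \<in> sets borel})"
      using error_indep[OF i, of k] unfolding indep_set_def
      by (rule indep_sets_mono_sets) (use sF sG in \<open>auto split: bool.split\<close>)
  qed
  then have "(CLINT \<omega>|M. ?F \<omega> * ?G \<omega>) = (CLINT \<omega>|M. ?F \<omega>) * (CLINT \<omega>|M. ?G \<omega>)"
    by (rule indep_var_lebesgue_integral)
      (intro integrable_iexp_real prob_space_axioms borel_measurable_sum borel_measurable_times x_index_rv i error_rv; simp)+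
  moreover have "(CLINT \<omega>|M. iexp ((\<Sum>j<p. a j * x k i \<omega> $ j) + r * u k i \<omega>)) = (CLINT \<omega>|M. ?F \<omega> * ?G \<omega>)"
    by (simp add: exp_add[symmetric] distrib_left)
  ultimately show ?thesis using gaussD(4)[OF gauss_x[OF i, of k], of a] by simp
qed

text \<open>Independence over samples and rows is assumed for the pairs (x, y), not for (x, u). So
  each exponent is rewritten in x and y through u = y - x . \<beta>, which replaces the coefficients
  a by a - r * \<beta>; the integral then factors, and each factor is turned back into x and
  u.\<close>

lemma joint_char:
  fixes a :: "sample \<times> nat \<Rightarrow> nat \<Rightarrow> real" and r :: "sample \<times> nat \<Rightarrow> real"
  shows "(CLINT \<omega>|M. iexp (\<Sum>q\<in>UNIV \<times> {..<n}. (\<Sum>j<p. a q j * x (fst q) (snd q) \<omega> $ j) + r q * u (fst q) (snd q) \<omega>))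
    = exp (- (\<Sum>q\<in>UNIV \<times> {..<n}. \<Sum>j<p. \<Sum>l<p. a q j * a q l * S (fst q) j l) / 2)
      * (\<Prod>q\<in>UNIV \<times> {..<n}. CLINT \<omega>|M. iexp (r q * u (fst q) (snd q) \<omega>))"
proof -
  let ?Q = "UNIV \<times> {..<n} :: (sample \<times> nat) set"
  let ?Z = "\<lambda>(k, i) \<omega>. (x k i \<omega>, y k i \<omega>)"
  define F where "F q z = iexp ((\<Sum>j<p. (a q j - r q * \<beta> (fst q) $ j) * fst z $ j) + r q * snd z)" for q and z :: "real vec \<times> real"
  have F: "F q \<in> borel_measurable (borel_vec p \<Otimes>\<^sub>M borel)" for q
  proof -
    have [measurable]: "(\<lambda>z. fst z $ j) \<in> borel_measurable (borel_vec p \<Otimes>\<^sub>M (borel :: real measure))" if "j < p" for j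
      by (rule measurable_compose[OF measurable_fst measurable_vec_index[OF that]])
    have "(\<lambda>z. (\<Sum>j<p. (a q j - r q * \<beta> (fst q) $ j) * fst z $ j) + r q * snd z) \<in> borel_measurable (borel_vec p \<Otimes>\<^sub>M (borel :: real measure))"
      by measurable
    from measurable_compose[OF this, of iexp borel] show ?thesis unfolding F_def by simp
  qed
  have FZ: "F q (?Z q \<omega>) = iexp ((\<Sum>j<p. a q j * x (fst q) (snd q) \<omega> $ j) + r q * u (fst q) (snd q) \<omega>)" if "q \<in> ?Q" "\<omega> \<in> space M" for q \<omega>
  proof -
    from that(1) obtain k i where q: "q = (k, i)" "i < n" by (cases q) auto
    have "x k i \<omega> \<bullet> \<beta> k = (\<Sum>j<p. \<beta> k $ j * x k i \<omega> $ j)"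
      using coeff_dim[of k] x_carrier[OF q(2) that(2)] by (auto simp: scalar_prod_def lessThan_atLeast0 mult.commute)
    then have "(\<Sum>j<p. (a q j - r q * \<beta> k $ j) * x k i \<omega> $ j) + r q * y k i \<omega> = (\<Sum>j<p. a q j * x k i \<omega> $ j) + r q * u k i \<omega>"
      using linear[OF q(2) that(2), of k] by (simp add: left_diff_distrib sum_subtractf sum_distrib_left algebra_simps)
    then show ?thesis by (simp only: F_def q fst_conv snd_conv case_prod_conv)
  qed
  have mi: "(\<lambda>\<omega>. (\<Sum>j<p. a q j * x (fst q) (snd q) \<omega> $ j) + r q * u (fst q) (snd q) \<omega>) \<in> borel_measurable M" if "q \<in> ?Q" for q
    using that by (intro borel_measurable_add borel_measurable_sum borel_measurable_times x_index_rv error_rv) auto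
  have ind: "indep_vars (\<lambda>_. borel) (\<lambda>q \<omega>. F q (?Z q \<omega>)) ?Q"
    by (rule indep_vars_compose2[OF indep]) (rule F)
  have "(CLINT \<omega>|M. iexp (\<Sum>q\<in>?Q. (\<Sum>j<p. a q j * x (fst q) (snd q) \<omega> $ j) + r q * u (fst q) (snd q) \<omega>))
    = (CLINT \<omega>|M. (\<Prod>q\<in>?Q. F q (?Z q \<omega>)))"
  proof (rule Bochner_Integration.integral_cong[OF refl])
    fix \<omega> assume "\<omega> \<in> space M"
    then have "(\<Prod>q\<in>?Q. F q (?Z q \<omega>)) = (\<Prod>q\<in>?Q. iexp ((\<Sum>j<p. a q j * x (fst q) (snd q) \<omega> $ j) + r q * u (fst q) (snd q) \<omega>))"
      by (intro prod.cong FZ) auto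
    also have "\<dots> = iexp (\<Sum>q\<in>?Q. (\<Sum>j<p. a q j * x (fst q) (snd q) \<omega> $ j) + r q * u (fst q) (snd q) \<omega>)"
      by (subst exp_sum[symmetric]) (auto simp: sum_distrib_left)
    finally show "iexp (\<Sum>q\<in>?Q. (\<Sum>j<p. a q j * x (fst q) (snd q) \<omega> $ j) + r q * u (fst q) (snd q) \<omega>) = (\<Prod>q\<in>?Q. F q (?Z q \<omega>))" by simp
  qed
  also have "\<dots> = (\<Prod>q\<in>?Q. CLINT \<omega>|M. F q (?Z q \<omega>))"
  proof (rule indep_vars_lebesgue_integral[OF _ ind])
    fix q assume q: "q \<in> ?Q"
    have "integrable M (\<lambda>\<omega>. iexp ((\<Sum>j<p. a q j * x (fst q) (snd q) \<omega> $ j) + r q * u (fst q) (snd q) \<omega>))"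
      by (rule integrable_iexp_real[OF prob_space_axioms mi[OF q]])
    then show "integrable M (\<lambda>\<omega>. F q (?Z q \<omega>))"
      by (subst Bochner_Integration.integrable_cong[OF refl FZ[OF q]]) auto
  qed simp
  also have "\<dots> = (\<Prod>q\<in>?Q. CLINT \<omega>|M. iexp ((\<Sum>j<p. a q j * x (fst q) (snd q) \<omega> $ j) + r q * u (fst q) (snd q) \<omega>))"
    by (intro prod.cong refl Bochner_Integration.integral_cong FZ)
  also have "\<dots> = (\<Prod>q\<in>?Q. complex_of_real (exp (- (\<Sum>j<p. \<Sum>l<p. a q j * a q l * S (fst q) j l) / 2)) * (CLINT \<omega>|M. iexp (r q * u (fst q) (snd q) \<omega>)))"
    by (intro prod.cong refl x_u_char) auto
  also have "\<dots> = (\<Prod>q\<in>?Q. complex_of_real (exp (- (\<Sum>j<p. \<Sum>l<p. a q j * a q l * S (fst q) j l) / 2))) * (\<Prod>q\<in>?Q. CLINT \<omega>|M. iexp (r q * u (fst q) (snd q) \<omega>))"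
    by (rule prod.distrib)
  also have "(\<Prod>q\<in>?Q. complex_of_real (exp (- (\<Sum>j<p. \<Sum>l<p. a q j * a q l * S (fst q) j l) / 2)))
    = complex_of_real (exp (\<Sum>q\<in>?Q. - (\<Sum>j<p. \<Sum>l<p. a q j * a q l * S (fst q) j l) / 2))"
    by (simp only: exp_sum[of ?Q, OF finite_cartesian_product[OF finite_sample finite_lessThan]] of_real_prod)
  also have "(\<Sum>q\<in>?Q. - (\<Sum>j<p. \<Sum>l<p. a q j * a q l * S (fst q) j l) / 2) = - (\<Sum>q\<in>?Q. \<Sum>j<p. \<Sum>l<p. a q j * a q l * S (fst q) j l) / 2"
    by (simp add: sum_negf sum_divide_distrib)
  finally show ?thesis .
qed

text \<open>The projection residual z_j - w . \<Pi>_j is linear in the two designs; these are its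
  coefficients on x_A and on x_B.\<close>

definition V_coeff :: "sample \<Rightarrow> nat \<Rightarrow> nat \<Rightarrow> real" where
  "V_coeff k j l = (case k of SA \<Rightarrow> of_bool (l = j) - Pst l j | SB \<Rightarrow> - (of_bool (l = j) + Pst l j))"

text \<open>The covariance of the projection residuals of columns j and j' within one row.\<close>

definition SV :: "nat \<Rightarrow> nat \<Rightarrow> real" where
  "SV j j' = (\<Sum>k\<in>UNIV. \<Sum>l<p. \<Sum>m<p. V_coeff k j l * V_coeff k j' m * S k l m)"

definition Wf :: "nat \<times> nat \<Rightarrow> 'a \<Rightarrow> real" where
  "Wf a \<omega> = x SA (fst a) \<omega> $ snd a + x SB (fst a) \<omega> $ snd a"

definition Vf :: "nat \<times> nat \<Rightarrow> 'a \<Rightarrow> real" where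
  "Vf a \<omega> = (x SA (fst a) \<omega> $ snd a - x SB (fst a) \<omega> $ snd a) - (\<Sum>l<p. Wf (fst a, l) \<omega> * Pst l (snd a))"

definition Uf :: "nat \<Rightarrow> 'a \<Rightarrow> real" where "Uf i \<omega> = u SA i \<omega> + u SB i \<omega>"

lemma sum_delta_lt: "i < p \<Longrightarrow> (\<Sum>a<p. of_bool (a = i) * f a) = (f i :: real)"
proof -
  assume "i < p"
  moreover have "(\<Sum>a<p. of_bool (a = i) * f a) = (\<Sum>a<p. if i = a then f a else 0)" by (intro sum.cong) auto
  ultimately show ?thesis by simp
qed

lemma Aco_sum:
  assumes "j < p"
  shows "(\<Sum>l<p. V_coeff SA j l * f l) = f j - (\<Sum>l<p. Pst l j * f l)"
    and "(\<Sum>l<p. V_coeff SB j l * f l) = - (f j + (\<Sum>l<p. Pst l j * f l))"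
  by (simp_all only: V_coeff_def sample.case left_diff_distrib mult_minus_left distrib_right sum_subtractf sum_negf sum.distrib sum_delta_lt[OF assms])

lemma Vf_eq: "j < p \<Longrightarrow> Vf (i, j) \<omega> = (\<Sum>k\<in>UNIV. \<Sum>l<p. V_coeff k j l * x k i \<omega> $ l)"
  by (simp add: Vf_def Wf_def UNIV_sample Aco_sum distrib_right sum.distrib mult.commute[of "Pst _ _"])

text \<open>The sum is the covariance of the projection residual of column j with w_m; its vanishing
  is the normal equations.\<close>

lemma cross_zero:
  assumes "j < p" "m < p"
  shows "(\<Sum>k\<in>UNIV. \<Sum>l<p. V_coeff k j l * S k l m) = 0"
proof -
  have "(\<Sum>k\<in>UNIV. \<Sum>l<p. V_coeff k j l * S k l m) = S SA j m - S SB j m - (\<Sum>l<p. SW l m * Pst l j)"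
    using assms by (simp add: UNIV_sample Aco_sum SW_def distrib_left distrib_right sum.distrib mult.commute[of "Pst _ _"])
  also have "(\<Sum>l<p. SW l m * Pst l j) = (\<Sum>l<p. SW m l * Pst l j)"
    using assms by (intro sum.cong) (auto simp: SW_sym)
  also have "\<dots> = S SA m j - S SB m j" by (rule normal_equations(2)[OF assms(2,1)])
  finally show ?thesis using S_sym assms by simp
qed

text \<open>The left side is the variance of s . v + t . w in one row, with v the projection
  residual. The mixed terms vanish by \<open>cross_zero\<close>, and this is the algebra behind the
  independence of v and w.\<close>

lemma row_quadratic:
  fixes s t :: "nat \<Rightarrow> real"
  defines "\<alpha> \<equiv> (\<lambda>k l. \<Sum>j<p. s j * V_coeff k j l)"
  shows "(\<Sum>k\<in>UNIV. \<Sum>l<p. \<Sum>m<p. (\<alpha> k l + t l) * (\<alpha> k m + t m) * S k l m)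
    = (\<Sum>j<p. \<Sum>j'<p. s j * s j' * SV j j') + (\<Sum>l<p. \<Sum>m<p. t l * t m * SW l m)"
proof -
  have 1: "(\<Sum>k\<in>UNIV. \<Sum>l<p. \<Sum>m<p. \<alpha> k l * \<alpha> k m * S k l m) = (\<Sum>j<p. \<Sum>j'<p. s j * s j' * SV j j')"
  proof -
    have "(\<Sum>l<p. \<Sum>m<p. \<alpha> k l * \<alpha> k m * S k l m) = (\<Sum>j<p. \<Sum>j'<p. s j * s j' * (\<Sum>l<p. \<Sum>m<p. V_coeff k j l * V_coeff k j' m * S k l m))" for k
    proof -
      have "(\<Sum>l<p. \<Sum>m<p. \<alpha> k l * \<alpha> k m * S k l m) = (\<Sum>l<p. \<Sum>m<p. \<Sum>j<p. \<Sum>j'<p. s j * s j' * (V_coeff k j l * V_coeff k j' m * S k l m))"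
        unfolding \<alpha>_def unfolding sum_product unfolding sum_distrib_right by (intro sum.cong refl) (simp add: mult_ac)
      also have "\<dots> = (\<Sum>l<p. \<Sum>j<p. \<Sum>m<p. \<Sum>j'<p. s j * s j' * (V_coeff k j l * V_coeff k j' m * S k l m))"
        by (intro sum.cong refl sum.swap)
      also have "\<dots> = (\<Sum>j<p. \<Sum>l<p. \<Sum>m<p. \<Sum>j'<p. s j * s j' * (V_coeff k j l * V_coeff k j' m * S k l m))"
        by (rule sum.swap)
      also have "\<dots> = (\<Sum>j<p. \<Sum>l<p. \<Sum>j'<p. \<Sum>m<p. s j * s j' * (V_coeff k j l * V_coeff k j' m * S k l m))"
        by (intro sum.cong refl sum.swap)
      also have "\<dots> = (\<Sum>j<p. \<Sum>j'<p. \<Sum>l<p. \<Sum>m<p. s j * s j' * (V_coeff k j l * V_coeff k j' m * S k l m))"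
        by (intro sum.cong refl sum.swap)
      finally show ?thesis by (simp add: sum_distrib_left)
    qed
    then show ?thesis unfolding SV_def by (simp add: UNIV_sample sum.distrib distrib_left)
  qed
  have c: "(\<Sum>k\<in>UNIV. \<Sum>l<p. \<alpha> k l * S k l m) = 0" if m: "m < p" for m
  proof -
    have "(\<Sum>l<p. \<alpha> k l * S k l m) = (\<Sum>j<p. s j * (\<Sum>l<p. V_coeff k j l * S k l m))" for k
      unfolding \<alpha>_def sum_distrib_left sum_distrib_right by (subst sum.swap) (simp add: mult_ac)
    then have "(\<Sum>k\<in>UNIV. \<Sum>l<p. \<alpha> k l * S k l m) = (\<Sum>j<p. s j * (\<Sum>k\<in>UNIV. \<Sum>l<p. V_coeff k j l * S k l m))"
      by (simp add: UNIV_sample sum.distrib distrib_left)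
    also have "\<dots> = 0" by (intro sum.neutral) (use m cross_zero in auto)
    finally show ?thesis .
  qed
  have 2: "(\<Sum>k\<in>UNIV. \<Sum>l<p. \<Sum>m<p. \<alpha> k l * t m * S k l m) = 0"
  proof -
    have "(\<Sum>l<p. \<Sum>m<p. \<alpha> k l * t m * S k l m) = (\<Sum>m<p. t m * (\<Sum>l<p. \<alpha> k l * S k l m))" for k
      unfolding sum_distrib_left by (subst sum.swap) (simp add: mult_ac)
    then have "(\<Sum>k\<in>UNIV. \<Sum>l<p. \<Sum>m<p. \<alpha> k l * t m * S k l m) = (\<Sum>m<p. t m * (\<Sum>k\<in>UNIV. \<Sum>l<p. \<alpha> k l * S k l m))"
      by (simp add: UNIV_sample sum.distrib distrib_left)
    also have "\<dots> = 0" by (intro sum.neutral) (use c in auto)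
    finally show ?thesis .
  qed
  have 3: "(\<Sum>k\<in>UNIV. \<Sum>l<p. \<Sum>m<p. t l * \<alpha> k m * S k l m) = 0"
  proof -
    have "(\<Sum>l<p. \<Sum>m<p. t l * \<alpha> k m * S k l m) = (\<Sum>l<p. \<Sum>m<p. \<alpha> k l * t m * S k l m)" for k
      by (subst sum.swap) (auto intro!: sum.cong simp: S_sym mult_ac)
    then show ?thesis using 2 by simp
  qed
  have "(\<Sum>k\<in>UNIV. \<Sum>l<p. \<Sum>m<p. (\<alpha> k l + t l) * (\<alpha> k m + t m) * S k l m)
    = (\<Sum>k\<in>UNIV. \<Sum>l<p. \<Sum>m<p. \<alpha> k l * \<alpha> k m * S k l m) + (\<Sum>k\<in>UNIV. \<Sum>l<p. \<Sum>m<p. \<alpha> k l * t m * S k l m)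
     + (\<Sum>k\<in>UNIV. \<Sum>l<p. \<Sum>m<p. t l * \<alpha> k m * S k l m) + (\<Sum>k\<in>UNIV. \<Sum>l<p. \<Sum>m<p. t l * t m * S k l m)"
    by (simp add: distrib_left distrib_right sum.distrib algebra_simps)
  also have "(\<Sum>k\<in>UNIV. \<Sum>l<p. \<Sum>m<p. t l * t m * S k l m) = (\<Sum>l<p. \<Sum>m<p. t l * t m * SW l m)"
    by (simp add: UNIV_sample SW_def distrib_left sum.distrib)
  finally show ?thesis using 1 2 3 by simp
qed

section \<open>Independence of the projection residual from design and noise\<close>

abbreviation NP :: "(nat \<times> nat) set" where "NP \<equiv> {..<n} \<times> {..<p}"

text \<open>One factor contains only \<open>s\<close>, the other only \<open>t\<close> and
  \<open>r\<close>, so \<open>Vf\<close> is independent of \<open>Wf\<close> and \<open>Uf\<close>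
  jointly. The noise factor stays unevaluated because the error law is arbitrary.\<close>

lemma VWU_char:
  fixes s t :: "nat \<times> nat \<Rightarrow> real" and r :: "nat \<Rightarrow> real"
  shows "(CLINT \<omega>|M. iexp ((\<Sum>a\<in>NP. s a * Vf a \<omega>) + ((\<Sum>a\<in>NP. t a * Wf a \<omega>) + (\<Sum>i<n. r i * Uf i \<omega>))))
    = exp (- (\<Sum>a\<in>NP. \<Sum>b\<in>NP. s a * s b * row_cov SV a b) / 2) *
      (exp (- (\<Sum>a\<in>NP. \<Sum>b\<in>NP. t a * t b * row_cov SW a b) / 2) * (\<Prod>q\<in>UNIV \<times> {..<n}. CLINT \<omega>|M. iexp (r (snd q) * u (fst q) (snd q) \<omega>)))"
proof -
  \<comment> \<open>The coefficient of the coordinate \<open>l\<close> of \<open>x k i\<close> after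
    expanding \<open>Vf\<close> and \<open>Wf\<close> in the designs of both samples.\<close>
  define \<alpha> where "\<alpha> q l = (\<Sum>j<p. s (snd q, j) * V_coeff (fst q) j l) + t (snd q, l)" for q :: "sample \<times> nat" and l
  have lin: "(\<Sum>a\<in>NP. s a * Vf a \<omega>) + ((\<Sum>a\<in>NP. t a * Wf a \<omega>) + (\<Sum>i<n. r i * Uf i \<omega>))
    = (\<Sum>q\<in>UNIV \<times> {..<n}. (\<Sum>l<p. \<alpha> q l * x (fst q) (snd q) \<omega> $ l) + r (snd q) * u (fst q) (snd q) \<omega>)" for \<omega>
  proof -
    have "(\<Sum>l<p. (\<Sum>j<p. s (i, j) * V_coeff k j l) * x k i \<omega> $ l) = (\<Sum>j<p. s (i, j) * (\<Sum>l<p. V_coeff k j l * x k i \<omega> $ l))" for k i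
      unfolding sum_distrib_left sum_distrib_right by (subst sum.swap) (simp add: mult_ac)
    then have "(\<Sum>q\<in>UNIV \<times> {..<n}. (\<Sum>l<p. \<alpha> q l * x (fst q) (snd q) \<omega> $ l) + r (snd q) * u (fst q) (snd q) \<omega>)
      = (\<Sum>k\<in>UNIV. \<Sum>i<n. (\<Sum>j<p. s (i, j) * (\<Sum>l<p. V_coeff k j l * x k i \<omega> $ l)) + (\<Sum>l<p. t (i, l) * x k i \<omega> $ l) + r i * u k i \<omega>)"
      by (simp add: sum.cartesian_product' \<alpha>_def distrib_right sum.distrib)
    also have "\<dots> = (\<Sum>i<n. \<Sum>j<p. s (i, j) * Vf (i, j) \<omega>) + ((\<Sum>i<n. \<Sum>j<p. t (i, j) * Wf (i, j) \<omega>) + (\<Sum>i<n. r i * Uf i \<omega>))"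
    proof -
      have "(\<Sum>j<p. s (i, j) * Vf (i, j) \<omega>) = (\<Sum>j<p. s (i, j) * (\<Sum>k\<in>UNIV. \<Sum>l<p. V_coeff k j l * x k i \<omega> $ l))" for i
        by (intro sum.cong) (auto simp: Vf_eq)
      then show ?thesis by (simp add: UNIV_sample Wf_def Uf_def distrib_left sum.distrib)
    qed
    finally show ?thesis by (simp add: sum.cartesian_product)
  qed
  have quad: "(\<Sum>q\<in>UNIV \<times> {..<n}. \<Sum>j<p. \<Sum>l<p. \<alpha> q j * \<alpha> q l * S (fst q) j l)
    = (\<Sum>a\<in>NP. \<Sum>b\<in>NP. s a * s b * row_cov SV a b) + (\<Sum>a\<in>NP. \<Sum>b\<in>NP. t a * t b * row_cov SW a b)"
  proof -
    have "(\<Sum>q\<in>UNIV \<times> {..<n}. \<Sum>j<p. \<Sum>l<p. \<alpha> q j * \<alpha> q l * S (fst q) j l)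
      = (\<Sum>k\<in>UNIV. \<Sum>i<n. \<Sum>j<p. \<Sum>l<p. \<alpha> (k, i) j * \<alpha> (k, i) l * S k j l)"
      by (simp add: sum.cartesian_product')
    also have "\<dots> = (\<Sum>i<n. \<Sum>k\<in>UNIV. \<Sum>j<p. \<Sum>l<p. \<alpha> (k, i) j * \<alpha> (k, i) l * S k j l)"
      by (rule sum.swap)
    also have "\<dots> = (\<Sum>i<n. (\<Sum>j<p. \<Sum>j'<p. s (i, j) * s (i, j') * SV j j') + (\<Sum>l<p. \<Sum>m<p. t (i, l) * t (i, m) * SW l m))"
      using row_quadratic[of "\<lambda>j. s (_, j)" "\<lambda>j. t (_, j)"] by (intro sum.cong refl) (simp only: \<alpha>_def fst_conv snd_conv)
    finally show ?thesis by (simp add: row_cov_sum sum.distrib)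
  qed
  have e: "exp (- (b + c) / 2) = exp (- b / 2) * exp (- c / 2)" for b c :: real
    by (simp add: mult_exp_exp field_simps)
  show ?thesis unfolding lin joint_char quad by (simp only: e of_real_mult mult.assoc)
qed

lemma char_zero_prod: "(\<Prod>q\<in>UNIV \<times> {..<n}. CLINT \<omega>|M. iexp (0 * u (fst q) (snd q) \<omega>)) = 1"
  by (simp add: prob_space)

lemma VWU_rv:
  "a \<in> NP \<Longrightarrow> Wf a \<in> borel_measurable M" "a \<in> NP \<Longrightarrow> Vf a \<in> borel_measurable M" "i < n \<Longrightarrow> Uf i \<in> borel_measurable M"
proof -
  show W: "Wf a \<in> borel_measurable M" if "a \<in> NP" for a
    using that unfolding Wf_def[abs_def] by (auto intro!: borel_measurable_add x_index_rv)
  show "Vf a \<in> borel_measurable M" if "a \<in> NP"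
    using that unfolding Vf_def[abs_def]
    by (intro borel_measurable_diff x_index_rv borel_measurable_sum borel_measurable_times W) auto
  show "Uf i \<in> borel_measurable M" if "i < n"
    using that unfolding Uf_def[abs_def] by (auto intro!: borel_measurable_add error_rv)
qed

lemma gauss_V: "gauss M NP Vf (row_cov SV)"
  unfolding gauss_def
proof (intro conjI allI ballI)
  fix s
  show "(CLINT \<omega>|M. iexp (\<Sum>a\<in>NP. s a * Vf a \<omega>)) = exp (- (\<Sum>a\<in>NP. \<Sum>b\<in>NP. s a * s b * row_cov SV a b) / 2)"
    using VWU_char[of s "\<lambda>_. 0" "\<lambda>_. 0", unfolded char_zero_prod] by simp
qed (auto intro!: prob_space_axioms VWU_rv)

lemma gauss_W: "gauss M NP Wf (row_cov SW)"
  unfolding gauss_def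
proof (intro conjI allI ballI)
  fix s
  show "(CLINT \<omega>|M. iexp (\<Sum>a\<in>NP. s a * Wf a \<omega>)) = exp (- (\<Sum>a\<in>NP. \<Sum>b\<in>NP. s a * s b * row_cov SW a b) / 2)"
    using VWU_char[of "\<lambda>_. 0" s "\<lambda>_. 0", unfolded char_zero_prod] by simp
qed (auto intro!: prob_space_axioms VWU_rv)

abbreviation PV :: "(nat \<times> nat \<Rightarrow> real) measure" where "PV \<equiv> \<Pi>\<^sub>M a\<in>NP. borel"
abbreviation RI :: "(nat \<times> nat + nat) set" where "RI \<equiv> NP <+> {..<n}"
abbreviation PR :: "(nat \<times> nat + nat \<Rightarrow> real) measure" where "PR \<equiv> \<Pi>\<^sub>M a\<in>RI. borel"

definition Rf :: "nat \<times> nat + nat \<Rightarrow> 'a \<Rightarrow> real" where "Rf = case_sum Wf Uf"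
definition MV where "MV = distr M PV (\<lambda>\<omega>. \<lambda>a\<in>NP. Vf a \<omega>)"
definition MR where "MR = distr M PR (\<lambda>\<omega>. \<lambda>a\<in>RI. Rf a \<omega>)"

lemma Rf_rv: "a \<in> RI \<Longrightarrow> Rf a \<in> borel_measurable M"
  unfolding Rf_def by (auto intro: VWU_rv)

lemma V_measurable: "(\<lambda>\<omega>. \<lambda>a\<in>NP. Vf a \<omega>) \<in> measurable M PV"
  by (intro measurable_restrict VWU_rv)

lemma R_measurable: "(\<lambda>\<omega>. \<lambda>a\<in>RI. Rf a \<omega>) \<in> measurable M PR"
  by (intro measurable_restrict Rf_rv)

lemma prob_MV: "prob_space MV" and prob_MR: "prob_space MR"
  unfolding MV_def MR_def by (auto intro!: prob_space_distr V_measurable R_measurable)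

lemma sets_MV[measurable_cong]: "sets MV = sets PV" and sets_MR[measurable_cong]: "sets MR = sets PR"
  by (auto simp: MV_def MR_def)

lemma gauss_MV: "gauss MV NP (\<lambda>a v. v a) (row_cov SV)"
  unfolding MV_def
proof (rule gauss_distrI[OF _ V_measurable])
  show "gauss M NP (\<lambda>a \<omega>. (\<lambda>a\<in>NP. Vf a \<omega>) a) (row_cov SV)"
    by (rule gauss_cong[OF gauss_V]) auto
qed auto

lemma gauss_MR: "gauss MR NP (\<lambda>a r. r (Inl a)) (row_cov SW)"
  unfolding MR_def
proof (rule gauss_distrI[OF _ R_measurable])
  show "gauss M NP (\<lambda>a \<omega>. (\<lambda>a\<in>RI. Rf a \<omega>) (Inl a)) (row_cov SW)"
    by (rule gauss_cong[OF gauss_W]) (auto simp: Rf_def)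
qed (auto intro!: measurable_component_singleton)

text \<open>Moves all later arguments to the product \<open>MV \<Otimes>\<^sub>M MR\<close>, where
  conditioning on design and noise is just fixing the second coordinate.\<close>

lemma VR_law: "distr M (PV \<Otimes>\<^sub>M PR) (\<lambda>\<omega>. (\<lambda>a\<in>NP. Vf a \<omega>, \<lambda>a\<in>RI. Rf a \<omega>)) = MV \<Otimes>\<^sub>M MR"
proof -
  interpret V: prob_space MV by (rule prob_MV)
  interpret R: prob_space MR by (rule prob_MR)
  interpret VR: pair_prob_space MV MR by standard
  have sumR: "(\<Sum>a\<in>RI. t a * Rf a \<omega>) = (\<Sum>a\<in>NP. t (Inl a) * Wf a \<omega>) + (\<Sum>i<n. t (Inr i) * Uf i \<omega>)" for t \<omega>
    by (simp add: sum.Plus Rf_def)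
  have m1: "(\<lambda>z. fst z a) \<in> borel_measurable (MV \<Otimes>\<^sub>M MR)" if "a \<in> NP" for a
    by (rule measurable_compose[OF measurable_fst]) (simp add: measurable_cong_sets[OF sets_MV refl] measurable_component_singleton that del: mem_Sigma_iff)
  have m2: "(\<lambda>z. snd z a) \<in> borel_measurable (MV \<Otimes>\<^sub>M MR)" if "a \<in> RI" for a
    by (rule measurable_compose[OF measurable_snd]) (simp add: measurable_cong_sets[OF sets_MR refl] measurable_component_singleton that del: mem_Sigma_iff)
  have "distr M (PV \<Otimes>\<^sub>M PR) (\<lambda>\<omega>. (\<lambda>a\<in>NP. Vf a \<omega>, \<lambda>a\<in>RI. Rf a \<omega>))
    = distr (MV \<Otimes>\<^sub>M MR) (PV \<Otimes>\<^sub>M PR) (\<lambda>z. (\<lambda>a\<in>NP. fst z a, \<lambda>a\<in>RI. snd z a))"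
  proof (rule pair_law_eq_if_char_eq)
    fix s t
    have cV: "(CLINT v|MV. iexp (\<Sum>a\<in>NP. s a * v a)) = exp (- (\<Sum>a\<in>NP. \<Sum>b\<in>NP. s a * s b * row_cov SV a b) / 2)"
      by (rule gaussD(4)[OF gauss_MV])
    have mR: "(\<lambda>v. iexp (\<Sum>a\<in>RI. t a * v a)) \<in> borel_measurable PR"
      by (rule measurable_compose[of "\<lambda>v. \<Sum>a\<in>RI. t a * v a" _ borel iexp])
        (auto intro!: borel_measurable_sum borel_measurable_times measurable_component_singleton)
    have cR: "(CLINT v|MR. iexp (\<Sum>a\<in>RI. t a * v a)) = (CLINT \<omega>|M. iexp ((\<Sum>a\<in>NP. t (Inl a) * Wf a \<omega>) + (\<Sum>i<n. t (Inr i) * Uf i \<omega>)))"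
      unfolding MR_def by (subst integral_distr[OF R_measurable mR]) (simp add: sumR[symmetric])
    have "(CLINT z|MV \<Otimes>\<^sub>M MR. iexp ((\<Sum>a\<in>NP. s a * fst z a) + (\<Sum>a\<in>RI. t a * snd z a)))
      = (CLINT z|MV \<Otimes>\<^sub>M MR. iexp (\<Sum>a\<in>NP. s a * fst z a) * iexp (\<Sum>a\<in>RI. t a * snd z a))"
      by (simp add: exp_add[symmetric] distrib_left)
    also have "\<dots> = (CLINT v|MV. iexp (\<Sum>a\<in>NP. s a * v a)) * (CLINT v|MR. iexp (\<Sum>a\<in>RI. t a * v a))"
      by (rule integral_pair_mult[OF prob_MV prob_MR]; rule integrable_iexp_real[OF prob_MV] integrable_iexp_real[OF prob_MR])
        (auto intro!: borel_measurable_sum borel_measurable_times measurable_component_singleton simp: measurable_cong_sets[OF sets_MV refl] measurable_cong_sets[OF sets_MR refl])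
    also have "\<dots> = (CLINT \<omega>|M. iexp ((\<Sum>a\<in>NP. s a * Vf a \<omega>) + (\<Sum>a\<in>RI. t a * Rf a \<omega>)))"
      unfolding cV cR sumR VWU_char
      using VWU_char[of "\<lambda>_. 0" "\<lambda>a. t (Inl a)" "\<lambda>a. t (Inr a)"] by simp
    finally show "(CLINT \<omega>|M. iexp ((\<Sum>a\<in>NP. s a * Vf a \<omega>) + (\<Sum>a\<in>RI. t a * Rf a \<omega>)))
      = (CLINT z|MV \<Otimes>\<^sub>M MR. iexp ((\<Sum>a\<in>NP. s a * fst z a) + (\<Sum>a\<in>RI. t a * snd z a)))" by simp
  qed (auto intro!: prob_space_axioms VR.prob_space_axioms VWU_rv Rf_rv m1 m2)
  also have "\<dots> = distr (MV \<Otimes>\<^sub>M MR) (MV \<Otimes>\<^sub>M MR) (\<lambda>z. z)"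
  proof (rule distr_cong)
    show "sets (PV \<Otimes>\<^sub>M PR) = sets (MV \<Otimes>\<^sub>M MR)" by (rule sets_pair_measure_cong) (auto simp: sets_MV sets_MR)
    fix z assume "z \<in> space (MV \<Otimes>\<^sub>M MR)"
    moreover have "space MV = extensional NP" "space MR = extensional RI"
      using sets_eq_imp_space_eq[OF sets_MV] sets_eq_imp_space_eq[OF sets_MR] by (auto simp: space_PiM PiE_def)
    ultimately show "(\<lambda>a\<in>NP. fst z a, \<lambda>a\<in>RI. snd z a) = z"
      by (cases z) (auto simp: space_pair_measure extensional_restrict)
  qed simp
  also have "\<dots> = MV \<Otimes>\<^sub>M MR" by (rule distr_id2) simp
  finally show ?thesis .
qed

end

section \<open>Linear combinations of rows\<close>

lemma sum_NP_delta:
  fixes n p :: nat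
  shows "j < p \<Longrightarrow> (\<Sum>a\<in>{..<n} \<times> {..<p}. of_bool (snd a = j) * f (fst a) * h a) = (\<Sum>i<n. f i * h (i, j) :: real)"
proof -
  assume j: "j < p"
  have "(\<Sum>l<p. of_bool (l = j) * f i * h (i, l)) = f i * h (i, j)" for i
  proof -
    have "(\<Sum>l<p. of_bool (l = j) * f i * h (i, l)) = (\<Sum>l<p. if j = l then f i * h (i, l) else 0)" by (intro sum.cong) auto
    then show ?thesis using j by simp
  qed
  then show ?thesis by (simp add: sum.cartesian_product')
qed

text \<open>Weighted sums of independent rows have as covariance the Gram matrix of the weight
  vectors tensored with \<open>C\<close>. A unit weight vector reproduces the law of a row, and
  orthogonal weight vectors give independent sums.\<close>

lemma gauss_row_combos:
  assumes g: "gauss M ({..<n} \<times> {..<p}) X (row_cov C)" and B: "finite B"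
  shows "gauss M (B \<times> {..<p}) (\<lambda>a \<omega>. \<Sum>i<n. e (fst a) i * X (i, snd a) \<omega>)
    (\<lambda>a b. (\<Sum>i<n. e (fst a) i * e (fst b) i) * C (snd a) (snd b))"
proof (rule gauss_cong[OF gauss_linear[OF g, of "B \<times> {..<p}" "\<lambda>a q. of_bool (snd q = snd a) * e (fst a) (fst q)"]])
  show "finite (B \<times> {..<p})" using B by simp
  show "(\<Sum>i<n. e (fst a) i * X (i, snd a) \<omega>) = (\<Sum>q\<in>{..<n} \<times> {..<p}. of_bool (snd q = snd a) * e (fst a) (fst q) * X q \<omega>)"
    if "a \<in> B \<times> {..<p}" for a \<omega>
    using that sum_NP_delta[of "snd a" p "\<lambda>i. e (fst a) i" "\<lambda>q. X q \<omega>" n] by auto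
  show "(\<Sum>i<n. e (fst a) i * e (fst b) i) * C (snd a) (snd b) = (\<Sum>q\<in>{..<n} \<times> {..<p}. \<Sum>q'\<in>{..<n} \<times> {..<p}.
      of_bool (snd q = snd a) * e (fst a) (fst q) * (of_bool (snd q' = snd b) * e (fst b) (fst q')) * row_cov C q q')"
    if "a \<in> B \<times> {..<p}" "b \<in> B \<times> {..<p}" for a b
  proof -
    have ab: "snd a < p" "snd b < p" using that by auto
    have "(\<Sum>q\<in>{..<n} \<times> {..<p}. \<Sum>q'\<in>{..<n} \<times> {..<p}.
      of_bool (snd q = snd a) * e (fst a) (fst q) * (of_bool (snd q' = snd b) * e (fst b) (fst q')) * row_cov C q q')
      = (\<Sum>q\<in>{..<n} \<times> {..<p}. of_bool (snd q = snd a) * e (fst a) (fst q) *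
          (\<Sum>q'\<in>{..<n} \<times> {..<p}. of_bool (snd q' = snd b) * e (fst b) (fst q') * row_cov C q q'))"
      by (simp only: sum_distrib_left mult.assoc)
    also have "\<dots> = (\<Sum>q\<in>{..<n} \<times> {..<p}. of_bool (snd q = snd a) * e (fst a) (fst q) * (\<Sum>i'<n. e (fst b) i' * row_cov C q (i', snd b)))"
      by (simp only: sum_NP_delta[OF ab(2)])
    also have "\<dots> = (\<Sum>i<n. e (fst a) i * (\<Sum>i'<n. e (fst b) i' * row_cov C (i, snd a) (i', snd b)))"
      by (rule sum_NP_delta[OF ab(1)])
    also have "\<dots> = (\<Sum>i<n. e (fst a) i * (e (fst b) i * C (snd a) (snd b)))"
    proof (intro sum.cong refl)
      fix i assume "i \<in> {..<n}"
      have "(\<Sum>i'<n. e (fst b) i' * row_cov C (i, snd a) (i', snd b)) = (\<Sum>i'<n. if i = i' then e (fst b) i' * C (snd a) (snd b) else 0)"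
        by (intro sum.cong) (auto simp: row_cov_def)
      then show "e (fst a) i * (\<Sum>i'<n. e (fst b) i' * row_cov C (i, snd a) (i', snd b)) = e (fst a) i * (e (fst b) i * C (snd a) (snd b))"
        using \<open>i \<in> {..<n}\<close> by simp
    qed
    finally show ?thesis by (simp add: sum_distrib_right mult.assoc)
  qed
qed

lemma gauss_row_combo:
  assumes g: "gauss M ({..<n} \<times> {..<p}) X (row_cov C)"
  shows "gauss M {..<p} (\<lambda>j \<omega>. \<Sum>i<n. e i * X (i, j) \<omega>) (\<lambda>j k. (\<Sum>i<n. e i * e i) * C j k)"
  using gauss_reindex[OF gauss_row_combos[OF g, of "{()}" "\<lambda>_. e"], of "{..<p}" "\<lambda>j. ((), j)"] by simp

lemma gauss_row_two_combos:
  assumes g: "gauss M ({..<n} \<times> {..<p}) X (row_cov C)"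
    and e: "(\<Sum>i<n. e i * e i) = 1" "(\<Sum>i<n. f i * f i) = 1" "(\<Sum>i<n. e i * f i) = 0"
  shows "gauss M ({..<p} <+> {..<p}) (\<lambda>k \<omega>. case k of Inl j \<Rightarrow> \<Sum>i<n. e i * X (i, j) \<omega> | Inr j \<Rightarrow> \<Sum>i<n. f i * X (i, j) \<omega>)
    (\<lambda>k l. case k of Inl i \<Rightarrow> (case l of Inl i' \<Rightarrow> C i i' | Inr _ \<Rightarrow> 0)
       | Inr j \<Rightarrow> (case l of Inl _ \<Rightarrow> 0 | Inr j' \<Rightarrow> C j j'))"
proof (rule gauss_cong[OF gauss_reindex[OF gauss_row_combos[OF g, of "UNIV :: bool set" "\<lambda>b. if b then e else f"],
    of "{..<p} <+> {..<p}" "case_sum (\<lambda>j. (True, j)) (\<lambda>j. (False, j))"]])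
  have "(\<Sum>i<n. f i * e i) = 0" using e(3) by (simp add: mult.commute)
  then show "(case k of Inl i \<Rightarrow> (case l of Inl i' \<Rightarrow> C i i' | Inr _ \<Rightarrow> 0) | Inr j \<Rightarrow> (case l of Inl _ \<Rightarrow> 0 | Inr j' \<Rightarrow> C j j'))
    = (\<Sum>i<n. (if fst (case k of Inl j \<Rightarrow> (True, j) | Inr j \<Rightarrow> (False, j)) then e else f) i *
         (if fst (case l of Inl j \<Rightarrow> (True, j) | Inr j \<Rightarrow> (False, j)) then e else f) i) *
      C (snd (case k of Inl j \<Rightarrow> (True, j) | Inr j \<Rightarrow> (False, j))) (snd (case l of Inl j \<Rightarrow> (True, j) | Inr j \<Rightarrow> (False, j)))"
    for k l :: "nat + nat"
    using e by (auto split: sum.split)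
qed (auto split: sum.split)

text \<open>A fixed linear form in the columns gives independent variables of equal variance over
  the rows, the input of \<open>gauss_iid_sum_squares\<close>.\<close>

lemma gauss_row_iid:
  assumes g: "gauss M ({..<n} \<times> {..<p}) X (row_cov C)"
  shows "gauss M {..<n} (\<lambda>i \<omega>. \<Sum>j<p. c j * X (i, j) \<omega>) (\<lambda>i i'. (\<Sum>j<p. \<Sum>k<p. c j * c k * C j k) * of_bool (i = i'))"
proof (rule gauss_cong[OF gauss_linear[OF g, of "{..<n}" "\<lambda>i q. of_bool (fst q = i) * c (snd q)"]])
  have d: "(\<Sum>q\<in>{..<n} \<times> {..<p}. of_bool (fst q = i) * c (snd q) * h q) = (\<Sum>j<p. c j * h (i, j))" if "i < n" for i and h :: "nat \<times> nat \<Rightarrow> real"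
  proof -
    have "(\<Sum>q\<in>{..<n} \<times> {..<p}. of_bool (fst q = i) * c (snd q) * h q) = (\<Sum>i'<n. if i = i' then (\<Sum>j<p. c j * h (i, j)) else 0)"
      unfolding sum.cartesian_product' by (intro sum.cong) auto
    then show ?thesis using that by simp
  qed
  show "(\<Sum>j<p. c j * X (i, j) \<omega>) = (\<Sum>q\<in>{..<n} \<times> {..<p}. of_bool (fst q = i) * c (snd q) * X q \<omega>)" if "i \<in> {..<n}" for i \<omega>
    using that d[of i "\<lambda>q. X q \<omega>"] by simp
  show "(\<Sum>j<p. \<Sum>k<p. c j * c k * C j k) * of_bool (i = i') = (\<Sum>q\<in>{..<n} \<times> {..<p}. \<Sum>q'\<in>{..<n} \<times> {..<p}.
     of_bool (fst q = i) * c (snd q) * (of_bool (fst q' = i') * c (snd q')) * row_cov C q q')" if "i \<in> {..<n}" "i' \<in> {..<n}" for i i'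
  proof -
    have ii: "i < n" "i' < n" using that by auto
    have "(\<Sum>q\<in>{..<n} \<times> {..<p}. \<Sum>q'\<in>{..<n} \<times> {..<p}. of_bool (fst q = i) * c (snd q) * (of_bool (fst q' = i') * c (snd q')) * row_cov C q q')
      = (\<Sum>q\<in>{..<n} \<times> {..<p}. of_bool (fst q = i) * c (snd q) * (\<Sum>q'\<in>{..<n} \<times> {..<p}. of_bool (fst q' = i') * c (snd q') * row_cov C q q'))"
      by (simp only: sum_distrib_left mult.assoc)
    also have "\<dots> = (\<Sum>j<p. c j * (\<Sum>k<p. c k * row_cov C (i, j) (i', k)))" by (simp only: d[OF ii(1)] d[OF ii(2)])
    also have "\<dots> = (\<Sum>j<p. \<Sum>k<p. c j * c k * C j k) * of_bool (i = i')"
      by (auto simp: row_cov_def sum_distrib_left mult.assoc)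
    finally show ?thesis by simp
  qed
qed simp

section \<open>Covariance of the projection residual and its maximum norm\<close>

context gaussian_two_sample
begin

text \<open>With b = \<Pi> s, the form s . v has the coefficient vectors s - b on x_A and -(s + b)
  on x_B. By the parallelogram law their squared norms add up to at least 2 |s|^2, whatever \<Pi>
  is.\<close>

lemma SV_lower: "2 * \<kappa>1 * (\<Sum>j<p. (s j)\<^sup>2) \<le> (\<Sum>j<p. \<Sum>k<p. s j * s k * SV j k)"
proof -
  define \<alpha> where "\<alpha> k l = (\<Sum>j<p. s j * V_coeff k j l)" for k l
  have q: "(\<Sum>j<p. \<Sum>k<p. s j * s k * SV j k) = (\<Sum>k\<in>UNIV. \<Sum>l<p. \<Sum>m<p. \<alpha> k l * \<alpha> k m * S k l m)"
    using row_quadratic[of s "\<lambda>_. 0"] by (simp add: \<alpha>_def)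
  define b where "b l = (\<Sum>j<p. s j * Pst l j)" for l
  have aA: "\<alpha> SA l = s l - b l" and aB: "\<alpha> SB l = - (s l + b l)" if "l < p" for l
  proof -
    have "(\<Sum>j<p. s j * of_bool (l = j)) = (\<Sum>j<p. if l = j then s j else 0)" by (intro sum.cong) auto
    then have d: "(\<Sum>j<p. s j * of_bool (l = j)) = s l" using that by simp
    show "\<alpha> SA l = s l - b l" "\<alpha> SB l = - (s l + b l)"
      by (simp_all only: \<alpha>_def b_def V_coeff_def sample.case right_diff_distrib mult_minus_right distrib_left sum_subtractf sum_negf sum.distrib d)
  qed
  have "2 * \<kappa>1 * (\<Sum>j<p. (s j)\<^sup>2) \<le> \<kappa>1 * (2 * (\<Sum>j<p. (s j)\<^sup>2) + 2 * (\<Sum>j<p. (b j)\<^sup>2))"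
    using kappa by (simp add: distrib_left sum_nonneg)
  also have "2 * (\<Sum>j<p. (s j)\<^sup>2) + 2 * (\<Sum>j<p. (b j)\<^sup>2) = (\<Sum>l<p. (\<alpha> SA l)\<^sup>2) + (\<Sum>l<p. (\<alpha> SB l)\<^sup>2)"
  proof -
    have "(\<alpha> SA l)\<^sup>2 + (\<alpha> SB l)\<^sup>2 = 2 * (s l)\<^sup>2 + 2 * (b l)\<^sup>2" if "l < p" for l
      unfolding aA[OF that] aB[OF that] by (simp add: power2_eq_square algebra_simps)
    then show ?thesis by (simp add: sum.distrib[symmetric] sum_distrib_left)
  qed
  also have "\<kappa>1 * ((\<Sum>l<p. (\<alpha> SA l)\<^sup>2) + (\<Sum>l<p. (\<alpha> SB l)\<^sup>2)) \<le> (\<Sum>k\<in>UNIV. \<Sum>l<p. \<Sum>m<p. \<alpha> k l * \<alpha> k m * S k l m)"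
    using S_lower[of "\<alpha> SA" SA] S_lower[of "\<alpha> SB" SB] by (simp add: UNIV_sample distrib_left)
  finally show ?thesis unfolding q .
qed

lemma SV_sym: "SV j k = SV k j" if "j < p" "k < p"
proof -
  have "(\<Sum>l<p. \<Sum>m<p. V_coeff i j l * V_coeff i k m * S i l m) = (\<Sum>l<p. \<Sum>m<p. V_coeff i k l * V_coeff i j m * S i l m)" for i
    by (subst sum.swap) (auto intro!: sum.cong simp: S_sym)
  then show ?thesis by (simp add: SV_def)
qed

lemma diag_quad: "j < p \<Longrightarrow> (\<Sum>a<p. \<Sum>b<p. of_bool (a = j) * of_bool (b = j) * f a b) = (f j j :: real)"
  by (simp only: mult.assoc sum_distrib_left[symmetric] sum_delta_lt)

lemma SW_diag_le: "j < p \<Longrightarrow> SW j j \<le> 2 * \<kappa>2"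
proof -
  assume j: "j < p"
  have "(\<Sum>i<p. (of_bool (i = j))\<^sup>2 :: real) = (\<Sum>i<p. of_bool (i = j) * 1)" by (intro sum.cong) auto
  then have "(\<Sum>i<p. (of_bool (i = j))\<^sup>2 :: real) = 1" using sum_delta_lt[OF j, of "\<lambda>_. 1"] by simp
  then have "S k j j \<le> \<kappa>2" for k
    using S_upper[of "\<lambda>i. of_bool (i = j)" k] diag_quad[OF j, of "S k"] by simp
  from add_mono[OF this[of SA] this[of SB]] show ?thesis by (simp add: SW_def)
qed

text \<open>Pythagoras: z_j is the orthogonal sum of its projection residual and its projection on
  w, and z_j has the same variance \<open>SW j j\<close> as w_j.\<close>

lemma SV_diag_le: "SV j j \<le> 2 * \<kappa>2" if j: "j < p"
proof -
  define s :: "nat \<Rightarrow> real" where "s i = of_bool (i = j)" for i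
  define t where "t l = Pst l j" for l
  have a: "(\<Sum>i<p. s i * V_coeff k i l) = V_coeff k j l" for k l unfolding s_def by (rule sum_delta_lt[OF j])
  have "(\<Sum>k\<in>UNIV. \<Sum>l<p. \<Sum>m<p. (V_coeff k j l + t l) * (V_coeff k j m + t m) * S k l m)
    = (\<Sum>i<p. \<Sum>i'<p. s i * s i' * SV i i') + (\<Sum>l<p. \<Sum>m<p. t l * t m * SW l m)"
    using row_quadratic[of s t] by (simp add: a)
  also have "(\<Sum>i<p. \<Sum>i'<p. s i * s i' * SV i i') = SV j j" unfolding s_def by (rule diag_quad[OF j])
  also have "(\<Sum>k\<in>UNIV. \<Sum>l<p. \<Sum>m<p. (V_coeff k j l + t l) * (V_coeff k j m + t m) * S k l m) = SW j j"
  proof -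
    have "V_coeff SA j l + t l = of_bool (l = j)" "V_coeff SB j l + t l = - of_bool (l = j)" for l by (auto simp: V_coeff_def t_def)
    then show ?thesis using diag_quad[OF j, of "S SA"] diag_quad[OF j, of "S SB"] by (simp add: UNIV_sample SW_def)
  qed
  finally have "SV j j = SW j j - (\<Sum>l<p. \<Sum>m<p. t l * t m * SW l m)" by simp
  moreover have "0 \<le> 2 * \<kappa>1 * (\<Sum>i<p. (t i)\<^sup>2)" using kappa by (simp add: sum_nonneg)
  ultimately show ?thesis using SW_lower[of t] SW_diag_le[OF j] by linarith
qed

text \<open>The decomposition that \<open>gauss_anticoncentration\<close> asks for;
  \<open>SV_lower\<close> leaves room for white noise of variance 2 * \<kappa>1.\<close>

lemma SV_factor: "\<exists>K. \<forall>j<p. \<forall>k<p. SV j k = (sqrt (2 * \<kappa>1))\<^sup>2 * of_bool (j = k) + (\<Sum>l<p. K j l * K k l)"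
proof -
  have "\<exists>K. \<forall>j<p. \<forall>k<p. SV j k - 2 * \<kappa>1 * of_bool (j = k) = (\<Sum>l<p. K j l * K k l)"
  proof (rule psd_factor)
    show "SV i j - 2 * \<kappa>1 * of_bool (i = j) = SV j i - 2 * \<kappa>1 * of_bool (j = i)" if "i < p" "j < p" for i j
      by (simp add: SV_sym[OF that] eq_commute)
    fix v
    have "(\<Sum>i<p. \<Sum>j<p. v i * v j * (2 * \<kappa>1 * of_bool (i = j))) = 2 * \<kappa>1 * (\<Sum>i<p. (v i)\<^sup>2)"
    proof -
      have "(\<Sum>j<p. v i * v j * (2 * \<kappa>1 * of_bool (i = j))) = 2 * \<kappa>1 * (v i)\<^sup>2" if "i < p" for i
      proof -
        have "(\<Sum>j<p. v i * v j * (2 * \<kappa>1 * of_bool (i = j))) = (\<Sum>j<p. if i = j then v i * v j * (2 * \<kappa>1) else 0)"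
          by (intro sum.cong) auto
        then show ?thesis using that by (simp add: power2_eq_square)
      qed
      then show ?thesis by (simp add: sum_distrib_left)
    qed
    then show "0 \<le> (\<Sum>i<p. \<Sum>j<p. v i * v j * (SV i j - 2 * \<kappa>1 * of_bool (i = j)))"
      using SV_lower[of v] by (simp only: right_diff_distrib sum_subtractf)
  qed
  then obtain K where K: "\<forall>j<p. \<forall>k<p. SV j k - 2 * \<kappa>1 * of_bool (j = k) = (\<Sum>l<p. K j l * K k l)" by (elim exE)
  have "SV j k = (sqrt (2 * \<kappa>1))\<^sup>2 * of_bool (j = k) + (\<Sum>l<p. K j l * K k l)" if "j < p" "k < p" for j k
  proof -
    have "SV j k - 2 * \<kappa>1 * of_bool (j = k) = (\<Sum>l<p. K j l * K k l)" using K that by simp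
    then show ?thesis using kappa by (simp only: real_sqrt_pow2)
  qed
  then show ?thesis by (intro exI[of _ K] allI impI)
qed

text \<open>Row 0 stands for an arbitrary row of \<open>V\<close>; it exists only for 0 < n, hence
  that condition where the law of a row is used.\<close>

definition F :: "real \<Rightarrow> real" where
  "F t = measure MV {v\<in>space MV. \<forall>j\<in>{..<p}. \<bar>v (0, j)\<bar> \<le> t}"

lemma gauss_row0: "0 < n \<Longrightarrow> gauss MV {..<p} (\<lambda>j v. v (0, j)) SV"
  by (rule gauss_cong[OF gauss_reindex[OF gauss_MV, of "{..<p}" "\<lambda>j. (0, j)"]]) (auto simp: row_cov_def)

lemma F_eq:
  assumes "0 < n" and g: "gauss N {..<p} X SV"
  shows "measure N {\<omega>\<in>space N. \<forall>j\<in>{..<p}. \<bar>X j \<omega>\<bar> \<le> t} = F t"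
  using gauss_prob_all_le_eq[OF g gauss_row0[OF assms(1)], of "\<lambda>_. t"] by (simp add: F_def)

lemma F_range: "0 \<le> F t" "F t \<le> 1"
proof -
  interpret MV: prob_space MV by (rule prob_MV)
  show "0 \<le> F t" "F t \<le> 1" by (simp_all add: F_def)
qed

lemma F_neg: "0 < p \<Longrightarrow> t < 0 \<Longrightarrow> F t = 0"
proof -
  assume "0 < p" "t < 0"
  then have e: "{v\<in>space MV. \<forall>j\<in>{..<p}. \<bar>v (0, j)\<bar> \<le> t} = {}" by (force dest: bspec[of _ _ 0])
  show ?thesis by (simp only: F_def e measure_empty)
qed

lemma F_set: "0 < n \<Longrightarrow> {v\<in>space MV. \<forall>j\<in>{..<p}. \<bar>v (0, j)\<bar> \<le> t} \<in> sets MV"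
proof -
  assume "0 < n"
  then have [measurable]: "(\<lambda>v. v (0, j)) \<in> borel_measurable MV" if "j \<in> {..<p}" for j
    using gaussD(3)[OF gauss_row0 that] by simp
  show ?thesis by measurable
qed

lemma F_mono: "0 < n \<Longrightarrow> s \<le> t \<Longrightarrow> F s \<le> F t"
proof -
  assume "0 < n" "s \<le> t"
  interpret MV: prob_space MV by (rule prob_MV)
  show ?thesis unfolding F_def
    by (rule MV.finite_measure_mono[OF _ F_set]) (use \<open>0 < n\<close> \<open>s \<le> t\<close> in \<open>auto intro: order_trans\<close>)
qed

text \<open>A Lipschitz constant of \<open>F\<close>. The level L = sqrt (2 * ln p) makes p * exp (-
  L^2 / 2) equal to 1 in \<open>gauss_anticoncentration\<close>.\<close>

definition anticonc_const :: real where "anticonc_const = 58 * sqrt (2 * ln p) / sqrt (2 * \<kappa>1)"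

lemma anticonc_const_nonneg: "2 \<le> p \<Longrightarrow> 0 \<le> anticonc_const"
  using kappa by (simp add: anticonc_const_def)

lemma F_anticoncentration:
  assumes n: "0 < n" and p: "2 \<le> p" and e: "0 \<le> e"
  shows "F (t + e) \<le> F t + anticonc_const * e"
proof -
  obtain K where K: "\<forall>j<p. \<forall>k<p. SV j k = (sqrt (2 * \<kappa>1))\<^sup>2 * of_bool (j = k) + (\<Sum>l<p. K j l * K k l)"
    using SV_factor by (elim exE)
  define L where "L = sqrt (2 * ln p)"
  have lp: "ln (real p) \<ge> 1 / 2"
  proof -
    have "ln (2::real) \<ge> 1 / 2" using ln2_ge_two_thirds by simp
    also have "ln (2::real) \<le> ln (real p)" using p by (subst ln_le_cancel_iff) auto
    finally show ?thesis by simp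
  qed
  have L: "1 \<le> L" "L\<^sup>2 = 2 * ln p" using lp by (auto simp: L_def intro!: real_le_rsqrt)
  have "card {..<p} * exp (- L\<^sup>2 / 2) \<le> 1" using p unfolding L(2) by (simp add: exp_minus)
  from gauss_anticoncentration[OF gauss_row0[OF n] _ _ _ L(1) this e, of "{..<p}" "sqrt (2 * \<kappa>1)" K t] K kappa
  have "F (t + e) \<le> F t + 58 * e * L / sqrt (2 * \<kappa>1)" unfolding F_def by auto
  then show ?thesis by (simp add: anticonc_const_def L_def mult_ac)
qed

end

section \<open>The test as a function of independent coordinates\<close>

lemma measurable_PiM_index: "i \<in> I \<Longrightarrow> (\<lambda>f. f i) \<in> borel_measurable (\<Pi>\<^sub>M i\<in>I. borel)"
  by (rule measurable_component_singleton)

locale tiers = gaussian_two_sample M n p \<beta> D x y u \<Sigma> \<kappa>1 \<kappa>2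
  for M :: "'a measure" and n p :: nat and \<beta> :: "sample \<Rightarrow> real vec"
    and D :: "sample \<Rightarrow> (real vec \<times> real) measure"
    and x :: "sample \<Rightarrow> nat \<Rightarrow> 'a \<Rightarrow> real vec" and y u :: "sample \<Rightarrow> nat \<Rightarrow> 'a \<Rightarrow> real"
    and \<Sigma> :: "sample \<Rightarrow> real mat" and \<kappa>1 \<kappa>2 :: real +
  fixes \<eta> :: real and \<theta> :: "real mat \<Rightarrow> real vec \<Rightarrow> real \<Rightarrow> real vec"
    and \<pi> :: "nat \<Rightarrow> real mat \<Rightarrow> real vec \<Rightarrow> real \<Rightarrow> real vec"
  assumes n_pos: "0 < n" and p_ge: "2 \<le> p" and eta_pos: "0 < \<eta>"
    and theta_rule: "adds_rule \<eta> n p \<theta>" and pi_rule: "\<And>j. j < p \<Longrightarrow> adds_rule \<eta> n p (\<pi> j)"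
begin

text \<open>A point of the product space is a pair \<open>z = (v, r)\<close>: \<open>v (i, j)\<close> are the entries of \<open>Z - W \<Pi>\<^sub>*\<close>,
  \<open>r (Inl (i, l))\<close> those of \<open>W\<close>, and \<open>r (Inr i)\<close> is the noise \<open>u\<^sub>A + u\<^sub>B\<close> of the i-th row.
  The ADDS residual \<open>uh\<close> depends on \<open>r\<close> only.\<close>

definition Wm :: "(nat \<times> nat + nat \<Rightarrow> real) \<Rightarrow> real mat" where
  "Wm r = mat n p (\<lambda>a. r (Inl a))"

definition Yv :: "(nat \<times> nat + nat \<Rightarrow> real) \<Rightarrow> real vec" where
  "Yv r = vec n (\<lambda>i. (\<Sum>l<p. r (Inl (i, l)) * \<beta> SA $ l) + r (Inr i))"

definition Zm :: "(nat \<times> nat \<Rightarrow> real) \<times> (nat \<times> nat + nat \<Rightarrow> real) \<Rightarrow> real mat" where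
  "Zm z = mat n p (\<lambda>a. fst z a + (\<Sum>l<p. snd z (Inl (fst a, l)) * Pst l (snd a)))"

definition uh :: "(nat \<times> nat + nat \<Rightarrow> real) \<Rightarrow> nat \<Rightarrow> real" where
  "uh r i = Yv r $ i - (\<Sum>k<p. Wm r $$ (i, k) * adds \<theta> (Wm r) (Yv r) $ k)"

definition residual_norm :: "(nat \<times> nat + nat \<Rightarrow> real) \<Rightarrow> real" where
  "residual_norm r = sqrt (\<Sum>i<n. (uh r i)\<^sup>2)"

definition Pt :: "(nat \<times> nat \<Rightarrow> real) \<times> (nat \<times> nat + nat \<Rightarrow> real) \<Rightarrow> nat \<Rightarrow> nat \<Rightarrow> real" where
  "Pt z j k = adds (\<pi> j) (Wm (snd z)) (col (Zm z) j) $ k"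

definition Vh :: "(nat \<times> nat \<Rightarrow> real) \<times> (nat \<times> nat + nat \<Rightarrow> real) \<Rightarrow> nat \<Rightarrow> nat \<Rightarrow> real" where
  "Vh z i j = Zm z $$ (i, j) - (\<Sum>k<p. Wm (snd z) $$ (i, k) * Pt z j k)"

definition Vmap :: "'a \<Rightarrow> (nat \<times> nat \<Rightarrow> real) \<times> (nat \<times> nat + nat \<Rightarrow> real)" where
  "Vmap \<omega> = (\<lambda>a\<in>NP. Vf a \<omega>, \<lambda>a\<in>RI. Rf a \<omega>)"

abbreviation Zs where "Zs \<equiv> MV \<Otimes>\<^sub>M MR"

lemma prob_Zs: "prob_space Zs"
proof -
  interpret V: prob_space MV by (rule prob_MV)
  interpret R: prob_space MR by (rule prob_MR)
  interpret VR: pair_prob_space MV MR by standard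
  show ?thesis by (rule VR.prob_space_axioms)
qed

lemma sets_Zs[measurable_cong]: "sets Zs = sets (PV \<Otimes>\<^sub>M PR)"
  by (rule sets_pair_measure_cong) (auto simp: sets_MV sets_MR)

lemma Wm_carrier: "Wm r \<in> carrier_mat n p" and Yv_carrier: "Yv r \<in> carrier_vec n" and Zm_carrier: "Zm z \<in> carrier_mat n p"
  by (auto simp: Wm_def Yv_def Zm_def)

text \<open>The null hypothesis enters here: with equal coefficients the regression of Y on W has
  the exact form W \<beta> plus noise, so Y is a function of the second coordinate alone.\<close>

lemma design_eq:
  assumes w: "\<omega> \<in> space M"
  shows "W_mat n p x \<omega> = Wm (snd (Vmap \<omega>))" "Y_vec n y \<omega> = Yv (snd (Vmap \<omega>))" "Z_mat n p x \<omega> = Zm (Vmap \<omega>)"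
proof -
  have d: "design n p (x k) \<omega> $$ (i, j) = x k i \<omega> $ j" if "i < n" "j < p" for k i j
    using that unfolding design_def by (subst mat_of_rows_index) auto
  have dc: "dim_row (design n p (x k) \<omega>) = n" "dim_col (design n p (x k) \<omega>) = p" for k by (auto simp: design_def)
  show "W_mat n p x \<omega> = Wm (snd (Vmap \<omega>))"
    unfolding W_mat_def by (intro eq_matI) (auto simp: Wm_def Vmap_def Rf_def Wf_def d dc)
  show "Z_mat n p x \<omega> = Zm (Vmap \<omega>)"
    unfolding Z_mat_def by (intro eq_matI) (auto simp: Zm_def Vmap_def Rf_def Vf_def d dc intro!: sum.cong)
  show "Y_vec n y \<omega> = Yv (snd (Vmap \<omega>))"
  proof (rule eq_vecI)
    fix i assume "i < dim_vec (Yv (snd (Vmap \<omega>)))"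
    then have i: "i < n" by (simp add: Yv_def)
    have s: "x k i \<omega> \<bullet> \<beta> SA = (\<Sum>l<p. x k i \<omega> $ l * \<beta> SA $ l)" for k
      using coeff_dim[of SA] by (auto simp: scalar_prod_def lessThan_atLeast0)
    have "y SA i \<omega> + y SB i \<omega> = (x SA i \<omega> \<bullet> \<beta> SA + x SB i \<omega> \<bullet> \<beta> SA) + (u SA i \<omega> + u SB i \<omega>)"
      using linear[OF i w] null by simp
    also have "\<dots> = (\<Sum>l<p. Wf (i, l) \<omega> * \<beta> SA $ l) + Uf i \<omega>"
      by (simp add: s Wf_def Uf_def distrib_right sum.distrib)
    finally show "Y_vec n y \<omega> $ i = Yv (snd (Vmap \<omega>)) $ i"
      using i by (auto simp: Y_vec_def Yv_def Vmap_def Rf_def intro!: sum.cong)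
  qed (simp add: Y_vec_def Yv_def)
qed

lemma Vmap_measurable: "Vmap \<in> measurable M (PV \<Otimes>\<^sub>M PR)"
  unfolding Vmap_def[abs_def] by (intro measurable_Pair V_measurable R_measurable)

lemma prob_transfer:
  assumes "{z\<in>space Zs. P z} \<in> sets Zs"
  shows "measure M {\<omega>\<in>space M. P (Vmap \<omega>)} = measure Zs {z\<in>space Zs. P z}"
proof -
  have "Zs = distr M (PV \<Otimes>\<^sub>M PR) Vmap" using VR_law by (simp add: Vmap_def[abs_def])
  then have "measure Zs {z\<in>space Zs. P z} = measure (distr M (PV \<Otimes>\<^sub>M PR) Vmap) {z\<in>space Zs. P z}" by simp
  also have "\<dots> = measure M (Vmap -` {z\<in>space Zs. P z} \<inter> space M)"
    using assms by (intro measure_distr Vmap_measurable) (simp add: sets_Zs)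
  also have "Vmap -` {z\<in>space Zs. P z} \<inter> space M = {\<omega>\<in>space M. P (Vmap \<omega>)}"
    using measurable_space[OF Vmap_measurable] sets_eq_imp_space_eq[OF sets_Zs] by auto
  finally show ?thesis by simp
qed

lemma Wm_measurable: "Wm \<in> measurable PR (borel_mat n p)"
proof (rule measurable_borel_matI)
  show "(\<lambda>r. Wm r $$ (i, j)) \<in> borel_measurable PR" if "i < n" "j < p" for i j
    using that measurable_PiM_index[of "Inl (i, j)" RI] by (simp add: Wm_def InlI)
qed (rule Wm_carrier)

lemma Yv_measurable: "Yv \<in> measurable PR (borel_vec n)"
proof (rule measurable_borel_vecI)
  show "(\<lambda>r. Yv r $ i) \<in> borel_measurable PR" if i: "i < n" for i
  proof -
    have "(\<lambda>r. (\<Sum>l<p. r (Inl (i, l)) * \<beta> SA $ l) + r (Inr i)) \<in> borel_measurable PR"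
      using i by (intro borel_measurable_add borel_measurable_sum borel_measurable_times measurable_PiM_index) auto
    then show ?thesis using i by (simp add: Yv_def)
  qed
qed (rule Yv_carrier)

lemma Zm_index_measurable: "i < n \<Longrightarrow> j < p \<Longrightarrow> (\<lambda>z. Zm z $$ (i, j)) \<in> borel_measurable (PV \<Otimes>\<^sub>M PR)"
proof -
  assume i: "i < n" "j < p"
  have 1: "(\<lambda>z. fst z a) \<in> borel_measurable (PV \<Otimes>\<^sub>M PR)" if "a \<in> NP" for a
    by (rule measurable_compose[OF measurable_fst measurable_PiM_index[OF that]])
  have 2: "(\<lambda>z. snd z a) \<in> borel_measurable (PV \<Otimes>\<^sub>M PR)" if "a \<in> RI" for a
    by (rule measurable_compose[OF measurable_snd measurable_PiM_index[OF that]])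
  have "(\<lambda>z. fst z (i, j) + (\<Sum>l<p. snd z (Inl (i, l)) * Pst l j)) \<in> borel_measurable (PV \<Otimes>\<^sub>M PR)"
    using i by (intro borel_measurable_add borel_measurable_sum borel_measurable_times 1 2) auto
  then show ?thesis using i by (simp add: Zm_def)
qed

lemma Zcol_measurable: "j < p \<Longrightarrow> (\<lambda>z. col (Zm z) j) \<in> measurable (PV \<Otimes>\<^sub>M PR) (borel_vec n)"
proof (rule measurable_borel_vecI)
  assume j: "j < p"
  show "col (Zm z) j \<in> carrier_vec n" for z using Zm_carrier[of z] by (simp add: col_def)
  show "(\<lambda>z. col (Zm z) j $ i) \<in> borel_measurable (PV \<Otimes>\<^sub>M PR)" if "i < n" for i
  proof -
    have "col (Zm z) j $ i = Zm z $$ (i, j)" for z using Zm_carrier[of z] that j by simp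
    then show ?thesis using Zm_index_measurable[OF that j] by simp
  qed
qed

lemma adds_measurable:
  assumes "adds_rule \<eta> n p \<phi>"
  shows "(\<lambda>(W, v). adds \<phi> W v) \<in> measurable (borel_mat n p \<Otimes>\<^sub>M borel_vec n) (borel_vec p)"
  using assms by (simp add: adds_rule_def)

lemma uh_measurable: "i < n \<Longrightarrow> (\<lambda>r. uh r i) \<in> borel_measurable PR"
proof -
  assume i: "i < n"
  have "(\<lambda>r. (Wm r, Yv r)) \<in> measurable PR (borel_mat n p \<Otimes>\<^sub>M borel_vec n)"
    by (intro measurable_Pair Wm_measurable Yv_measurable)
  from measurable_compose[OF this adds_measurable[OF theta_rule]]
  have a: "(\<lambda>r. adds \<theta> (Wm r) (Yv r)) \<in> measurable PR (borel_vec p)" by simp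
  have 1: "(\<lambda>r. Wm r $$ (i, k)) \<in> borel_measurable PR" if "k < p" for k
    using i that measurable_PiM_index[of "Inl (i, k)" RI] by (simp add: Wm_def InlI)
  show ?thesis unfolding uh_def
    by (intro borel_measurable_diff borel_measurable_sum borel_measurable_times 1
      measurable_compose[OF a measurable_vec_index] measurable_compose[OF Yv_measurable measurable_vec_index] i) auto
qed

lemma residual_norm_measurable: "residual_norm \<in> borel_measurable PR"
proof -
  have [measurable]: "(\<lambda>r. uh r i) \<in> borel_measurable PR" if "i \<in> {..<n}" for i using uh_measurable that by simp
  show ?thesis unfolding residual_norm_def[abs_def] by measurable
qed

lemma Vh_measurable: "i < n \<Longrightarrow> j < p \<Longrightarrow> (\<lambda>z. Vh z i j) \<in> borel_measurable (PV \<Otimes>\<^sub>M PR)"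
proof -
  assume i: "i < n" and j: "j < p"
  have "(\<lambda>z. (Wm (snd z), col (Zm z) j)) \<in> measurable (PV \<Otimes>\<^sub>M PR) (borel_mat n p \<Otimes>\<^sub>M borel_vec n)"
    by (intro measurable_Pair measurable_compose[OF measurable_snd Wm_measurable] Zcol_measurable[OF j])
  from measurable_compose[OF this adds_measurable[OF pi_rule[OF j]]]
  have a: "(\<lambda>z. adds (\<pi> j) (Wm (snd z)) (col (Zm z) j)) \<in> measurable (PV \<Otimes>\<^sub>M PR) (borel_vec p)" by simp
  have 1: "(\<lambda>z. Wm (snd z) $$ (i, k)) \<in> borel_measurable (PV \<Otimes>\<^sub>M PR)" if "k < p" for k
    using i that measurable_compose[OF measurable_snd measurable_PiM_index[of "Inl (i, k)" RI], of PV] by (simp add: Wm_def InlI)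
  show ?thesis unfolding Vh_def Pt_def
    by (intro borel_measurable_diff borel_measurable_sum borel_measurable_times 1
      measurable_compose[OF a measurable_vec_index] Zm_index_measurable i j) auto
qed

section \<open>Statistic, covariance estimate and rejection in coordinates\<close>

definition Tz :: "(nat \<times> nat \<Rightarrow> real) \<times> (nat \<times> nat + nat \<Rightarrow> real) \<Rightarrow> real" where
  "Tz z = T_stat \<theta> \<pi> (Wm (snd z)) (Zm z) (Yv (snd z))"

definition Qz :: "(nat \<times> nat \<Rightarrow> real) \<times> (nat \<times> nat + nat \<Rightarrow> real) \<Rightarrow> real mat" where
  "Qz z = Q_hat \<pi> (Wm (snd z)) (Zm z)"

lemma adds_theta_carrier: "adds \<theta> (Wm r) (Yv r) \<in> carrier_vec p"
  by (rule adds_feasible(1)[OF theta_rule Wm_carrier Yv_carrier n_pos less_imp_le[OF eta_pos]])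

lemma Vhat_index:
  assumes "i < n" "j < p"
  shows "(Zm z - Wm (snd z) * Pi_tilde \<pi> (Wm (snd z)) (Zm z)) $$ (i, j) = Vh z i j"
    and "Zm z - Wm (snd z) * Pi_tilde \<pi> (Wm (snd z)) (Zm z) \<in> carrier_mat n p"
proof -
  have P: "Pi_tilde \<pi> (Wm (snd z)) (Zm z) \<in> carrier_mat p p"
    using Wm_carrier[of "snd z"] Zm_carrier[of z] by (auto simp: Pi_tilde_def)
  then show "Zm z - Wm (snd z) * Pi_tilde \<pi> (Wm (snd z)) (Zm z) \<in> carrier_mat n p"
    using Wm_carrier[of "snd z"] Zm_carrier[of z] by auto
  have ix: "Pi_tilde \<pi> (Wm (snd z)) (Zm z) $$ (k, j) = Pt z j k" if "k < p" for k
    using that assms(2) Wm_carrier[of "snd z"] Zm_carrier[of z] unfolding Pi_tilde_def Pt_def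
    by (subst mat_of_cols_index) auto
  have "(Wm (snd z) * Pi_tilde \<pi> (Wm (snd z)) (Zm z)) $$ (i, j) = (\<Sum>k<p. Wm (snd z) $$ (i, k) * Pt z j k)"
    using assms P Wm_carrier[of "snd z"] by (auto simp: scalar_prod_def lessThan_atLeast0 ix intro!: sum.cong)
  then show "(Zm z - Wm (snd z) * Pi_tilde \<pi> (Wm (snd z)) (Zm z)) $$ (i, j) = Vh z i j"
    using assms P Wm_carrier[of "snd z"] Zm_carrier[of z] by (simp add: Vh_def)
qed

lemma residual_index: "i < n \<Longrightarrow> (Yv r - Wm r *\<^sub>v adds \<theta> (Wm r) (Yv r)) $ i = uh r i"
  using Wm_carrier[of r] Yv_carrier[of r] mult_mat_vec_index_sum[OF Wm_carrier adds_theta_carrier, of i r] by (simp add: uh_def)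

lemma sigma_hat_eq: "sigma_hat \<theta> (Wm r) (Yv r) = residual_norm r / sqrt n"
proof -
  have d: "dim_vec (Yv r - Wm r *\<^sub>v adds \<theta> (Wm r) (Yv r)) = n" "dim_row (Wm r) = n"
    using Wm_carrier[of r] by auto
  have "l2_norm (Yv r - Wm r *\<^sub>v adds \<theta> (Wm r) (Yv r)) = residual_norm r"
    unfolding l2_norm_def d(1) residual_norm_def by (intro arg_cong[where f = sqrt] sum.cong refl) (simp only: residual_index lessThan_iff)
  then show ?thesis unfolding sigma_hat_def d(2) by simp
qed

text \<open>Since sqrt n times \<open>sigma_hat\<close> is the residual norm, the statistic is the
  maximum norm of the transpose of \<open>Vh\<close> applied to the normalised residual. Clearing
  the denominator needs a nonzero residual.\<close>

lemma Tz_le_iff: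
  assumes N: "residual_norm (snd z) \<noteq> 0" and t: "0 \<le> t"
  shows "Tz z \<le> t \<longleftrightarrow> (\<forall>j<p. \<bar>\<Sum>i<n. Vh z i j * uh (snd z) i\<bar> \<le> t * residual_norm (snd z))"
proof -
  let ?V = "Zm z - Wm (snd z) * Pi_tilde \<pi> (Wm (snd z)) (Zm z)"
  let ?U = "Yv (snd z) - Wm (snd z) *\<^sub>v adds \<theta> (Wm (snd z)) (Yv (snd z))"
  have V: "?V \<in> carrier_mat n p" using Vhat_index(2)[of 0 0] n_pos p_ge by simp
  have U: "dim_vec ?U = n" "dim_row (Wm (snd z)) = n" using Wm_carrier[of "snd z"] by auto
  have Np: "residual_norm (snd z) > 0" using N by (simp add: residual_norm_def sum_nonneg less_le)
  define X where "X = transpose_mat ?V *\<^sub>v ?U"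
  have ix: "X $ j = (\<Sum>i<n. Vh z i j * uh (snd z) i)" if "j < p" for j
  proof -
    have "X $ j = (\<Sum>i\<in>{0..<n}. ?V $$ (i, j) * ?U $ i)"
      unfolding X_def using V U that by (auto simp: scalar_prod_def intro!: sum.cong)
    also have "\<dots> = (\<Sum>i<n. Vh z i j * uh (snd z) i)"
      unfolding lessThan_atLeast0 using that by (intro sum.cong) (auto simp only: Vhat_index(1) residual_index atLeastLessThan_iff)
    finally show ?thesis .
  qed
  have "dim_vec X = p" unfolding X_def using V by auto
  then have "linf_norm X \<le> t * residual_norm (snd z) \<longleftrightarrow> (\<forall>j<p. \<bar>\<Sum>i<n. Vh z i j * uh (snd z) i\<bar> \<le> t * residual_norm (snd z))"
    using t Np by (simp add: linf_norm_le_iff ix)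
  moreover have "Tz z = linf_norm X / residual_norm (snd z)"
    unfolding X_def Tz_def T_stat_def sigma_hat_eq U(2) using n_pos by simp
  ultimately show ?thesis using Np by (simp add: divide_le_eq)
qed

lemma Tz_nonneg: "0 \<le> Tz z"
proof -
  have "0 \<le> linf_norm v" for v using linf_norm_le_iff[of v "linf_norm v"] by simp
  moreover have "0 \<le> residual_norm r" for r by (simp add: residual_norm_def sum_nonneg)
  ultimately show ?thesis unfolding Tz_def T_stat_def sigma_hat_eq by simp
qed

text \<open>For fixed data, the rows of \<open>Vh\<close> weighted by independent standard normal
  multipliers and divided by sqrt n have covariance exactly \<open>Qz z\<close>. So
  \<open>Qz z\<close> is a covariance matrix for every data point.\<close>

lemma Qz_facts:
  shows "Qz z \<in> carrier_mat p p" and "i < p \<Longrightarrow> j < p \<Longrightarrow> Qz z $$ (i, j) = Qz z $$ (j, i)"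
    and "gauss (std_gauss {..<n}) {..<p} (\<lambda>j g. \<Sum>i<n. Vh z i j / sqrt n * g i) (\<lambda>i j. Qz z $$ (i, j))"
proof -
  let ?V = "Zm z - Wm (snd z) * Pi_tilde \<pi> (Wm (snd z)) (Zm z)"
  have V: "?V \<in> carrier_mat n p" using Vhat_index(2)[of 0 0] n_pos p_ge by simp
  show c: "Qz z \<in> carrier_mat p p" using V by (auto simp: Qz_def Q_hat_def Let_def)
  have q: "Qz z $$ (j, k) = (\<Sum>i<n. Vh z i j * Vh z i k) / n" if "j < p" "k < p" for j k
  proof -
    have "Qz z $$ (j, k) = (\<Sum>i<n. ?V $$ (i, j) * ?V $$ (i, k)) / n"
      using V that unfolding Qz_def Q_hat_def Let_def by (metis (no_types, lifting) carrier_matD index_mat(1) case_prod_conv)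
    also have "(\<Sum>i<n. ?V $$ (i, j) * ?V $$ (i, k)) = (\<Sum>i<n. Vh z i j * Vh z i k)"
      using that by (intro sum.cong) (auto simp only: Vhat_index(1) lessThan_iff)
    finally show ?thesis .
  qed
  show "i < p \<Longrightarrow> j < p \<Longrightarrow> Qz z $$ (i, j) = Qz z $$ (j, i)" by (simp add: q mult.commute)
  show "gauss (std_gauss {..<n}) {..<p} (\<lambda>j g. \<Sum>i<n. Vh z i j / sqrt n * g i) (\<lambda>i j. Qz z $$ (i, j))"
  proof (rule gauss_cong[OF gauss_linear_std[of "{..<n}" "{..<p}" "\<lambda>j i. Vh z i j / sqrt n"]])
    show "Qz z $$ (i, j) = (\<Sum>ia<n. Vh z ia i / sqrt n * (Vh z ia j / sqrt n))" if "i \<in> {..<p}" "j \<in> {..<p}" for i j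
      using that q[of i j] by (simp add: sum_divide_distrib)
  qed auto
qed

text \<open>Since \<open>Qz z\<close> is the Gram matrix of the columns of \<open>Vh z\<close> divided by \<open>n\<close>, \<open>H t z\<close> is \<open>Gam t (Qz z)\<close>, with the normal vector
  realised through \<open>n\<close> independent standard normal multipliers.\<close>

definition Hset :: "real \<Rightarrow> (((nat \<times> nat \<Rightarrow> real) \<times> (nat \<times> nat + nat \<Rightarrow> real)) \<times> (nat \<Rightarrow> real)) set" where
  "Hset t = {w \<in> space (Zs \<Otimes>\<^sub>M std_gauss {..<n}). \<forall>j\<in>{..<p}. \<bar>\<Sum>i<n. Vh (fst w) i j * snd w i\<bar> \<le> t * sqrt n}"

definition H :: "real \<Rightarrow> (nat \<times> nat \<Rightarrow> real) \<times> (nat \<times> nat + nat \<Rightarrow> real) \<Rightarrow> real" where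
  "H t z = measure (std_gauss {..<n}) {g\<in>space (std_gauss {..<n}). \<forall>j\<in>{..<p}. \<bar>\<Sum>i<n. Vh z i j * g i\<bar> \<le> t * sqrt n}"

lemma Vh_measurable_Zs: "i < n \<Longrightarrow> j < p \<Longrightarrow> (\<lambda>z. Vh z i j) \<in> borel_measurable Zs"
  using Vh_measurable by (simp add: measurable_cong_sets[OF sets_Zs refl])

lemma std_gauss_index: "i \<in> I \<Longrightarrow> (\<lambda>g. g i) \<in> borel_measurable (std_gauss I)"
  using measurable_PiM_index[of i I] by (simp add: measurable_cong_sets[OF sets_std_gauss refl])

lemma Hset_sets: "Hset t \<in> sets (Zs \<Otimes>\<^sub>M std_gauss {..<n})"
proof -
  have [measurable]: "(\<lambda>w. \<Sum>i<n. Vh (fst w) i j * snd w i) \<in> borel_measurable (Zs \<Otimes>\<^sub>M std_gauss {..<n})" if "j \<in> {..<p}" for j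
    by (intro borel_measurable_sum borel_measurable_times measurable_compose[OF measurable_fst Vh_measurable_Zs]
      measurable_compose[OF measurable_snd std_gauss_index]) (use that in auto)
  show ?thesis unfolding Hset_def by measurable
qed

lemma H_section: "z \<in> space Zs \<Longrightarrow> H t z = measure (std_gauss {..<n}) (Pair z -` Hset t)"
  unfolding H_def Hset_def by (rule arg_cong[where f = "measure _"]) (auto simp: space_pair_measure)

lemma H_measurable: "H t \<in> borel_measurable Zs"
proof -
  have "(\<lambda>z. measure (std_gauss {..<n}) (Pair z -` Hset t)) \<in> borel_measurable Zs"
    by (rule measurable_prob_section[OF prob_Zs prob_space_std_gauss Hset_sets])
  then show ?thesis by (simp add: H_section cong: measurable_cong)
qed

lemma H_range: "0 \<le> H t z" "H t z \<le> 1"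
proof -
  interpret G: prob_space "std_gauss {..<n}" by (rule prob_space_std_gauss)
  show "0 \<le> H t z" "H t z \<le> 1" by (simp_all add: H_def)
qed

lemma Gam_Qz: "Gam t (Qz z) = (if 0 \<le> t then H t z else 0)"
proof -
  have "\<bar>\<Sum>i<n. Vh z i j / sqrt n * g i\<bar> \<le> t \<longleftrightarrow> \<bar>\<Sum>i<n. Vh z i j * g i\<bar> \<le> t * sqrt n" for j g
  proof -
    have "(\<Sum>i<n. Vh z i j / sqrt n * g i) = (\<Sum>i<n. Vh z i j * g i) / sqrt n" by (simp add: sum_divide_distrib)
    then show ?thesis using n_pos by (simp add: divide_le_eq)
  qed
  then show ?thesis
    using Gam_eq[OF Qz_facts(1)[of z] Qz_facts(2)[where z = z] Qz_facts(3)[of z], of t] unfolding H_def by simp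
qed

lemma reject_iff:
  assumes "0 < q" "q < 1"
  shows "Gam_inv q (Qz z) < Tz z \<longleftrightarrow> (\<exists>r\<in>\<rat>. r < Tz z \<and> q \<le> (if 0 \<le> r then H r z else 0))"
  using less_Gam_inv_iff[OF Qz_facts(1)[of z] Qz_facts(2)[where z = z] Qz_facts(3)[of z] assms, of "Tz z"] by (simp add: Gam_Qz)

lemma H_mono: "s \<le> t \<Longrightarrow> H s z \<le> H t z" if "0 \<le> s"
  using Gam_mono[OF Qz_facts(1)[of z] Qz_facts(2)[where z = z] Qz_facts(3)[of z], of s t] that by (simp add: Gam_Qz)

lemma Tz_measurable: "Tz \<in> borel_measurable Zs"
proof (rule borel_measurable_iff_le[THEN iffD2], intro allI)
  fix t
  have [measurable]: "(\<lambda>z. \<Sum>i<n. Vh z i j * uh (snd z) i) \<in> borel_measurable Zs" if "j \<in> {..<p}" for j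
    by (intro borel_measurable_sum borel_measurable_times Vh_measurable_Zs measurable_compose[OF measurable_snd, of _ MR])
      (use that uh_measurable in \<open>auto simp: measurable_cong_sets[OF sets_MR refl]\<close>)
  have [measurable]: "(\<lambda>z. residual_norm (snd z)) \<in> borel_measurable Zs"
    by (rule measurable_compose[OF measurable_snd, of _ MR]) (use residual_norm_measurable in \<open>simp add: measurable_cong_sets[OF sets_MR refl]\<close>)
  \<comment> \<open>Division by zero yields 0, so a vanishing residual gives the statistic
    0.\<close>
  have T0: "Tz z = 0" if "residual_norm (snd z) = 0" for z using that by (simp add: Tz_def T_stat_def sigma_hat_eq)
  have "{z \<in> space Zs. Tz z \<le> t} = {z \<in> space Zs. 0 \<le> t \<and> (residual_norm (snd z) = 0 \<or> (residual_norm (snd z) \<noteq> 0 \<and> (\<forall>j\<in>{..<p}. \<bar>\<Sum>i<n. Vh z i j * uh (snd z) i\<bar> \<le> t * residual_norm (snd z))))}"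
    using Tz_le_iff[of _ t] T0 Tz_nonneg by (auto simp: order_trans[OF Tz_nonneg])
  also have "\<dots> \<in> sets Zs" by measurable
  finally show "{z \<in> space Zs. Tz z \<le> t} \<in> sets Zs" .
qed

lemma reject_sets:
  assumes "0 < q" "q < 1"
  shows "{z\<in>space Zs. Gam_inv q (Qz z) < Tz z} \<in> sets Zs"
proof -
  note [measurable] = Tz_measurable H_measurable
  have "{z\<in>space Zs. Gam_inv q (Qz z) < Tz z} = (\<Union>r\<in>\<rat>. {z\<in>space Zs. r < Tz z \<and> q \<le> (if 0 \<le> r then H r z else 0)})"
    using reject_iff[OF assms] by auto
  also have "\<dots> \<in> sets Zs"
    by (intro sets.countable_UN'' countable_rat) measurable
  finally show ?thesis .
qed

end

section \<open>The good event and the law of the statistic\<close>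

text \<open>Fubini with the second coordinate held fixed. It serves twice: with the residual fixed
  in the numerator, and with multipliers fixed in the critical value, where \<open>B\<close>
  contains the vectors of atypical norm or inner product.\<close>

lemma prob_pair_le_except:
  assumes M: "prob_space M" and N: "prob_space N" and A: "A \<in> sets (M \<Otimes>\<^sub>M N)" and B: "B \<in> sets N" and c: "0 \<le> c"
    and le: "\<And>y. y \<in> space N \<Longrightarrow> y \<notin> B \<Longrightarrow> measure M {x\<in>space M. (x, y) \<in> A} \<le> c"
  shows "measure (M \<Otimes>\<^sub>M N) A \<le> c + measure N B"
proof -
  interpret M: prob_space M by fact
  interpret N: prob_space N by fact
  interpret P: pair_prob_space M N by standard
  interpret Q: pair_prob_space N M by standard
  let ?s = "\<lambda>(x, y). (y, x)"
  let ?A = "?s -` A \<inter> space (N \<Otimes>\<^sub>M M)"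
  have ms: "?s \<in> measurable (N \<Otimes>\<^sub>M M) (M \<Otimes>\<^sub>M N)" by (rule measurable_pair_swap')
  have A': "?A \<in> sets (N \<Otimes>\<^sub>M M)" by (rule measurable_sets[OF ms A])
  have "measure (M \<Otimes>\<^sub>M N) A = measure (distr (N \<Otimes>\<^sub>M M) (M \<Otimes>\<^sub>M N) ?s) A"
    using P.distr_pair_swap by simp
  also have "\<dots> = measure (N \<Otimes>\<^sub>M M) ?A" by (rule measure_distr[OF ms A])
  also have "\<dots> = (\<integral>y. measure M (Pair y -` ?A) \<partial>N)" by (rule prob_pair_integral[OF N M A'])
  also have "\<dots> \<le> (\<integral>y. c + indicator B y \<partial>N)"
  proof (rule integral_mono)
    show "integrable N (\<lambda>y. measure M (Pair y -` ?A))"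
      by (rule N.integrable_const_bound[of _ 1], simp, rule measurable_prob_section[OF N M A'])
    show "integrable N (\<lambda>y. c + indicator B y)" using B by (auto intro!: integrable_real_indicator simp: N.emeasure_eq_measure)
    fix y assume y: "y \<in> space N"
    have eq: "Pair y -` ?A = {x\<in>space M. (x, y) \<in> A}" using y by (auto simp: space_pair_measure)
    show "measure M (Pair y -` ?A) \<le> c + indicator B y"
    proof (cases "y \<in> B")
      case True
      then have i: "indicator B y = (1 :: real)" by simp
      show ?thesis unfolding eq i using M.prob_le_1[of "{x\<in>space M. (x, y) \<in> A}"] c by linarith
    next
      case False
      then show ?thesis unfolding eq using le[OF y] by simp
    qed
  qed
  also have "\<dots> = c + measure N B" using B by (subst Bochner_Integration.integral_add) (auto simp: N.prob_space N.emeasure_eq_measure)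
  finally show ?thesis .
qed

lemma prob_pair_fst:
  assumes "prob_space M" "prob_space N" "{x\<in>space M. P x} \<in> sets M"
  shows "measure (M \<Otimes>\<^sub>M N) {z\<in>space (M \<Otimes>\<^sub>M N). P (fst z)} = measure M {x\<in>space M. P x}"
proof -
  have "{z\<in>space (M \<Otimes>\<^sub>M N). P (fst z)} = {x\<in>space M. P x} \<times> space N" by (auto simp: space_pair_measure)
  then show ?thesis using prob_pair_times[OF assms(1,2,3) sets.top] prob_space.prob_space[OF assms(2)] by simp
qed

lemma prob_pair_snd:
  assumes "prob_space M" "prob_space N" "{x\<in>space N. P x} \<in> sets N"
  shows "measure (M \<Otimes>\<^sub>M N) {z\<in>space (M \<Otimes>\<^sub>M N). P (snd z)} = measure N {x\<in>space N. P x}"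
proof -
  have "{z\<in>space (M \<Otimes>\<^sub>M N). P (snd z)} = space M \<times> {x\<in>space N. P x}" by (auto simp: space_pair_measure)
  then show ?thesis using prob_pair_times[OF assms(1,2) sets.top assms(3)] prob_space.prob_space[OF assms(1)] by simp
qed

context tiers
begin

section \<open>Typical behaviour of the design and of the projection residual\<close>

abbreviation w where "w r i k \<equiv> r (Inl (i, k))"

lemma MV_index: "i < n \<Longrightarrow> j < p \<Longrightarrow> (\<lambda>v. v (i, j)) \<in> borel_measurable MV"
  using measurable_PiM_index[of "(i, j)" NP] by (simp add: measurable_cong_sets[OF sets_MV refl])

lemma MR_index: "i < n \<Longrightarrow> j < p \<Longrightarrow> (\<lambda>r. w r i j) \<in> borel_measurable MR"
  using measurable_PiM_index[of "Inl (i, j)" RI] by (simp add: measurable_cong_sets[OF sets_MR refl] InlI)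

definition noise_event where "noise_event z \<longleftrightarrow> (\<forall>j\<in>{..<p}. \<forall>k\<in>{..<p}.
  \<bar>\<Sum>i<n. w (snd z) i k * fst z (i, j)\<bar> \<le> \<eta> * sqrt n * sqrt (\<Sum>i<n. (fst z (i, j))\<^sup>2))"

text \<open>\<open>e\<close> is a relative accuracy, since 2 * \<kappa>2 bounds all diagonal entries
  of \<open>SW\<close>.\<close>

definition gram_event :: "real \<Rightarrow> (nat \<times> nat + nat \<Rightarrow> real) \<Rightarrow> bool" where "gram_event e r \<longleftrightarrow> (\<forall>j\<in>{..<p}. \<forall>k\<in>{..<p}. \<bar>(\<Sum>i<n. w r i j * w r i k) / n - SW j k\<bar> \<le> 2 * \<kappa>2 * e)"

definition norm_event where "norm_event v \<longleftrightarrow> (\<forall>j\<in>{..<p}. (\<Sum>i<n. (v (i, j))\<^sup>2) \<le> 4 * \<kappa>2 * n)"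

lemma event_sets:
  "{z\<in>space Zs. \<not> noise_event z} \<in> sets Zs" "{r\<in>space MR. \<not> gram_event e r} \<in> sets MR" "{v\<in>space MV. \<not> norm_event v} \<in> sets MV"
proof -
  have 1[measurable]: "(\<lambda>z. fst z (i, j)) \<in> borel_measurable Zs" if "i \<in> {..<n}" "j \<in> {..<p}" for i j
    by (rule measurable_compose[OF measurable_fst MV_index]) (use that in auto)
  have 2[measurable]: "(\<lambda>z. w (snd z) i j) \<in> borel_measurable Zs" if "i \<in> {..<n}" "j \<in> {..<p}" for i j
    by (rule measurable_compose[OF measurable_snd MR_index]) (use that in auto)
  show "{z\<in>space Zs. \<not> noise_event z} \<in> sets Zs" unfolding noise_event_def by measurable
  have [measurable]: "(\<lambda>v. v (i, j)) \<in> borel_measurable MV" if "i \<in> {..<n}" "j \<in> {..<p}" for i j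
    using that by (auto intro: MV_index)
  have [measurable]: "(\<lambda>r. w r i j) \<in> borel_measurable MR" if "i \<in> {..<n}" "j \<in> {..<p}" for i j
    using that by (auto intro: MR_index)
  show "{r\<in>space MR. \<not> gram_event e r} \<in> sets MR" unfolding gram_event_def by measurable
  show "{v\<in>space MV. \<not> norm_event v} \<in> sets MV" unfolding norm_event_def by measurable
qed

lemma prob_union_le:
  fixes c :: real
  assumes "prob_space N" "finite I" "\<And>i. i \<in> I \<Longrightarrow> A i \<in> sets N" "\<And>i. i \<in> I \<Longrightarrow> measure N (A i) \<le> c"
  shows "measure N (\<Union>i\<in>I. A i) \<le> card I * c"
proof -
  interpret N: prob_space N by fact
  have "measure N (\<Union>i\<in>I. A i) \<le> (\<Sum>i\<in>I. measure N (A i))" using assms by (intro measure_UNION_le) auto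
  also have "\<dots> \<le> (\<Sum>i\<in>I. c)" by (intro sum_mono assms)
  finally show ?thesis by simp
qed

lemma SW_diag_nonneg: "j < p \<Longrightarrow> 0 \<le> SW j j"
  using gauss_var_nonneg[OF gauss_MR, of "(0, j)"] n_pos by (simp add: row_cov_def)

lemma W_combo_tail:
  assumes A: "(\<Sum>i<n. g i * g i) \<le> A" "0 < A" and m: "0 \<le> m"
  shows "measure MR {r\<in>space MR. \<exists>k\<in>{..<p}. m < \<bar>\<Sum>i<n. g i * w r i k\<bar>} \<le> 2 * p * exp (- m\<^sup>2 / (8 * \<kappa>2 * A))"
proof -
  have "gauss MR {..<p} (\<lambda>k r. \<Sum>i<n. g i * w r i k) (\<lambda>j k. (\<Sum>i<n. g i * g i) * SW j k)"
    by (rule gauss_row_combo[OF gauss_MR])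
  moreover have "(\<Sum>i<n. g i * g i) * SW j j \<le> A * (2 * \<kappa>2)" if "j \<in> {..<p}" for j
    using that A kappa SW_diag_le[of j] SW_diag_nonneg[of j] by (intro mult_mono') (auto intro!: sum_nonneg)
  ultimately have "measure MR {r\<in>space MR. \<exists>k\<in>{..<p}. m < \<bar>\<Sum>i<n. g i * w r i k\<bar>} \<le> 2 * real (card {..<p}) * exp (- m\<^sup>2 / (4 * (A * (2 * \<kappa>2))))"
    using A kappa m by (intro gauss_max_tail) auto
  then show ?thesis by (simp add: mult_ac)
qed

lemma V_combo_tail:
  assumes e: "(\<Sum>i<n. e i * e i) = 1" and m: "0 \<le> m"
  shows "measure MV {v\<in>space MV. \<exists>j\<in>{..<p}. m < \<bar>\<Sum>i<n. e i * v (i, j)\<bar>} \<le> 2 * p * exp (- m\<^sup>2 / (8 * \<kappa>2))"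
proof -
  have "gauss MV {..<p} (\<lambda>j v. \<Sum>i<n. e i * v (i, j)) SV"
    by (rule gauss_cong[OF gauss_row_combo[OF gauss_MV, of e]]) (auto simp: e)
  then have "measure MV {v\<in>space MV. \<exists>j\<in>{..<p}. m < \<bar>\<Sum>i<n. e i * v (i, j)\<bar>} \<le> 2 * real (card {..<p}) * exp (- m\<^sup>2 / (4 * (2 * \<kappa>2)))"
    using kappa m SV_diag_le by (intro gauss_max_tail) auto
  then show ?thesis by (simp add: mult_ac)
qed

text \<open>For fixed \<open>v\<close> the correlations are normal with variance proportional to the
  squared column norm, and the threshold carries the same norm. The bound is therefore free of
  \<open>v\<close>, and a union over p columns and p correlations finishes.\<close>

lemma noise_event_prob: "measure Zs {z\<in>space Zs. \<not> noise_event z} \<le> p * (2 * p * exp (- (real n * \<eta>\<^sup>2) / (8 * \<kappa>2)))"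
proof (rule prob_pair_le[OF prob_MV prob_MR event_sets(1)])
  fix v assume v: "v \<in> space MV"
  interpret R: prob_space MR by (rule prob_MR)
  define A where "A j = {r\<in>space MR. \<exists>k\<in>{..<p}. \<eta> * sqrt n * sqrt (\<Sum>i<n. (v (i, j))\<^sup>2) < \<bar>\<Sum>i<n. v (i, j) * w r i k\<bar>}" for j
  have [measurable]: "(\<lambda>r. w r i j) \<in> borel_measurable MR" if "i \<in> {..<n}" "j \<in> {..<p}" for i j
    using that by (auto intro: MR_index)
  have sA: "A j \<in> sets MR" for j unfolding A_def by measurable
  have "Pair v -` {z\<in>space Zs. \<not> noise_event z} = (\<Union>j\<in>{..<p}. A j)"
    using v by (auto simp: noise_event_def A_def space_pair_measure not_le mult.commute[of "w _ _ _"])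
  also have "measure MR \<dots> \<le> card {..<p} * (2 * p * exp (- (real n * \<eta>\<^sup>2) / (8 * \<kappa>2)))"
  proof (rule prob_union_le[OF prob_MR _ sA])
    fix j assume "j \<in> {..<p}"
    show "measure MR (A j) \<le> 2 * p * exp (- (real n * \<eta>\<^sup>2) / (8 * \<kappa>2))"
    proof (cases "(\<Sum>i<n. (v (i, j))\<^sup>2) = 0")
      \<comment> \<open>A zero column has threshold and correlations 0, excluded by the strict
        inequality; the tail bound needs a positive variance bound.\<close>
      case True
      then have "\<And>i. i < n \<Longrightarrow> v (i, j) = 0" by (auto simp: sum_nonneg_eq_0_iff)
      then have "A j = {}" by (simp add: A_def)
      then show ?thesis by simp
    next
      case False
      let ?A = "\<Sum>i<n. (v (i, j))\<^sup>2"
      have p: "0 < ?A" using False by (simp add: sum_nonneg less_le)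
      have "measure MR (A j) \<le> 2 * p * exp (- (\<eta> * sqrt n * sqrt ?A)\<^sup>2 / (8 * \<kappa>2 * ?A))"
        unfolding A_def using p eta_pos by (intro W_combo_tail) (auto simp: power2_eq_square)
      also have "(\<eta> * sqrt n * sqrt ?A)\<^sup>2 = n * \<eta>\<^sup>2 * ?A" using p by (simp add: power_mult_distrib)
      also have "- (n * \<eta>\<^sup>2 * ?A) / (8 * \<kappa>2 * ?A) = - (real n * \<eta>\<^sup>2) / (8 * \<kappa>2)" using p by simp
      finally show ?thesis .
    qed
  qed simp
  finally show "measure MR (Pair v -` {z\<in>space Zs. \<not> noise_event z}) \<le> p * (2 * p * exp (- (real n * \<eta>\<^sup>2) / (8 * \<kappa>2)))" by simp
qed

text \<open>The mean of the sum of squares is at most 2 * \<kappa>2 * n, so leaving the event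
  requires a relative deviation of at least 1.\<close>

lemma norm_event_prob: "measure MV {v\<in>space MV. \<not> norm_event v} \<le> p * (2 * exp (- real n / 16))"
proof -
  interpret V: prob_space MV by (rule prob_MV)
  define A where "A j = {v\<in>space MV. 4 * \<kappa>2 * n < (\<Sum>i<n. (v (i, j))\<^sup>2)}" for j
  have [measurable]: "(\<lambda>v. v (i, j)) \<in> borel_measurable MV" if "i \<in> {..<n}" "j \<in> {..<p}" for i j
    using that by (auto intro: MV_index)
  have sA: "A j \<in> sets MV" if "j \<in> {..<p}" for j unfolding A_def using that by measurable
  have "{v\<in>space MV. \<not> norm_event v} = (\<Union>j\<in>{..<p}. A j)" by (auto simp: norm_event_def A_def not_le)
  also have "measure MV \<dots> \<le> card {..<p} * (2 * exp (- real n / 16))"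
  proof (rule prob_union_le[OF prob_MV _ sA])
    fix j assume j: "j \<in> {..<p}"
    have c: "0 \<le> SV j j" using gauss_var_nonneg[OF gauss_row0[OF n_pos] j] .
    have g: "gauss MV {..<n} (\<lambda>i v. v (i, j)) (\<lambda>i i'. SV j j * of_bool (i = i'))"
      by (rule gauss_cong[OF gauss_reindex[OF gauss_MV, of "{..<n}" "\<lambda>i. (i, j)"]]) (use j in \<open>auto simp: row_cov_def\<close>)
    have sub: "A j \<subseteq> {v\<in>space MV. SV j j * card {..<n} * 1 < \<bar>(\<Sum>i<n. (v (i, j))\<^sup>2) - SV j j * card {..<n}\<bar>}"
    proof
      fix v assume v: "v \<in> A j"
      have "SV j j * n \<le> 2 * \<kappa>2 * n" using SV_diag_le[of j] j by (intro mult_right_mono) auto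
      moreover have "4 * \<kappa>2 * n < (\<Sum>i<n. (v (i, j))\<^sup>2)" using v by (simp add: A_def)
      ultimately have "SV j j * n < (\<Sum>i<n. (v (i, j))\<^sup>2) - SV j j * n" by linarith
      also have "\<dots> \<le> \<bar>(\<Sum>i<n. (v (i, j))\<^sup>2) - SV j j * n\<bar>" by (rule abs_ge_self)
      finally show "v \<in> {v\<in>space MV. SV j j * card {..<n} * 1 < \<bar>(\<Sum>i<n. (v (i, j))\<^sup>2) - SV j j * card {..<n}\<bar>}"
        using v by (simp add: A_def)
    qed
    then have "measure MV (A j) \<le> measure MV {v\<in>space MV. SV j j * card {..<n} * 1 < \<bar>(\<Sum>i<n. (v (i, j))\<^sup>2) - SV j j * card {..<n}\<bar>}"
      by (rule V.finite_measure_mono) (use j in measurable)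
    also have "\<dots> \<le> 2 * exp (- (real (card {..<n}) * 1\<^sup>2) / 16)" by (rule gauss_iid_sum_squares[OF g c]) auto
    finally show "measure MV (A j) \<le> 2 * exp (- real n / 16)" by simp
  qed simp
  finally show ?thesis by simp
qed

text \<open>Polarisation: w_j + w_k and w_j - w_k have independent normal entries over the rows, so
  their sums of squares concentrate, and the difference of these sums is four times the inner
  product. The two errors add up to at most 8 * \<kappa>2 * e * n, a quarter of which
  remains.\<close>

lemma gram_event_prob:
  fixes e :: real
  assumes e: "0 \<le> e" "e \<le> 1"
  shows "measure MR {r\<in>space MR. \<not> gram_event e r} \<le> p * p * (4 * exp (- (real n * e\<^sup>2) / 16))"
proof -
  interpret R: prob_space MR by (rule prob_MR)
  define c where "c s q = SW (fst q) (fst q) + 2 * s * SW (fst q) (snd q) + s\<^sup>2 * SW (snd q) (snd q)" for s :: real and q :: "nat \<times> nat"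
  define Xs where "Xs s q r i = w r i (fst q) + s * w r i (snd q)" for s :: real and q :: "nat \<times> nat" and r :: "nat \<times> nat + nat \<Rightarrow> real" and i
  define A where "A s q = {r\<in>space MR. c s q * card {..<n} * e < \<bar>(\<Sum>i<n. (Xs s q r i)\<^sup>2) - c s q * card {..<n}\<bar>}" for s q
  define A2 where "A2 q = A 1 q \<union> A (-1) q" for q
  let ?q = "{..<p} \<times> {..<p}"
  have [measurable]: "(\<lambda>r. w r i j) \<in> borel_measurable MR" if "i \<in> {..<n}" "j \<in> {..<p}" for i j
    using that by (auto intro: MR_index)
  have sA: "A s q \<in> sets MR" if "q \<in> ?q" for s q
    unfolding A_def Xs_def using that by (cases q) (simp, measurable)
  have g: "gauss MR {..<n} (\<lambda>i r. Xs s q r i) (\<lambda>i i'. c s q * of_bool (i = i'))" if q: "q \<in> ?q" for s q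
  proof -
    obtain j k where jk: "q = (j, k)" "j < p" "k < p" using q by auto
    have g1: "gauss MR {..<n} (\<lambda>i r. \<Sum>l<p. (of_bool (l = j) + s * of_bool (l = k)) * w r i l)
      (\<lambda>i i'. (\<Sum>l<p. \<Sum>m<p. (of_bool (l = j) + s * of_bool (l = k)) * (of_bool (m = j) + s * of_bool (m = k)) * SW l m) * of_bool (i = i'))"
      by (rule gauss_row_iid[OF gauss_MR])
    have d2: "(\<Sum>l<p. \<Sum>m<p. of_bool (l = a) * of_bool (m = b) * f l m) = (f a b :: real)" if "a < p" "b < p" for a b f
      by (simp only: mult.assoc sum_distrib_left[symmetric] sum_delta_lt that)
    have "(\<Sum>l<p. (of_bool (l = j) + s * of_bool (l = k)) * f l) = f j + s * f k" for f :: "nat \<Rightarrow> real"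
      using jk by (simp only: distrib_right sum.distrib mult.assoc sum_delta_lt sum_distrib_left[symmetric])
    moreover from this have "(\<Sum>l<p. \<Sum>m<p. (of_bool (l = j) + s * of_bool (l = k)) * (of_bool (m = j) + s * of_bool (m = k)) * SW l m)
      = (SW j j + s * SW j k) + s * (SW k j + s * SW k k)"
      by (simp only: mult.assoc sum_distrib_left[symmetric])
    ultimately have "gauss MR {..<n} (\<lambda>i r. Xs s q r i) (\<lambda>i i'. ((SW j j + s * SW j k) + s * (SW k j + s * SW k k)) * of_bool (i = i'))"
      using g1 by (simp only: Xs_def jk fst_conv snd_conv)
    moreover have "(SW j j + s * SW j k) + s * (SW k j + s * SW k k) = c s q"
      using SW_sym[OF jk(2,3)] by (simp add: c_def jk power2_eq_square algebra_simps)
    ultimately show ?thesis by simp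
  qed
  have pA: "measure MR (A s q) \<le> 2 * exp (- (real n * e\<^sup>2) / 16)" if q: "q \<in> ?q" for s q
  proof -
    have "0 \<le> c s q" using gauss_var_nonneg[OF g[OF q, of s], of 0] n_pos by simp
    then have "measure MR (A s q) \<le> 2 * exp (- (real (card {..<n}) * e\<^sup>2) / 16)"
      unfolding A_def by (rule gauss_iid_sum_squares[OF g[OF q, of s] _ e])
    then show ?thesis by simp
  qed
  have sA2: "A2 q \<in> sets MR" if "q \<in> ?q" for q unfolding A2_def using sA[OF that] by auto
  have sub: "{r\<in>space MR. \<not> gram_event e r} \<subseteq> (\<Union>q\<in>?q. A2 q)"
  proof
    fix r assume r: "r \<in> {r\<in>space MR. \<not> gram_event e r}"
    then obtain j k where jk: "j < p" "k < p" "2 * \<kappa>2 * e < \<bar>(\<Sum>i<n. w r i j * w r i k) / n - SW j k\<bar>"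
      by (auto simp: gram_event_def not_le)
    have "r \<in> A2 (j, k)"
    proof (rule ccontr)
      assume "r \<notin> A2 (j, k)"
      then have b: "\<bar>(\<Sum>i<n. (Xs s (j, k) r i)\<^sup>2) - c s (j, k) * n\<bar> \<le> c s (j, k) * n * e" if "s = 1 \<or> s = -1" for s
        using r that by (auto simp: A2_def A_def not_less)
      have s4: "(\<Sum>i<n. (Xs 1 (j, k) r i)\<^sup>2) - (\<Sum>i<n. (Xs (-1) (j, k) r i)\<^sup>2) = 4 * (\<Sum>i<n. w r i j * w r i k)"
        unfolding sum_subtractf[symmetric] sum_distrib_left by (intro sum.cong) (auto simp: Xs_def power2_eq_square algebra_simps)
      have c4: "c 1 (j, k) - c (-1) (j, k) = 4 * SW j k" "c 1 (j, k) + c (-1) (j, k) = 2 * (SW j j + SW k k)"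
        by (auto simp: c_def)
      have cn: "c 1 (j, k) * n - c (-1) (j, k) * n = 4 * (SW j k * n)"
        "c 1 (j, k) * n * e + c (-1) (j, k) * n * e = 2 * (SW j j + SW k k) * (n * e)"
        using arg_cong[OF c4(1), of "\<lambda>x. x * n"] arg_cong[OF c4(2), of "\<lambda>x. x * (n * e)"] by (simp_all add: algebra_simps)
      have "\<bar>4 * (\<Sum>i<n. w r i j * w r i k) - 4 * (SW j k * n)\<bar> \<le> 2 * (SW j j + SW k k) * (n * e)"
        using b[of 1] b[of "-1"] s4 cn by linarith
      also have "\<dots> \<le> 2 * (2 * \<kappa>2 + 2 * \<kappa>2) * (n * e)"
        using SW_diag_le[OF jk(1)] SW_diag_le[OF jk(2)] e by (intro mult_right_mono mult_left_mono add_mono) auto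
      finally have "\<bar>(\<Sum>i<n. w r i j * w r i k) - SW j k * n\<bar> \<le> 2 * \<kappa>2 * e * n" by (simp add: mult_ac)
      moreover have "(\<Sum>i<n. w r i j * w r i k) / n - SW j k = ((\<Sum>i<n. w r i j * w r i k) - SW j k * n) / n"
        using n_pos by (simp add: field_simps)
      ultimately have "\<bar>(\<Sum>i<n. w r i j * w r i k) / n - SW j k\<bar> \<le> 2 * \<kappa>2 * e"
        using n_pos by (simp add: abs_divide divide_le_eq)
      then show False using jk(3) by simp
    qed
    then show "r \<in> (\<Union>q\<in>?q. A2 q)" using jk by auto
  qed
  have "measure MR {r\<in>space MR. \<not> gram_event e r} \<le> measure MR (\<Union>q\<in>?q. A2 q)"
    by (rule R.finite_measure_mono[OF sub]) (intro sets.finite_UN sA2; simp)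
  also have "\<dots> \<le> card ?q * (4 * exp (- (real n * e\<^sup>2) / 16))"
  proof (rule prob_union_le[OF prob_MR _ sA2])
    fix q assume q: "q \<in> ?q"
    have "measure MR (A2 q) \<le> measure MR (A 1 q) + measure MR (A (-1) q)"
      unfolding A2_def by (rule measure_Un_le) (use sA[OF q] in auto)
    then show "measure MR (A2 q) \<le> 4 * exp (- (real n * e\<^sup>2) / 16)" using pA[OF q, of 1] pA[OF q, of "-1"] by simp
  qed simp
  finally show ?thesis by simp
qed

section \<open>Error of the estimated projection\<close>

definition s where "s = s_Pi p D"

lemma support_card: "j < p \<Longrightarrow> card {k. k < p \<and> Pst k j \<noteq> 0} \<le> s"
proof -
  assume j: "j < p"
  have "l0_norm (col (Pi_star p D) j) = card {k. k < p \<and> Pst k j \<noteq> 0}"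
    using normal_equations(1) j unfolding l0_norm_def Pst_def by (intro arg_cong[where f = card]) auto
  moreover have "l0_norm (col (Pi_star p D) j) \<le> s" unfolding s_def s_Pi_def using j by (intro Max_ge) auto
  ultimately show ?thesis by simp
qed

text \<open>The bound of \<open>adds_l1_error\<close> with c = 2 * \<kappa>1 and the noise level 2 *
  sqrt \<kappa>2 granted by \<open>norm_event\<close>.\<close>

definition d where "d = 48 * real s * \<eta> / (2 * \<kappa>1) * (2 * sqrt \<kappa>2)"

lemma d_nonneg: "0 \<le> d" using kappa eta_pos by (simp add: d_def)

lemma Pt_l1_error:
  assumes g: "noise_event z" "gram_event e (snd z)" "norm_event (fst z)" and small: "8 * real s * (2 * \<kappa>2 * e) \<le> 2 * \<kappa>1" "512 * real s * \<eta>\<^sup>2 \<le> 2 * \<kappa>1"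
    and j: "j < p"
  shows "(\<Sum>k<p. \<bar>Pst k j - Pt z j k\<bar>) \<le> d"
proof -
  let ?A = "\<Sum>i<n. (fst z (i, j))\<^sup>2"
  have Wix: "Wm (snd z) $$ (i, k) = w (snd z) i k" if "i < n" "k < p" for i k using that by (simp add: Wm_def)
  have col: "col (Zm z) j \<in> carrier_vec n" using Zm_carrier[of z] by (auto simp: col_def)
  have "(\<Sum>k<p. \<bar>adds (\<pi> j) (Wm (snd z)) (col (Zm z) j) $ k - Pst k j\<bar>) \<le> 48 * real s * \<eta> / (2 * \<kappa>1) * (sqrt ?A / sqrt n)"
  proof (rule adds_l1_error[OF pi_rule[OF j] Wm_carrier col n_pos eta_pos _ _ SW_lower support_card[OF j] small])
    show "0 < 2 * \<kappa>1" using kappa by simp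
    show "\<bar>(\<Sum>i<n. Wm (snd z) $$ (i, a) * Wm (snd z) $$ (i, b)) / n - SW a b\<bar> \<le> 2 * \<kappa>2 * e" if "a < p" "b < p" for a b
      using g(2) that by (auto simp: gram_event_def Wix)
    show "fst z (i, j) = col (Zm z) j $ i - (\<Sum>k<p. Wm (snd z) $$ (i, k) * Pst k j)" if "i < n" for i
      using that j Zm_carrier[of z] by (simp add: Zm_def Wm_def)
    show "\<bar>\<Sum>i<n. Wm (snd z) $$ (i, k) * fst z (i, j)\<bar> \<le> \<eta> * sqrt n * sqrt ?A" if "k < p" for k
      using g(1) that j by (auto simp: noise_event_def Wix)
  qed
  also have "\<dots> \<le> d"
  proof -
    have "sqrt ?A \<le> sqrt (4 * \<kappa>2 * n)" using g(3) j by (simp add: norm_event_def)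
    also have "\<dots> = 2 * sqrt \<kappa>2 * sqrt n" by (simp add: real_sqrt_mult)
    finally have "sqrt ?A / sqrt n \<le> 2 * sqrt \<kappa>2" using n_pos by (simp add: divide_le_eq)
    then show ?thesis unfolding d_def using kappa eta_pos by (intro mult_left_mono) auto
  qed
  finally show ?thesis by (simp add: Pt_def abs_minus_commute)
qed

text \<open>Hoelder's inequality: the difference is the inner product of the estimation error of
  column j with the vector of sums of \<open>W\<close> against \<open>g\<close>. Here
  \<open>g\<close> is the residual in the numerator and a multiplier vector in the critical
  value.\<close>

lemma combo_diff:
  assumes l1: "(\<Sum>k<p. \<bar>Pst k j - Pt z j k\<bar>) \<le> d" and m: "\<And>k. k < p \<Longrightarrow> \<bar>\<Sum>i<n. w (snd z) i k * g i\<bar> \<le> m" "0 \<le> m" and j: "j < p"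
  shows "\<bar>(\<Sum>i<n. Vh z i j * g i) - (\<Sum>i<n. fst z (i, j) * g i)\<bar> \<le> d * m"
proof -
  have "Vh z i j = fst z (i, j) + (\<Sum>k<p. w (snd z) i k * (Pst k j - Pt z j k))" if "i < n" for i
    using that j by (simp add: Vh_def Zm_def Wm_def right_diff_distrib sum_subtractf)
  then have "(\<Sum>i<n. Vh z i j * g i) - (\<Sum>i<n. fst z (i, j) * g i) = (\<Sum>i<n. (\<Sum>k<p. w (snd z) i k * (Pst k j - Pt z j k)) * g i)"
    by (simp add: distrib_right sum.distrib)
  also have "\<dots> = (\<Sum>k<p. (Pst k j - Pt z j k) * (\<Sum>i<n. w (snd z) i k * g i))"
    unfolding sum_distrib_left sum_distrib_right by (subst sum.swap) (simp add: mult_ac)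
  also have "\<bar>\<dots>\<bar> \<le> (\<Sum>k<p. \<bar>Pst k j - Pt z j k\<bar> * m)"
  proof (rule order_trans[OF sum_abs], intro sum_mono)
    fix k assume "k \<in> {..<p}"
    then show "\<bar>(Pst k j - Pt z j k) * (\<Sum>i<n. w (snd z) i k * g i)\<bar> \<le> \<bar>Pst k j - Pt z j k\<bar> * m"
      unfolding abs_mult using m by (intro mult_left_mono) auto
  qed
  also have "\<dots> \<le> d * m" unfolding sum_distrib_right[symmetric] using l1 m by (intro mult_right_mono)
  finally show ?thesis .
qed

definition Good where "Good e z \<longleftrightarrow> noise_event z \<and> gram_event e (snd z) \<and> norm_event (fst z)"

definition bad_bound :: "real \<Rightarrow> real" where
  "bad_bound e = p * (2 * p * exp (- (real n * \<eta>\<^sup>2) / (8 * \<kappa>2))) + p * p * (4 * exp (- (real n * e\<^sup>2) / 16)) + p * (2 * exp (- real n / 16))"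

lemma Good_sets: "{z\<in>space Zs. \<not> Good e z} \<in> sets Zs"
proof -
  have "{z\<in>space Zs. \<not> Good e z} = {z\<in>space Zs. \<not> noise_event z} \<union> (space MV \<times> {r\<in>space MR. \<not> gram_event e r}) \<union> ({v\<in>space MV. \<not> norm_event v} \<times> space MR)"
    by (auto simp: Good_def space_pair_measure)
  also have "\<dots> \<in> sets Zs" by (intro sets.Un event_sets pair_measureI sets.top)
  finally show ?thesis .
qed

lemma Good_prob: "0 \<le> e \<Longrightarrow> e \<le> 1 \<Longrightarrow> measure Zs {z\<in>space Zs. \<not> Good e z} \<le> bad_bound e"
proof -
  assume e: "0 \<le> e" "e \<le> 1"
  interpret Z: prob_space Zs by (rule prob_Zs)
  have eq: "{z\<in>space Zs. \<not> Good e z} = ({z\<in>space Zs. \<not> noise_event z} \<union> (space MV \<times> {r\<in>space MR. \<not> gram_event e r})) \<union> ({v\<in>space MV. \<not> norm_event v} \<times> space MR)"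
    by (auto simp: Good_def space_pair_measure)
  have "measure Zs {z\<in>space Zs. \<not> Good e z} \<le> measure Zs ({z\<in>space Zs. \<not> noise_event z} \<union> (space MV \<times> {r\<in>space MR. \<not> gram_event e r})) + measure Zs ({v\<in>space MV. \<not> norm_event v} \<times> space MR)"
    unfolding eq by (rule measure_Un_le) (intro sets.Un event_sets pair_measureI sets.top)+
  also have "measure Zs ({z\<in>space Zs. \<not> noise_event z} \<union> (space MV \<times> {r\<in>space MR. \<not> gram_event e r})) \<le> measure Zs {z\<in>space Zs. \<not> noise_event z} + measure Zs (space MV \<times> {r\<in>space MR. \<not> gram_event e r})"
    by (rule measure_Un_le) (intro sets.Un event_sets pair_measureI sets.top)+
  also have "measure Zs (space MV \<times> {r\<in>space MR. \<not> gram_event e r}) = measure MR {r\<in>space MR. \<not> gram_event e r}"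
    using prob_pair_times[OF prob_MV prob_MR sets.top event_sets(2)] prob_space.prob_space[OF prob_MV] by simp
  also have "measure Zs ({v\<in>space MV. \<not> norm_event v} \<times> space MR) = measure MV {v\<in>space MV. \<not> norm_event v}"
    using prob_pair_times[OF prob_MV prob_MR event_sets(3) sets.top] prob_space.prob_space[OF prob_MR] by simp
  finally show ?thesis using noise_event_prob gram_event_prob[OF e] norm_event_prob unfolding bad_bound_def by linarith
qed

section \<open>Law of the test statistic\<close>

lemma V_combo_F:
  assumes e: "(\<Sum>i<n. e i * e i) = 1"
  shows "measure MV {v\<in>space MV. \<forall>j\<in>{..<p}. \<bar>\<Sum>i<n. e i * v (i, j)\<bar> \<le> t} = F t"
proof (rule F_eq[OF n_pos])
  show "gauss MV {..<p} (\<lambda>j v. \<Sum>i<n. e i * v (i, j)) SV"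
    by (rule gauss_cong[OF gauss_row_combo[OF gauss_MV, of e]]) (auto simp: e)
qed

lemma V_combo_scaled_F:
  assumes N: "(\<Sum>i<n. (g i)\<^sup>2) = N\<^sup>2" "0 < N"
  shows "measure MV {v\<in>space MV. \<forall>j\<in>{..<p}. \<bar>\<Sum>i<n. v (i, j) * g i\<bar> \<le> t * N} = F t"
proof -
  have "(\<Sum>i<n. g i / N * (g i / N)) = (\<Sum>i<n. (g i)\<^sup>2) / N\<^sup>2"
    by (simp add: sum_divide_distrib power2_eq_square)
  then have 1: "(\<Sum>i<n. g i / N * (g i / N)) = 1" using N by simp
  have "\<bar>\<Sum>i<n. g i / N * v (i, j)\<bar> \<le> t \<longleftrightarrow> \<bar>\<Sum>i<n. v (i, j) * g i\<bar> \<le> t * N" for v :: "nat \<times> nat \<Rightarrow> real" and j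
  proof -
    have "(\<Sum>i<n. g i / N * v (i, j)) = (\<Sum>i<n. v (i, j) * g i) / N" by (simp add: sum_divide_distrib mult.commute)
    then show ?thesis using N by (simp add: abs_divide divide_le_eq)
  qed
  then show ?thesis using V_combo_F[OF 1, of t] by simp
qed

lemma MR_measurable_uh: "i < n \<Longrightarrow> (\<lambda>r. uh r i) \<in> borel_measurable MR" and MR_measurable_Nm: "residual_norm \<in> borel_measurable MR"
  using uh_measurable residual_norm_measurable by (auto simp: measurable_cong_sets[OF sets_MR refl])

definition zero_residual_prob where "zero_residual_prob = measure Zs {z\<in>space Zs. residual_norm (snd z) = 0}"
text \<open>By \<open>adds_feasible\<close> the residual of Y has correlations with W of at most
  \<eta> * sqrt (2 * n) times its norm; the factor \<open>d\<close> is the l1 error. The product is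
  the resulting shift in the argument of \<open>F\<close>.\<close>

definition numerator_error where "numerator_error = d * (\<eta> * sqrt (2 * n))"

lemma T_numerator_close:
  assumes g: "Good e z" and small: "8 * real s * (2 * \<kappa>2 * e) \<le> 2 * \<kappa>1" "512 * real s * \<eta>\<^sup>2 \<le> 2 * \<kappa>1" and j: "j < p"
  shows "\<bar>(\<Sum>i<n. Vh z i j * uh (snd z) i) - (\<Sum>i<n. fst z (i, j) * uh (snd z) i)\<bar> \<le> numerator_error * residual_norm (snd z)"
proof -
  have N0: "0 \<le> residual_norm (snd z)" by (simp add: residual_norm_def sum_nonneg)
  have "\<bar>\<Sum>i<n. w (snd z) i k * uh (snd z) i\<bar> \<le> \<eta> * sqrt (2 * n) * residual_norm (snd z)" if "k < p" for k
    using adds_feasible(2)[OF theta_rule Wm_carrier Yv_carrier n_pos less_imp_le[OF eta_pos] that, of "snd z" "snd z"] that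
    unfolding uh_def[symmetric] residual_norm_def[symmetric] by (simp add: Wm_def)
  then have "\<bar>(\<Sum>i<n. Vh z i j * uh (snd z) i) - (\<Sum>i<n. fst z (i, j) * uh (snd z) i)\<bar> \<le> d * (\<eta> * sqrt (2 * n) * residual_norm (snd z))"
    using N0 eta_pos g by (intro combo_diff Pt_l1_error[OF _ _ _ small j] j) (auto simp: Good_def)
  then show ?thesis by (simp add: numerator_error_def mult_ac)
qed

text \<open>For fixed \<open>r\<close> the residual is a fixed vector, so its normalised combination
  of rows of \<open>V\<close> has exactly the law of one row. A vanishing residual contributes
  nothing to either event, hence inequalities on both sides; the missing mass is
  \<open>zero_residual_prob\<close>.\<close>

lemma T_sections:
  shows "{z\<in>space Zs. residual_norm (snd z) \<noteq> 0 \<and> (\<forall>j\<in>{..<p}. \<bar>\<Sum>i<n. fst z (i, j) * uh (snd z) i\<bar> \<le> t * residual_norm (snd z))} \<in> sets Zs" (is "?A \<in> _")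
    and "{z\<in>space Zs. residual_norm (snd z) \<noteq> 0 \<and> \<not> (\<forall>j\<in>{..<p}. \<bar>\<Sum>i<n. fst z (i, j) * uh (snd z) i\<bar> \<le> t * residual_norm (snd z))} \<in> sets Zs" (is "?B \<in> _")
    and "{z\<in>space Zs. residual_norm (snd z) = 0} \<in> sets Zs"
    and "measure Zs {z\<in>space Zs. residual_norm (snd z) \<noteq> 0 \<and> (\<forall>j\<in>{..<p}. \<bar>\<Sum>i<n. fst z (i, j) * uh (snd z) i\<bar> \<le> t * residual_norm (snd z))} \<le> F t"
    and "measure Zs {z\<in>space Zs. residual_norm (snd z) \<noteq> 0 \<and> \<not> (\<forall>j\<in>{..<p}. \<bar>\<Sum>i<n. fst z (i, j) * uh (snd z) i\<bar> \<le> t * residual_norm (snd z))} \<le> 1 - F t"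
proof -
  interpret V: prob_space MV by (rule prob_MV)
  have [measurable]: "(\<lambda>z. fst z (i, j)) \<in> borel_measurable Zs" if "i \<in> {..<n}" "j \<in> {..<p}" for i j
    by (rule measurable_compose[OF measurable_fst MV_index]) (use that in auto)
  have [measurable]: "(\<lambda>z. uh (snd z) i) \<in> borel_measurable Zs" if "i \<in> {..<n}" for i
    by (rule measurable_compose[OF measurable_snd MR_measurable_uh]) (use that in auto)
  have [measurable]: "(\<lambda>z. residual_norm (snd z)) \<in> borel_measurable Zs"
    by (rule measurable_compose[OF measurable_snd MR_measurable_Nm])
  have [measurable]: "(\<lambda>v. v (i, j)) \<in> borel_measurable MV" if "i \<in> {..<n}" "j \<in> {..<p}" for i j
    using that by (auto intro: MV_index)
  show A: "?A \<in> sets Zs" by measurable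
  show B: "?B \<in> sets Zs" by measurable
  show "{z\<in>space Zs. residual_norm (snd z) = 0} \<in> sets Zs" by measurable
  have N: "(\<Sum>i<n. (uh r i)\<^sup>2) = (residual_norm r)\<^sup>2" "0 \<le> residual_norm r" for r by (simp_all add: residual_norm_def sum_nonneg)
  have "measure Zs ?A \<le> F t + measure MR {}"
  proof (rule prob_pair_le_except[OF prob_MV prob_MR A])
    fix r assume r: "r \<in> space MR"
    show "measure MV {v\<in>space MV. (v, r) \<in> ?A} \<le> F t"
    proof (cases "residual_norm r = 0")
      case True
      then show ?thesis using F_range by simp
    next
      case False
      then have "measure MV {v\<in>space MV. \<forall>j\<in>{..<p}. \<bar>\<Sum>i<n. v (i, j) * uh r i\<bar> \<le> t * residual_norm r} = F t"
        using N by (intro V_combo_scaled_F) (auto simp: less_le)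
      moreover have "{v\<in>space MV. (v, r) \<in> ?A} = {v\<in>space MV. \<forall>j\<in>{..<p}. \<bar>\<Sum>i<n. v (i, j) * uh r i\<bar> \<le> t * residual_norm r}"
        using r False by (auto simp: space_pair_measure)
      ultimately show ?thesis by simp
    qed
  qed (auto simp: F_range)
  then show "measure Zs ?A \<le> F t" by simp
  have "measure Zs ?B \<le> (1 - F t) + measure MR {}"
  proof (rule prob_pair_le_except[OF prob_MV prob_MR B])
    fix r assume r: "r \<in> space MR"
    show "measure MV {v\<in>space MV. (v, r) \<in> ?B} \<le> 1 - F t"
    proof (cases "residual_norm r = 0")
      case True
      then show ?thesis using F_range by simp
    next
      case False
      let ?S = "{v\<in>space MV. \<forall>j\<in>{..<p}. \<bar>\<Sum>i<n. v (i, j) * uh r i\<bar> \<le> t * residual_norm r}"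
      have "measure MV ?S = F t" using N False by (intro V_combo_scaled_F) (auto simp: less_le)
      moreover have "{v\<in>space MV. (v, r) \<in> ?B} = space MV - ?S" using r False by (auto simp: space_pair_measure)
      moreover have "?S \<in> sets MV" by measurable
      ultimately show ?thesis using V.prob_compl[of ?S] by simp
    qed
  qed (auto simp: F_range)
  then show "measure Zs ?B \<le> 1 - F t" by simp
qed

lemma T_distribution:
  assumes e: "0 \<le> e" "e \<le> 1" and small: "8 * real s * (2 * \<kappa>2 * e) \<le> 2 * \<kappa>1" "512 * real s * \<eta>\<^sup>2 \<le> 2 * \<kappa>1" and t: "0 \<le> t"
  shows "measure Zs {z\<in>space Zs. Tz z \<le> t} \<le> F (t + numerator_error) + bad_bound e + zero_residual_prob" (is "measure Zs ?T \<le> _")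
    and "measure Zs {z\<in>space Zs. t < Tz z} \<le> 1 - F (t - numerator_error) + bad_bound e + zero_residual_prob" (is "measure Zs ?T' \<le> _")
proof -
  interpret Z: prob_space Zs by (rule prob_Zs)
  let ?A = "\<lambda>t. {z\<in>space Zs. residual_norm (snd z) \<noteq> 0 \<and> (\<forall>j\<in>{..<p}. \<bar>\<Sum>i<n. fst z (i, j) * uh (snd z) i\<bar> \<le> t * residual_norm (snd z))}"
  let ?B = "\<lambda>t. {z\<in>space Zs. residual_norm (snd z) \<noteq> 0 \<and> \<not> (\<forall>j\<in>{..<p}. \<bar>\<Sum>i<n. fst z (i, j) * uh (snd z) i\<bar> \<le> t * residual_norm (snd z))}"
  let ?N = "{z\<in>space Zs. residual_norm (snd z) = 0}" and ?G = "{z\<in>space Zs. \<not> Good e z}"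
  have un: "measure Zs S \<le> c + bad_bound e + zero_residual_prob" if "S \<subseteq> (X \<union> ?G) \<union> ?N" "X \<in> sets Zs" "measure Zs X \<le> c" for S X c
  proof -
    have "measure Zs S \<le> measure Zs ((X \<union> ?G) \<union> ?N)"
      by (rule Z.finite_measure_mono[OF that(1)]) (intro sets.Un that Good_sets T_sections)
    also have "\<dots> \<le> measure Zs (X \<union> ?G) + measure Zs ?N" by (rule measure_Un_le) (intro sets.Un that Good_sets T_sections)+
    also have "measure Zs (X \<union> ?G) \<le> measure Zs X + measure Zs ?G" by (rule measure_Un_le) (intro that Good_sets)+
    finally show ?thesis using that(3) Good_prob[OF e] unfolding zero_residual_prob_def by linarith
  qed
  have close: "\<bar>(\<Sum>i<n. Vh z i j * uh (snd z) i) - (\<Sum>i<n. fst z (i, j) * uh (snd z) i)\<bar> \<le> numerator_error * residual_norm (snd z)" if "Good e z" "j < p" for z j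
    by (rule T_numerator_close[OF that(1) small that(2)])
  show "measure Zs ?T \<le> F (t + numerator_error) + bad_bound e + zero_residual_prob"
  proof (rule un[OF _ T_sections(1) T_sections(4)], rule subsetI, rule ccontr)
    fix z assume z: "z \<in> ?T" "z \<notin> (?A (t + numerator_error) \<union> ?G) \<union> ?N"
    then have N: "residual_norm (snd z) \<noteq> 0" and G: "Good e z" by auto
    have "\<forall>j<p. \<bar>\<Sum>i<n. Vh z i j * uh (snd z) i\<bar> \<le> t * residual_norm (snd z)" using z(1) Tz_le_iff[OF N t] by simp
    then have b: "\<bar>\<Sum>i<n. Vh z i j * uh (snd z) i\<bar> \<le> t * residual_norm (snd z)" if "j < p" for j using that by blast
    have "\<bar>\<Sum>i<n. fst z (i, j) * uh (snd z) i\<bar> \<le> (t + numerator_error) * residual_norm (snd z)" if "j < p" for j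
      using close[OF G that] b[OF that] unfolding distrib_right by linarith
    then have "\<forall>j\<in>{..<p}. \<bar>\<Sum>i<n. fst z (i, j) * uh (snd z) i\<bar> \<le> (t + numerator_error) * residual_norm (snd z)" by simp
    then show False using z N by auto
  qed
  show "measure Zs ?T' \<le> 1 - F (t - numerator_error) + bad_bound e + zero_residual_prob"
  proof (rule un[OF _ T_sections(2) T_sections(5)], rule subsetI, rule ccontr)
    fix z assume z: "z \<in> ?T'" "z \<notin> (?B (t - numerator_error) \<union> ?G) \<union> ?N"
    then have N: "residual_norm (snd z) \<noteq> 0" and G: "Good e z" by auto
    then have "\<forall>j\<in>{..<p}. \<bar>\<Sum>i<n. fst z (i, j) * uh (snd z) i\<bar> \<le> (t - numerator_error) * residual_norm (snd z)" using z by auto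
    then have b: "\<bar>\<Sum>i<n. fst z (i, j) * uh (snd z) i\<bar> \<le> (t - numerator_error) * residual_norm (snd z)" if "j < p" for j using that by blast
    have "\<bar>\<Sum>i<n. Vh z i j * uh (snd z) i\<bar> \<le> t * residual_norm (snd z)" if "j < p" for j
      using close[OF G that] b[OF that] unfolding left_diff_distrib by linarith
    then have "\<forall>j<p. \<bar>\<Sum>i<n. Vh z i j * uh (snd z) i\<bar> \<le> t * residual_norm (snd z)" by simp
    then have "Tz z \<le> t" using Tz_le_iff[OF N t] by simp
    then show False using z(1) by simp
  qed
qed

section \<open>Concentration of the conditional distribution function\<close>


text \<open>A factor 1 + \<delta> in the norm of \<open>g\<close> becomes an additive shift \<delta>
  * \<tau> in the argument of \<open>F\<close>, as long as the Gaussian maximum is at most \<tau>.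
  The last term is the price for that restriction.\<close>

lemma V_single_lower:
  assumes g: "\<bar>(\<Sum>i<n. (g i)\<^sup>2) - real n\<bar> \<le> \<delta> * real n" and del: "0 < \<delta>" "\<delta> \<le> 1 / 4" and tau: "0 \<le> \<tau>"
  shows "measure MV {v\<in>space MV. \<not> (\<forall>j\<in>{..<p}. \<bar>\<Sum>i<n. v (i, j) * g i\<bar> \<le> T * sqrt n)}
    \<le> 1 - F (T - \<delta> * \<tau>) + 2 * real p * exp (- \<tau>\<^sup>2 / (8 * \<kappa>2))"
proof -
  interpret V: prob_space MV by (rule prob_MV)
  have [measurable]: "(\<lambda>v. v (i, j)) \<in> borel_measurable MV" if "i \<in> {..<n}" "j \<in> {..<p}" for i j
    using that by (auto intro: MV_index)
  define a where "a = sqrt (\<Sum>i<n. (g i)\<^sup>2)"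
  have n0: "0 < real n" using n_pos by simp
  have Apos: "0 < (\<Sum>i<n. (g i)\<^sup>2)"
  proof -
    have "real n - \<delta> * real n \<le> (\<Sum>i<n. (g i)\<^sup>2)" using g by linarith
    moreover have "\<delta> * real n \<le> 1 / 4 * real n" using del by (intro mult_right_mono) auto
    ultimately show ?thesis using n0 by linarith
  qed
  have a: "a\<^sup>2 = (\<Sum>i<n. (g i)\<^sup>2)" "0 < a" using Apos by (auto simp: a_def)
  have au: "a \<le> (1 + \<delta>) * sqrt n"
  proof -
    have "(\<Sum>i<n. (g i)\<^sup>2) \<le> (1 + \<delta>) * real n" using g by (simp add: distrib_right abs_le_iff)
    also have "\<dots> \<le> (1 + \<delta>)\<^sup>2 * real n" using del by (intro mult_right_mono) (auto simp: power2_eq_square)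
    also have "\<dots> = ((1 + \<delta>) * sqrt n)\<^sup>2" by (simp add: power_mult_distrib)
    finally show ?thesis unfolding a_def using del by (intro real_le_lsqrt) auto
  qed
  have nrm: "(\<Sum>i<n. g i / a * (g i / a)) = 1"
  proof -
    have "(\<Sum>i<n. g i / a * (g i / a)) = (\<Sum>i<n. (g i)\<^sup>2) / a\<^sup>2" by (simp add: sum_divide_distrib power2_eq_square)
    then show ?thesis using a Apos by simp
  qed
  let ?q = "\<lambda>v j. \<Sum>i<n. g i / a * v (i, j)"
  have q: "(\<Sum>i<n. v (i, j) * g i) = a * ?q v j" for v :: "nat \<times> nat \<Rightarrow> real" and j
    using a(2) by (simp add: sum_distrib_left mult_ac)
  let ?S = "{v\<in>space MV. \<forall>j\<in>{..<p}. \<bar>?q v j\<bar> \<le> T - \<delta> * \<tau>}" and ?B = "{v\<in>space MV. \<exists>j\<in>{..<p}. \<tau> < \<bar>?q v j\<bar>}"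
  have s: "?S \<in> sets MV" "?B \<in> sets MV" by measurable
  have "{v\<in>space MV. \<not> (\<forall>j\<in>{..<p}. \<bar>\<Sum>i<n. v (i, j) * g i\<bar> \<le> T * sqrt n)} \<subseteq> (space MV - ?S) \<union> ?B"
  proof (rule subsetI, rule ccontr)
    fix v assume v: "v \<in> {v\<in>space MV. \<not> (\<forall>j\<in>{..<p}. \<bar>\<Sum>i<n. v (i, j) * g i\<bar> \<le> T * sqrt n)}" "v \<notin> (space MV - ?S) \<union> ?B"
    have "\<bar>\<Sum>i<n. v (i, j) * g i\<bar> \<le> T * sqrt n" if j: "j \<in> {..<p}" for j
    proof -
      have 1: "\<bar>?q v j\<bar> \<le> T - \<delta> * \<tau>" "\<bar>?q v j\<bar> \<le> \<tau>" using v j by (auto simp: not_less)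
      have "\<bar>\<Sum>i<n. v (i, j) * g i\<bar> = a * \<bar>?q v j\<bar>" unfolding q using a(2) by (simp add: abs_mult)
      also have "\<dots> \<le> (1 + \<delta>) * sqrt n * \<bar>?q v j\<bar>" using au by (rule mult_right_mono) simp
      also have "\<dots> = sqrt n * (\<bar>?q v j\<bar> + \<delta> * \<bar>?q v j\<bar>)" by (simp add: algebra_simps)
      also have "\<dots> \<le> sqrt n * ((T - \<delta> * \<tau>) + \<delta> * \<tau>)" using 1 del by (intro mult_left_mono add_mono) auto
      finally show ?thesis by (simp add: mult.commute)
    qed
    then show False using v(1) by auto
  qed
  then have "measure MV {v\<in>space MV. \<not> (\<forall>j\<in>{..<p}. \<bar>\<Sum>i<n. v (i, j) * g i\<bar> \<le> T * sqrt n)} \<le> measure MV ((space MV - ?S) \<union> ?B)"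
    using s by (intro V.finite_measure_mono) auto
  also have "\<dots> \<le> measure MV (space MV - ?S) + measure MV ?B" using s by (intro measure_Un_le) auto
  also have "measure MV (space MV - ?S) = 1 - F (T - \<delta> * \<tau>)" using V.prob_compl[OF s(1)] V_combo_F[OF nrm] by simp
  also have "measure MV ?B \<le> 2 * real p * exp (- \<tau>\<^sup>2 / (8 * \<kappa>2))" using V_combo_tail[OF nrm tau] by simp
  finally show ?thesis by simp
qed

text \<open>Gram-Schmidt applied to \<open>g\<close> and \<open>h\<close> gives two orthonormal vectors, and the corresponding
  combinations of the rows of \<open>V\<close> are independent copies.\<close>

lemma V_pair_upper:
  assumes g: "\<bar>(\<Sum>i<n. (g i)\<^sup>2) - real n\<bar> \<le> \<delta> * real n" and h: "\<bar>(\<Sum>i<n. (h i)\<^sup>2) - real n\<bar> \<le> \<delta> * real n"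
    and gh: "\<bar>\<Sum>i<n. g i * h i\<bar> \<le> \<delta> * real n" and del: "0 < \<delta>" "\<delta> \<le> 1 / 4" and tau: "0 \<le> \<tau>"
  shows "measure MV {v\<in>space MV. (\<forall>j\<in>{..<p}. \<bar>\<Sum>i<n. v (i, j) * g i\<bar> \<le> T * sqrt n) \<and> (\<forall>j\<in>{..<p}. \<bar>\<Sum>i<n. v (i, j) * h i\<bar> \<le> T * sqrt n)}
    \<le> F (T + 4 * \<delta> * \<tau>) * F (T + 4 * \<delta> * \<tau>) + 2 * (2 * real p * exp (- \<tau>\<^sup>2 / (8 * \<kappa>2)))"
proof -
  interpret V: prob_space MV by (rule prob_MV)
  have [measurable]: "(\<lambda>v. v (i, j)) \<in> borel_measurable MV" if "i \<in> {..<n}" "j \<in> {..<p}" for i j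
    using that by (auto intro: MV_index)
  define A where "A = (\<Sum>i<n. (g i)\<^sup>2)"
  define B where "B = (\<Sum>i<n. (h i)\<^sup>2)"
  define I where "I = (\<Sum>i<n. g i * h i)"
  define a where "a = sqrt A"
  \<comment> \<open>\<open>c\<close> is the component of \<open>h\<close> along the normalised
    \<open>g\<close>, and \<open>b\<close> is the length of the remainder. Near orthogonality makes
    \<open>c\<close> at most 2 * \<delta> * sqrt n and \<open>b\<close> at least (1 - 2 * \<delta>)
    * sqrt n.\<close>
  define c where "c = I / a"
  define b where "b = sqrt (B - c\<^sup>2)"
  have n0: "0 < real n" using n_pos by simp
  have dn: "\<delta> * real n \<le> 1 / 4 * real n" "0 < \<delta> * real n" using del n0 by (auto intro!: mult_right_mono)
  have A: "(1 - \<delta>) * real n \<le> A" "A \<le> (1 + \<delta>) * real n" and B: "(1 - \<delta>) * real n \<le> B" "B \<le> (1 + \<delta>) * real n"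
    using g h unfolding A_def[symmetric] B_def[symmetric] left_diff_distrib distrib_right by linarith+
  have I: "\<bar>I\<bar> \<le> \<delta> * real n" using gh by (simp add: I_def)
  have A34: "3 / 4 * real n \<le> A" using A(1) dn unfolding left_diff_distrib by linarith
  have Apos: "0 < A" using A34 n0 by linarith
  have a: "a\<^sup>2 = A" "0 < a" using Apos by (auto simp: a_def)
  have c2: "c\<^sup>2 \<le> \<delta> * real n"
  proof -
    have "I\<^sup>2 \<le> (\<delta> * real n)\<^sup>2" using I by (intro abs_le_square_iff[THEN iffD1]) (use dn in auto)
    also have "\<dots> \<le> (\<delta> * real n) * A"
    proof -
      have "\<delta> * real n \<le> A" using A34 dn n0 by linarith
      then show ?thesis unfolding power2_eq_square using dn by (intro mult_left_mono) auto
    qed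
    finally have "I\<^sup>2 \<le> (\<delta> * real n) * A" .
    then show ?thesis unfolding c_def power_divide a(1) using Apos by (simp add: divide_le_eq)
  qed
  have c1: "\<bar>c\<bar> \<le> 2 * \<delta> * sqrt n"
  proof -
    have "1 / 4 * real n \<le> A" using A34 n0 by linarith
    then have "sqrt (1 / 4 * real n) \<le> a" unfolding a_def by (rule real_sqrt_le_mono)
    then have "sqrt n / 2 \<le> a" by (simp add: real_sqrt_mult real_sqrt_divide)
    then have "\<delta> * real n \<le> 2 * \<delta> * sqrt n * a"
    proof -
      have "\<delta> * real n = 2 * \<delta> * sqrt n * (sqrt n / 2)" by simp
      also have "\<dots> \<le> 2 * \<delta> * sqrt n * a" using \<open>sqrt n / 2 \<le> a\<close> del by (intro mult_left_mono) auto
      finally show ?thesis .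
    qed
    then show ?thesis unfolding c_def abs_divide using I a(2) by (simp add: divide_le_eq)
  qed
  have Bc: "(1 - 2 * \<delta>) * real n \<le> B - c\<^sup>2" "B - c\<^sup>2 \<le> (1 + \<delta>) * real n"
    using B c2 zero_le_power2[of c] unfolding left_diff_distrib by linarith+
  have Bcpos: "0 < B - c\<^sup>2"
  proof -
    have "0 < (1 - 2 * \<delta>) * real n" using del n0 by (intro mult_pos_pos) auto
    then show ?thesis using Bc(1) by linarith
  qed
  have b: "b\<^sup>2 = B - c\<^sup>2" "0 < b" using Bcpos by (auto simp: b_def)
  have sq: "(1 - k) * sqrt n \<le> sqrt X" if "(1 - k) * real n \<le> X" "0 \<le> k" "k \<le> 1" for k X
  proof (rule real_le_rsqrt)
    have "((1 - k) * sqrt n)\<^sup>2 = (1 - k)\<^sup>2 * real n" by (simp add: power_mult_distrib)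
    also have "\<dots> \<le> (1 - k) * real n" using that by (intro mult_right_mono) (auto simp: power2_eq_square mult_left_le)
    finally show "((1 - k) * sqrt n)\<^sup>2 \<le> X" using that(1) by linarith
  qed
  have al: "(1 - \<delta>) * sqrt n \<le> a" unfolding a_def by (rule sq) (use A del in auto)
  have bl: "(1 - 2 * \<delta>) * sqrt n \<le> b" unfolding b_def by (rule sq) (use Bc del in auto)
  define e where "e i = g i / a" for i
  define f where "f i = (h i - c * e i) / b" for i
  have ee: "(\<Sum>i<n. e i * e i) = 1"
  proof -
    have "(\<Sum>i<n. e i * e i) = A / a\<^sup>2" by (simp add: e_def A_def sum_divide_distrib power2_eq_square)
    then show ?thesis using a Apos by simp
  qed
  have eh: "(\<Sum>i<n. e i * h i) = c" by (simp add: e_def c_def I_def sum_divide_distrib)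
  have ef: "(\<Sum>i<n. e i * f i) = 0"
  proof -
    have "(\<Sum>i<n. e i * f i) = ((\<Sum>i<n. e i * h i) - c * (\<Sum>i<n. e i * e i)) / b"
      by (simp add: f_def sum_divide_distrib sum_distrib_left sum_subtractf[symmetric] algebra_simps)
    then show ?thesis by (simp add: ee eh)
  qed
  have ff: "(\<Sum>i<n. f i * f i) = 1"
  proof -
    have "(\<Sum>i<n. f i * f i) = (\<Sum>i<n. (h i)\<^sup>2 - 2 * c * (e i * h i) + c\<^sup>2 * (e i * e i)) / b\<^sup>2"
      unfolding sum_divide_distrib by (intro sum.cong) (auto simp: f_def power2_eq_square algebra_simps add_divide_distrib diff_divide_distrib)
    also have "(\<Sum>i<n. (h i)\<^sup>2 - 2 * c * (e i * h i) + c\<^sup>2 * (e i * e i)) = B - 2 * c * c + c\<^sup>2"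
      by (simp add: sum.distrib sum_subtractf sum_distrib_left[symmetric] B_def ee eh)
    also have "\<dots> = B - c\<^sup>2" by (simp add: power2_eq_square)
    finally show ?thesis using b Bcpos by simp
  qed
  let ?e = "\<lambda>v j. \<Sum>i<n. e i * v (i, j)" and ?f = "\<lambda>v j. \<Sum>i<n. f i * v (i, j)"
  have vg: "(\<Sum>i<n. v (i, j) * g i) = a * ?e v j" for v :: "nat \<times> nat \<Rightarrow> real" and j
    using a(2) by (simp add: sum_distrib_left e_def mult_ac)
  have vh: "(\<Sum>i<n. v (i, j) * h i) = c * ?e v j + b * ?f v j" for v :: "nat \<times> nat \<Rightarrow> real" and j
  proof -
    have hi: "h i = c * e i + b * f i" for i using b(2) by (simp add: f_def)
    show ?thesis unfolding hi by (simp add: sum_distrib_left sum.distrib[symmetric] algebra_simps)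
  qed
  let ?T = "T + 4 * \<delta> * \<tau>"
  let ?S = "{v\<in>space MV. (\<forall>j\<in>{..<p}. \<bar>?e v j\<bar> \<le> ?T) \<and> (\<forall>j\<in>{..<p}. \<bar>?f v j\<bar> \<le> ?T)}"
  let ?E = "{v\<in>space MV. \<exists>j\<in>{..<p}. \<tau> < \<bar>?e v j\<bar>}" and ?F = "{v\<in>space MV. \<exists>j\<in>{..<p}. \<tau> < \<bar>?f v j\<bar>}"
  have s: "?S \<in> sets MV" "?E \<in> sets MV" "?F \<in> sets MV" by measurable
  let ?A = "{v\<in>space MV. (\<forall>j\<in>{..<p}. \<bar>\<Sum>i<n. v (i, j) * g i\<bar> \<le> T * sqrt n) \<and> (\<forall>j\<in>{..<p}. \<bar>\<Sum>i<n. v (i, j) * h i\<bar> \<le> T * sqrt n)}"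
  have "?A \<subseteq> (?S \<union> ?E) \<union> ?F"
  proof (rule subsetI, rule ccontr)
    fix v assume v: "v \<in> ?A" "v \<notin> (?S \<union> ?E) \<union> ?F"
    have "\<bar>?e v j\<bar> \<le> ?T \<and> \<bar>?f v j\<bar> \<le> ?T" if j: "j \<in> {..<p}" for j
    proof -
      have 1: "\<bar>?e v j\<bar> \<le> \<tau>" "\<bar>?f v j\<bar> \<le> \<tau>" using v j by (auto simp: not_less)
      have 2: "a * \<bar>?e v j\<bar> \<le> T * sqrt n" "\<bar>c * ?e v j + b * ?f v j\<bar> \<le> T * sqrt n"
        using v(1) j a(2) unfolding vg vh by (auto simp: abs_mult)
      have sn: "0 < sqrt n" using n0 by simp
      have dt: "0 \<le> \<delta> * \<tau>" using del tau by simp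
      have "sqrt n * \<bar>?e v j\<bar> = (1 - \<delta>) * sqrt n * \<bar>?e v j\<bar> + \<delta> * sqrt n * \<bar>?e v j\<bar>" by (simp add: algebra_simps)
      also have "\<dots> \<le> a * \<bar>?e v j\<bar> + \<delta> * sqrt n * \<tau>"
        using al 1 del by (intro add_mono mult_right_mono mult_left_mono) auto
      also have "\<dots> \<le> sqrt n * (T + \<delta> * \<tau>)" using 2(1) by (simp add: algebra_simps)
      finally have e1: "\<bar>?e v j\<bar> \<le> T + \<delta> * \<tau>" using sn by simp
      have "sqrt n * \<bar>?f v j\<bar> = (1 - 2 * \<delta>) * sqrt n * \<bar>?f v j\<bar> + 2 * \<delta> * sqrt n * \<bar>?f v j\<bar>" by (simp add: algebra_simps)
      also have "\<dots> \<le> b * \<bar>?f v j\<bar> + 2 * \<delta> * sqrt n * \<tau>"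
        using bl 1 del by (intro add_mono mult_right_mono mult_left_mono) auto
      also have "b * \<bar>?f v j\<bar> \<le> \<bar>c * ?e v j + b * ?f v j\<bar> + \<bar>c\<bar> * \<bar>?e v j\<bar>"
      proof -
        have "b * \<bar>?f v j\<bar> = \<bar>(c * ?e v j + b * ?f v j) - c * ?e v j\<bar>" using b(2) by (simp add: abs_mult)
        also have "\<dots> \<le> \<bar>c * ?e v j + b * ?f v j\<bar> + \<bar>c * ?e v j\<bar>" by (rule abs_triangle_ineq4)
        finally show ?thesis by (simp add: abs_mult)
      qed
      also have "\<bar>c\<bar> * \<bar>?e v j\<bar> \<le> (2 * \<delta> * sqrt n) * \<tau>" using c1 1 del by (intro mult_mono) auto
      \<comment> \<open>The shift 4 * \<delta> * \<tau> consists of 2 * \<delta> * \<tau> from the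
        length \<open>b\<close> and 2 * \<delta> * \<tau> from the component
        \<open>c\<close>.\<close>
      finally have "sqrt n * \<bar>?f v j\<bar> \<le> sqrt n * ?T" using 2(2) by (simp add: algebra_simps)
      then have "\<bar>?f v j\<bar> \<le> ?T" using sn by simp
      then show ?thesis using e1 dt by linarith
    qed
    then show False using v by auto
  qed
  then have "measure MV ?A \<le> measure MV ((?S \<union> ?E) \<union> ?F)" using s by (intro V.finite_measure_mono) auto
  also have "\<dots> \<le> measure MV (?S \<union> ?E) + measure MV ?F" using s by (intro measure_Un_le) auto
  also have "measure MV (?S \<union> ?E) \<le> measure MV ?S + measure MV ?E" using s by (intro measure_Un_le) auto
  also have "measure MV ?S = F ?T * F ?T"
  proof -
    have G: "gauss MV ({..<p} <+> {..<p}) (\<lambda>k \<omega>. case k of Inl j \<Rightarrow> \<Sum>i<n. e i * \<omega> (i, j) | Inr j \<Rightarrow> \<Sum>i<n. f i * \<omega> (i, j))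
      (\<lambda>k l. case k of Inl i \<Rightarrow> (case l of Inl i' \<Rightarrow> SV i i' | Inr _ \<Rightarrow> 0) | Inr j \<Rightarrow> (case l of Inl _ \<Rightarrow> 0 | Inr j' \<Rightarrow> SV j j'))"
      by (rule gauss_row_two_combos[OF gauss_MV ee ff ef])
    from gauss_prob_two_blocks[OF G gauss_row0[OF n_pos] gauss_row0[OF n_pos], of ?T ?T]
    show ?thesis by (simp add: F_def)
  qed
  also have "measure MV ?E \<le> 2 * real p * exp (- \<tau>\<^sup>2 / (8 * \<kappa>2))" using V_combo_tail[OF ee tau] by simp
  also have "measure MV ?F \<le> 2 * real p * exp (- \<tau>\<^sup>2 / (8 * \<kappa>2))" using V_combo_tail[OF ff tau] by simp
  finally show ?thesis by simp
qed


text \<open>The three tails belong to a multiplier sum over W exceeding \<mu> * sqrt n, to a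
  Gaussian maximum over V exceeding \<tau>, and to a multiplier norm or inner product off by
  \<delta>. The 16 in \<open>W_tail\<close> is 8 * 2, as a typical multiplier vector has squared
  norm at most 2 * n.\<close>

definition W_tail :: "real \<Rightarrow> real" where "W_tail \<mu> = 2 * real p * exp (- \<mu>\<^sup>2 / (16 * \<kappa>2))"
definition V_tail :: "real \<Rightarrow> real" where "V_tail \<tau> = 2 * real p * exp (- \<tau>\<^sup>2 / (8 * \<kappa>2))"
definition norm_tail :: "real \<Rightarrow> real" where "norm_tail \<delta> = 2 * exp (- (real n * \<delta>\<^sup>2) / 16)"

lemma tails_nonneg: "0 \<le> W_tail \<mu>" "0 \<le> V_tail \<tau>" "0 \<le> norm_tail \<delta>" "0 \<le> bad_bound e"
  by (auto simp: W_tail_def V_tail_def norm_tail_def bad_bound_def)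

section \<open>First and second moments of \<open>H\<close> with the multipliers held fixed\<close>

lemma W_event:
  assumes g: "(\<Sum>i<n. (g i)\<^sup>2) \<le> 2 * real n" and mu: "0 \<le> \<mu>"
  shows "{z\<in>space Zs. \<exists>k\<in>{..<p}. \<mu> * sqrt n < \<bar>\<Sum>i<n. g i * w (snd z) i k\<bar>} \<in> sets Zs"
    and "measure Zs {z\<in>space Zs. \<exists>k\<in>{..<p}. \<mu> * sqrt n < \<bar>\<Sum>i<n. g i * w (snd z) i k\<bar>} \<le> W_tail \<mu>"
proof -
  have [measurable]: "(\<lambda>z. w (snd z) i j) \<in> borel_measurable Zs" if "i \<in> {..<n}" "j \<in> {..<p}" for i j
    by (rule measurable_compose[OF measurable_snd MR_index]) (use that in auto)
  show "{z\<in>space Zs. \<exists>k\<in>{..<p}. \<mu> * sqrt n < \<bar>\<Sum>i<n. g i * w (snd z) i k\<bar>} \<in> sets Zs" by measurable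
  have [measurable]: "(\<lambda>r. w r i j) \<in> borel_measurable MR" if "i \<in> {..<n}" "j \<in> {..<p}" for i j
    using that by (auto intro: MR_index)
  have s: "{r\<in>space MR. \<exists>k\<in>{..<p}. \<mu> * sqrt n < \<bar>\<Sum>i<n. g i * w r i k\<bar>} \<in> sets MR" by measurable
  have "measure Zs {z\<in>space Zs. \<exists>k\<in>{..<p}. \<mu> * sqrt n < \<bar>\<Sum>i<n. g i * w (snd z) i k\<bar>}
    = measure MR {r\<in>space MR. \<exists>k\<in>{..<p}. \<mu> * sqrt n < \<bar>\<Sum>i<n. g i * w r i k\<bar>}"
    by (rule prob_pair_snd[OF prob_MV prob_MR s])
  also have "\<dots> \<le> 2 * real p * exp (- (\<mu> * sqrt n)\<^sup>2 / (8 * \<kappa>2 * (2 * real n)))"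
    using W_combo_tail[of g "2 * real n" "\<mu> * sqrt n"] g mu n_pos by (simp add: power2_eq_square)
  also have "- (\<mu> * sqrt n)\<^sup>2 / (8 * \<kappa>2 * (2 * real n)) = - \<mu>\<^sup>2 / (16 * \<kappa>2)"
    using n_pos by (simp add: power_mult_distrib)
  finally show "measure Zs {z\<in>space Zs. \<exists>k\<in>{..<p}. \<mu> * sqrt n < \<bar>\<Sum>i<n. g i * w (snd z) i k\<bar>} \<le> W_tail \<mu>" by (simp add: W_tail_def)
qed

lemma combo_close:
  assumes G: "Good e z" and small: "8 * real s * (2 * \<kappa>2 * e) \<le> 2 * \<kappa>1" "512 * real s * \<eta>\<^sup>2 \<le> 2 * \<kappa>1"
    and W: "\<not> (\<exists>k\<in>{..<p}. \<mu> * sqrt n < \<bar>\<Sum>i<n. g i * w (snd z) i k\<bar>)" and mu: "0 \<le> \<mu>" and j: "j < p"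
  shows "\<bar>(\<Sum>i<n. Vh z i j * g i) - (\<Sum>i<n. fst z (i, j) * g i)\<bar> \<le> d * \<mu> * sqrt n"
proof -
  have "\<bar>(\<Sum>i<n. Vh z i j * g i) - (\<Sum>i<n. fst z (i, j) * g i)\<bar> \<le> d * (\<mu> * sqrt n)"
    using G W mu by (intro combo_diff Pt_l1_error[OF _ _ _ small j] j) (auto simp: Good_def not_less mult.commute)
  then show ?thesis by (simp add: mult.assoc)
qed

lemma V_event_sets:
  "{v\<in>space MV. \<forall>j\<in>{..<p}. \<bar>\<Sum>i<n. v (i, j) * g i\<bar> \<le> T} \<in> sets MV"
proof -
  have [measurable]: "(\<lambda>v. v (i, j)) \<in> borel_measurable MV" if "i \<in> {..<n}" "j \<in> {..<p}" for i j
    using that by (auto intro: MV_index)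
  show ?thesis by measurable
qed

lemma prob_cover3:
  assumes "A \<subseteq> (X \<union> Y) \<union> Z" "X \<in> sets Zs" "Y \<in> sets Zs" "Z \<in> sets Zs"
  shows "measure Zs A \<le> measure Zs X + measure Zs Y + measure Zs Z"
proof -
  interpret Z: prob_space Zs by (rule prob_Zs)
  have "measure Zs A \<le> measure Zs ((X \<union> Y) \<union> Z)" by (rule Z.finite_measure_mono[OF assms(1)]) (intro sets.Un assms)
  also have "\<dots> \<le> measure Zs (X \<union> Y) + measure Zs Z" by (rule measure_Un_le) (intro sets.Un assms)+
  also have "measure Zs (X \<union> Y) \<le> measure Zs X + measure Zs Y" by (rule measure_Un_le) (intro assms)+
  finally show ?thesis by simp
qed

lemma norm_le_2n: "\<bar>(\<Sum>i<n. (g i)\<^sup>2) - real n\<bar> \<le> \<delta> * real n \<Longrightarrow> \<delta> \<le> 1 / 4 \<Longrightarrow> (\<Sum>i<n. (g i)\<^sup>2) \<le> 2 * real n"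
  using mult_right_mono[of \<delta> "1/4" "real n"] by linarith

text \<open>With \<open>g\<close> fixed and the data random, the combination of rows of
  \<open>V\<close> has an exact normal law, although the estimated projection inside
  \<open>Vh\<close> depends on \<open>V\<close>. That dependence is confined to the error
  \<open>d * \<mu>\<close>.\<close>

lemma section_lower:
  assumes e: "0 \<le> e" "e \<le> 1" and small: "8 * real s * (2 * \<kappa>2 * e) \<le> 2 * \<kappa>1" "512 * real s * \<eta>\<^sup>2 \<le> 2 * \<kappa>1"
    and del: "0 < \<delta>" "\<delta> \<le> 1 / 4" and tau: "0 \<le> \<tau>" and mu: "0 \<le> \<mu>"
    and g: "\<bar>(\<Sum>i<n. (g i)\<^sup>2) - real n\<bar> \<le> \<delta> * real n"
  shows "measure Zs {z\<in>space Zs. \<not> (\<forall>j\<in>{..<p}. \<bar>\<Sum>i<n. Vh z i j * g i\<bar> \<le> t * sqrt n)}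
    \<le> bad_bound e + W_tail \<mu> + (1 - F (t - d * \<mu> - \<delta> * \<tau>) + V_tail \<tau>)" (is "measure Zs ?A \<le> _")
proof -
  let ?T = "(t - d * \<mu>) * sqrt n"
  let ?X = "{z\<in>space Zs. \<not> Good e z}" and ?Y = "{z\<in>space Zs. \<exists>k\<in>{..<p}. \<mu> * sqrt n < \<bar>\<Sum>i<n. g i * w (snd z) i k\<bar>}"
  let ?V = "{v\<in>space MV. \<not> (\<forall>j\<in>{..<p}. \<bar>\<Sum>i<n. v (i, j) * g i\<bar> \<le> ?T)}"
  let ?Z = "{z\<in>space Zs. \<not> (\<forall>j\<in>{..<p}. \<bar>\<Sum>i<n. fst z (i, j) * g i\<bar> \<le> ?T)}"
  note W = W_event[OF norm_le_2n[OF g del(2)] mu]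
  have V: "?V \<in> sets MV"
  proof -
    have "?V = space MV - {v\<in>space MV. \<forall>j\<in>{..<p}. \<bar>\<Sum>i<n. v (i, j) * g i\<bar> \<le> ?T}" by auto
    then show ?thesis using V_event_sets[of g ?T] by simp
  qed
  have "?Z = ?V \<times> space MR" by (auto simp: space_pair_measure)
  then have Z: "?Z \<in> sets Zs" using V by simp
  have "?A \<subseteq> (?X \<union> ?Y) \<union> ?Z"
  proof (rule subsetI, rule ccontr)
    fix z assume z: "z \<in> ?A" "z \<notin> (?X \<union> ?Y) \<union> ?Z"
    have "\<bar>\<Sum>i<n. Vh z i j * g i\<bar> \<le> t * sqrt n" if j: "j < p" for j
    proof -
      have "\<bar>(\<Sum>i<n. Vh z i j * g i) - (\<Sum>i<n. fst z (i, j) * g i)\<bar> \<le> d * \<mu> * sqrt n"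
        by (rule combo_close[where e = e, OF _ small _ mu j]) (use z in auto)
      moreover have "\<bar>\<Sum>i<n. fst z (i, j) * g i\<bar> \<le> t * sqrt n - d * \<mu> * sqrt n" using z j by (auto simp: left_diff_distrib)
      ultimately show ?thesis by linarith
    qed
    then show False using z(1) by auto
  qed
  from prob_cover3[OF this Good_sets W(1) Z]
  have "measure Zs ?A \<le> measure Zs ?X + measure Zs ?Y + measure Zs ?Z" .
  moreover have "measure Zs ?Z = measure MV ?V" by (rule prob_pair_fst[OF prob_MV prob_MR V])
  moreover have "measure MV ?V \<le> 1 - F (t - d * \<mu> - \<delta> * \<tau>) + V_tail \<tau>"
    unfolding V_tail_def by (rule V_single_lower[OF g del tau])
  ultimately show ?thesis using Good_prob[OF e] W(2) by linarith
qed

lemma section_upper: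
  assumes e: "0 \<le> e" "e \<le> 1" and small: "8 * real s * (2 * \<kappa>2 * e) \<le> 2 * \<kappa>1" "512 * real s * \<eta>\<^sup>2 \<le> 2 * \<kappa>1"
    and del: "0 < \<delta>" "\<delta> \<le> 1 / 4" and tau: "0 \<le> \<tau>" and mu: "0 \<le> \<mu>"
    and g: "\<bar>(\<Sum>i<n. (g i)\<^sup>2) - real n\<bar> \<le> \<delta> * real n" and h: "\<bar>(\<Sum>i<n. (h i)\<^sup>2) - real n\<bar> \<le> \<delta> * real n"
    and gh: "\<bar>\<Sum>i<n. g i * h i\<bar> \<le> \<delta> * real n"
  shows "measure Zs {z\<in>space Zs. (\<forall>j\<in>{..<p}. \<bar>\<Sum>i<n. Vh z i j * g i\<bar> \<le> t * sqrt n) \<and> (\<forall>j\<in>{..<p}. \<bar>\<Sum>i<n. Vh z i j * h i\<bar> \<le> t * sqrt n)}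
    \<le> bad_bound e + 2 * W_tail \<mu> + (F (t + d * \<mu> + 4 * \<delta> * \<tau>) * F (t + d * \<mu> + 4 * \<delta> * \<tau>) + 2 * V_tail \<tau>)" (is "measure Zs ?A \<le> _")
proof -
  let ?T = "(t + d * \<mu>) * sqrt n"
  let ?X = "{z\<in>space Zs. \<not> Good e z}"
  let ?Y = "\<lambda>g. {z\<in>space Zs. \<exists>k\<in>{..<p}. \<mu> * sqrt n < \<bar>\<Sum>i<n. g i * w (snd z) i k\<bar>}"
  let ?V = "{v\<in>space MV. (\<forall>j\<in>{..<p}. \<bar>\<Sum>i<n. v (i, j) * g i\<bar> \<le> ?T) \<and> (\<forall>j\<in>{..<p}. \<bar>\<Sum>i<n. v (i, j) * h i\<bar> \<le> ?T)}"
  let ?Z = "{z\<in>space Zs. (\<forall>j\<in>{..<p}. \<bar>\<Sum>i<n. fst z (i, j) * g i\<bar> \<le> ?T) \<and> (\<forall>j\<in>{..<p}. \<bar>\<Sum>i<n. fst z (i, j) * h i\<bar> \<le> ?T)}"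
  note Wg = W_event[OF norm_le_2n[OF g del(2)] mu] and Wh = W_event[OF norm_le_2n[OF h del(2)] mu]
  have V: "?V \<in> sets MV"
  proof -
    have "?V = {v\<in>space MV. \<forall>j\<in>{..<p}. \<bar>\<Sum>i<n. v (i, j) * g i\<bar> \<le> ?T} \<inter> {v\<in>space MV. \<forall>j\<in>{..<p}. \<bar>\<Sum>i<n. v (i, j) * h i\<bar> \<le> ?T}" by auto
    then show ?thesis using V_event_sets[of g ?T] V_event_sets[of h ?T] by simp
  qed
  have "?Z = ?V \<times> space MR" by (auto simp: space_pair_measure)
  then have Z: "?Z \<in> sets Zs" using V by simp
  have "?A \<subseteq> (?X \<union> (?Y g \<union> ?Y h)) \<union> ?Z"
  proof (rule subsetI, rule ccontr)
    fix z assume z: "z \<in> ?A" "z \<notin> (?X \<union> (?Y g \<union> ?Y h)) \<union> ?Z"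
    have "\<bar>\<Sum>i<n. fst z (i, j) * q i\<bar> \<le> ?T" if j: "j < p" and q: "q = g \<or> q = h" for j q
    proof -
      have "\<bar>(\<Sum>i<n. Vh z i j * q i) - (\<Sum>i<n. fst z (i, j) * q i)\<bar> \<le> d * \<mu> * sqrt n"
        by (rule combo_close[where e = e, OF _ small _ mu j]) (use z q in auto)
      moreover have "\<bar>\<Sum>i<n. Vh z i j * q i\<bar> \<le> t * sqrt n" using z j q by auto
      ultimately show ?thesis unfolding distrib_right by linarith
    qed
    then show False using z by auto
  qed
  from prob_cover3[OF this Good_sets sets.Un[OF Wg(1) Wh(1)] Z]
  have "measure Zs ?A \<le> measure Zs ?X + measure Zs (?Y g \<union> ?Y h) + measure Zs ?Z" .
  moreover have "measure Zs (?Y g \<union> ?Y h) \<le> measure Zs (?Y g) + measure Zs (?Y h)" by (rule measure_Un_le) (intro Wg Wh)+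
  moreover have "measure Zs ?Z = measure MV ?V" by (rule prob_pair_fst[OF prob_MV prob_MR V])
  moreover have "measure MV ?V \<le> F (t + d * \<mu> + 4 * \<delta> * \<tau>) * F (t + d * \<mu> + 4 * \<delta> * \<tau>) + 2 * V_tail \<tau>"
    unfolding V_tail_def by (rule V_pair_upper[OF g h gh del tau])
  ultimately show ?thesis using Good_prob[OF e] Wg(2) Wh(2) by linarith
qed

abbreviation Gs where "Gs \<equiv> std_gauss {..<n}"

lemma g_norm_prob:
  assumes del: "0 < \<delta>" "\<delta> \<le> 1 / 4"
  shows "{g\<in>space Gs. \<delta> * real n < \<bar>(\<Sum>i<n. (g i)\<^sup>2) - real n\<bar>} \<in> sets Gs"
    and "measure Gs {g\<in>space Gs. \<delta> * real n < \<bar>(\<Sum>i<n. (g i)\<^sup>2) - real n\<bar>} \<le> norm_tail \<delta>"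
proof -
  show "{g\<in>space Gs. \<delta> * real n < \<bar>(\<Sum>i<n. (g i)\<^sup>2) - real n\<bar>} \<in> sets Gs" by measurable
  show "measure Gs {g\<in>space Gs. \<delta> * real n < \<bar>(\<Sum>i<n. (g i)\<^sup>2) - real n\<bar>} \<le> norm_tail \<delta>"
    using std_gauss_sum_squares[of "{..<n}" \<delta>] del by (simp add: norm_tail_def mult.commute[of \<delta>])
qed

text \<open>By Fubini the mean of \<open>H t\<close> is the probability of \<open>Hset t\<close>,
  and the complement of \<open>Hset t\<close> is estimated for each multiplier vector of nearly
  correct norm.\<close>

lemma H_mean_lower:
  assumes e: "0 \<le> e" "e \<le> 1" and small: "8 * real s * (2 * \<kappa>2 * e) \<le> 2 * \<kappa>1" "512 * real s * \<eta>\<^sup>2 \<le> 2 * \<kappa>1"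
    and del: "0 < \<delta>" "\<delta> \<le> 1 / 4" and tau: "0 \<le> \<tau>" and mu: "0 \<le> \<mu>"
  shows "F (t - d * \<mu> - \<delta> * \<tau>) - (bad_bound e + W_tail \<mu> + V_tail \<tau> + norm_tail \<delta>) \<le> (\<integral>z. H t z \<partial>Zs)"
proof -
  interpret Z: prob_space Zs by (rule prob_Zs)
  interpret G: prob_space Gs by (rule prob_space_std_gauss)
  interpret P: pair_prob_space Zs Gs by standard
  let ?B = "{g\<in>space Gs. \<delta> * real n < \<bar>(\<Sum>i<n. (g i)\<^sup>2) - real n\<bar>}"
  let ?c = "bad_bound e + W_tail \<mu> + (1 - F (t - d * \<mu> - \<delta> * \<tau>) + V_tail \<tau>)"
  have "(\<integral>z. H t z \<partial>Zs) = (\<integral>z. measure Gs (Pair z -` Hset t) \<partial>Zs)"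
    by (intro Bochner_Integration.integral_cong refl H_section)
  also have "\<dots> = measure (Zs \<Otimes>\<^sub>M Gs) (Hset t)"
    by (rule prob_pair_integral[OF prob_Zs prob_space_std_gauss Hset_sets, symmetric])
  finally have EH: "(\<integral>z. H t z \<partial>Zs) = measure (Zs \<Otimes>\<^sub>M Gs) (Hset t)" .
  have "measure (Zs \<Otimes>\<^sub>M Gs) (space (Zs \<Otimes>\<^sub>M Gs) - Hset t) \<le> ?c + measure Gs ?B"
  proof (rule prob_pair_le_except[OF prob_Zs prob_space_std_gauss _ g_norm_prob(1)[OF del]])
    show "space (Zs \<Otimes>\<^sub>M Gs) - Hset t \<in> sets (Zs \<Otimes>\<^sub>M Gs)" using Hset_sets by auto
    show "0 \<le> ?c" using tails_nonneg(1)[of \<mu>] tails_nonneg(2)[of \<tau>] tails_nonneg(4)[of e] F_range(2)[of "t - d * \<mu> - \<delta> * \<tau>"] by linarith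
    fix g assume g: "g \<in> space Gs" "g \<notin> ?B"
    have "{z\<in>space Zs. (z, g) \<in> space (Zs \<Otimes>\<^sub>M Gs) - Hset t} = {z\<in>space Zs. \<not> (\<forall>j\<in>{..<p}. \<bar>\<Sum>i<n. Vh z i j * g i\<bar> \<le> t * sqrt n)}"
      using g(1) unfolding Hset_def by (auto simp: space_pair_measure)
    moreover have "measure Zs {z\<in>space Zs. \<not> (\<forall>j\<in>{..<p}. \<bar>\<Sum>i<n. Vh z i j * g i\<bar> \<le> t * sqrt n)} \<le> ?c"
      by (rule section_lower[OF e small del tau mu]) (use g in auto)
    ultimately show "measure Zs {z\<in>space Zs. (z, g) \<in> space (Zs \<Otimes>\<^sub>M Gs) - Hset t} \<le> ?c" by simp
  qed
  then show ?thesis using g_norm_prob(2)[OF del] P.prob_compl[OF Hset_sets, of t] unfolding EH by linarith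
qed

text \<open>Given a vector h of squared norm at most 2 * n, its inner product with an independent
  standard normal vector is normal with variance at most 2 * n, so it exceeds \<delta> * n with
  probability of order exp (- n * \<delta>^2 / 8).\<close>

lemma gg_prob:
  assumes del: "0 < \<delta>" "\<delta> \<le> 1 / 4"
  defines "B \<equiv> {q\<in>space (Gs \<Otimes>\<^sub>M Gs). \<delta> * real n < \<bar>(\<Sum>i<n. (fst q i)\<^sup>2) - real n\<bar> \<or>
     \<delta> * real n < \<bar>(\<Sum>i<n. (snd q i)\<^sup>2) - real n\<bar> \<or> \<delta> * real n < \<bar>\<Sum>i<n. fst q i * snd q i\<bar>}"
  shows "B \<in> sets (Gs \<Otimes>\<^sub>M Gs)" and "measure (Gs \<Otimes>\<^sub>M Gs) B \<le> 3 * norm_tail \<delta>"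
proof -
  interpret G: prob_space Gs by (rule prob_space_std_gauss)
  have [measurable]: "(\<lambda>q. fst q i) \<in> borel_measurable (Gs \<Otimes>\<^sub>M Gs)" "(\<lambda>q. snd q i) \<in> borel_measurable (Gs \<Otimes>\<^sub>M Gs)" if "i \<in> {..<n}" for i
    using that by (auto intro!: measurable_compose[OF measurable_fst std_gauss_index] measurable_compose[OF measurable_snd std_gauss_index])
  show B: "B \<in> sets (Gs \<Otimes>\<^sub>M Gs)" unfolding B_def by measurable
  let ?N = "{g\<in>space Gs. \<delta> * real n < \<bar>(\<Sum>i<n. (g i)\<^sup>2) - real n\<bar>}"
  have "measure (Gs \<Otimes>\<^sub>M Gs) B \<le> 2 * norm_tail \<delta> + measure Gs ?N"
  proof (rule prob_pair_le_except[OF prob_space_std_gauss prob_space_std_gauss B g_norm_prob(1)[OF del]])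
    show "0 \<le> 2 * norm_tail \<delta>" using tails_nonneg(3) by simp
    fix h assume h: "h \<in> space Gs" "h \<notin> ?N"
    let ?C = "{g\<in>space Gs. \<delta> * real n < \<bar>\<Sum>i<n. h i * g i\<bar>}"
    have C: "?C \<in> sets Gs" by measurable
    have "{g\<in>space Gs. (g, h) \<in> B} \<subseteq> ?N \<union> ?C" using h by (auto simp: B_def mult.commute)
    then have "measure Gs {g\<in>space Gs. (g, h) \<in> B} \<le> measure Gs (?N \<union> ?C)"
      by (rule G.finite_measure_mono) (intro sets.Un C g_norm_prob(1)[OF del])
    also have "\<dots> \<le> measure Gs ?N + measure Gs ?C" by (rule measure_Un_le) (intro C g_norm_prob(1)[OF del])+
    also have "measure Gs ?C \<le> norm_tail \<delta>"
    proof -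
      have v: "(\<Sum>i<n. h i * h i) \<le> 2 * real n" using norm_le_2n[of h \<delta>] h del by (simp add: power2_eq_square not_less)
      have "measure Gs ?C \<le> sqrt 2 * exp (- (\<delta> * real n)\<^sup>2 / (4 * (2 * real n)))"
        by (rule gauss_tail[OF gauss_linear_std[of "{..<n}" "{()}" "\<lambda>_. h"], of "()"]) (use v n_pos del in auto)
      also have "(\<delta> * real n)\<^sup>2 / (4 * (2 * real n)) = real n * \<delta>\<^sup>2 / 8" using n_pos by (simp add: power2_eq_square)
      then have "exp (- (\<delta> * real n)\<^sup>2 / (4 * (2 * real n))) = exp (- (real n * \<delta>\<^sup>2 / 8))" by simp
      also have "sqrt 2 * exp (- (real n * \<delta>\<^sup>2 / 8)) \<le> 2 * exp (- (real n * \<delta>\<^sup>2) / 16)"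
        by (intro mult_mono real_le_lsqrt) auto
      finally show ?thesis by (simp add: norm_tail_def)
    qed
    finally show "measure Gs {g\<in>space Gs. (g, h) \<in> B} \<le> 2 * norm_tail \<delta>" using g_norm_prob(2)[OF del] by linarith
  qed
  then show "measure (Gs \<Otimes>\<^sub>M Gs) B \<le> 3 * norm_tail \<delta>" using g_norm_prob(2)[OF del] by linarith
qed

text \<open>The square of a conditional probability is the conditional probability of the same event
  for two independent multiplier vectors. Fubini then fixes the pair and
  \<open>section_upper\<close> applies.\<close>

lemma H_second_moment_upper:
  assumes e: "0 \<le> e" "e \<le> 1" and small: "8 * real s * (2 * \<kappa>2 * e) \<le> 2 * \<kappa>1" "512 * real s * \<eta>\<^sup>2 \<le> 2 * \<kappa>1"
    and del: "0 < \<delta>" "\<delta> \<le> 1 / 4" and tau: "0 \<le> \<tau>" and mu: "0 \<le> \<mu>"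
  shows "(\<integral>z. H t z * H t z \<partial>Zs) \<le> F (t + d * \<mu> + 4 * \<delta> * \<tau>) * F (t + d * \<mu> + 4 * \<delta> * \<tau>)
    + (bad_bound e + 2 * W_tail \<mu> + 2 * V_tail \<tau> + 3 * norm_tail \<delta>)"
proof -
  interpret Z: prob_space Zs by (rule prob_Zs)
  interpret G: prob_space Gs by (rule prob_space_std_gauss)
  interpret GG: pair_prob_space Gs Gs by standard
  have pGG: "prob_space (Gs \<Otimes>\<^sub>M Gs)" by (rule GG.prob_space_axioms)
  let ?A = "{q\<in>space (Zs \<Otimes>\<^sub>M (Gs \<Otimes>\<^sub>M Gs)). (\<forall>j\<in>{..<p}. \<bar>\<Sum>i<n. Vh (fst q) i j * fst (snd q) i\<bar> \<le> t * sqrt n)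
    \<and> (\<forall>j\<in>{..<p}. \<bar>\<Sum>i<n. Vh (fst q) i j * snd (snd q) i\<bar> \<le> t * sqrt n)}"
  let ?c = "bad_bound e + 2 * W_tail \<mu> + (F (t + d * \<mu> + 4 * \<delta> * \<tau>) * F (t + d * \<mu> + 4 * \<delta> * \<tau>) + 2 * V_tail \<tau>)"
  have [measurable]: "(\<lambda>q. Vh (fst q) i j) \<in> borel_measurable (Zs \<Otimes>\<^sub>M (Gs \<Otimes>\<^sub>M Gs))" if "i \<in> {..<n}" "j \<in> {..<p}" for i j
    by (rule measurable_compose[OF measurable_fst Vh_measurable_Zs]) (use that in auto)
  have [measurable]: "(\<lambda>q. fst (snd q) i) \<in> borel_measurable (Zs \<Otimes>\<^sub>M (Gs \<Otimes>\<^sub>M Gs))" if "i \<in> {..<n}" for i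
    by (rule measurable_compose[OF measurable_snd measurable_compose[OF measurable_fst std_gauss_index]]) (use that in auto)
  have [measurable]: "(\<lambda>q. snd (snd q) i) \<in> borel_measurable (Zs \<Otimes>\<^sub>M (Gs \<Otimes>\<^sub>M Gs))" if "i \<in> {..<n}" for i
    by (rule measurable_compose[OF measurable_snd measurable_compose[OF measurable_snd std_gauss_index]]) (use that in auto)
  have A: "?A \<in> sets (Zs \<Otimes>\<^sub>M (Gs \<Otimes>\<^sub>M Gs))" by measurable
  have "(\<integral>z. H t z * H t z \<partial>Zs) = (\<integral>z. measure (Gs \<Otimes>\<^sub>M Gs) (Pair z -` ?A) \<partial>Zs)"
  proof (intro Bochner_Integration.integral_cong refl)
    fix z assume z: "z \<in> space Zs"
    let ?S = "{g\<in>space Gs. \<forall>j\<in>{..<p}. \<bar>\<Sum>i<n. Vh z i j * g i\<bar> \<le> t * sqrt n}"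
    have S: "?S \<in> sets Gs" by measurable
    have "Pair z -` ?A = ?S \<times> ?S" using z by (auto simp: space_pair_measure)
    then show "H t z * H t z = measure (Gs \<Otimes>\<^sub>M Gs) (Pair z -` ?A)"
      using prob_pair_times[OF prob_space_std_gauss prob_space_std_gauss S S] by (simp add: H_def)
  qed
  also have "\<dots> = measure (Zs \<Otimes>\<^sub>M (Gs \<Otimes>\<^sub>M Gs)) ?A"
    by (rule prob_pair_integral[OF prob_Zs pGG A, symmetric])
  also have "\<dots> \<le> ?c + measure (Gs \<Otimes>\<^sub>M Gs) {q\<in>space (Gs \<Otimes>\<^sub>M Gs). \<delta> * real n < \<bar>(\<Sum>i<n. (fst q i)\<^sup>2) - real n\<bar> \<or>
     \<delta> * real n < \<bar>(\<Sum>i<n. (snd q i)\<^sup>2) - real n\<bar> \<or> \<delta> * real n < \<bar>\<Sum>i<n. fst q i * snd q i\<bar>}" (is "_ \<le> _ + measure _ ?B")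
  proof (rule prob_pair_le_except[OF prob_Zs pGG A gg_prob(1)[OF del]])
    show "0 \<le> ?c" using tails_nonneg(1)[of \<mu>] tails_nonneg(2)[of \<tau>] tails_nonneg(4)[of e] F_range by (intro add_nonneg_nonneg mult_nonneg_nonneg) auto
    fix q assume q: "q \<in> space (Gs \<Otimes>\<^sub>M Gs)" "q \<notin> ?B"
    have "{z\<in>space Zs. (z, q) \<in> ?A} = {z\<in>space Zs. (\<forall>j\<in>{..<p}. \<bar>\<Sum>i<n. Vh z i j * fst q i\<bar> \<le> t * sqrt n) \<and> (\<forall>j\<in>{..<p}. \<bar>\<Sum>i<n. Vh z i j * snd q i\<bar> \<le> t * sqrt n)}"
      using q(1) by (auto simp: space_pair_measure)
    moreover have "measure Zs {z\<in>space Zs. (\<forall>j\<in>{..<p}. \<bar>\<Sum>i<n. Vh z i j * fst q i\<bar> \<le> t * sqrt n) \<and> (\<forall>j\<in>{..<p}. \<bar>\<Sum>i<n. Vh z i j * snd q i\<bar> \<le> t * sqrt n)} \<le> ?c"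
      by (rule section_upper[OF e small del tau mu]) (use q in auto)
    ultimately show "measure Zs {z\<in>space Zs. (z, q) \<in> ?A} \<le> ?c" by simp
  qed
  finally show ?thesis using gg_prob(2)[OF del] by linarith
qed

definition mean_sq_bound :: "real \<Rightarrow> real \<Rightarrow> real \<Rightarrow> real \<Rightarrow> real" where
  "mean_sq_bound e \<delta> \<tau> \<mu> = 4 * anticonc_const * (d * \<mu> + 4 * \<delta> * \<tau>) + 3 * bad_bound e + 4 * W_tail \<mu> + 4 * V_tail \<tau> + 5 * norm_tail \<delta>"

text \<open>Two independent multiplier vectors are nearly orthogonal, so the second moment of \<open>H t\<close> is
  at most \<open>(F t)\<^sup>2\<close> up to small terms; this replaces a Gaussian comparison theorem.\<close>

lemma H_mean_square:
  assumes e: "0 \<le> e" "e \<le> 1" and small: "8 * real s * (2 * \<kappa>2 * e) \<le> 2 * \<kappa>1" "512 * real s * \<eta>\<^sup>2 \<le> 2 * \<kappa>1"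
    and del: "0 < \<delta>" "\<delta> \<le> 1 / 4" and tau: "0 \<le> \<tau>" and mu: "0 \<le> \<mu>"
  shows "(\<integral>z. (H t z - F t)\<^sup>2 \<partial>Zs) \<le> mean_sq_bound e \<delta> \<tau> \<mu>"
proof -
  interpret Z: prob_space Zs by (rule prob_Zs)
  let ?a = "d * \<mu> + 4 * \<delta> * \<tau>" and ?err = "bad_bound e + W_tail \<mu> + V_tail \<tau> + norm_tail \<delta>"
  have a0: "0 \<le> d * \<mu>" "0 \<le> \<delta> * \<tau>" using d_nonneg mu del tau by auto
  have iH: "integrable Zs (H t)"
    by (rule Z.integrable_const_bound[of _ 1]) (use H_range in \<open>auto intro: H_measurable\<close>)
  have iHH: "integrable Zs (\<lambda>z. H t z * H t z)"
    by (rule Z.integrable_const_bound[of _ 1]) (use H_range in \<open>auto intro!: mult_le_one borel_measurable_times H_measurable\<close>)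
  have "(\<integral>z. (H t z - F t)\<^sup>2 \<partial>Zs) = (\<integral>z. H t z * H t z - 2 * F t * H t z + F t * F t \<partial>Zs)"
    by (intro Bochner_Integration.integral_cong) (auto simp: power2_eq_square algebra_simps)
  also have "\<dots> = (\<integral>z. H t z * H t z \<partial>Zs) - 2 * F t * (\<integral>z. H t z \<partial>Zs) + F t * F t"
    using iH iHH by (simp add: Z.prob_space)
  \<comment> \<open>The second moment enters with a plus sign and the mean with a minus sign, so an
    upper bound on the former and a lower bound on the latter suffice.\<close>
  finally have eq: "(\<integral>z. (H t z - F t)\<^sup>2 \<partial>Zs) = (\<integral>z. H t z * H t z \<partial>Zs) - 2 * F t * (\<integral>z. H t z \<partial>Zs) + F t * F t" .
  have up: "F (t + d * \<mu> + 4 * \<delta> * \<tau>) \<le> F t + anticonc_const * ?a"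
    using F_anticoncentration[OF n_pos p_ge, of ?a t] a0 by (simp add: add.assoc)
  have "F (t + d * \<mu> + 4 * \<delta> * \<tau>) * F (t + d * \<mu> + 4 * \<delta> * \<tau>) - F t * F t
    = (F (t + d * \<mu> + 4 * \<delta> * \<tau>) - F t) * (F (t + d * \<mu> + 4 * \<delta> * \<tau>) + F t)" by (simp add: algebra_simps)
  also have "\<dots> \<le> (anticonc_const * ?a) * 2"
    using up F_range(1) F_range(2)[of t] F_range(2)[of "t + d * \<mu> + 4 * \<delta> * \<tau>"] anticonc_const_nonneg[OF p_ge] a0 by (intro mult_mono) auto
  finally have sq: "F (t + d * \<mu> + 4 * \<delta> * \<tau>) * F (t + d * \<mu> + 4 * \<delta> * \<tau>) \<le> F t * F t + 2 * (anticonc_const * ?a)" by simp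
  have "F t \<le> F (t - d * \<mu> - \<delta> * \<tau>) + anticonc_const * (d * \<mu> + \<delta> * \<tau>)"
    using F_anticoncentration[OF n_pos p_ge, of "d * \<mu> + \<delta> * \<tau>" "t - d * \<mu> - \<delta> * \<tau>"] a0 by simp
  also have "anticonc_const * (d * \<mu> + \<delta> * \<tau>) \<le> anticonc_const * ?a" using anticonc_const_nonneg[OF p_ge] a0 by (intro mult_left_mono) auto
  finally have "F t - anticonc_const * ?a - ?err \<le> (\<integral>z. H t z \<partial>Zs)" using H_mean_lower[OF e small del tau mu, of t] by linarith
  then have "2 * F t * (F t - anticonc_const * ?a - ?err) \<le> 2 * F t * (\<integral>z. H t z \<partial>Zs)" using F_range(1) by (intro mult_left_mono) auto
  moreover have "2 * F t * (F t - anticonc_const * ?a - ?err) = 2 * (F t * F t) - 2 * (F t * (anticonc_const * ?a + ?err))" by (simp add: algebra_simps)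
  moreover have "F t * (anticonc_const * ?a + ?err) \<le> 1 * (anticonc_const * ?a + ?err)"
    using F_range tails_nonneg(1)[of \<mu>] tails_nonneg(2)[of \<tau>] tails_nonneg(3)[of \<delta>] tails_nonneg(4)[of e] anticonc_const_nonneg[OF p_ge] a0
    by (intro mult_right_mono) auto
  ultimately have "(\<integral>z. (H t z - F t)\<^sup>2 \<partial>Zs) \<le> 2 * (anticonc_const * ?a) + (bad_bound e + 2 * W_tail \<mu> + 2 * V_tail \<tau> + 3 * norm_tail \<delta>) + 2 * (anticonc_const * ?a + ?err)"
    using H_second_moment_upper[OF e small del tau mu, of t] sq unfolding eq by linarith
  also have "\<dots> = mean_sq_bound e \<delta> \<tau> \<mu>" by (simp add: mean_sq_bound_def algebra_simps)
  finally show ?thesis .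
qed

section \<open>Quantiles of \<open>F\<close> and the rejection probability\<close>

lemma F_continuous: "continuous_on UNIV F"
proof -
  have lip: "\<bar>F x - F y\<bar> \<le> (anticonc_const + 1) * \<bar>x - y\<bar>" for x y
  proof -
    have *: "F y - F x \<le> (anticonc_const + 1) * (y - x)" "F x \<le> F y" if "x \<le> y" for x y
      using F_anticoncentration[OF n_pos p_ge, of "y - x" x] F_mono[OF n_pos that] that by (auto simp: distrib_right)
    show ?thesis using *[of x y] *[of y x] by (cases "x \<le> y") auto
  qed
  show ?thesis
    unfolding continuous_on_iff
  proof (intro ballI allI impI)
    fix x \<epsilon> :: real assume \<epsilon>: "0 < \<epsilon>"
    have A: "0 < anticonc_const + 1" using anticonc_const_nonneg[OF p_ge] by linarith
    have "dist (F y) (F x) < \<epsilon>" if "dist y x < \<epsilon> / (anticonc_const + 1)" for y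
    proof -
      have "(anticonc_const + 1) * \<bar>y - x\<bar> < \<epsilon>" using that A by (simp add: dist_real_def pos_less_divide_eq mult.commute)
      then show ?thesis using lip[of y x] by (simp add: dist_real_def)
    qed
    then show "\<exists>\<delta>>0. \<forall>y\<in>UNIV. dist y x < \<delta> \<longrightarrow> dist (F y) (F x) < \<epsilon>"
      using \<epsilon> A by (intro exI[of _ "\<epsilon> / (anticonc_const + 1)"]) auto
  qed
qed

text \<open>Intermediate values: \<open>F\<close> is continuous by anticoncentration, vanishes at
  -1, and reaches \<open>q\<close> at some T by the tail bound.\<close>

lemma F_quantile:
  assumes q: "0 < q" "q < 1"
  obtains t where "0 \<le> t" "F t = q"
proof -
  interpret V: prob_space MV by (rule prob_MV)
  obtain T where T: "0 \<le> T" "q \<le> F T"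
  proof -
    \<comment> \<open>Makes the tail bound 2 * p * exp (- T^2 / (8 * \<kappa>2)) at most 1 - q; the
      absolute value keeps the radicand nonnegative.\<close>
    define T where "T = sqrt (8 * \<kappa>2 * (\<bar>ln (2 * real p / (1 - q))\<bar>))"
    have T0: "0 \<le> T" using kappa by (simp add: T_def)
    have e1: "(\<Sum>i<n. of_bool (i = 0) * of_bool (i = 0)) = (1::real)"
    proof -
      have "(\<Sum>i<n. of_bool (i = 0) * of_bool (i = 0)) = (\<Sum>i<n. if 0 = i then 1 else (0::real))" by (intro sum.cong) auto
      then show ?thesis using n_pos by simp
    qed
    have sm: "(\<Sum>i<n. of_bool (i = 0) * v (i, j)) = v (0, j)" for v :: "nat \<times> nat \<Rightarrow> real" and j
    proof -
      have "(\<Sum>i<n. of_bool (i = 0) * v (i, j)) = (\<Sum>i<n. if 0 = i then v (i, j) else 0)" by (intro sum.cong) auto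
      then show ?thesis using n_pos by simp
    qed
    have "measure MV {v\<in>space MV. \<exists>j\<in>{..<p}. T < \<bar>v (0, j)\<bar>} \<le> 2 * real p * exp (- T\<^sup>2 / (8 * \<kappa>2))"
      using V_combo_tail[OF e1 T0] by (simp only: sm)
    also have "- T\<^sup>2 / (8 * \<kappa>2) \<le> - ln (2 * real p / (1 - q))" using kappa by (simp add: T_def)
    then have "2 * real p * exp (- T\<^sup>2 / (8 * \<kappa>2)) \<le> 2 * real p * exp (- ln (2 * real p / (1 - q)))"
      by (intro mult_left_mono) auto
    also have "\<dots> = 1 - q" using q p_ge by (simp add: exp_minus)
    finally have "measure MV {v\<in>space MV. \<exists>j\<in>{..<p}. T < \<bar>v (0, j)\<bar>} \<le> 1 - q" .
    moreover have "{v\<in>space MV. \<exists>j\<in>{..<p}. T < \<bar>v (0, j)\<bar>} = space MV - {v\<in>space MV. \<forall>j\<in>{..<p}. \<bar>v (0, j)\<bar> \<le> T}" by (simp only: set_eq_iff Diff_iff mem_Collect_eq not_le[symmetric]) blast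
    ultimately have "q \<le> F T" using V.prob_compl[OF F_set[OF n_pos, of T]] by (simp add: F_def)
    then show ?thesis using that T0 by blast
  qed
  have "F (-1) = 0" using p_ge by (intro F_neg) auto
  then have "\<exists>x\<ge>-1. x \<le> T \<and> F x = q"
    using T q by (intro IVT') (auto intro: continuous_on_subset[OF F_continuous])
  then obtain t where t: "F t = q" by blast
  have "0 \<le> t"
  proof (rule ccontr)
    assume "\<not> 0 \<le> t"
    then have "F t = 0" using p_ge by (intro F_neg) auto
    then show False using t q by simp
  qed
  then show ?thesis using that t by blast
qed

lemma H_deviation:
  assumes e: "0 \<le> e" "e \<le> 1" and small: "8 * real s * (2 * \<kappa>2 * e) \<le> 2 * \<kappa>1" "512 * real s * \<eta>\<^sup>2 \<le> 2 * \<kappa>1"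
    and del: "0 < \<delta>" "\<delta> \<le> 1 / 4" and tau: "0 \<le> \<tau>" and mu: "0 \<le> \<mu>" and r: "0 < r"
  shows "{z\<in>space Zs. r \<le> \<bar>H t z - F t\<bar>} \<in> sets Zs"
    and "measure Zs {z\<in>space Zs. r \<le> \<bar>H t z - F t\<bar>} \<le> mean_sq_bound e \<delta> \<tau> \<mu> / r\<^sup>2"
proof -
  interpret Z: prob_space Zs by (rule prob_Zs)
  note [measurable] = H_measurable
  show "{z\<in>space Zs. r \<le> \<bar>H t z - F t\<bar>} \<in> sets Zs" by measurable
  have "\<bar>H t z - F t\<bar> \<le> 1" for z using H_range[of t z] F_range[of t] by (simp add: abs_le_iff)
  then have b: "(H t z - F t)\<^sup>2 \<le> 1" for z by (simp add: abs_square_le_1)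
  have i: "integrable Zs (\<lambda>z. (H t z - F t)\<^sup>2)"
    by (rule Z.integrable_const_bound[of _ 1]) (use b in auto)
  have "r \<le> \<bar>x\<bar> \<longleftrightarrow> r\<^sup>2 \<le> x\<^sup>2" for x using abs_le_square_iff[of r x] r by simp
  then have "measure Zs {z\<in>space Zs. r \<le> \<bar>H t z - F t\<bar>} = measure Zs {z\<in>space Zs. r\<^sup>2 \<le> (H t z - F t)\<^sup>2}" by simp
  also have "\<dots> \<le> (\<integral>z. (H t z - F t)\<^sup>2 \<partial>Zs) / r\<^sup>2"
    using i r by (intro integral_Markov_inequality_measure[where A = "{}"]) auto
  also have "\<dots> \<le> mean_sq_bound e \<delta> \<tau> \<mu> / r\<^sup>2" by (intro divide_right_mono H_mean_square assms) auto
  finally show "measure Zs {z\<in>space Zs. r \<le> \<bar>H t z - F t\<bar>} \<le> mean_sq_bound e \<delta> \<tau> \<mu> / r\<^sup>2" .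
qed

text \<open>The quantiles t1 and t2 of \<open>F\<close> at the levels 1 - \<alpha> + r and 1 -
  \<alpha> - r bracket the critical value as soon as \<open>H\<close> is within \<open>r\<close> of
  \<open>F\<close> at these two arguments. So concentration of \<open>H t\<close> for a fixed
  \<open>t\<close> is enough, and the law of the statistic at t1 and t2 gives the two
  bounds.\<close>

lemma rejection_probability:
  assumes e: "0 \<le> e" "e \<le> 1" and small: "8 * real s * (2 * \<kappa>2 * e) \<le> 2 * \<kappa>1" "512 * real s * \<eta>\<^sup>2 \<le> 2 * \<kappa>1"
    and del: "0 < \<delta>" "\<delta> \<le> 1 / 4" and tau: "0 \<le> \<tau>" and mu: "0 \<le> \<mu>"
    and r: "0 < r" "r < \<alpha>" "r < 1 - \<alpha>"
  shows "\<bar>measure M {\<omega>\<in>space M. T_stat \<theta> \<pi> (W_mat n p x \<omega>) (Z_mat n p x \<omega>) (Y_vec n y \<omega>)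
      > Gam_inv (1 - \<alpha>) (Q_hat \<pi> (W_mat n p x \<omega>) (Z_mat n p x \<omega>))} - \<alpha>\<bar>
    \<le> r + anticonc_const * numerator_error + bad_bound e + measure M {\<omega>\<in>space M. sigma_hat \<theta> (W_mat n p x \<omega>) (Y_vec n y \<omega>) = 0}
      + mean_sq_bound e \<delta> \<tau> \<mu> / r\<^sup>2"
proof -
  interpret Z: prob_space Zs by (rule prob_Zs)
  let ?R = "{z\<in>space Zs. Gam_inv (1 - \<alpha>) (Qz z) < Tz z}"
  have q: "0 < 1 - \<alpha>" "1 - \<alpha> < 1" using r by auto
  have Rs: "?R \<in> sets Zs" by (rule reject_sets[OF q])
  have Req: "measure M {\<omega>\<in>space M. T_stat \<theta> \<pi> (W_mat n p x \<omega>) (Z_mat n p x \<omega>) (Y_vec n y \<omega>)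
      > Gam_inv (1 - \<alpha>) (Q_hat \<pi> (W_mat n p x \<omega>) (Z_mat n p x \<omega>))} = measure Zs ?R"
    unfolding prob_transfer[OF Rs, symmetric]
    by (rule arg_cong[where f = "measure M"]) (auto simp: Tz_def Qz_def design_eq)
  have Neq: "measure M {\<omega>\<in>space M. sigma_hat \<theta> (W_mat n p x \<omega>) (Y_vec n y \<omega>) = 0} = zero_residual_prob"
    unfolding zero_residual_prob_def prob_transfer[OF T_sections(3), symmetric]
    by (rule arg_cong[where f = "measure M"]) (use n_pos in \<open>auto simp: design_eq sigma_hat_eq\<close>)
  note [measurable] = Tz_measurable H_measurable
  have ea: "0 \<le> numerator_error" unfolding numerator_error_def using d_nonneg eta_pos by simp
  note Hd = H_deviation[OF e small del tau mu r(1)]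
  obtain t1 where t1: "0 \<le> t1" "F t1 = 1 - \<alpha> + r" using F_quantile[of "1 - \<alpha> + r"] r by auto
  obtain t2 where t2: "0 \<le> t2" "F t2 = 1 - \<alpha> - r" using F_quantile[of "1 - \<alpha> - r"] r by auto
  have lower: "\<alpha> - measure Zs ?R \<le> r + anticonc_const * numerator_error + bad_bound e + zero_residual_prob + mean_sq_bound e \<delta> \<tau> \<mu> / r\<^sup>2"
  proof -
    let ?B = "{z\<in>space Zs. r \<le> \<bar>H t1 z - F t1\<bar>}" and ?T = "{z\<in>space Zs. Tz z \<le> t1}"
    have "space Zs - ?R \<subseteq> ?T \<union> ?B"
    proof (rule subsetI, rule ccontr)
      fix z assume z: "z \<in> space Zs - ?R" "z \<notin> ?T \<union> ?B"
      then have T: "t1 < Tz z" and H: "1 - \<alpha> \<le> H t1 z" using t1(2) by auto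
      \<comment> \<open>\<open>reject_iff\<close> asks for a rational argument strictly below the
        statistic, so \<open>t1\<close> itself is replaced by a rational above it.\<close>
      obtain c where c: "c \<in> \<rat>" "t1 < c" "c < Tz z" using Rats_dense_in_real[OF T] by blast
      have "1 - \<alpha> \<le> H c z" using H H_mono[OF t1(1), of c z] c by simp
      then have "Gam_inv (1 - \<alpha>) (Qz z) < Tz z"
        using c t1(1) unfolding reject_iff[OF q] by (intro bexI[of _ c]) auto
      then show False using z(1) by auto
    qed
    then have "measure Zs (space Zs - ?R) \<le> measure Zs (?T \<union> ?B)" by (intro Z.finite_measure_mono) measurable
    also have "\<dots> \<le> measure Zs ?T + measure Zs ?B" by (intro measure_Un_le) measurable
    also have "measure Zs ?T \<le> F (t1 + numerator_error) + bad_bound e + zero_residual_prob" by (rule T_distribution(1)[OF e small t1(1)])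
    also have "F (t1 + numerator_error) \<le> F t1 + anticonc_const * numerator_error" by (rule F_anticoncentration[OF n_pos p_ge ea])
    finally show ?thesis using Z.prob_compl[OF Rs] Hd(2)[of t1] t1(2) by linarith
  qed
  have upper: "measure Zs ?R - \<alpha> \<le> r + anticonc_const * numerator_error + bad_bound e + zero_residual_prob + mean_sq_bound e \<delta> \<tau> \<mu> / r\<^sup>2"
  proof -
    let ?B = "{z\<in>space Zs. r \<le> \<bar>H t2 z - F t2\<bar>}" and ?T = "{z\<in>space Zs. t2 < Tz z}"
    have "?R \<subseteq> ?T \<union> ?B"
    proof (rule subsetI, rule ccontr)
      fix z assume z: "z \<in> ?R" "z \<notin> ?T \<union> ?B"
      then have T: "Tz z \<le> t2" and H: "H t2 z < 1 - \<alpha>" using t2(2) by auto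
      obtain c where c: "c < Tz z" "1 - \<alpha> \<le> (if 0 \<le> c then H c z else 0)" using z(1) reject_iff[OF q, of z] by auto
      then have c0: "0 \<le> c" using q(1) by (auto split: if_splits)
      then have "1 - \<alpha> \<le> H c z" using c by simp
      also have "\<dots> \<le> H t2 z" using c0 c T by (intro H_mono) auto
      finally show False using H by simp
    qed
    then have "measure Zs ?R \<le> measure Zs (?T \<union> ?B)" by (intro Z.finite_measure_mono) measurable
    also have "\<dots> \<le> measure Zs ?T + measure Zs ?B" by (intro measure_Un_le) measurable
    also have "measure Zs ?T \<le> 1 - F (t2 - numerator_error) + bad_bound e + zero_residual_prob" by (rule T_distribution(2)[OF e small t2(1)])
    finally show ?thesis using F_anticoncentration[OF n_pos p_ge ea, of "t2 - numerator_error"] Hd(2)[of t2] t2(2) by simp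
  qed
  show ?thesis unfolding Req Neq using lower upper by (simp add: abs_le_iff)
qed

section \<open>Rates\<close>


text \<open>Chooses the free parameters so that every error is a multiple of \<open>a\<close>,
  \<open>b\<close> or 1 / p, apart from \<open>r\<close> and the probability of a vanishing
  residual. The smallness conditions on \<open>a\<close> and \<open>b\<close> are those under which
  the earlier bounds apply.\<close>

lemma rejection_probability_rate:
  fixes C L q b a r :: real
  assumes L: "L = ln p" "1 \<le> L" and q: "q = sqrt (L / n)" and b: "b = sqrt (L / sqrt n)" "b \<le> 1 / 8"
    and a: "a = real s * sqrt (L ^ 3 / n)" "64 * \<kappa>2 * a \<le> \<kappa>1" "256 * C\<^sup>2 * a \<le> \<kappa>1"
    and eta: "sqrt (32 * \<kappa>2) * q \<le> \<eta>" "\<eta> \<le> C * q" and C: "0 < C"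
    and r: "0 < r" "r < \<alpha>" "r < 1 - \<alpha>"
  defines "Ka \<equiv> 58 * sqrt 2 / sqrt (2 * \<kappa>1)" and "Kd \<equiv> 48 * C * sqrt \<kappa>2 / \<kappa>1"
  shows "\<bar>measure M {\<omega>\<in>space M. T_stat \<theta> \<pi> (W_mat n p x \<omega>) (Z_mat n p x \<omega>) (Y_vec n y \<omega>)
      > Gam_inv (1 - \<alpha>) (Q_hat \<pi> (W_mat n p x \<omega>) (Z_mat n p x \<omega>))} - \<alpha>\<bar>
    \<le> r + Ka * Kd * C * sqrt 2 * a + 8 * (1 / real p)
      + measure M {\<omega>\<in>space M. sigma_hat \<theta> (W_mat n p x \<omega>) (Y_vec n y \<omega>) = 0}
      + (4 * (Ka * Kd * sqrt (32 * \<kappa>2) * a + 4 * Ka * sqrt (16 * \<kappa>2) * b) + 40 * (1 / real p) + 160 * b) / r\<^sup>2"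
proof -
  \<comment> \<open>The accuracy 8 * q gives n * e^2 / 16 = 4 * L, hence p^-4 against p^2 Gram
    entries. The levels \<tau> and \<mu> make both tails 2 / p. The accuracy b / L makes \<delta> *
    L equal to b and n * \<delta>^2 equal to 1 / b^2.\<close>
  let ?e = "8 * q" and ?\<delta> = "b / L" and ?\<tau> = "sqrt (16 * \<kappa>2) * sqrt L" and ?\<mu> = "sqrt (32 * \<kappa>2) * sqrt L"
  define N where "N = sqrt (real n)"
  have N: "0 < N" "N\<^sup>2 = real n" using n_pos by (auto simp: N_def)
  have L0: "0 < L" using L(2) by simp
  have b2: "b\<^sup>2 = L / N" using L0 N by (simp add: b N_def)
  have b0: "0 < b" using L0 N by (simp add: b N_def)
  have bsq: "b\<^sup>2 \<le> 1 / 64" using power_mono[OF b(2), of 2] b0 by (simp add: power2_eq_square)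
  \<comment> \<open>From b \<le> 1/8; it also yields 32 * L \<le> n, so that exp (- n / 16) is at
    most p^-2.\<close>
  have LN: "64 * L \<le> N" using bsq N unfolding b2 by (simp add: divide_le_eq)
  have Nn: "N * 64 \<le> N * N" using LN L(2) N by (intro mult_left_mono) auto
  have n32: "32 * L \<le> real n" using LN Nn N unfolding power2_eq_square by linarith
  have q2: "q\<^sup>2 = L / real n" using L0 by (simp add: q)
  have qN: "q * N = sqrt L" using N by (simp add: q N_def real_sqrt_divide)
  have q0: "0 < q" using L0 n_pos by (simp add: q)
  have qb: "q \<le> b"
  proof -
    have "L / real n \<le> L / N" using L0 N Nn by (intro divide_left_mono) (auto simp: N(2)[symmetric] power2_eq_square)
    then show ?thesis unfolding q b(1) N_def[symmetric] by (rule real_sqrt_le_mono)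
  qed
  \<comment> \<open>The sparsity rate is L times the Dantzig rate s * q. The extra L is one factor
    sqrt L from \<open>anticonc_const\<close> and one from a Gaussian maximum or from \<eta> * sqrt
    n.\<close>
  have a_eq: "a = real s * (L * q)"
  proof -
    have "sqrt (L ^ 3 / n) = sqrt (L\<^sup>2 * (L / n))" by (simp add: power3_eq_cube power2_eq_square)
    also have "\<dots> = L * q" unfolding q real_sqrt_mult using L0 by simp
    finally show ?thesis by (simp add: a(1))
  qed
  have a0: "0 \<le> a" using L0 q0 by (simp add: a_eq)
  have sq_a: "real s * q \<le> a"
  proof -
    have "real s * (1 * q) \<le> real s * (L * q)" using L(2) q0 by (intro mult_left_mono mult_right_mono) auto
    then show ?thesis by (simp add: a_eq)
  qed
  have e: "0 \<le> ?e" "?e \<le> 1" using q0 qb b(2) by auto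
  have small: "8 * real s * (2 * \<kappa>2 * ?e) \<le> 2 * \<kappa>1" "512 * real s * \<eta>\<^sup>2 \<le> 2 * \<kappa>1"
  proof -
    have "8 * real s * (2 * \<kappa>2 * ?e) = 128 * \<kappa>2 * (real s * q)" by simp
    also have "\<dots> \<le> 128 * \<kappa>2 * a" using sq_a kappa by (intro mult_left_mono) auto
    finally show "8 * real s * (2 * \<kappa>2 * ?e) \<le> 2 * \<kappa>1" using a(2) by linarith
    have "\<eta>\<^sup>2 \<le> (C * q)\<^sup>2" using eta(2) eta_pos by (intro power_mono) auto
    also have "\<dots> = C\<^sup>2 * (q * q)" by (simp add: power2_eq_square)
    also have "\<dots> \<le> C\<^sup>2 * (q * 1)" using q0 qb b(2) by (intro mult_left_mono) auto
    finally have "real s * \<eta>\<^sup>2 \<le> real s * (C\<^sup>2 * (q * 1))" by (rule mult_left_mono) simp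
    also have "\<dots> = C\<^sup>2 * (real s * q)" by simp
    also have "\<dots> \<le> C\<^sup>2 * a" using sq_a by (intro mult_left_mono) auto
    finally show "512 * real s * \<eta>\<^sup>2 \<le> 2 * \<kappa>1" using a(3) by linarith
  qed
  have del: "0 < ?\<delta>" "?\<delta> \<le> 1 / 4"
  proof -
    show "0 < ?\<delta>" using b0 L0 by simp
    have "?\<delta> \<le> b" using L b0 by (simp add: divide_le_eq)
    then show "?\<delta> \<le> 1 / 4" using b(2) by simp
  qed
  have tau: "0 \<le> ?\<tau>" and mu: "0 \<le> ?\<mu>" using L0 kappa by auto
  have p1: "1 \<le> real p" using p_ge by simp
  have expL: "exp L = real p" using p1 by (simp add: L)
  have expk: "exp (- (real k * L)) = 1 / real p ^ k" for k
    by (simp add: exp_minus exp_of_nat_mult expL inverse_eq_divide)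
  have inv_p: "1 / (real p * real p) \<le> 1 / real p"
    using p1 by (intro divide_left_mono) auto
  have anticonc_const: "anticonc_const = Ka * sqrt L" by (simp add: anticonc_const_def Ka_def L real_sqrt_mult)
  have K: "0 \<le> Ka" "0 \<le> Kd" using kappa C by (auto simp: Ka_def Kd_def)
  have d: "d \<le> Kd * (real s * q)"
  proof -
    have "d = 48 * sqrt \<kappa>2 / \<kappa>1 * (real s * \<eta>)" using kappa by (simp add: d_def)
    also have "\<dots> \<le> 48 * sqrt \<kappa>2 / \<kappa>1 * (real s * (C * q))"
      using eta(2) kappa by (intro mult_left_mono) auto
    finally show ?thesis by (simp add: Kd_def mult_ac)
  qed
  have T1: "anticonc_const * numerator_error \<le> Ka * Kd * C * sqrt 2 * a"
  proof -
    have "d * (\<eta> * sqrt (2 * n)) \<le> (Kd * (real s * q)) * ((C * q) * (sqrt 2 * N))"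
      using d eta eta_pos d_nonneg K q0 N by (intro mult_mono) (auto simp: N_def real_sqrt_mult)
    also have "\<dots> = Kd * C * sqrt 2 * (real s * (sqrt L * q))" by (simp add: qN[symmetric] mult_ac)
    finally have "anticonc_const * numerator_error \<le> (Ka * sqrt L) * (Kd * C * sqrt 2 * (real s * (sqrt L * q)))"
      unfolding anticonc_const numerator_error_def using K L0 by (intro mult_left_mono) auto
    also have "\<dots> = Ka * Kd * C * sqrt 2 * (real s * ((sqrt L * sqrt L) * q))" by (simp only: mult_ac)
    finally show ?thesis using L0 by (simp add: a_eq)
  qed
  have T2: "anticonc_const * (d * ?\<mu> + 4 * ?\<delta> * ?\<tau>) \<le> Ka * Kd * sqrt (32 * \<kappa>2) * a + 4 * Ka * sqrt (16 * \<kappa>2) * b"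
  proof -
    have "d * ?\<mu> \<le> Kd * (real s * q) * ?\<mu>" using d mu by (rule mult_right_mono)
    then have "anticonc_const * (d * ?\<mu> + 4 * ?\<delta> * ?\<tau>) \<le> (Ka * sqrt L) * (Kd * (real s * q) * ?\<mu> + 4 * ?\<delta> * ?\<tau>)"
      unfolding anticonc_const using K L0 by (intro mult_left_mono add_right_mono) auto
    also have "\<dots> = Ka * Kd * sqrt (32 * \<kappa>2) * (real s * ((sqrt L * sqrt L) * q)) + 4 * Ka * sqrt (16 * \<kappa>2) * (b / L * (sqrt L * sqrt L))"
      by (simp only: distrib_left mult_ac)
    finally show ?thesis using L0 by (simp add: a_eq)
  qed
  have B: "bad_bound ?e \<le> 8 * (1 / real p)"
  proof -
    \<comment> \<open>The lower bound on \<eta> is calibrated to n * \<eta>^2 / (8 * \<kappa>2)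
      \<ge> 4 * L: an exponential factor of at most p^-4 against the p^2 correlations of the union
      bound.\<close>
    have "32 * \<kappa>2 * L = real n * (sqrt (32 * \<kappa>2) * q)\<^sup>2" using kappa n_pos by (simp add: power_mult_distrib q2)
    also have "\<dots> \<le> real n * \<eta>\<^sup>2" using eta(1) q0 kappa by (intro mult_left_mono power_mono) auto
    finally have "4 * L \<le> real n * \<eta>\<^sup>2 / (8 * \<kappa>2)" using kappa by (simp add: le_divide_eq mult_ac)
    then have le: "exp (- (real n * \<eta>\<^sup>2) / (8 * \<kappa>2)) \<le> 1 / real p ^ 4" unfolding expk[symmetric] by simp
    have "p * (2 * p * exp (- (real n * \<eta>\<^sup>2) / (8 * \<kappa>2))) = real p * (2 * real p * exp (- (real n * \<eta>\<^sup>2) / (8 * \<kappa>2)))" by simp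
    also have "\<dots> \<le> real p * (2 * real p * (1 / real p ^ 4))" by (intro mult_left_mono le) auto
    also have "\<dots> = 2 * (1 / (real p * real p))" using p1 by (simp add: power_numeral_reduce)
    also have "\<dots> \<le> 2 * (1 / real p)" using inv_p by (intro mult_left_mono) auto
    finally have 1: "p * (2 * p * exp (- (real n * \<eta>\<^sup>2) / (8 * \<kappa>2))) \<le> 2 * (1 / real p)" .
    have "- (real n * ?e\<^sup>2) / 16 = - (real 4 * L)" using n_pos by (simp add: power_mult_distrib q2)
    then have "exp (- (real n * ?e\<^sup>2) / 16) = 1 / real p ^ 4" by (simp only: expk)
    then have "p * p * (4 * exp (- (real n * ?e\<^sup>2) / 16)) = real p * real p * (4 * (1 / real p ^ 4))" by simp
    also have "\<dots> = 4 * (1 / (real p * real p))" using p1 by (simp add: power_numeral_reduce)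
    also have "\<dots> \<le> 4 * (1 / real p)" using inv_p by (intro mult_left_mono) auto
    finally have 2: "p * p * (4 * exp (- (real n * ?e\<^sup>2) / 16)) \<le> 4 * (1 / real p)" .
    have "exp (- real n / 16) \<le> 1 / real p ^ 2" unfolding expk[symmetric] using n32 by simp
    then have "p * (2 * exp (- real n / 16)) \<le> real p * (2 * (1 / real p ^ 2))" by (intro mult_left_mono) auto
    also have "\<dots> = 2 * (1 / real p)" using p1 by (simp add: power2_eq_square)
    finally have 3: "p * (2 * exp (- real n / 16)) \<le> 2 * (1 / real p)" .
    show ?thesis unfolding bad_bound_def using 1 2 3 by linarith
  qed
  have W_tail: "W_tail ?\<mu> \<le> 2 * (1 / real p)" and V_tail: "V_tail ?\<tau> \<le> 2 * (1 / real p)"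
  proof -
    have "- ?\<mu>\<^sup>2 / (16 * \<kappa>2) = - (real 2 * L)" "- ?\<tau>\<^sup>2 / (8 * \<kappa>2) = - (real 2 * L)"
      using kappa L0 by (auto simp: power_mult_distrib)
    then have "exp (- ?\<mu>\<^sup>2 / (16 * \<kappa>2)) = 1 / real p ^ 2" "exp (- ?\<tau>\<^sup>2 / (8 * \<kappa>2)) = 1 / real p ^ 2"
      by (simp_all only: expk)
    then show "W_tail ?\<mu> \<le> 2 * (1 / real p)" "V_tail ?\<tau> \<le> 2 * (1 / real p)"
      unfolding W_tail_def V_tail_def using p1 by (simp_all add: power2_eq_square)
  qed
  have norm_tail: "norm_tail ?\<delta> \<le> 32 * b"
  proof -
    let ?x = "1 / (16 * b\<^sup>2)"
    have "real n * ?\<delta>\<^sup>2 = N * N * (L / N) / (L * L)"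
      unfolding power_divide b2 N(2)[symmetric] by (simp add: power2_eq_square)
    also have "\<dots> = 1 / b\<^sup>2" unfolding b2 using L0 N by simp
    finally have "norm_tail ?\<delta> = 2 * exp (- ?x)" by (simp add: norm_tail_def)
    \<comment> \<open>A bound that is polynomial in \<open>b\<close> is enough for the
      limit.\<close>
    also have "exp (- ?x) \<le> 1 / ?x"
    proof -
      have "?x \<le> exp ?x" using exp_ge_add_one_self[of ?x] by linarith
      then show ?thesis unfolding exp_minus inverse_eq_divide using b0 by (intro divide_left_mono) auto
    qed
    also have "2 * (1 / ?x) = 32 * (b * b)" by (simp add: power2_eq_square)
    also have "\<dots> \<le> 32 * (b * 1)" using b0 b(2) by (intro mult_left_mono) auto
    finally show ?thesis by simp
  qed
  have "mean_sq_bound ?e ?\<delta> ?\<tau> ?\<mu>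
    \<le> 4 * (Ka * Kd * sqrt (32 * \<kappa>2) * a + 4 * Ka * sqrt (16 * \<kappa>2) * b) + 40 * (1 / real p) + 160 * b"
  proof -
    have "4 * m + 3 * b1 + 4 * w1 + 4 * v1 + 5 * g1 \<le> 4 * m' + 40 * h + 160 * b"
      if "m \<le> m'" "b1 \<le> 8 * h" "w1 \<le> 2 * h" "v1 \<le> 2 * h" "g1 \<le> 32 * b" for m m' b1 w1 v1 g1 h b :: real
      using that by linarith
    from this[OF T2 B W_tail V_tail norm_tail] show ?thesis unfolding mean_sq_bound_def mult.assoc[of 4 anticonc_const] .
  qed
  then have "mean_sq_bound ?e ?\<delta> ?\<tau> ?\<mu> / r\<^sup>2
    \<le> (4 * (Ka * Kd * sqrt (32 * \<kappa>2) * a + 4 * Ka * sqrt (16 * \<kappa>2) * b) + 40 * (1 / real p) + 160 * b) / r\<^sup>2"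
    by (rule divide_right_mono) simp
  then show ?thesis using rejection_probability[OF e small del tau mu r] T1 B by linarith
qed

end

theorem theorem5:
  fixes \<kappa>1 \<kappa>2 :: real
  assumes "0 < \<kappa>1" and "0 < \<kappa>2"
  shows "\<exists>c0>0. \<forall>(M :: nat \<Rightarrow> 'a measure) (p :: nat \<Rightarrow> nat) (\<Sigma> :: nat \<Rightarrow> sample \<Rightarrow> real mat)
      (\<beta> :: nat \<Rightarrow> sample \<Rightarrow> real vec) (D :: nat \<Rightarrow> sample \<Rightarrow> (real vec \<times> real) measure)
      (x :: nat \<Rightarrow> sample \<Rightarrow> nat \<Rightarrow> 'a \<Rightarrow> real vec) (y :: nat \<Rightarrow> sample \<Rightarrow> nat \<Rightarrow> 'a \<Rightarrow> real)
      (u :: nat \<Rightarrow> sample \<Rightarrow> nat \<Rightarrow> 'a \<Rightarrow> real) (\<eta> :: nat \<Rightarrow> real)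
      (\<theta> :: nat \<Rightarrow> real mat \<Rightarrow> real vec \<Rightarrow> real \<Rightarrow> real vec)
      (\<pi> :: nat \<Rightarrow> nat \<Rightarrow> real mat \<Rightarrow> real vec \<Rightarrow> real \<Rightarrow> real vec).
    (\<forall>n. two_sample_linear_model (M n) n (p n) (\<beta> n) (D n) (x n) (y n) (u n)) \<longrightarrow>
    (\<forall>n k. \<Sigma> n k \<in> carrier_mat (p n) (p n) \<and> transpose_mat (\<Sigma> n k) = \<Sigma> n k \<and>
       distr (D n k) (borel_vec (p n)) fst = gaussian (\<Sigma> n k)) \<longrightarrow>
    (\<forall>n k e. eigenvalue (\<Sigma> n k) e \<longrightarrow> \<kappa>1 < e \<and> e < \<kappa>2) \<longrightarrow>
    (\<lambda>n. real (s_Pi (p n) (D n))) \<in> o(\<lambda>n. sqrt (real n / ln (real (p n)) ^ 3)) \<longrightarrow>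
    \<eta> \<in> \<Theta>(\<lambda>n. sqrt (ln (real (p n)) / real n)) \<longrightarrow>
    (\<forall>\<^sub>F n in sequentially. \<eta> n \<ge> c0 * sqrt (ln (real (p n)) / real n)) \<longrightarrow>
    (\<forall>\<^sub>F n in sequentially. adds_rule (\<eta> n) n (p n) (\<theta> n) \<and>
       (\<forall>j<p n. adds_rule (\<eta> n) n (p n) (\<pi> n j))) \<longrightarrow>
    (\<lambda>n. measure (M n) {\<omega> \<in> space (M n).
       sigma_hat (\<theta> n) (W_mat n (p n) (x n) \<omega>) (Y_vec n (y n) \<omega>) = 0}) \<longlonglongrightarrow> 0 \<longrightarrow>
    filterlim p at_top sequentially \<longrightarrow>
    (\<lambda>n. ln (real (p n))) \<in> o(\<lambda>n. sqrt (real n)) \<longrightarrow>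
    (\<forall>n. \<beta> n SA = \<beta> n SB) \<longrightarrow>
    (\<forall>\<alpha>\<in>{0<..<1}.
      (\<lambda>n. measure (M n) {\<omega> \<in> space (M n).
         T_stat (\<theta> n) (\<pi> n) (W_mat n (p n) (x n) \<omega>) (Z_mat n (p n) (x n) \<omega>) (Y_vec n (y n) \<omega>)
           > Gam_inv (1 - \<alpha>) (Q_hat (\<pi> n) (W_mat n (p n) (x n) \<omega>) (Z_mat n (p n) (x n) \<omega>))})
        \<longlonglongrightarrow> \<alpha>)"
proof (intro exI[of _ "sqrt (32 * \<kappa>2)"] conjI allI impI ballI)
  \<comment> \<open>The constant depends on \<kappa>2 only and is the one that makes
    \<open>noise_event\<close> fail with probability at most 2 / p.\<close>
  show "0 < sqrt (32 * \<kappa>2)" using assms by simp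
next
  fix M :: "nat \<Rightarrow> 'a measure" and p :: "nat \<Rightarrow> nat" and \<Sigma> :: "nat \<Rightarrow> sample \<Rightarrow> real mat"
    and \<beta> :: "nat \<Rightarrow> sample \<Rightarrow> real vec" and D :: "nat \<Rightarrow> sample \<Rightarrow> (real vec \<times> real) measure"
    and x :: "nat \<Rightarrow> sample \<Rightarrow> nat \<Rightarrow> 'a \<Rightarrow> real vec" and y u :: "nat \<Rightarrow> sample \<Rightarrow> nat \<Rightarrow> 'a \<Rightarrow> real"
    and \<eta> :: "nat \<Rightarrow> real" and \<theta> :: "nat \<Rightarrow> real mat \<Rightarrow> real vec \<Rightarrow> real \<Rightarrow> real vec"
    and \<pi> :: "nat \<Rightarrow> nat \<Rightarrow> real mat \<Rightarrow> real vec \<Rightarrow> real \<Rightarrow> real vec" and \<alpha> :: real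
  assume model: "\<forall>n. two_sample_linear_model (M n) n (p n) (\<beta> n) (D n) (x n) (y n) (u n)"
    and gaussian: "\<forall>n k. \<Sigma> n k \<in> carrier_mat (p n) (p n) \<and> transpose_mat (\<Sigma> n k) = \<Sigma> n k \<and>
       distr (D n k) (borel_vec (p n)) fst = gaussian (\<Sigma> n k)"
    and eigen: "\<forall>n k e. eigenvalue (\<Sigma> n k) e \<longrightarrow> \<kappa>1 < e \<and> e < \<kappa>2"
    and sparse: "(\<lambda>n. real (s_Pi (p n) (D n))) \<in> o(\<lambda>n. sqrt (real n / ln (real (p n)) ^ 3))"
    and eta_Theta: "\<eta> \<in> \<Theta>(\<lambda>n. sqrt (ln (real (p n)) / real n))"
    and eta_lower: "\<forall>\<^sub>F n in sequentially. \<eta> n \<ge> sqrt (32 * \<kappa>2) * sqrt (ln (real (p n)) / real n)"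
    and rules: "\<forall>\<^sub>F n in sequentially. adds_rule (\<eta> n) n (p n) (\<theta> n) \<and> (\<forall>j<p n. adds_rule (\<eta> n) n (p n) (\<pi> n j))"
    and sigma0: "(\<lambda>n. measure (M n) {\<omega> \<in> space (M n).
       sigma_hat (\<theta> n) (W_mat n (p n) (x n) \<omega>) (Y_vec n (y n) \<omega>) = 0}) \<longlonglongrightarrow> 0"
    and p_top: "filterlim p at_top sequentially"
    and log_p: "(\<lambda>n. ln (real (p n))) \<in> o(\<lambda>n. sqrt (real n))"
    and null: "\<forall>n. \<beta> n SA = \<beta> n SB"
    and alpha: "\<alpha> \<in> {0<..<1}"
  define P where "P n = measure (M n) {\<omega> \<in> space (M n).
    T_stat (\<theta> n) (\<pi> n) (W_mat n (p n) (x n) \<omega>) (Z_mat n (p n) (x n) \<omega>) (Y_vec n (y n) \<omega>)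
      > Gam_inv (1 - \<alpha>) (Q_hat (\<pi> n) (W_mat n (p n) (x n) \<omega>) (Z_mat n (p n) (x n) \<omega>))}" for n
  define z where "z n = measure (M n) {\<omega> \<in> space (M n). sigma_hat (\<theta> n) (W_mat n (p n) (x n) \<omega>) (Y_vec n (y n) \<omega>) = 0}" for n
  define L where "L n = ln (real (p n))" for n
  define a where "a n = real (s_Pi (p n) (D n)) * sqrt (L n ^ 3 / real n)" for n
  define b where "b n = sqrt (L n / sqrt (real n))" for n
  have rp: "filterlim (\<lambda>n. real (p n)) at_top sequentially"
    by (rule filterlim_compose[OF filterlim_real_sequentially p_top])
  have L_top: "filterlim L at_top sequentially" unfolding L_def by (rule filterlim_compose[OF ln_at_top rp])
  have L1: "\<forall>\<^sub>F n in sequentially. 1 \<le> L n" using L_top by (simp add: filterlim_at_top)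
  have n1: "\<forall>\<^sub>F n in sequentially. 0 < n" by (rule eventually_gt_at_top)
  have p2: "\<forall>\<^sub>F n in sequentially. 2 \<le> p n" using p_top by (simp add: filterlim_at_top)
  have ip: "(\<lambda>n. 1 / real (p n)) \<longlonglongrightarrow> 0" by (rule tendsto_divide_0[OF tendsto_const filterlim_at_top_imp_at_infinity[OF rp]])
  have a_lim: "a \<longlonglongrightarrow> 0"
  proof (rule Lim_transform_eventually[OF smalloD_tendsto[OF sparse]])
    show "\<forall>\<^sub>F n in sequentially. real (s_Pi (p n) (D n)) / sqrt (real n / ln (real (p n)) ^ 3) = a n"
      by (rule eventually_mono[OF L1]) (simp add: a_def L_def[symmetric] real_sqrt_divide)
  qed
  have b_lim: "b \<longlonglongrightarrow> 0"
    unfolding b_def[abs_def] L_def using tendsto_real_sqrt[OF smalloD_tendsto[OF log_p]] by simp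
  obtain C where C: "0 < C" "\<forall>\<^sub>F n in sequentially. \<bar>\<eta> n\<bar> \<le> C * \<bar>sqrt (L n / real n)\<bar>"
    using landau_o.bigE[OF bigthetaD1[OF eta_Theta]] unfolding L_def by auto
  define Ka where "Ka = 58 * sqrt 2 / sqrt (2 * \<kappa>1)"
  define Kd where "Kd = 48 * C * sqrt \<kappa>2 / \<kappa>1"
  have "\<forall>\<^sub>F n in sequentially. b n < 1 / 8" using b_lim by (rule order_tendstoD) simp
  moreover have "\<forall>\<^sub>F n in sequentially. 64 * \<kappa>2 * a n < \<kappa>1"
    by (rule order_tendstoD(2)[OF tendsto_mult_right_zero[OF a_lim] assms(1)])
  moreover have "\<forall>\<^sub>F n in sequentially. 256 * C\<^sup>2 * a n < \<kappa>1"
    by (rule order_tendstoD(2)[OF tendsto_mult_right_zero[OF a_lim] assms(1)])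
  \<comment> \<open>The bound holds for all \<open>r\<close> from the same index on;
    \<open>r\<close> is chosen from the target accuracy before n grows.\<close>
  ultimately have rate: "\<forall>\<^sub>F n in sequentially. \<forall>r>0. r < \<alpha> \<longrightarrow> r < 1 - \<alpha> \<longrightarrow> \<bar>P n - \<alpha>\<bar>
    \<le> r + Ka * Kd * C * sqrt 2 * a n + 8 * (1 / real (p n)) + z n
      + (4 * (Ka * Kd * sqrt (32 * \<kappa>2) * a n + 4 * Ka * sqrt (16 * \<kappa>2) * b n) + 40 * (1 / real (p n)) + 160 * b n) / r\<^sup>2"
    using eta_lower C(2) rules L1 n1 p2
  proof eventually_elim
    case (elim n)
    have q: "0 < sqrt (L n / real n)" using elim by simp
    have eta: "sqrt (32 * \<kappa>2) * sqrt (L n / real n) \<le> \<eta> n" using elim by (simp add: L_def)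
    have "0 < sqrt (32 * \<kappa>2) * sqrt (L n / real n)" using q assms by (intro mult_pos_pos) auto
    with eta have eta0: "0 < \<eta> n" by linarith
    have eta': "\<eta> n \<le> C * sqrt (L n / real n)" using elim q by simp
    interpret tiers "M n" n "p n" "\<beta> n" "D n" "x n" "y n" "u n" "\<Sigma> n" \<kappa>1 \<kappa>2 "\<eta> n" "\<theta> n" "\<pi> n"
      using model gaussian eigen null assms elim eta0
      by (intro tiers.intro gaussian_two_sample.intro gaussian_two_sample_axioms.intro tiers_axioms.intro) auto
    show ?case
      unfolding P_def z_def Ka_def Kd_def
      by (intro allI impI rejection_probability_rate[where L = "L n" and q = "sqrt (L n / real n)"])
        (use elim eta eta' C(1) in \<open>auto simp: L_def a_def b_def s_def\<close>)
  qed
  have "P \<longlonglongrightarrow> \<alpha>"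
  proof (rule tendstoI)
    fix \<epsilon> :: real assume \<epsilon>: "0 < \<epsilon>"
    \<comment> \<open>Keeps both levels 1 - \<alpha> + r and 1 - \<alpha> - r inside (0, 1) and
      leaves half of \<epsilon> for the vanishing terms.\<close>
    define r where "r = min (\<epsilon> / 2) (min (\<alpha> / 2) ((1 - \<alpha>) / 2))"
    have r: "0 < r" "r < \<alpha>" "r < 1 - \<alpha>" "r \<le> \<epsilon> / 2" using \<epsilon> alpha by (auto simp: r_def min_def)
    have "(\<lambda>n. Ka * Kd * C * sqrt 2 * a n + 8 * (1 / real (p n)) + z n
      + (4 * (Ka * Kd * sqrt (32 * \<kappa>2) * a n + 4 * Ka * sqrt (16 * \<kappa>2) * b n) + 40 * (1 / real (p n)) + 160 * b n) / r\<^sup>2)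
      \<longlonglongrightarrow> Ka * Kd * C * sqrt 2 * 0 + 8 * 0 + 0
      + (4 * (Ka * Kd * sqrt (32 * \<kappa>2) * 0 + 4 * Ka * sqrt (16 * \<kappa>2) * 0) + 40 * 0 + 160 * 0) / r\<^sup>2"
      using r(1) sigma0[folded z_def] by (intro tendsto_add tendsto_mult tendsto_divide tendsto_const a_lim b_lim ip) auto
    then have "\<forall>\<^sub>F n in sequentially. Ka * Kd * C * sqrt 2 * a n + 8 * (1 / real (p n)) + z n
      + (4 * (Ka * Kd * sqrt (32 * \<kappa>2) * a n + 4 * Ka * sqrt (16 * \<kappa>2) * b n) + 40 * (1 / real (p n)) + 160 * b n) / r\<^sup>2 < \<epsilon> / 2"
      using \<epsilon> by (intro order_tendstoD(2)) auto
    then show "\<forall>\<^sub>F n in sequentially. dist (P n) \<alpha> < \<epsilon>"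
      using rate
    proof eventually_elim
      case (elim n)
      from elim(2)[rule_format, OF r(1-3)] elim(1) r(4) show ?case unfolding dist_real_def by linarith
    qed
  qed
  then show "(\<lambda>n. measure (M n) {\<omega> \<in> space (M n).
         T_stat (\<theta> n) (\<pi> n) (W_mat n (p n) (x n) \<omega>) (Z_mat n (p n) (x n) \<omega>) (Y_vec n (y n) \<omega>)
           > Gam_inv (1 - \<alpha>) (Q_hat (\<pi> n) (W_mat n (p n) (x n) \<omega>) (Z_mat n (p n) (x n) \<omega>))}) \<longlonglongrightarrow> \<alpha>"
    by (simp add: P_def[abs_def])
qed

end
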